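(* Let $k\in\mathbb{N}=\{1,2,\dots\}$ and $p\in[1,\infty)$ satisfy $p\ge k+1\ge2$. Let $(G,\mathcal{G})$ be a measurable space endowed with a nonnegative measure $q$, let $N(ds,du,dz)$ be a Poisson measure on $[0,\infty)\times[0,\infty)\times G$ with intensity measure $ds\,du\,q(dz)$, and let $b:\mathbb{R}\to\mathbb{R}$, $\gamma:\mathbb{R}\to\mathbb{R}_+$, $h:\mathbb{R}\times G\to\mathbb{R}$. Assume that: (A) $b$ and $\gamma$ are of class $C^{k+1}$ with all derivatives of order $0$ to $k+1$ bounded; $h$ is measurable, for each $z\in G$ the map $y\mapsto h(y,z)$ is of class $C^{k+1}$ on $\mathbb{R}$, and there is $\eta\in (L^1\cap L^p)(G,q)$ such that $|h^{(l)}(y,z)|\le\eta(z)$ for all $y\in\mathbb{R}$, $z\in G$, $l\in\{0,\dots,k+1\}$; (S) there is $c_0>0$ such that $1+h'(y,z)\ge c_0$ for all $z\in G$, $y\in\mathbb{R}$. For $x\in\mathbb{R}$ and $t\ge0$ let $p(t,x,dy)$ be the law of $X^x_t$, where $(X^x_t)_{t\ge0}$ is the solution of $$X_t^x = x + \int_0^t b(X_s^x)\,ds+\int_0^t\int_0^\infty\int_G h(X_{s-}^x,z)\mathbf{1}_{\{u\le\gamma(X_{s-}^x)\}}N(ds,du,dz),$$ and for a probability measure $f$ on $\mathbb{R}$ let $p(t,f,dy)$ be the measure on $\mathbb{R}$ defined by $p(t,f,A)=\int_{\mathbb{R}}f(dx)\,p(t,x,A)$. Then there is $C_k>0$ such that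 for all probability measures $f\in\bar W^{k,1}(\mathbb{R})$ and all $t\ge0$, $$\|p(t,f,\cdot)\|_{\bar W^{k,1}(\mathbb{R})}\le\|f\|_{\bar W^{k,1}(\mathbb{R})}\,e^{C_kt}.$$
   Context: Notation: $h^{(l)}(y,z)$ is the $l$-th derivative of $h$ with respect to $y$, and $h'=\partial_y h$. $C^k_b(\mathbb{R})$ is the set of $C^k$ functions all of whose derivatives (orders $0$ to $k$) are bounded. For a finite (signed) measure $f$ on $\mathbb{R}$, $$\|f\|_{\bar W^{k,1}(\mathbb{R})}:=\sum_{l=0}^k\sup\Big\{\int_{\mathbb{R}} f(dy)\phi^{(l)}(y):\ \phi\in C^k_b(\mathbb{R}),\ \|\phi\|_\infty\le1\Big\}\in[0,\infty].$$ $\bar W^{k,1}(\mathbb{R})$ is the space of finite signed measures for which this is finite; equivalently, for $l=1,\dots,k$ the $l$-th distributional derivative $f^{(l)}$ is a finite signed measure, and then $\|f\|_{\bar W^{k,1}(\mathbb{R})}=\sum_{l=0}^k\|f^{(l)}\|_{TV}$. Set $\mathcal{F}_t:=\sigma\{N(A):A\in\mathcal{B}([0,t])\otimes\mathcal{B}([0,\infty))\otimes\mathcal{G}\}$. Under the assumptions on $b,\gamma,h$, it is known that for every $x\in\mathbb{R}$ there is a unique càdlàg $(\mathcal{F}_t)_{t\ge0}$-adapted solution $(X^x_t)_{t\ge0}$ of the equation such that $E[\sup_{s\in[0,T]}|X^x_s|^p]<\infty$ for all $T\in[0,\infty)$, and that $(X^x_t)_{t\ge0,x\in\mathbb{R}}$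 is a strong Markov process. *)

theory Defs
  imports "HOL-Probability.Probability"
begin

section \<open>Differentiability classes and the norm\<close>

definition C_k :: "nat \<Rightarrow> (real \<Rightarrow> real) \<Rightarrow> bool" where
  "C_k k \<phi> \<longleftrightarrow>
     (\<forall>l<k. \<forall>y. ((deriv ^^ l) \<phi>) field_differentiable (at y)) \<and>
     continuous_on UNIV ((deriv ^^ k) \<phi>)"

definition C_k_b :: "nat \<Rightarrow> (real \<Rightarrow> real) set" where
  "C_k_b k = {\<phi>. C_k k \<phi> \<and> (\<forall>l\<le>k. bounded (range ((deriv ^^ l) \<phi>)))}"

text \<open>
  The norm of W-bar\<open>\<^sup>k\<^sup>,\<^sup>1(\<real>)\<close>, for nonnegative measures only: the libraries have no signed measures,
  and the norm is only ever evaluated at probability measures on the Borel line. It takes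
  values in \<open>[0, \<infinity>]\<close>, since \<open>\<phi> = 0\<close> is admissible.
\<close>

definition Wbar_norm :: "nat \<Rightarrow> real measure \<Rightarrow> ereal" where
  "Wbar_norm k f =
     (\<Sum>l\<le>k. SUP \<phi> \<in> {\<phi> \<in> C_k_b k. \<forall>y. \<bar>\<phi> y\<bar> \<le> 1}. ereal (\<integral>y. (deriv ^^ l) \<phi> y \<partial>f))"

definition Wbar_prob :: "nat \<Rightarrow> real measure set" where
  "Wbar_prob k = {f. prob_space f \<and> sets f = sets borel \<and> Wbar_norm k f < \<infinity>}"


section \<open>Poisson measures\<close>

text \<open>
  \<open>\<mu>\<close> is a measure \<open>ds du q(dz)\<close> on \<open>[0,\<infinity>) \<times> [0,\<infinity>) \<times> G\<close>, where \<open>q\<close> carries the measurable space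
  \<open>G\<close>. It is characterised by its values on boxes, because \<open>\<Otimes>\<^sub>M\<close> of measures is only meaningful when
  \<open>q\<close> is \<open>\<sigma>\<close>-finite, which is not assumed; in that case \<open>\<mu>\<close> is the library's product measure
  (\<open>jump_intensity_iff_pair_measure\<close> below).
\<close>

definition jump_intensity :: "'g measure \<Rightarrow> (real \<times> real \<times> 'g) measure \<Rightarrow> bool" where
  "jump_intensity q \<mu> \<longleftrightarrow>
     sets \<mu> = sets (restrict_space borel {0..} \<Otimes>\<^sub>M restrict_space borel {0..} \<Otimes>\<^sub>M q) \<and>
     (\<forall>A\<in>sets (restrict_space borel {0..}). \<forall>B\<in>sets (restrict_space borel {0..}). \<forall>C\<in>sets q.
        emeasure \<mu> (A \<times> B \<times> C) = emeasure lborel A * emeasure lborel B * emeasure q C)"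

lemma jump_intensity_iff_pair_measure:
  assumes "sigma_finite_measure q"
  shows "jump_intensity q \<mu> \<longleftrightarrow>
    \<mu> = restrict_space lborel {0..} \<Otimes>\<^sub>M restrict_space lborel {0..} \<Otimes>\<^sub>M q"
proof -
  define R :: "real measure" where "R = restrict_space lborel {0..}"
  have half: "{0..} \<in> sets (borel :: real measure)" by (rule borel_closed) simp
  have sR: "sets R = sets (restrict_space borel {0..})"
    unfolding R_def by (intro sets_restrict_space_cong) simp
  have sfR: "sigma_finite_measure R"
    unfolding R_def by (rule sigma_finite_measure_restrict_space[OF sigma_finite_lborel]) (use half in simp)
  interpret q: sigma_finite_measure q by fact
  interpret R: sigma_finite_measure R by fact
  interpret Rq: pair_sigma_finite R q ..
  have sfRq: "sigma_finite_measure (R \<Otimes>\<^sub>M q)" by unfold_locales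
  interpret RRq: pair_sigma_finite R "R \<Otimes>\<^sub>M q" ..
  have sets_eq: "sets (R \<Otimes>\<^sub>M R \<Otimes>\<^sub>M q)
      = sets (restrict_space borel {0..} \<Otimes>\<^sub>M restrict_space borel {0..} \<Otimes>\<^sub>M q)"
    by (intro sets_pair_measure_cong sR refl)
  have eR: "emeasure R A = emeasure lborel A" if "A \<in> sets (restrict_space borel {0..})" for A
    unfolding R_def
  proof (rule emeasure_restrict_space)
    show "{0..} \<inter> space lborel \<in> sets (lborel :: real measure)" using half by simp
    show "A \<subseteq> {0..}" using sets.sets_into_space[OF that] by (simp add: space_restrict_space)
  qed
  have box: "emeasure (R \<Otimes>\<^sub>M R \<Otimes>\<^sub>M q) (A \<times> B \<times> C)
      = emeasure lborel A * emeasure lborel B * emeasure q C"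
    if "A \<in> sets (restrict_space borel {0..})" "B \<in> sets (restrict_space borel {0..})" "C \<in> sets q"
    for A B C
  proof -
    have "A \<in> sets R" "B \<in> sets R" using that sR by auto
    then show ?thesis using that
      by (simp add: sigma_finite_measure.emeasure_pair_measure_Times[OF sfRq] q.emeasure_pair_measure_Times eR mult.assoc)
  qed
  show ?thesis
    unfolding R_def[symmetric]
  proof
    assume "\<mu> = R \<Otimes>\<^sub>M R \<Otimes>\<^sub>M q"
    then show "jump_intensity q \<mu>"
      unfolding jump_intensity_def using box sets_eq by auto
  next
    assume J: "jump_intensity q \<mu>"
    let ?P = "R \<Otimes>\<^sub>M R \<Otimes>\<^sub>M q"
    let ?\<Omega> = "space R \<times> space R \<times> space q"
    let ?E = "{A \<times> B \<times> C | A B C. A \<in> sets R \<and> B \<in> sets R \<and> C \<in> sets q}"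
    have E_sub: "?E \<subseteq> Pow ?\<Omega>"
      using sets.sets_into_space[of _ R] sets.sets_into_space[of _ q] by blast
    interpret S: sigma_algebra ?\<Omega> "sigma_sets ?\<Omega> ?E"
      by (rule sigma_algebra_sigma_sets) (rule E_sub)
    have E2_in: "A \<times> D \<in> sigma_sets ?\<Omega> ?E" if A: "A \<in> sets R" and D: "D \<in> sets (R \<Otimes>\<^sub>M q)" for A D
      using D unfolding sets_pair_measure
    proof (induction rule: sigma_sets.induct)
      case (Basic D)
      then show ?case using A by (intro sigma_sets.Basic) blast
    next
      case Empty
      have "{} \<in> sigma_sets ?\<Omega> ?E" by (rule sigma_sets.Empty)
      then show ?case by simp
    next
      case (Compl D)
      have "A \<times> space R \<times> space q \<in> sigma_sets ?\<Omega> ?E"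
        using A by (intro sigma_sets.Basic) blast
      then have "A \<times> space R \<times> space q - A \<times> D \<in> sigma_sets ?\<Omega> ?E"
        using Compl.IH by (rule S.Diff)
      also have "A \<times> space R \<times> space q - A \<times> D = A \<times> (space R \<times> space q - D)" by blast
      finally show ?case .
    next
      case (Union D)
      have "(\<Union>i. A \<times> D i) \<in> sigma_sets ?\<Omega> ?E"
        using Union.IH by (intro sigma_sets.Union)
      also have "(\<Union>i. A \<times> D i) = A \<times> (\<Union>i. D i)" by blast
      finally show ?case .
    qed
    have gen: "sets ?P = sigma_sets ?\<Omega> ?E"
    proof
      show "sets ?P \<subseteq> sigma_sets ?\<Omega> ?E"
        unfolding sets_pair_measure[of R "R \<Otimes>\<^sub>M q"] space_pair_measure
        by (rule sigma_sets_mono) (use E2_in in auto)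
      show "sigma_sets ?\<Omega> ?E \<subseteq> sets ?P"
        using sets.sigma_sets_subset[of ?E ?P] by (auto simp: space_pair_measure)
    qed
    obtain F :: "nat \<Rightarrow> real set" where F: "range F \<subseteq> sets R" "(\<Union>i. F i) = space R"
        "\<And>i. emeasure R (F i) \<noteq> \<infinity>" "incseq F"
      by (rule R.sigma_finite_incseq) blast
    obtain H where H: "range H \<subseteq> sets q" "(\<Union>i. H i) = space q"
        "\<And>i. emeasure q (H i) \<noteq> \<infinity>" "incseq H"
      by (rule q.sigma_finite_incseq) blast
    have "?P = \<mu>"
    proof (rule measure_eqI_generator_eq[where E = ?E and \<Omega> = ?\<Omega> and A = "\<lambda>i. F i \<times> F i \<times> H i"])
      show "Int_stable ?E"
        unfolding Int_stable_def
      proof (intro ballI)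
        fix a b assume "a \<in> ?E" "b \<in> ?E"
        then obtain A B C A' B' C' where *: "a = A \<times> B \<times> C" "b = A' \<times> B' \<times> C'"
          "A \<in> sets R" "B \<in> sets R" "C \<in> sets q" "A' \<in> sets R" "B' \<in> sets R" "C' \<in> sets q"
          by blast
        have "a \<inter> b = (A \<inter> A') \<times> (B \<inter> B') \<times> (C \<inter> C')" unfolding * by blast
        moreover have "A \<inter> A' \<in> sets R" "B \<inter> B' \<in> sets R" "C \<inter> C' \<in> sets q"
          using * by auto
        ultimately show "a \<inter> b \<in> ?E" by blast
      qed
      show "?E \<subseteq> Pow ?\<Omega>" by (rule E_sub)
      show "sets ?P = sigma_sets ?\<Omega> ?E" by (rule gen)
      then show "sets \<mu> = sigma_sets ?\<Omega> ?E"
        using J sets_eq unfolding jump_intensity_def by simp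
      have "F i \<in> sets R" "H i \<in> sets q" for i using F(1) H(1) by auto
      then show "range (\<lambda>i. F i \<times> F i \<times> H i) \<subseteq> ?E" by blast
      show "(\<Union>i. F i \<times> F i \<times> H i) = ?\<Omega>"
      proof
        show "(\<Union>i. F i \<times> F i \<times> H i) \<subseteq> ?\<Omega>" unfolding F(2)[symmetric] H(2)[symmetric] by auto
        show "?\<Omega> \<subseteq> (\<Union>i. F i \<times> F i \<times> H i)"
        proof
          fix w assume "w \<in> ?\<Omega>"
          then obtain s u z where w: "w = (s, u, z)" "s \<in> space R" "u \<in> space R" "z \<in> space q"
            by auto
          then obtain i j k where "s \<in> F i" "u \<in> F j" "z \<in> H k"
            unfolding F(2)[symmetric] H(2)[symmetric] by auto
          moreover obtain m where "i \<le> m" "j \<le> m" "k \<le> m"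
            using max.cobounded1 max.cobounded2 by (metis le_trans)
          ultimately have "s \<in> F m" "u \<in> F m" "z \<in> H m"
            using incseqD[OF F(4), of i m] incseqD[OF F(4), of j m] incseqD[OF H(4), of k m] by blast+
          then show "w \<in> (\<Union>i. F i \<times> F i \<times> H i)" unfolding w(1) by auto
        qed
      qed
      show "emeasure ?P (F i \<times> F i \<times> H i) \<noteq> \<infinity>" for i
      proof -
        have m: "F i \<in> sets R" "F i \<in> sets (restrict_space borel {0..})" "H i \<in> sets q"
          using F(1) H(1) sR by auto
        have "emeasure lborel (F i) < top" "emeasure q (H i) < top"
          using F(3)[of i] H(3)[of i] eR[OF m(2)] by (auto simp: less_top)
        then show ?thesis
          using box[OF m(2,2,3)] by (simp add: ennreal_mult_eq_top_iff less_top)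
      qed
      show "emeasure ?P X = emeasure \<mu> X" if X: "X \<in> ?E" for X
      proof -
        obtain A B C where *: "X = A \<times> B \<times> C" "A \<in> sets (restrict_space borel {0..})"
            "B \<in> sets (restrict_space borel {0..})" "C \<in> sets q"
          using X sR by auto
        show ?thesis
          unfolding *(1) box[OF *(2-4)] using J *(2-4) by (simp add: jump_intensity_def)
      qed
    qed
    then show "\<mu> = ?P" by simp
  qed
qed

text \<open>
  A Poisson measure with intensity \<open>\<mu>\<close> is a random \<open>\<nat> \<union> {\<infinity>}\<close>-valued measure that is
  independent on disjoint sets and such that \<open>N(A)\<close> has the Poisson law with parameter \<open>\<mu>(A)\<close>. The
  law is spelled out because \<open>poisson_pmf\<close> excludes the parameter \<open>0\<close>.
\<close>

definition poisson_measure :: "'w measure \<Rightarrow> 'e measure \<Rightarrow> ('w \<Rightarrow> 'e measure) \<Rightarrow> bool" where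
  "poisson_measure P \<mu> N \<longleftrightarrow>
     prob_space P \<and>
     (\<forall>\<omega>\<in>space P. sets (N \<omega>) = sets \<mu> \<and>
        (\<forall>A\<in>sets \<mu>. emeasure (N \<omega>) A \<in> insert \<infinity> (range of_nat))) \<and>
     (\<forall>A\<in>sets \<mu>. (\<lambda>\<omega>. emeasure (N \<omega>) A) \<in> borel_measurable P) \<and>
     (\<forall>A\<in>sets \<mu>. emeasure \<mu> A < \<infinity> \<longrightarrow> (\<forall>n::nat.
        measure P {\<omega>\<in>space P. emeasure (N \<omega>) A = of_nat n} =
          measure \<mu> A ^ n / fact n * exp (- measure \<mu> A))) \<and>
     (\<forall>A\<in>sets \<mu>. emeasure \<mu> A = \<infinity> \<longrightarrow> (AE \<omega> in P. emeasure (N \<omega>) A = \<infinity>)) \<and>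
     (\<forall>(n::nat) A. (\<forall>i<n. A i \<in> sets \<mu>) \<and> disjoint_family_on A {..<n} \<longrightarrow>
        prob_space.indep_vars P (\<lambda>_. borel) (\<lambda>i \<omega>. emeasure (N \<omega>) (A i)) {..<n})"

definition jump_filtration ::
    "'w measure \<Rightarrow> 'g measure \<Rightarrow> ('w \<Rightarrow> (real \<times> real \<times> 'g) measure) \<Rightarrow> real \<Rightarrow> 'w measure" where
  "jump_filtration P q N t =
     sigma (space P)
       {(\<lambda>\<omega>. emeasure (N \<omega>) A) -` B \<inter> space P | A B.
          A \<in> sets (restrict_space borel {0..t} \<Otimes>\<^sub>M restrict_space borel {0..} \<Otimes>\<^sub>M q) \<and>
          B \<in> sets borel}"


section \<open>The equation\<close>

text \<open>Processes are indexed by all of \<open>real\<close>; only times \<open>t \<ge> 0\<close> matter.\<close>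

definition cadlag :: "(real \<Rightarrow> real) \<Rightarrow> bool" where
  "cadlag \<xi> \<longleftrightarrow>
     (\<forall>t\<ge>0. (\<xi> \<longlongrightarrow> \<xi> t) (at_right t)) \<and>
     (\<forall>t>0. \<exists>l. (\<xi> \<longlongrightarrow> l) (at_left t))"

definition left_lim :: "(real \<Rightarrow> real) \<Rightarrow> real \<Rightarrow> real" where
  "left_lim \<xi> t = Lim (at_left t) \<xi>"

text \<open>
  \<open>\<integral>\<^sub>0\<^sup>t\<close> in the jump term is over \<open>(0, t]\<close>. Path regularity and the equation are required almost
  surely, for all times simultaneously.
\<close>

definition jump_sde_solution ::
    "'w measure \<Rightarrow> 'g measure \<Rightarrow> ('w \<Rightarrow> (real \<times> real \<times> 'g) measure) \<Rightarrow>
     (real \<Rightarrow> real) \<Rightarrow> (real \<Rightarrow> real) \<Rightarrow> (real \<Rightarrow> 'g \<Rightarrow> real) \<Rightarrow> real \<Rightarrow> real \<Rightarrow>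
     (real \<Rightarrow> 'w \<Rightarrow> real) \<Rightarrow> bool" where
  "jump_sde_solution P q N b \<gamma> h p x X \<longleftrightarrow>
     (\<forall>t\<ge>0. X t \<in> borel_measurable (jump_filtration P q N t)) \<and>
     (AE \<omega> in P. cadlag (\<lambda>t. X t \<omega>)) \<and>
     (\<forall>T\<ge>0. (\<integral>\<^sup>+\<omega>. (SUP s\<in>{0..T}. ennreal (\<bar>X s \<omega>\<bar> powr p)) \<partial>P) < \<infinity>) \<and>
     (AE \<omega> in P. \<forall>t\<ge>0.
        X t \<omega> = x + (LBINT s:{0..t}. b (X s \<omega>)) +
          (\<integral>(s, u, z).
              indicator {0<..t} s *
              (h (left_lim (\<lambda>r. X r \<omega>) s) z *
               indicator {..\<gamma> (left_lim (\<lambda>r. X r \<omega>) s)} u) \<partial>(N \<omega>)))"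

end

theory Submission
  imports Defs
begin

text \<open>
  The jumps with marks outside \<open>G = {1/(n + 1) \<le> \<eta> \<le> n + 1}\<close> are discarded, and the remaining
  equation is compared with the one-step operators
  \<open>T \<phi> x = (1 - \<epsilon> B q(G)) \<phi>(x + \<epsilon> b(x)) + \<epsilon> \<integral>\<^sub>G (\<gamma>(x) \<phi>(x + h(x,z)) + (B - \<gamma>(x)) \<phi>(x)) q(dz)\<close>.

  The norm of the dual of \<open>T\<close> is at most \<open>1 + C \<epsilon>\<close> with \<open>C\<close> independent of \<open>G\<close>. Indeed, for
  \<open>\<tau>(x) = x + h(x,z)\<close> one has \<open>\<phi>' \<circ> \<tau> = (\<phi> \<circ> \<tau>)' / \<tau>'\<close>, where \<open>1 / \<tau>'\<close> is bounded by (S); moving the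
  weight under the derivative and iterating expresses the \<open>l\<close>-th derivative of the image
  of \<open>f\<close> under \<open>\<tau>\<close> by derivatives of \<open>f\<close> of orders \<open>0\<close> to \<open>l\<close>, and
  all correction terms are \<open>O(\<eta> (1 + \<eta>)\<^sup>k)\<close>, which is integrable because \<open>p \<ge> k + 1\<close>.

  On a time window of length \<open>\<epsilon>\<close> the Poisson measure is independent of the past, and up to an error
  \<open>o(\<epsilon>)\<close> plus the mass of the discarded jumps the solution performs at most one jump, so
  \<open>E \<phi>(X\<^sub>t\<^sub>+\<^sub>\<epsilon>) \<approx> E (T \<phi>)(X\<^sub>t)\<close> for Lipschitz \<open>\<phi>\<close>. Since \<open>T\<close> preserves Lipschitz functions with constant
  \<open>1 + C \<epsilon>\<close>, telescoping yields \<open>E \<phi>(X\<^sub>t\<^sup>x) = lim T\<^sup>m \<phi> x\<close>. Neither Ito calculus nor the Markov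
  property is used, and measurability of the kernel in \<open>x\<close> comes for free from this limit.
\<close>

section \<open>Functions with bounded derivatives\<close>

text \<open>The obstacle is the total jump rate \<open>measure q G\<close>, which may tend to
  infinity as the truncation is removed. Hence one step may lose only quantities that are integrable
  in the mark, and the leading coefficient of the jump part must be exactly \<open>B\<close>. This
  is why fictitious jumps at rate \<open>B - \<gamma>\<close> belong to the operator: accepted and
  rejected candidates have the constant total weight \<open>B\<close>, and derivatives of the
  weights cancel up to \<open>O(\<eta>)\<close>. As a mixture of drift, acceptance and rejection,
  the step also maps probability measures to probability measures by duality and can be iterated.
  The norm is a sum of suprema over different test functions, so the bounds are carried as a vector
  indexed by the order. Comparison with the equation needs Lipschitz derivatives up to order
  \<open>k\<close>, thus test functions with \<open>k + 1\<close> derivatives; averages over short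
  intervals lead back to \<open>k\<close>. The truncation is fixed before the step length, because
  the local error \<open>O(\<epsilon>\<^sup>2)\<close> has a constant depending on
  \<open>G\<close>.\<close>

lemma funpow_Suc': "(f ^^ Suc n) x = (f ^^ n) (f x)"
  by (simp add: funpow_swap1)

lemma bounded_range_iff: "bounded (range (f :: real \<Rightarrow> real)) \<longleftrightarrow> (\<exists>G. \<forall>x. \<bar>f x\<bar> \<le> G)"
  by (auto simp: bounded_iff)

lemma C_k_0: "C_k 0 f \<longleftrightarrow> continuous_on UNIV f"
  by (simp add: C_k_def)

lemma C_k_Suc: "C_k (Suc m) f \<longleftrightarrow> (\<forall>x. f field_differentiable at x) \<and> C_k m (deriv f)"
  unfolding C_k_def All_less_Suc2 by (simp del: funpow.simps add: funpow_Suc')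

lemma C_k_b_0: "f \<in> C_k_b 0 \<longleftrightarrow> continuous_on UNIV f \<and> (\<exists>G. \<forall>x. \<bar>f x\<bar> \<le> G)"
  by (simp add: C_k_b_def C_k_0 bounded_range_iff)

lemma All_le_Suc2: "(\<forall>i\<le>Suc n. Q i) \<longleftrightarrow> Q 0 \<and> (\<forall>i\<le>n. Q (Suc i))"
  using All_less_Suc2[of "Suc n" Q] by (simp add: less_Suc_eq_le)

text \<open>The derivative peeled off is the innermost one. Closure under sums, products and
  composition then follows by induction on the order with the function generalised.\<close>

lemma C_k_b_Suc:
  "f \<in> C_k_b (Suc m) \<longleftrightarrow>
    (\<forall>x. f field_differentiable at x) \<and> (\<exists>G. \<forall>x. \<bar>f x\<bar> \<le> G) \<and> deriv f \<in> C_k_b m"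
  unfolding C_k_b_def mem_Collect_eq C_k_Suc All_le_Suc2 funpow_Suc' bounded_range_iff
  by auto

lemma C_k_continuous: "C_k m f \<Longrightarrow> continuous_on UNIV f"
  by (cases m) (auto simp: C_k_0 C_k_Suc intro!: continuous_at_imp_continuous_on field_differentiable_imp_continuous_at)

lemma C_k_b_imp_continuous: "f \<in> C_k_b m \<Longrightarrow> continuous_on UNIV f"
  using C_k_continuous by (auto simp: C_k_b_def)

lemma C_k_b_imp_bounded: "f \<in> C_k_b m \<Longrightarrow> \<exists>G. \<forall>x. \<bar>f x\<bar> \<le> G"
  by (auto simp: C_k_b_def bounded_range_iff[symmetric])

lemma C_k_b_SucD: "f \<in> C_k_b (Suc m) \<Longrightarrow> f \<in> C_k_b m"
proof (induction m arbitrary: f)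
  case 0
  then show ?case
    using C_k_b_imp_continuous C_k_b_imp_bounded unfolding C_k_b_0 by blast
next
  case (Suc m)
  then show ?case unfolding C_k_b_Suc[of _ "Suc m"] C_k_b_Suc[of _ m] by blast
qed

lemma C_k_b_mono: "f \<in> C_k_b n \<Longrightarrow> m \<le> n \<Longrightarrow> f \<in> C_k_b m"
proof (induction n)
  case (Suc n)
  then show ?case using C_k_b_SucD by (cases "m = Suc n") auto
qed auto

lemma C_k_b_iterated_deriv: "f \<in> C_k_b (l + m) \<Longrightarrow> (deriv ^^ l) f \<in> C_k_b m"
  by (induction l arbitrary: f) (auto simp: C_k_b_Suc funpow_Suc' simp del: funpow.simps)

lemma C_k_b_const: "(\<lambda>x. c) \<in> C_k_b m"
  by (induction m arbitrary: c) (auto simp: C_k_b_0 C_k_b_Suc)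

lemma C_k_b_add:
  "f \<in> C_k_b m \<Longrightarrow> g \<in> C_k_b m \<Longrightarrow> (\<lambda>x. f x + g x) \<in> C_k_b m"
proof (induction m arbitrary: f g)
  case 0
  then show ?case
    by (auto simp: C_k_b_0 intro!: continuous_intros) (meson abs_triangle_ineq add_mono order_trans)
next
  case (Suc m)
  have "deriv (\<lambda>x. f x + g x) = (\<lambda>x. deriv f x + deriv g x)"
    using Suc.prems by (auto simp: C_k_b_Suc)
  moreover obtain F G where "\<And>x. \<bar>f x\<bar> \<le> F" "\<And>x. \<bar>g x\<bar> \<le> G"
    using Suc.prems C_k_b_imp_bounded by meson
  then have "\<And>x. \<bar>f x + g x\<bar> \<le> F + G"
    by (meson abs_triangle_ineq add_mono order_trans)
  ultimately show ?case
    using Suc by (auto simp: C_k_b_Suc intro!: derivative_intros)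
qed

lemma C_k_b_mult:
  "f \<in> C_k_b m \<Longrightarrow> g \<in> C_k_b m \<Longrightarrow> (\<lambda>x. f x * g x) \<in> C_k_b m"
proof (induction m arbitrary: f g)
  case 0
  then obtain F G where "\<And>x. \<bar>f x\<bar> \<le> F" "\<And>x. \<bar>g x\<bar> \<le> G"
    using C_k_b_imp_bounded by meson
  then have "\<bar>f x * g x\<bar> \<le> F * G" for x
    unfolding abs_mult by (intro mult_mono) (auto intro: order_trans[OF abs_ge_zero])
  then show ?case
    using 0 by (auto simp: C_k_b_0 intro!: continuous_intros)
next
  case (Suc m)
  have d: "deriv (\<lambda>x. f x * g x) = (\<lambda>x. f x * deriv g x + deriv f x * g x)"
    using Suc.prems by (auto simp: C_k_b_Suc)
  obtain F G where "\<And>x. \<bar>f x\<bar> \<le> F" "\<And>x. \<bar>g x\<bar> \<le> G"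
    using Suc.prems C_k_b_imp_bounded by meson
  then have "\<bar>f x * g x\<bar> \<le> F * G" for x
    unfolding abs_mult by (intro mult_mono) (auto intro: order_trans[OF abs_ge_zero])
  moreover have "(\<lambda>x. f x * deriv g x + deriv f x * g x) \<in> C_k_b m"
    using Suc.prems C_k_b_SucD by (intro C_k_b_add Suc.IH) (auto simp: C_k_b_Suc[of _ m])
  ultimately show ?case
    using Suc.prems by (auto simp: C_k_b_Suc d intro!: field_differentiable_mult)
qed

lemma C_k_b_cmult: "f \<in> C_k_b m \<Longrightarrow> (\<lambda>x. c * f x) \<in> C_k_b m"
  by (intro C_k_b_mult C_k_b_const)

lemma C_k_b_minus: "f \<in> C_k_b m \<Longrightarrow> (\<lambda>x. - f x) \<in> C_k_b m"
  using C_k_b_cmult[of f m "-1"] by simp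

lemma C_k_b_diff: "f \<in> C_k_b m \<Longrightarrow> g \<in> C_k_b m \<Longrightarrow> (\<lambda>x. f x - g x) \<in> C_k_b m"
  using C_k_b_add[of f m "\<lambda>x. - g x"] C_k_b_minus by simp

lemma field_differentiable_compose':
  fixes f g :: "real \<Rightarrow> real"
  assumes "f field_differentiable at (g x)" "g field_differentiable at x"
  shows "(\<lambda>x. f (g x)) field_differentiable at x"
  using field_differentiable_compose[of g x f] assms by (simp add: o_def)

lemma deriv_compose:
  fixes f g :: "real \<Rightarrow> real"
  assumes "f field_differentiable at (g x)" "g field_differentiable at x"
  shows "deriv (\<lambda>x. f (g x)) x = deriv f (g x) * deriv g x"
  using deriv_chain[of g x f] assms by (simp add: o_def)

text \<open>Only the derivative of the inner function enters the chain rule, so \<open>g\<close>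
  itself may be unbounded, as for maps of the form \<open>x + h x\<close>. The guard
  \<open>m = Suc l\<close> leaves order 0 free of any condition on \<open>deriv g\<close>.\<close>

lemma C_k_b_compose:
  assumes "f \<in> C_k_b m" "\<And>x. g field_differentiable at x" "\<And>l. m = Suc l \<Longrightarrow> deriv g \<in> C_k_b l"
  shows "(\<lambda>x. f (g x)) \<in> C_k_b m"
  using assms
proof (induction m arbitrary: f)
  case 0
  have "continuous_on UNIV g"
    using 0(2) by (auto intro!: continuous_at_imp_continuous_on field_differentiable_imp_continuous_at)
  with 0 show ?case
    by (auto simp: C_k_b_0 intro: continuous_on_compose2[of UNIV f UNIV g])
next
  case (Suc m)
  have d: "deriv (\<lambda>x. f (g x)) = (\<lambda>x. deriv f (g x) * deriv g x)"
    using Suc.prems by (auto simp: C_k_b_Suc deriv_compose)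
  have "(\<lambda>x. deriv f (g x)) \<in> C_k_b m"
    using Suc.prems C_k_b_SucD[of "deriv g"] by (intro Suc.IH) (auto simp: C_k_b_Suc[of f])
  then have "(\<lambda>x. deriv f (g x) * deriv g x) \<in> C_k_b m"
    using Suc.prems by (intro C_k_b_mult) auto
  moreover have "(\<lambda>x. f (g x)) field_differentiable at x" for x
    using Suc.prems by (intro field_differentiable_compose'[of f g]) (auto simp: C_k_b_Suc)
  ultimately show ?case
    using Suc.prems(1) unfolding C_k_b_Suc d by blast
qed

lemma iterated_deriv_add:
  "f \<in> C_k_b m \<Longrightarrow> g \<in> C_k_b m \<Longrightarrow>
    (deriv ^^ m) (\<lambda>x. f x + g x) = (\<lambda>x. (deriv ^^ m) f x + (deriv ^^ m) g x)"
proof (induction m arbitrary: f g)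
  case (Suc m)
  have d: "deriv (\<lambda>x. f x + g x) = (\<lambda>x. deriv f x + deriv g x)"
    using Suc.prems by (auto simp: C_k_b_Suc)
  show ?case
    using Suc by (simp add: funpow_Suc' d C_k_b_Suc del: funpow.simps)
qed simp

lemma iterated_deriv_cmult:
  "f \<in> C_k_b m \<Longrightarrow> (deriv ^^ m) (\<lambda>x. c * f x) = (\<lambda>x. c * (deriv ^^ m) f x)"
proof (induction m arbitrary: f)
  case (Suc m)
  have d: "deriv (\<lambda>x. c * f x) = (\<lambda>x. c * deriv f x)"
    using Suc.prems by (auto simp: C_k_b_Suc)
  show ?case
    using Suc by (simp add: funpow_Suc' d C_k_b_Suc del: funpow.simps)
qed simp

lemma iterated_deriv_diff:
  assumes "f \<in> C_k_b m" "g \<in> C_k_b m"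
  shows "(deriv ^^ m) (\<lambda>x. f x - g x) = (\<lambda>x. (deriv ^^ m) f x - (deriv ^^ m) g x)"
  using iterated_deriv_add[OF assms(1) C_k_b_cmult[OF assms(2), of "-1"]]
    iterated_deriv_cmult[OF assms(2), of "-1"] by simp

section \<open>Derivatives of graded size\<close>

text \<open>\<open>G\<close> is the size of the function and \<open>Y\<close> the price of one
  derivative. Each differentiation of \<open>1 / (1 + h)\<close> can produce another factor of size
  \<open>\<theta>\<close>, the bound for \<open>h\<close> and its derivatives; one factor
  \<open>Y \<ge> \<theta>\<close> per derivative records this growth, while \<open>Y = 1\<close>
  describes the coefficients themselves.\<close>

definition graded :: "nat \<Rightarrow> real \<Rightarrow> real \<Rightarrow> (real \<Rightarrow> real) \<Rightarrow> bool" where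
  "graded m G Y g \<longleftrightarrow> g \<in> C_k_b m \<and> (\<forall>i\<le>m. \<forall>x. \<bar>(deriv ^^ i) g x\<bar> \<le> G * Y ^ i)"

lemma graded_0: "graded 0 G Y g \<longleftrightarrow> continuous_on UNIV g \<and> (\<forall>x. \<bar>g x\<bar> \<le> G)"
  by (auto simp: graded_def C_k_b_0)

lemma graded_Suc:
  "graded (Suc m) G Y g \<longleftrightarrow>
    (\<forall>x. g field_differentiable at x) \<and> (\<forall>x. \<bar>g x\<bar> \<le> G) \<and> graded m (G * Y) Y (deriv g)"
  unfolding graded_def C_k_b_Suc All_le_Suc2 by (auto simp: funpow_Suc' mult.assoc simp del: funpow.simps)

lemma graded_imp_C_k_b: "graded m G Y g \<Longrightarrow> g \<in> C_k_b m"
  by (simp add: graded_def)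

lemma graded_bound: "graded m G Y g \<Longrightarrow> \<bar>g x\<bar> \<le> G"
  by (force simp: graded_def)

lemma graded_nonneg: "graded m G Y g \<Longrightarrow> 0 \<le> G"
  using graded_bound[of m G Y g 0] by linarith

lemma graded_mono:
  assumes "graded m G Y g" "n \<le> m" "G \<le> G'" "Y \<le> Y'" "0 \<le> Y"
  shows "graded n G' Y' g"
  unfolding graded_def
proof (intro conjI allI impI)
  show "g \<in> C_k_b n"
    using assms C_k_b_mono by (auto simp: graded_def)
  fix i x assume "i \<le> n"
  then have "\<bar>(deriv ^^ i) g x\<bar> \<le> G * Y ^ i"
    using assms by (auto simp: graded_def)
  also have "\<dots> \<le> G' * Y' ^ i"
    using assms graded_nonneg[OF assms(1)] by (intro mult_mono power_mono) auto
  finally show "\<bar>(deriv ^^ i) g x\<bar> \<le> G' * Y' ^ i" .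
qed

lemma C_k_b_imp_graded:
  assumes "g \<in> C_k_b m"
  shows "\<exists>G. graded m G 1 g"
  using assms
proof (induction m arbitrary: g)
  case 0
  then show ?case by (auto simp: C_k_b_0 graded_0)
next
  case (Suc m)
  then obtain G H where "graded m G 1 (deriv g)" "\<And>x. \<bar>g x\<bar> \<le> H"
    unfolding C_k_b_Suc by blast
  then have "graded (Suc m) (max G H) 1 g"
    using Suc.prems graded_mono[of m G 1 "deriv g" m "max G H" 1]
    by (auto simp: graded_Suc C_k_b_Suc max.coboundedI2)
  then show ?case ..
qed

lemma graded_add:
  assumes "graded m G Y g" "graded m H Y h"
  shows "graded m (G + H) Y (\<lambda>x. g x + h x)"
  using assms
proof (induction m arbitrary: g h G H)
  case 0
  then show ?case
    by (auto simp: graded_0 intro!: continuous_intros intro: order_trans[OF abs_triangle_ineq add_mono])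
next
  case (Suc m)
  have "deriv (\<lambda>x. g x + h x) = (\<lambda>x. deriv g x + deriv h x)"
    using Suc.prems by (auto simp: graded_Suc)
  with Suc show ?case
    by (auto simp: graded_Suc distrib_right intro!: field_differentiable_add
        intro: order_trans[OF abs_triangle_ineq add_mono])
qed

text \<open>The factor \<open>2 ^ m\<close> counts the terms of the Leibniz rule: every derivative
  turns one product into two.\<close>

lemma graded_mult:
  assumes "graded m G Y g" "graded m H Y h" "0 \<le> Y"
  shows "graded m (2 ^ m * (G * H)) Y (\<lambda>x. g x * h x)"
  using assms(1,2)
proof (induction m arbitrary: g h G H)
  case 0
  then show ?case
    by (auto simp: graded_0 abs_mult intro!: continuous_intros mult_mono
        intro: order_trans[OF abs_ge_zero])
next
  case (Suc m)
  have d: "deriv (\<lambda>x. g x * h x) = (\<lambda>x. g x * deriv h x + deriv g x * h x)"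
    using Suc.prems by (auto simp: graded_Suc)
  have nn: "0 \<le> G" "0 \<le> H"
    using Suc.prems graded_nonneg by blast+
  have gh: "graded m G Y g" "graded m H Y h"
    using graded_mono[OF Suc.prems(1) _ order_refl order_refl assms(3), of m]
      graded_mono[OF Suc.prems(2) _ order_refl order_refl assms(3), of m] by auto
  have "graded m (2 ^ m * (G * (H * Y)) + 2 ^ m * (G * Y * H)) Y
      (\<lambda>x. g x * deriv h x + deriv g x * h x)"
    using Suc.prems by (intro graded_add Suc.IH gh) (auto simp: graded_Suc)
  then have D: "graded m (2 ^ Suc m * (G * H) * Y) Y (deriv (\<lambda>x. g x * h x))"
    unfolding d by (simp add: algebra_simps)
  have "\<bar>g x * h x\<bar> \<le> 2 ^ Suc m * (G * H)" for x
  proof -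
    have "\<bar>g x * h x\<bar> \<le> 1 * (G * H)"
      using Suc.prems nn by (simp add: abs_mult graded_Suc mult_mono)
    also have "\<dots> \<le> 2 ^ Suc m * (G * H)"
      using nn by (intro mult_right_mono) (auto simp del: power_Suc)
    finally show ?thesis .
  qed
  with D Suc.prems show ?case
    by (auto simp: graded_Suc intro!: field_differentiable_mult)
qed

lemma graded_const: "\<bar>c\<bar> \<le> G \<Longrightarrow> 0 \<le> Y \<Longrightarrow> graded m G Y (\<lambda>x. c)"
proof (induction m arbitrary: c G)
  case (Suc m)
  moreover have "0 \<le> G * Y" using Suc.prems by (intro mult_nonneg_nonneg) auto
  ultimately show ?case by (auto simp: graded_Suc)
qed (auto simp: graded_0)

lemma graded_cmult:
  assumes "graded m G Y g" "0 \<le> Y"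
  shows "graded m (\<bar>c\<bar> * G) Y (\<lambda>x. c * g x)"
proof -
  have "(deriv ^^ i) (\<lambda>x. c * g x) = (\<lambda>x. c * (deriv ^^ i) g x)" if "i \<le> m" for i
    using assms that C_k_b_mono by (intro iterated_deriv_cmult) (auto simp: graded_def)
  then show ?thesis
    using assms by (auto simp: graded_def abs_mult mult.assoc intro!: C_k_b_cmult mult_left_mono)
qed

lemma graded_diff:
  assumes "graded m G Y g" "graded m H Y h" "0 \<le> Y"
  shows "graded m (G + H) Y (\<lambda>x. g x - h x)"
  using graded_add[OF assms(1) graded_cmult[OF assms(2,3), of "-1"]] by simp

text \<open>The derivative is \<open>- h' / (1 + h)\<^sup>2\<close>, a product of functions covered
  by the induction hypothesis and of \<open>h'\<close>, whose size \<open>\<theta>\<close> is paid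
  by the factor \<open>Y\<close> of that derivative. \<open>W\<close> depends on \<open>c\<close>
  and \<open>m\<close> only. The second bound keeps \<open>\<theta>\<close>: the reciprocal differs
  from 1 by \<open>O(\<theta>)\<close>, which makes the later corrections integrable in the
  mark.\<close>

lemma graded_reciprocal:
  assumes "c > 0"
  shows "\<exists>W\<ge>1. \<forall>h \<theta> Y. graded m \<theta> 1 h \<longrightarrow> (\<forall>x. c \<le> 1 + h x) \<longrightarrow> 1 \<le> Y \<longrightarrow> \<theta> \<le> Y \<longrightarrow>
    graded m W Y (\<lambda>x. 1 / (1 + h x)) \<and> graded m (W * \<theta>) Y (\<lambda>x. 1 / (1 + h x) - 1)"
proof (induction m)
  case 0
  have bnd: "\<bar>1 / (1 + h x)\<bar> \<le> max 1 (1 / c)" "\<bar>1 / (1 + h x) - 1\<bar> \<le> max 1 (1 / c) * \<theta>"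
    if "c \<le> 1 + h x" "\<bar>h x\<bar> \<le> \<theta>" for h and \<theta> x :: real
  proof -
    have *: "\<bar>1 / (1 + h x)\<bar> \<le> 1 / c"
      using that assms by (simp add: frac_le)
    then show "\<bar>1 / (1 + h x)\<bar> \<le> max 1 (1 / c)" by simp
    have "1 / (1 + h x) - 1 = 1 / (1 + h x) * (- h x)"
      using that assms by (simp add: field_simps)
    then have "\<bar>1 / (1 + h x) - 1\<bar> = \<bar>1 / (1 + h x)\<bar> * \<bar>h x\<bar>"
      by (simp add: abs_mult)
    also have "\<dots> \<le> max 1 (1 / c) * \<theta>"
      using * that by (intro mult_mono) auto
    finally show "\<bar>1 / (1 + h x) - 1\<bar> \<le> max 1 (1 / c) * \<theta>" .
  qed
  show ?case
  proof (intro exI[of _ "max 1 (1 / c)"] conjI allI impI)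
    fix h :: "real \<Rightarrow> real" and \<theta> Y :: real
    assume *: "graded 0 \<theta> 1 h" "\<forall>x. c \<le> 1 + h x"
    have hb: "c \<le> 1 + h x" "\<bar>h x\<bar> \<le> \<theta>" for x using * by (auto simp: graded_0)
    have "1 + h x \<noteq> 0" for x using hb(1)[of x] assms by linarith
    then have c1: "continuous_on UNIV (\<lambda>x. 1 / (1 + h x))"
      using * by (intro continuous_intros) (auto simp: graded_0)
    then have c2: "continuous_on UNIV (\<lambda>x. 1 / (1 + h x) - 1)"
      by (intro continuous_on_diff continuous_on_const)
    show "graded 0 (max 1 (1 / c)) Y (\<lambda>x. 1 / (1 + h x))"
        "graded 0 (max 1 (1 / c) * \<theta>) Y (\<lambda>x. 1 / (1 + h x) - 1)"
      unfolding graded_0 using c1 c2 bnd(1)[of h, OF hb(1) hb(2)] bnd(2)[of h, OF hb(1) hb(2)]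
      by (iprover intro: conjI allI)+
  qed simp
next
  case (Suc m)
  then obtain W where W: "W \<ge> 1" "\<And>h \<theta> Y. graded m \<theta> 1 h \<Longrightarrow> (\<And>x. c \<le> 1 + h x) \<Longrightarrow> 1 \<le> Y \<Longrightarrow> \<theta> \<le> Y \<Longrightarrow>
    graded m W Y (\<lambda>x. 1 / (1 + h x)) \<and> graded m (W * \<theta>) Y (\<lambda>x. 1 / (1 + h x) - 1)"
    by blast
  define K where "K = 2 ^ m * (2 ^ m * (W * W))"
  define V where "V = max W K"
  have V: "W \<le> V" "K \<le> V" "1 \<le> V" "0 \<le> K" using W(1) by (auto simp: V_def K_def)
  show ?case
  proof (intro exI[of _ V] conjI allI impI)
    show "1 \<le> V" by (rule V)
    fix h :: "real \<Rightarrow> real" and \<theta> Y :: real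
    assume *: "graded (Suc m) \<theta> 1 h" "\<forall>x. c \<le> 1 + h x" "1 \<le> Y" "\<theta> \<le> Y"
    have hm: "graded m \<theta> 1 h"
      using *(1) by (rule graded_mono) auto
    note w = W(2)[OF hm _ *(3,4), rule_format, OF *(2)[rule_format]]
    have t: "0 \<le> \<theta>" using graded_nonneg hm by blast
    have nz: "1 + h x \<noteq> 0" for x using *(2)[rule_format, of x] assms by linarith
    have fd: "h field_differentiable at x" for x using *(1) by (auto simp: graded_Suc)
    have der: "((\<lambda>x. 1 / (1 + h x)) has_field_derivative deriv h x * (- 1 * (1 / (1 + h x) * (1 / (1 + h x))))) (at x)" for x
      using nz[of x] fd[of x, folded DERIV_deriv_iff_field_differentiable]
      by (auto intro!: derivative_eq_intros simp: field_simps)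
    have der': "((\<lambda>x. 1 / (1 + h x) - 1) has_field_derivative deriv h x * (- 1 * (1 / (1 + h x) * (1 / (1 + h x))))) (at x)" for x
      using DERIV_diff[OF der[of x] DERIV_const[of 1]] by simp
    have "graded m \<theta> Y (deriv h)"
      using *(1,3) by (auto simp: graded_Suc intro!: graded_mono[of m \<theta> 1 "deriv h" m \<theta> Y])
    then have "graded m (2 ^ m * (\<theta> * (\<bar>-1\<bar> * (2 ^ m * (W * W))))) Y
        (\<lambda>x. deriv h x * (- 1 * (1 / (1 + h x) * (1 / (1 + h x)))))"
      using w *(3) by (intro graded_mult graded_cmult) auto
    then have D: "graded m (K * \<theta>) Y (\<lambda>x. deriv h x * (- 1 * (1 / (1 + h x) * (1 / (1 + h x)))))"
      by (simp add: K_def mult_ac)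
    \<comment> \<open>Both functions have the same derivative, of size \<open>K * \<theta>\<close>.
      Using \<open>\<theta> \<le> Y\<close> gives the first grade; keeping \<open>\<theta>\<close>
      and using \<open>1 \<le> Y\<close> gives the second.\<close>
    have "K * \<theta> \<le> V * Y" "K * \<theta> \<le> V * \<theta> * Y"
    proof -
      show "K * \<theta> \<le> V * Y" using V t * by (intro mult_mono) auto
      have "K * \<theta> * 1 \<le> V * \<theta> * Y" using V t * by (intro mult_mono) auto
      then show "K * \<theta> \<le> V * \<theta> * Y" by simp
    qed
    note D' = this[THEN graded_mono[OF D order_refl _ order_refl], unfolded mult.assoc]
    have d: "deriv (\<lambda>x. 1 / (1 + h x)) = (\<lambda>x. deriv h x * (- 1 * (1 / (1 + h x) * (1 / (1 + h x)))))"
        "deriv (\<lambda>x. 1 / (1 + h x) - 1) = (\<lambda>x. deriv h x * (- 1 * (1 / (1 + h x) * (1 / (1 + h x)))))"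
      using der der' by (auto intro!: DERIV_imp_deriv)
    have fd1: "(\<lambda>x. 1 / (1 + h x)) field_differentiable at x" "(\<lambda>x. 1 / (1 + h x) - 1) field_differentiable at x" for x
      using der[of x] der'[of x] unfolding field_differentiable_def by blast+
    have b: "\<bar>1 / (1 + h x)\<bar> \<le> V" "\<bar>1 / (1 + h x) - 1\<bar> \<le> V * \<theta>" for x
      using graded_bound[OF conjunct1[OF w], of x] graded_bound[OF conjunct2[OF w], of x] V(1) t
      by (auto intro: order_trans mult_right_mono)
    show "graded (Suc m) V Y (\<lambda>x. 1 / (1 + h x))" "graded (Suc m) (V * \<theta>) Y (\<lambda>x. 1 / (1 + h x) - 1)"
      unfolding graded_Suc d mult.assoc using b D' *(3) fd1 by (blast intro: order_trans[OF zero_le_one])+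
  qed
qed

section \<open>Smoothing of test functions by averages over short intervals\<close>

lemma antiderivative_exists:
  fixes f :: "real \<Rightarrow> real"
  assumes "continuous_on UNIV f"
  obtains F where "\<And>x. (F has_field_derivative f x) (at x)"
proof
  fix x :: real
  define a where "a = - \<bar>x\<bar> - 1"
  have "((\<lambda>u. LBINT y=ereal 0..ereal u. f y) has_vector_derivative f x) (at x within {a..-a})"
    using assms by (intro interval_integral_FTC2) (auto simp: a_def intro: continuous_on_subset)
  moreover have "at x within {a..-a} = at x"
    by (rule at_within_Icc_at) (auto simp: a_def)
  ultimately show "((\<lambda>u. LBINT y=ereal 0..ereal u. f y) has_field_derivative f x) (at x)"
    by (simp add: has_real_derivative_iff_has_vector_derivative)
qed

lemma iterated_deriv_shift:
  "(deriv ^^ j) (\<lambda>x. f (x + d :: real)) = (\<lambda>x. (deriv ^^ j) f (x + d))"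
proof (induction j arbitrary: f)
  case (Suc j)
  have "deriv (\<lambda>x. f (x + d)) = (\<lambda>x. deriv f (x + d))"
    unfolding deriv_def by (simp add: DERIV_shift)
  then show ?case by (simp add: funpow_Suc' Suc del: funpow.simps)
qed simp

lemma abs_diff_le_of_deriv_bound:
  fixes f :: "real \<Rightarrow> real"
  assumes "\<And>x. (f has_field_derivative f' x) (at x)" "\<And>x. \<bar>f' x\<bar> \<le> B"
  shows "\<bar>f x - f y\<bar> \<le> B * \<bar>x - y\<bar>"
  using field_differentiable_bound[of UNIV f f' B x y] assms by simp

text \<open>Box averages gain one derivative, do not increase the sup norm, and commute with \<open>deriv\<close>.\<close>

lemma integral_deriv_le_of_smoother:
  fixes f :: "real measure"
  assumes "prob_space f" and sets: "sets f = sets borel" and "j \<le> m"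
    and le: "\<And>\<phi>. \<phi> \<in> C_k_b (Suc m) \<Longrightarrow> (\<And>y. \<bar>\<phi> y\<bar> \<le> 1) \<Longrightarrow> (\<integral>y. (deriv ^^ j) \<phi> y \<partial>f) \<le> a"
    and \<phi>: "\<phi> \<in> C_k_b m" "\<And>y. \<bar>\<phi> y\<bar> \<le> 1"
  shows "(\<integral>y. (deriv ^^ j) \<phi> y \<partial>f) \<le> a"
proof -
  interpret prob_space f by fact
  obtain \<Phi> where \<Phi>: "\<And>x. (\<Phi> has_field_derivative \<phi> x) (at x)"
    using antiderivative_exists C_k_b_imp_continuous[OF \<phi>(1)] by blast
  define \<delta> :: "nat \<Rightarrow> real" where "\<delta> n = 1 / real (Suc n)" for n
  have \<delta>: "\<delta> n > 0" for n by (simp add: \<delta>_def)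
  \<comment> \<open>The mean of \<open>\<phi>\<close> over an interval of length
    \<open>\<delta> n\<close> to the right of \<open>x\<close>, written through an antiderivative so
    that its derivative is a difference quotient.\<close>
  define \<psi> where "\<psi> n x = (1 / \<delta> n) * (\<Phi> (x + \<delta> n) - \<Phi> x)" for n x
  have d\<psi>: "(\<psi> n has_field_derivative (1 / \<delta> n) * (\<phi> (x + \<delta> n) - \<phi> x)) (at x)" for n x
    unfolding \<psi>_def[abs_def] using \<Phi>
    by (intro DERIV_cmult DERIV_diff) (auto simp: DERIV_shift[symmetric])
  then have d\<psi>': "deriv (\<psi> n) = (\<lambda>x. (1 / \<delta> n) * (\<phi> (x + \<delta> n) - \<phi> x))" for n
    by (auto intro!: DERIV_imp_deriv)
  have quot: "\<bar>(1 / \<delta> n) * (F (x + \<delta> n) - F x)\<bar> \<le> B"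
    if "\<And>x. (F has_field_derivative F' x) (at x)" "\<And>x. \<bar>F' x\<bar> \<le> B" for F F' :: "real \<Rightarrow> real" and B n x
    using abs_diff_le_of_deriv_bound[of F F' B "x + \<delta> n" x, OF that] \<delta>[of n]
    by (simp add: abs_mult field_simps)
  have lim: "(\<lambda>n. (1 / \<delta> n) * (F (x + \<delta> n) - F x)) \<longlonglongrightarrow> F' x"
    if "\<And>x. (F has_field_derivative F' x) (at x)" for F F' :: "real \<Rightarrow> real" and x
  proof -
    have "filterlim \<delta> (at 0) sequentially"
      unfolding filterlim_at using \<delta> LIMSEQ_inverse_real_of_nat
      by (auto simp: \<delta>_def[abs_def] inverse_eq_divide intro!: always_eventually)
    with that[of x, unfolded DERIV_def] have "(\<lambda>n. (F (x + \<delta> n) - F x) / \<delta> n) \<longlonglongrightarrow> F' x"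
      by (rule filterlim_compose)
    then show ?thesis by simp
  qed
  have shift: "(\<lambda>x. \<phi> (x + d)) \<in> C_k_b m" for d
  proof (rule C_k_b_compose[OF \<phi>(1)])
    have "deriv (\<lambda>x. x + d) = (\<lambda>x. 1)"
      by (auto intro!: DERIV_imp_deriv derivative_eq_intros)
    then show "deriv (\<lambda>x. x + d) \<in> C_k_b l" for l by (simp add: C_k_b_const)
  qed (auto intro: derivative_intros)
  have \<psi>1: "\<bar>\<psi> n x\<bar> \<le> 1" for n x
    unfolding \<psi>_def by (rule quot[OF \<Phi> \<phi>(2)])
  have \<psi>C: "\<psi> n \<in> C_k_b (Suc m)" for n
    unfolding C_k_b_Suc d\<psi>'
  proof (intro conjI allI exI[of _ 1])
    show "\<psi> n field_differentiable at x" for x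
      using d\<psi> unfolding field_differentiable_def by blast
    show "(\<lambda>x. 1 / \<delta> n * (\<phi> (x + \<delta> n) - \<phi> x)) \<in> C_k_b m"
      by (intro C_k_b_cmult C_k_b_diff shift \<phi>(1))
  qed (rule \<psi>1)
  \<comment> \<open>The \<open>j\<close>-th derivative of \<open>\<psi> n\<close> is again a
    difference quotient, now of an antiderivative \<open>F\<close> of the \<open>j\<close>-th
    derivative of \<open>\<phi>\<close>: for \<open>j = 0\<close> this is \<open>\<Phi>\<close>,
    otherwise the derivative of order \<open>j - 1\<close>. Bound and limit then come from
    \<open>quot\<close> and \<open>lim\<close>.\<close>
  obtain F where F: "\<And>x. (F has_field_derivative (deriv ^^ j) \<phi> x) (at x)"
    "\<And>n. (deriv ^^ j) (\<psi> n) = (\<lambda>x. (1 / \<delta> n) * (F (x + \<delta> n) - F x))"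
  proof (cases j)
    case 0
    then show ?thesis using that[of \<Phi>] \<Phi> by (simp add: \<psi>_def[abs_def])
  next
    case (Suc i)
    have 1: "\<phi> \<in> C_k_b i" "(\<lambda>x. \<phi> (x + d)) \<in> C_k_b i" for d
      using \<open>j \<le> m\<close> Suc by (auto intro: C_k_b_mono[OF \<phi>(1)] C_k_b_mono[OF shift])
    have "(deriv ^^ i) \<phi> \<in> C_k_b 1"
      using \<open>j \<le> m\<close> Suc by (intro C_k_b_iterated_deriv C_k_b_mono[OF \<phi>(1)]) auto
    then have "((deriv ^^ i) \<phi> has_field_derivative (deriv ^^ j) \<phi> x) (at x)" for x
      using Suc by (simp add: C_k_b_Suc DERIV_deriv_iff_field_differentiable)
    moreover have "(deriv ^^ j) (\<psi> n) = (\<lambda>x. (1 / \<delta> n) * ((deriv ^^ i) \<phi> (x + \<delta> n) - (deriv ^^ i) \<phi> x))" for n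
      unfolding Suc funpow_Suc' d\<psi>'
      by (simp only: iterated_deriv_cmult[OF C_k_b_diff[OF 1(2) 1(1)]] iterated_deriv_diff[OF 1(2) 1(1)]
          iterated_deriv_shift)
    ultimately show ?thesis using that by blast
  qed
  obtain B where B: "\<And>x. \<bar>(deriv ^^ j) \<phi> x\<bar> \<le> B"
    using C_k_b_imp_bounded[OF C_k_b_iterated_deriv[of _ j 0]] C_k_b_mono[OF \<phi>(1) \<open>j \<le> m\<close>] by auto
  have meas: "(deriv ^^ j) g \<in> borel_measurable f" if "g \<in> C_k_b m" for g
    using C_k_b_imp_continuous[OF C_k_b_iterated_deriv[of g j 0]] C_k_b_mono[OF that \<open>j \<le> m\<close>] sets
    by (simp add: measurable_cong_sets[OF sets refl] borel_measurable_continuous_onI)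
  have "(\<lambda>n. \<integral>y. (deriv ^^ j) (\<psi> n) y \<partial>f) \<longlonglongrightarrow> (\<integral>y. (deriv ^^ j) \<phi> y \<partial>f)"
  proof (rule integral_dominated_convergence[where w = "\<lambda>_. B"])
    show "AE x in f. (\<lambda>n. (deriv ^^ j) (\<psi> n) x) \<longlonglongrightarrow> (deriv ^^ j) \<phi> x"
      unfolding F(2) using lim[OF F(1)] by (intro AE_I2)
    show "AE x in f. norm ((deriv ^^ j) (\<psi> n) x) \<le> B" for n
      unfolding F(2) real_norm_def using quot[OF F(1) B] by (intro AE_I2)
  qed (auto intro: meas \<phi> C_k_b_SucD \<psi>C)
  then show ?thesis
    by (rule LIMSEQ_le_const2) (use le[OF \<psi>C \<psi>1] in auto)
qed

section \<open>Measures with derivatives of finite mass\<close>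

text \<open>\<open>c j\<close> stands for the total variation of the \<open>j\<close>-th
  distributional derivative of \<open>f\<close>. The test functions have only \<open>j\<close>
  derivatives and an arbitrary bound \<open>M\<close>, since the transport argument inserts weighted
  and pulled back derivatives of test functions, which have fewer derivatives and another
  bound.\<close>

definition deriv_bounds :: "nat \<Rightarrow> real measure \<Rightarrow> (nat \<Rightarrow> real) \<Rightarrow> bool" where
  "deriv_bounds k f c \<longleftrightarrow>
    (\<forall>j\<le>k. \<forall>\<psi>\<in>C_k_b j. \<forall>M. (\<forall>y. \<bar>\<psi> y\<bar> \<le> M) \<longrightarrow> \<bar>\<integral>y. (deriv ^^ j) \<psi> y \<partial>f\<bar> \<le> M * c j)"

lemma deriv_boundsD:
  assumes "deriv_bounds k f c" "j \<le> k" "\<psi> \<in> C_k_b j" "\<And>y. \<bar>\<psi> y\<bar> \<le> M"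
  shows "\<bar>\<integral>y. (deriv ^^ j) \<psi> y \<partial>f\<bar> \<le> M * c j"
  using assms by (auto simp: deriv_bounds_def)

lemma deriv_bounds_nonneg: "deriv_bounds k f c \<Longrightarrow> j \<le> k \<Longrightarrow> 0 \<le> c j"
  using deriv_boundsD[of k f c j "\<lambda>_. 0" 1] abs_ge_zero order_trans
  by (fastforce simp: C_k_b_const)

lemma iterated_deriv_zero: "(deriv ^^ j) (\<lambda>x::real. 0::real) = (\<lambda>x. 0)"
  by (induction j) auto

lemma integral_deriv_le_of_smoother':
  assumes "prob_space f" "sets f = sets borel" "j \<le> m"
    and "\<And>\<phi>. \<phi> \<in> C_k_b (m + n) \<Longrightarrow> (\<And>y. \<bar>\<phi> y\<bar> \<le> 1) \<Longrightarrow> (\<integral>y. (deriv ^^ j) \<phi> y \<partial>f) \<le> a"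
    and "\<phi> \<in> C_k_b m" "\<And>y. \<bar>\<phi> y\<bar> \<le> 1"
  shows "(\<integral>y. (deriv ^^ j) \<phi> y \<partial>f) \<le> a"
  using assms
proof (induction n arbitrary: m \<phi>)
  case (Suc n)
  show ?case
  proof (rule integral_deriv_le_of_smoother[OF Suc.prems(1-3) _ Suc.prems(5,6)])
    fix \<psi> assume \<psi>: "\<psi> \<in> C_k_b (Suc m)" "\<And>y. \<bar>\<psi> y\<bar> \<le> 1"
    show "(\<integral>y. (deriv ^^ j) \<psi> y \<partial>f) \<le> a"
      by (rule Suc.IH[OF Suc.prems(1,2) _ _ \<psi>]) (use Suc.prems in auto)
  qed
qed simp

text \<open>Testing with \<open>k\<close> derivatives and bound 1, as in the norm, suffices:
  averaging lowers the smoothness to order \<open>j\<close>, and scaling by \<open>1 / M\<close> and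
  \<open>- 1 / M\<close> yields the two signs of the absolute value. For \<open>M = 0\<close> the
  test function vanishes.\<close>

lemma deriv_boundsI:
  assumes f: "prob_space f" "sets f = sets borel"
    and le: "\<And>j \<phi>. j \<le> k \<Longrightarrow> \<phi> \<in> C_k_b k \<Longrightarrow> (\<And>y. \<bar>\<phi> y\<bar> \<le> 1) \<Longrightarrow> (\<integral>y. (deriv ^^ j) \<phi> y \<partial>f) \<le> c j"
  shows "deriv_bounds k f c"
  unfolding deriv_bounds_def
proof (intro allI impI ballI)
  fix j \<psi> M assume j: "j \<le> k" and \<psi>: "\<psi> \<in> C_k_b j" "\<forall>y. \<bar>\<psi> y\<bar> \<le> M"
  have 1: "(\<integral>y. (deriv ^^ j) \<phi> y \<partial>f) \<le> c j" if "\<phi> \<in> C_k_b j" "\<And>y. \<bar>\<phi> y\<bar> \<le> 1" for \<phi>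
    by (rule integral_deriv_le_of_smoother'[OF f order_refl _ that, of "k - j"]) (use le j in auto)
  show "\<bar>\<integral>y. (deriv ^^ j) \<psi> y \<partial>f\<bar> \<le> M * c j"
  proof (cases "M = 0")
    case True
    then have "\<psi> = (\<lambda>_. 0)" using \<psi> by auto
    then show ?thesis using True by (simp add: iterated_deriv_zero)
  next
    case False
    then have M: "M > 0" using \<psi>(2)[rule_format, of 0] by linarith
    have "(\<integral>y. a * (deriv ^^ j) \<psi> y \<partial>f) \<le> c j" if "\<bar>a\<bar> = 1 / M" for a
    proof -
      have "(\<integral>y. (deriv ^^ j) (\<lambda>x. a * \<psi> x) y \<partial>f) \<le> c j"
      proof (rule 1)
        show "\<bar>a * \<psi> y\<bar> \<le> 1" for y
          unfolding abs_mult that using \<psi>(2) M by simp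
      qed (intro C_k_b_cmult \<psi>(1))
      then show ?thesis by (simp add: iterated_deriv_cmult[OF \<psi>(1)])
    qed
    from this[of "1 / M"] this[of "- 1 / M"] M show ?thesis
      by (simp add: field_simps abs_le_iff)
  qed
qed

section \<open>Transport of derivative bounds by a single displacement\<close>

locale transport =
  fixes k :: nat and f :: "real measure" and c :: "nat \<Rightarrow> real" and h :: "real \<Rightarrow> real"
    and \<theta> W Y :: real
  assumes f: "prob_space f" "sets f = sets borel"
    and bounds: "deriv_bounds k f c"
    and h: "\<And>x. h field_differentiable at x" "\<And>x. \<bar>h x\<bar> \<le> \<theta>" "graded k \<theta> 1 (deriv h)"
    and h_pos: "\<And>x. 1 + deriv h x > 0"
    and W: "1 \<le> W" and Y: "1 \<le> Y"
    and w: "graded k W Y (\<lambda>x. 1 / (1 + deriv h x))"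
    and w1: "graded k (W * \<theta>) Y (\<lambda>x. 1 / (1 + deriv h x) - 1)"
begin

definition \<tau> where "\<tau> x = x + h x"
definition w where "w x = 1 / (1 + deriv h x)"
definition c_sum where "c_sum n = (\<Sum>j\<le>n. c j)"
text \<open>Solution of \<open>K (Suc l) = 2 * (2 ^ k * W + 1) * K l\<close> with
  \<open>K 0 = 2\<close>: the recursion is the one of \<open>K_step\<close>, the initial value the
  constant of \<open>integral_displacement\<close>.\<close>

definition K where "K l = 2 * (2 * (2 ^ k * W + 1)) ^ l"

text \<open>\<open>g\<close> weights the position after the jump and \<open>r\<close> the unchanged
  position of a rejected candidate. They are carried together because only their sum is close to a
  constant.\<close>

abbreviation pull where
  "pull g r l \<phi> \<equiv> \<lambda>x. g x * (deriv ^^ l) \<phi> (\<tau> x) + r x * (deriv ^^ l) \<phi> x"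

lemma w_graded: "graded k W Y w" "graded k (W * \<theta>) Y (\<lambda>x. w x - 1)"
  using w w1 by (simp_all add: w_def[abs_def])

lemma \<theta>_nonneg: "0 \<le> \<theta>" using h(2)[of 0] by linarith

lemma K_nonneg: "0 \<le> K l" using W by (simp add: K_def)

lemma \<tau>_deriv: "\<tau> field_differentiable at x" "deriv \<tau> x = 1 + deriv h x"
proof -
  have "(\<tau> has_field_derivative 1 + deriv h x) (at x)"
    unfolding \<tau>_def[abs_def] using h(1)
    by (auto intro!: derivative_eq_intros simp: DERIV_deriv_iff_field_differentiable)
  then show "\<tau> field_differentiable at x" "deriv \<tau> x = 1 + deriv h x"
    by (auto simp: field_differentiable_def intro: DERIV_imp_deriv)
qed

lemma C_k_b_\<tau>:
  assumes "\<phi> \<in> C_k_b m" "m \<le> Suc k"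
  shows "(\<lambda>x. \<phi> (\<tau> x)) \<in> C_k_b m"
proof (rule C_k_b_compose[OF assms(1)])
  fix l assume "m = Suc l"
  with assms(2) have "deriv h \<in> C_k_b l" using h(3) C_k_b_mono by (auto simp: graded_def)
  moreover have "deriv \<tau> = (\<lambda>x. 1 + deriv h x)" by (auto simp: \<tau>_deriv)
  ultimately show "deriv \<tau> \<in> C_k_b l" by (auto intro!: C_k_b_add C_k_b_const)
qed (auto simp: \<tau>_deriv)

lemma pull_C_k_b:
  assumes "i + l \<le> k" "g \<in> C_k_b i" "r \<in> C_k_b i" "\<phi> \<in> C_k_b k"
  shows "pull g r l \<phi> \<in> C_k_b i"
proof -
  have "(deriv ^^ l) \<phi> \<in> C_k_b i"
    using assms by (intro C_k_b_iterated_deriv C_k_b_mono[OF assms(4)]) auto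
  then show ?thesis
    using assms by (intro C_k_b_add C_k_b_mult C_k_b_\<tau>) auto
qed

lemma integrable_deriv:
  assumes "\<psi> \<in> C_k_b i"
  shows "integrable f ((deriv ^^ i) \<psi>)"
proof -
  interpret prob_space f by (rule f)
  have "(deriv ^^ i) \<psi> \<in> C_k_b 0"
    using assms C_k_b_iterated_deriv[of \<psi> i 0] by simp
  then obtain B where B: "continuous_on UNIV ((deriv ^^ i) \<psi>)" "\<And>x. \<bar>(deriv ^^ i) \<psi> x\<bar> \<le> B"
    unfolding C_k_b_0 by blast
  then show ?thesis
    using f(2) by (intro integrable_const_bound[of _ B])
      (auto simp: measurable_cong_sets[OF f(2) refl] borel_measurable_continuous_onI)
qed

text \<open>\<open>w\<close> is the reciprocal of the derivative of \<open>\<tau>\<close>, so by the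
  chain rule the weighted derivative of order \<open>Suc l\<close> at \<open>\<tau> x\<close> is the
  derivative of the one of order \<open>l\<close> with weight \<open>g * w\<close>, minus the term
  in which the derivative falls on \<open>g * w\<close>. One derivative thus moves outside, where it
  acts on \<open>f\<close>, at the price of a term of lower order with differentiated
  weights.\<close>

lemma integral_pull_Suc:
  assumes "i + Suc l \<le> k" "g \<in> C_k_b (Suc i)" "r \<in> C_k_b (Suc i)" "\<phi> \<in> C_k_b k"
  shows "(\<integral>x. (deriv ^^ i) (pull g r (Suc l) \<phi>) x \<partial>f) =
    (\<integral>x. (deriv ^^ Suc i) (pull (\<lambda>x. g x * w x) r l \<phi>) x \<partial>f) -
    (\<integral>x. (deriv ^^ i) (pull (deriv (\<lambda>x. g x * w x)) (deriv r) l \<phi>) x \<partial>f)"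
proof -
  have gw: "(\<lambda>x. g x * w x) \<in> C_k_b (Suc i)"
    using assms w_graded by (intro C_k_b_mult C_k_b_mono[OF graded_imp_C_k_b[of k W Y w]]) auto
  let ?Q = "pull (\<lambda>x. g x * w x) r l \<phi>" and ?R = "pull (deriv (\<lambda>x. g x * w x)) (deriv r) l \<phi>"
  have Q: "?Q \<in> C_k_b (Suc i)"
    using assms gw by (intro pull_C_k_b) auto
  have R: "?R \<in> C_k_b i"
    using assms gw by (intro pull_C_k_b) (auto simp: C_k_b_Suc)
  have Q': "deriv ?Q \<in> C_k_b i" using Q by (simp add: C_k_b_Suc)
  have "pull g r (Suc l) \<phi> = (\<lambda>x. deriv ?Q x - ?R x)"
  proof
    fix x
    have "(deriv ^^ l) \<phi> \<in> C_k_b (Suc 0)"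
      using assms by (intro C_k_b_iterated_deriv C_k_b_mono[OF assms(4)]) auto
    then have d\<phi>: "((deriv ^^ l) \<phi> has_field_derivative (deriv ^^ Suc l) \<phi> y) (at y)" for y
      by (simp add: C_k_b_Suc DERIV_deriv_iff_field_differentiable)
    have d\<tau>: "(\<tau> has_field_derivative 1 + deriv h x) (at x)"
      using \<tau>_deriv[of x] by (metis DERIV_deriv_iff_field_differentiable)
    have dgw: "((\<lambda>x. g x * w x) has_field_derivative deriv (\<lambda>x. g x * w x) x) (at x)"
      using gw by (simp add: C_k_b_Suc DERIV_deriv_iff_field_differentiable)
    have dr: "(r has_field_derivative deriv r x) (at x)"
      using assms by (simp add: C_k_b_Suc DERIV_deriv_iff_field_differentiable)
    have "(?Q has_field_derivative
        (g x * w x) * ((deriv ^^ Suc l) \<phi> (\<tau> x) * (1 + deriv h x)) + deriv (\<lambda>x. g x * w x) x * (deriv ^^ l) \<phi> (\<tau> x)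
        + (r x * (deriv ^^ Suc l) \<phi> x + deriv r x * (deriv ^^ l) \<phi> x)) (at x)"
      by (intro DERIV_add DERIV_mult' dgw dr d\<phi> DERIV_chain2[OF d\<phi> d\<tau>])
    moreover have "w x * (1 + deriv h x) = 1"
      using h_pos[of x] by (simp add: w_def)
    ultimately show "pull g r (Suc l) \<phi> x = deriv ?Q x - ?R x"
      by (simp add: DERIV_imp_deriv mult.assoc mult.left_commute[of "w x"] del: funpow.simps)
  qed
  then show ?thesis
    using integrable_deriv[OF R] integrable_deriv[OF Q']
    by (simp add: iterated_deriv_diff[OF Q' R] funpow_Suc' del: funpow.simps)
qed

lemma c_sum_mono: "m \<le> n \<Longrightarrow> n \<le> k \<Longrightarrow> c_sum m \<le> c_sum n"
  unfolding c_sum_def using deriv_bounds_nonneg[OF bounds]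
  by (intro sum_mono2) auto

lemma c_le_sum: "j \<le> n \<Longrightarrow> n \<le> k \<Longrightarrow> c j \<le> c_sum n"
  unfolding c_sum_def using deriv_bounds_nonneg[OF bounds]
  by (intro member_le_sum) auto

lemma c_sum_nonneg: "n \<le> k \<Longrightarrow> 0 \<le> c_sum n"
  unfolding c_sum_def using deriv_bounds_nonneg[OF bounds]
  by (intro sum_nonneg) auto

text \<open>
  With an antiderivative \<open>\<Phi>\<close> of \<open>\<phi>\<close>, \<open>\<phi> \<circ> \<tau> - \<phi> = (\<Phi> \<circ> \<tau> - \<Phi>)' - h' \<cdot> (\<phi> \<circ> \<tau>)\<close>, and both terms on
  the right are small in the sup norm. This is what makes the zeroth order of the jump part
  small although \<open>\<phi>\<close> is merely bounded.
\<close>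

lemma integral_displacement:
  assumes i: "Suc i \<le> k" and r: "r \<in> C_k_b (Suc i)" "\<And>x. \<bar>r x\<bar> \<le> R" "\<And>x. \<bar>deriv r x\<bar> \<le> R"
    and \<phi>: "\<phi> \<in> C_k_b k" "\<And>x. \<bar>\<phi> x\<bar> \<le> 1"
  shows "\<bar>\<integral>x. (deriv ^^ i) (\<lambda>x. r x * (\<phi> (\<tau> x) - \<phi> x)) x \<partial>f\<bar> \<le> 2 * (R * \<theta>) * c_sum (Suc i)"
proof -
  obtain \<Phi> where \<Phi>: "\<And>x. (\<Phi> has_field_derivative \<phi> x) (at x)"
    using antiderivative_exists C_k_b_imp_continuous[OF \<phi>(1)] by blast
  define \<psi> where "\<psi> x = \<Phi> (\<tau> x) - \<Phi> x" for x
  have d\<tau>: "(\<tau> has_field_derivative 1 + deriv h x) (at x)" for x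
    using \<tau>_deriv[of x] by (metis DERIV_deriv_iff_field_differentiable)
  have d\<psi>: "(\<psi> has_field_derivative (\<phi> (\<tau> x) * (1 + deriv h x) - \<phi> x)) (at x)" for x
    unfolding \<psi>_def[abs_def] using \<Phi> d\<tau> by (intro DERIV_diff DERIV_chain2)
  have \<psi>_bound: "\<bar>\<psi> x\<bar> \<le> \<theta>" for x
    unfolding \<psi>_def using abs_diff_le_of_deriv_bound[OF \<Phi> \<phi>(2), of "\<tau> x" x] h(2)[of x]
    by (simp add: \<tau>_def)
  have d\<psi>': "deriv \<psi> = (\<lambda>x. \<phi> (\<tau> x) * (1 + deriv h x) - \<phi> x)"
    using d\<psi> by (auto intro!: DERIV_imp_deriv)
  have hi: "deriv h \<in> C_k_b i" using graded_imp_C_k_b[OF h(3)] i C_k_b_mono Suc_leD by blast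
  have \<phi>i: "\<phi> \<in> C_k_b i" "(\<lambda>x. \<phi> (\<tau> x)) \<in> C_k_b i" 
    using \<phi> i C_k_b_mono by (auto intro!: C_k_b_\<tau>)
  have \<psi>C: "\<psi> \<in> C_k_b (Suc i)"
    unfolding C_k_b_Suc d\<psi>' using d\<psi> \<psi>_bound hi \<phi>i
    by (auto simp: field_differentiable_def intro!: C_k_b_diff C_k_b_mult C_k_b_add C_k_b_const)
  have ri: "r \<in> C_k_b i" "deriv r \<in> C_k_b i" using r C_k_b_SucD by (auto simp: C_k_b_Suc[of r])
  have R: "0 \<le> R" using r(2)[of 0] by linarith
  let ?A = "\<lambda>x. r x * \<psi> x" and ?B = "\<lambda>x. deriv r x * \<psi> x" and ?D = "\<lambda>x. r x * (deriv h x * \<phi> (\<tau> x))"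
  have A: "?A \<in> C_k_b (Suc i)" using r(1) \<psi>C by (rule C_k_b_mult)
  have A': "deriv ?A \<in> C_k_b i" using A by (simp add: C_k_b_Suc)
  have B: "?B \<in> C_k_b i" using ri \<psi>C C_k_b_SucD by (intro C_k_b_mult) auto
  have D: "?D \<in> C_k_b i" using ri hi \<phi>i by (intro C_k_b_mult)
  have "deriv ?A = (\<lambda>x. r x * (\<phi> (\<tau> x) * (1 + deriv h x) - \<phi> x) + deriv r x * \<psi> x)"
    using r(1) d\<psi>
    by (auto intro!: DERIV_imp_deriv DERIV_mult' simp: C_k_b_Suc DERIV_deriv_iff_field_differentiable)
  then have split: "(\<lambda>x. r x * (\<phi> (\<tau> x) - \<phi> x)) = (\<lambda>x. (deriv ?A x - ?B x) - ?D x)"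
    by (auto simp: algebra_simps)
  have "(\<integral>x. (deriv ^^ i) (\<lambda>x. r x * (\<phi> (\<tau> x) - \<phi> x)) x \<partial>f) =
      (\<integral>x. (deriv ^^ Suc i) ?A x \<partial>f) - (\<integral>x. (deriv ^^ i) ?B x \<partial>f) - (\<integral>x. (deriv ^^ i) ?D x \<partial>f)"
    unfolding split funpow_Suc' using integrable_deriv[OF A'] integrable_deriv[OF B] integrable_deriv[OF D]
    by (simp add: iterated_deriv_diff[OF C_k_b_diff[OF A' B] D] iterated_deriv_diff[OF A' B])
  moreover have "\<bar>\<integral>x. (deriv ^^ Suc i) ?A x \<partial>f\<bar> \<le> R * \<theta> * c (Suc i)"
    using i R r \<psi>_bound by (intro deriv_boundsD[OF bounds _ A]) (auto simp: abs_mult intro!: mult_mono)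
  moreover have "\<bar>\<integral>x. (deriv ^^ i) ?B x \<partial>f\<bar> \<le> R * \<theta> * c i"
    using i R r \<psi>_bound by (intro deriv_boundsD[OF bounds _ B]) (auto simp: abs_mult intro!: mult_mono)
  moreover have "\<bar>r x * (deriv h x * \<phi> (\<tau> x))\<bar> \<le> R * (\<theta> * 1)" for x
    unfolding abs_mult using R r \<phi> graded_bound[OF h(3)] \<theta>_nonneg by (intro mult_mono) auto
  then have "\<bar>\<integral>x. (deriv ^^ i) ?D x \<partial>f\<bar> \<le> R * \<theta> * c i"
    using i by (intro deriv_boundsD[OF bounds _ D]) auto
  \<comment> \<open>The first two terms involve the different orders \<open>Suc i\<close> and
    \<open>i\<close> and fit into one copy of the sum; the third needs a second copy, whence the
    factor 2.\<close>
  moreover have "R * \<theta> * c (Suc i) + R * \<theta> * c i \<le> R * \<theta> * c_sum (Suc i)"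
    using i R \<theta>_nonneg c_le_sum[of i i]
    by (auto simp: c_sum_def distrib_left[symmetric] intro!: mult_left_mono)
  moreover have "R * \<theta> * c i \<le> R * \<theta> * c_sum (Suc i)"
    using i R \<theta>_nonneg by (intro mult_left_mono c_le_sum) auto
  ultimately show ?thesis by simp
qed

text \<open>The identity \<open>g * w + r - \<Gamma> = (g + r - \<Gamma>) * w + \<Gamma> * (w - 1) -
  r * (w - 1)\<close> shows that multiplying \<open>g\<close> by \<open>w\<close> disturbs the near
  constancy of \<open>g + r\<close> only through \<open>w - 1\<close>, which is of size
  \<open>W * \<theta>\<close>.\<close>

lemma graded_w_step:
  assumes "graded l S Y (\<lambda>x. g x + r x - \<Gamma>)" "graded l R 1 r" "l \<le> k" "0 \<le> \<Gamma>"
  shows "graded l (2 ^ k * W * (S + (R + \<Gamma>) * \<theta>)) Y (\<lambda>x. g x * w x + r x - \<Gamma>)"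
proof -
  have wl: "graded l W Y w" "graded l (W * \<theta>) Y (\<lambda>x. w x - 1)"
    using Y assms(3) by (auto intro!: graded_mono[OF w_graded(1)] graded_mono[OF w_graded(2)])
  have rl: "graded l R Y r" using Y by (intro graded_mono[OF assms(2)]) auto
  have "graded l (2 ^ l * (S * W) + \<bar>\<Gamma>\<bar> * (W * \<theta>) + 2 ^ l * (R * (W * \<theta>))) Y
      (\<lambda>x. (g x + r x - \<Gamma>) * w x + \<Gamma> * (w x - 1) - r x * (w x - 1))"
    using Y by (intro graded_diff graded_add graded_mult graded_cmult wl rl assms) auto
  also have "(\<lambda>x. (g x + r x - \<Gamma>) * w x + \<Gamma> * (w x - 1) - r x * (w x - 1)) = (\<lambda>x. g x * w x + r x - \<Gamma>)"
    by (auto simp: algebra_simps)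
  finally have *: "graded l (2 ^ l * (S * W) + \<bar>\<Gamma>\<bar> * (W * \<theta>) + 2 ^ l * (R * (W * \<theta>))) Y
      (\<lambda>x. g x * w x + r x - \<Gamma>)" .
  have nn: "0 \<le> S" "0 \<le> R" using graded_nonneg assms by blast+
  have "2 ^ l \<le> (2 ^ k :: real)" "1 \<le> (2 ^ k :: real)" using assms(3) by auto
  then have "2 ^ l * (S * W) + 1 * (\<Gamma> * (W * \<theta>)) + 2 ^ l * (R * (W * \<theta>))
      \<le> 2 ^ k * (S * W) + 2 ^ k * (\<Gamma> * (W * \<theta>)) + 2 ^ k * (R * (W * \<theta>))"
    using nn W \<theta>_nonneg assms(4) by (intro add_mono mult_right_mono) auto
  also have "\<dots> = 2 ^ k * W * (S + (R + \<Gamma>) * \<theta>)" by (simp add: algebra_simps)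
  finally show ?thesis
    using Y assms(4) by (intro graded_mono[OF *]) auto
qed

text \<open>Adds the two branches of \<open>integral_pull_Suc\<close>. \<open>d\<close> and
  \<open>e\<close> are partial sums of the \<open>c j\<close>, \<open>z\<close> is the deviation of
  the weights from constancy including the part \<open>v\<close> due to the displacement. Either
  branch is at most \<open>K l * ((2 ^ k * W + 1) * z * Y) * Y ^ l * e\<close>.\<close>

lemma K_step:
  assumes "0 \<le> z" "0 \<le> d" "0 \<le> e" "d \<le> e" "0 \<le> v" "v \<le> z"
  shows "K l * (2 ^ k * W * z + v) * Y ^ l * d + K l * (2 ^ k * W * z * Y + v) * Y ^ l * e
    \<le> K (Suc l) * z * Y ^ Suc l * e"
proof -
  have a: "0 \<le> 2 ^ k * W * z" using W assms by simp
  have yl: "0 \<le> Y ^ l" using Y by simp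
  have "2 ^ k * W * z * 1 \<le> 2 ^ k * W * z * Y" "z * 1 \<le> z * Y"
    using mult_left_mono[OF Y a] mult_left_mono[OF Y assms(1)] by auto
  then have b: "2 ^ k * W * z + v \<le> (2 ^ k * W + 1) * z * Y" "2 ^ k * W * z * Y + v \<le> (2 ^ k * W + 1) * z * Y"
    using assms by (auto simp: algebra_simps)
  have "K l * (2 ^ k * W * z + v) * Y ^ l * d \<le> K l * ((2 ^ k * W + 1) * z * Y) * Y ^ l * e"
    using K_nonneg[of l] b yl assms a Y W
    by (intro mult_mono mult_left_mono mult_right_mono mult_nonneg_nonneg add_nonneg_nonneg) auto
  moreover have "K l * (2 ^ k * W * z * Y + v) * Y ^ l * e \<le> K l * ((2 ^ k * W + 1) * z * Y) * Y ^ l * e"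
    using K_nonneg[of l] b yl assms Y W
    by (intro mult_mono mult_left_mono mult_right_mono mult_nonneg_nonneg add_nonneg_nonneg) auto
  moreover have "K (Suc l) * z * Y ^ Suc l * e = 2 * (K l * ((2 ^ k * W + 1) * z * Y) * Y ^ l * e)"
    by (simp add: K_def algebra_simps)
  ultimately show ?thesis by linarith
qed

text \<open>Since \<open>g * (\<phi> \<circ> \<tau>) + r * \<phi>\<close> equals \<open>(g + r) *
  (\<phi> \<circ> \<tau>) - r * (\<phi> \<circ> \<tau> - \<phi>)\<close>, a small sum
  \<open>g + r\<close> and a small displacement suffice, although \<open>g\<close> and
  \<open>r\<close> need not be small. The displacement term costs one more derivative of
  \<open>f\<close>, which \<open>i + l + 1 \<le> k\<close> provides.\<close>

lemma integral_pull_lower: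
  assumes "i + l + 1 \<le> k" "g \<in> C_k_b (i + l)" "r \<in> C_k_b (i + l + 1)"
    "graded l S Y (\<lambda>x. g x + r x)" "graded (Suc l) R 1 r" "\<phi> \<in> C_k_b k" "\<And>x. \<bar>\<phi> x\<bar> \<le> 1"
  shows "\<bar>\<integral>x. (deriv ^^ i) (pull g r l \<phi>) x \<partial>f\<bar> \<le> K l * (S + R * \<theta>) * Y ^ l * c_sum (i + l + 1)"
  using assms
proof (induction l arbitrary: i g r S R)
  case 0
  let ?A = "\<lambda>x. (g x + r x) * \<phi> (\<tau> x)" and ?B = "\<lambda>x. r x * (\<phi> (\<tau> x) - \<phi> x)"
  have S: "0 \<le> S" using 0 graded_nonneg by blast
  have R: "0 \<le> R" using 0 graded_nonneg by blast
  have \<phi>i: "\<phi> \<in> C_k_b i" using 0 by (intro C_k_b_mono[OF 0(6)]) auto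
  have r: "r \<in> C_k_b i" using 0 C_k_b_SucD by simp
  have A: "?A \<in> C_k_b i" using 0 r \<phi>i by (intro C_k_b_mult C_k_b_add C_k_b_\<tau>) auto
  have B: "?B \<in> C_k_b i" using 0 r \<phi>i by (intro C_k_b_mult C_k_b_diff C_k_b_\<tau>) auto
  have eq: "pull g r 0 \<phi> = (\<lambda>x. ?A x - ?B x)" by (auto simp: algebra_simps)
  have "\<bar>(g x + r x) * \<phi> (\<tau> x)\<bar> \<le> S * 1" for x
    unfolding abs_mult using 0 S graded_bound[OF 0(4)] by (intro mult_mono) auto
  then have "\<bar>\<integral>x. (deriv ^^ i) ?A x \<partial>f\<bar> \<le> S * 1 * c i"
    using 0 by (intro deriv_boundsD[OF bounds _ A]) auto
  moreover have "S * 1 * c i \<le> S * c_sum (Suc i)"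
    using S 0 by (auto intro!: mult_left_mono c_le_sum)
  moreover have "\<bar>\<integral>x. (deriv ^^ i) ?B x \<partial>f\<bar> \<le> 2 * (R * \<theta>) * c_sum (Suc i)"
    using 0 by (intro integral_displacement) (auto simp: graded_Suc graded_bound)
  moreover have "(\<integral>x. (deriv ^^ i) (pull g r 0 \<phi>) x \<partial>f) = (\<integral>x. (deriv ^^ i) ?A x \<partial>f) - (\<integral>x. (deriv ^^ i) ?B x \<partial>f)"
    unfolding eq
    using integrable_deriv[OF A] integrable_deriv[OF B] by (simp add: iterated_deriv_diff[OF A B])
  moreover have "0 \<le> S * c_sum (Suc i)" using S 0 c_sum_nonneg by simp
  ultimately show ?case by (simp add: K_def algebra_simps)
next
  case (Suc l)
  let ?z = "S + R * \<theta>" and ?gw = "\<lambda>x. g x * w x"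
  let ?S = "2 ^ k * W * ?z"
  have nn: "0 \<le> S" "0 \<le> R" using Suc.prems graded_nonneg by blast+
  have Cw: "w \<in> C_k_b (i + Suc l)"
    using w_graded Suc.prems by (intro C_k_b_mono[OF graded_imp_C_k_b[of k W Y w]]) auto
  have gw: "?gw \<in> C_k_b (i + Suc l)" by (rule C_k_b_mult[OF Suc.prems(2) Cw])
  have r1: "graded (Suc l) R 1 r" by (rule graded_mono[OF Suc.prems(5)]) auto
  have s: "graded (Suc l) ?S Y (\<lambda>x. ?gw x + r x)"
    using graded_w_step[of "Suc l" S g r 0 R] Suc.prems r1 by simp
  have s0: "graded l ?S Y (\<lambda>x. ?gw x + r x)" by (rule graded_mono[OF s]) (use Y in auto)
  have "deriv (\<lambda>x. ?gw x + r x) = (\<lambda>x. deriv ?gw x + deriv r x)"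
    using gw Suc.prems by (auto simp: C_k_b_Suc)
  then have s': "graded l (?S * Y) Y (\<lambda>x. deriv ?gw x + deriv r x)"
    using s by (simp add: graded_Suc[of l])
  have "\<bar>\<integral>x. (deriv ^^ Suc i) (pull ?gw r l \<phi>) x \<partial>f\<bar> \<le> K l * (?S + R * \<theta>) * Y ^ l * c_sum (Suc i + l + 1)"
    using Suc.prems gw s0 r1 by (intro Suc.IH) auto
  moreover have "\<bar>\<integral>x. (deriv ^^ i) (pull (deriv ?gw) (deriv r) l \<phi>) x \<partial>f\<bar>
      \<le> K l * (?S * Y + R * \<theta>) * Y ^ l * c_sum (i + l + 1)"
    using Suc.prems gw s' by (intro Suc.IH) (auto simp: C_k_b_Suc graded_Suc[of "Suc l"])
  moreover have "K l * (?S * Y + R * \<theta>) * Y ^ l * c_sum (i + l + 1) \<le> K l * (?S * Y + R * \<theta>) * Y ^ l * c_sum (i + Suc l + 1)"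
    using K_nonneg nn W Y \<theta>_nonneg Suc.prems by (intro mult_left_mono c_sum_mono) auto
  moreover have "(\<integral>x. (deriv ^^ i) (pull g r (Suc l) \<phi>) x \<partial>f) =
    (\<integral>x. (deriv ^^ Suc i) (pull ?gw r l \<phi>) x \<partial>f) - (\<integral>x. (deriv ^^ i) (pull (deriv ?gw) (deriv r) l \<phi>) x \<partial>f)"
    using Suc.prems
    by (intro integral_pull_Suc) (auto intro: C_k_b_mono[OF Suc.prems(2)] C_k_b_mono[OF Suc.prems(3)])
  moreover have "K l * (?S + R * \<theta>) * Y ^ l * c_sum (Suc i + l + 1) + K l * (?S * Y + R * \<theta>) * Y ^ l * c_sum (i + Suc l + 1)
     \<le> K (Suc l) * ?z * Y ^ Suc l * c_sum (i + Suc l + 1)"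
    using nn \<theta>_nonneg Suc.prems by (intro K_step) (auto intro!: c_sum_nonneg)
  ultimately show ?case by linarith
qed

text \<open>The term of top order has no derivative to spare for
  \<open>integral_displacement\<close>, so its weights are bounded pointwise: each step multiplies
  \<open>g\<close> by one more factor \<open>w\<close>, and \<open>U\<close> controls the final
  weights. The other term of each step is of lower order, and its weights add up to the derivative
  of \<open>g * w + r - \<Gamma>\<close>; the constant drops out and leaves the small sum that
  \<open>integral_pull_lower\<close> requires.\<close>

lemma integral_pull_top:
  assumes "i + l \<le> k" "g \<in> C_k_b (i + l)" "r \<in> C_k_b (i + l + 1)" "0 \<le> \<Gamma>"
    "graded l S Y (\<lambda>x. g x + r x - \<Gamma>)" "graded (Suc l) R 1 r" "\<And>x. \<bar>g x\<bar> * w x ^ l + \<bar>r x\<bar> \<le> U"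
    "\<phi> \<in> C_k_b k" "\<And>x. \<bar>\<phi> x\<bar> \<le> 1"
  shows "\<bar>\<integral>x. (deriv ^^ i) (pull g r l \<phi>) x \<partial>f\<bar>
    \<le> U * c (i + l) + K l * (S + (R + \<Gamma>) * \<theta>) * Y ^ l * c_sum (i + l)"
  using assms
proof (induction l arbitrary: i g r S)
  case 0
  have "\<bar>g x * \<phi> (\<tau> x) + r x * \<phi> x\<bar> \<le> U" for x
  proof -
    have "\<bar>g x * \<phi> (\<tau> x) + r x * \<phi> x\<bar> \<le> \<bar>g x\<bar> * \<bar>\<phi> (\<tau> x)\<bar> + \<bar>r x\<bar> * \<bar>\<phi> x\<bar>"
      by (metis abs_mult abs_triangle_ineq)
    also have "\<dots> \<le> \<bar>g x\<bar> * 1 + \<bar>r x\<bar> * 1"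
      using 0 by (intro add_mono mult_left_mono) auto
    finally show ?thesis using 0(7)[of x] by simp
  qed
  then have "\<bar>\<integral>x. (deriv ^^ i) (pull g r 0 \<phi>) x \<partial>f\<bar> \<le> U * c i"
    using 0 C_k_b_SucD by (intro deriv_boundsD[OF bounds] pull_C_k_b) auto
  moreover have "0 \<le> K 0 * (S + (R + \<Gamma>) * \<theta>) * Y ^ 0 * c_sum (i + 0)"
    using 0 K_nonneg \<theta>_nonneg graded_nonneg[OF 0(5)] graded_nonneg[OF 0(6)] Y
    by (intro mult_nonneg_nonneg add_nonneg_nonneg c_sum_nonneg) auto
  ultimately show ?case by simp
next
  case (Suc l)
  let ?v = "(R + \<Gamma>) * \<theta>" and ?gw = "\<lambda>x. g x * w x"
  let ?z = "S + ?v"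
  let ?S = "2 ^ k * W * ?z"
  have nn: "0 \<le> S" "0 \<le> R" using Suc.prems graded_nonneg by blast+
  have Cw: "w \<in> C_k_b (i + Suc l)"
    using w_graded Suc.prems by (intro C_k_b_mono[OF graded_imp_C_k_b[of k W Y w]]) auto
  have gw: "?gw \<in> C_k_b (i + Suc l)" by (rule C_k_b_mult[OF Suc.prems(2) Cw])
  have r1: "graded (Suc l) R 1 r" by (rule graded_mono[OF Suc.prems(6)]) auto
  have s: "graded (Suc l) ?S Y (\<lambda>x. ?gw x + r x - \<Gamma>)"
    using graded_w_step[of "Suc l" S g r \<Gamma> R] Suc.prems r1 by simp
  have s0: "graded l ?S Y (\<lambda>x. ?gw x + r x - \<Gamma>)" by (rule graded_mono[OF s]) (use Y in auto)
  have fd: "?gw field_differentiable at x" "r field_differentiable at x" for x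
    using gw Suc.prems by (auto simp: C_k_b_Suc)
  have "deriv (\<lambda>x. ?gw x + r x - \<Gamma>) = (\<lambda>x. deriv ?gw x + deriv r x)"
  proof
    fix x
    have "((\<lambda>x. ?gw x + r x - \<Gamma>) has_field_derivative deriv ?gw x + deriv r x - 0) (at x)"
      using fd by (intro DERIV_diff DERIV_add) (auto simp: DERIV_deriv_iff_field_differentiable)
    then show "deriv (\<lambda>x. ?gw x + r x - \<Gamma>) x = deriv ?gw x + deriv r x"
      by (simp add: DERIV_imp_deriv)
  qed
  then have s': "graded l (?S * Y) Y (\<lambda>x. deriv ?gw x + deriv r x)"
    using s by (simp add: graded_Suc[of l])
  have wpos: "0 \<le> w x" for x using h_pos[of x] by (simp add: w_def)
  have "\<bar>\<integral>x. (deriv ^^ Suc i) (pull ?gw r l \<phi>) x \<partial>f\<bar> \<le> U * c (Suc i + l) + K l * (?S + ?v) * Y ^ l * c_sum (Suc i + l)"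
    using Suc.prems gw s0 r1 wpos by (intro Suc.IH) (auto simp: abs_mult mult.assoc)
  moreover have "\<bar>\<integral>x. (deriv ^^ i) (pull (deriv ?gw) (deriv r) l \<phi>) x \<partial>f\<bar>
      \<le> K l * (?S * Y + R * \<theta>) * Y ^ l * c_sum (i + l + 1)"
    using Suc.prems gw s' by (intro integral_pull_lower) (auto simp: C_k_b_Suc graded_Suc[of "Suc l"])
  moreover have "K l * (?S * Y + R * \<theta>) * Y ^ l * c_sum (i + l + 1) \<le> K l * (?S * Y + ?v) * Y ^ l * c_sum (i + Suc l)"
  proof -
    have "K l * (?S * Y + R * \<theta>) * Y ^ l \<le> K l * (?S * Y + ?v) * Y ^ l"
      using K_nonneg Y Suc.prems(4) \<theta>_nonneg
      by (intro mult_left_mono[OF _ K_nonneg] mult_right_mono[of _ _ "Y ^ l"] add_left_mono) (auto simp: mult_right_mono)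
    then show ?thesis using c_sum_nonneg[of "i + l + 1"] Suc.prems by (auto intro: mult_right_mono)
  qed
  moreover have "(\<integral>x. (deriv ^^ i) (pull g r (Suc l) \<phi>) x \<partial>f) =
    (\<integral>x. (deriv ^^ Suc i) (pull ?gw r l \<phi>) x \<partial>f) - (\<integral>x. (deriv ^^ i) (pull (deriv ?gw) (deriv r) l \<phi>) x \<partial>f)"
    using Suc.prems
    by (intro integral_pull_Suc) (auto intro: C_k_b_mono[OF Suc.prems(2)] C_k_b_mono[OF Suc.prems(3)])
  moreover have "K l * (?S + ?v) * Y ^ l * c_sum (Suc i + l) + K l * (?S * Y + ?v) * Y ^ l * c_sum (i + Suc l)
     \<le> K (Suc l) * ?z * Y ^ Suc l * c_sum (i + Suc l)"
    using nn \<theta>_nonneg Suc.prems by (intro K_step) (auto intro!: c_sum_nonneg)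
  ultimately show ?case by simp
qed

text \<open>Telescoping over the factors: each differs from 1 by at most
  \<open>W * \<theta>\<close>, and the others are at most \<open>W\<close>. The leading term is kept
  exactly 1 so that the coefficient \<open>B\<close> in \<open>transport_estimate\<close> is
  preserved.\<close>

lemma w_power: "w x ^ l \<le> 1 + real l * W ^ l * (W * \<theta>)"
proof -
  have wx: "0 \<le> w x" "w x \<le> W" "\<bar>w x - 1\<bar> \<le> W * \<theta>"
    using h_pos[of x] graded_bound[OF w_graded(1), of x] graded_bound[OF w_graded(2), of x]
    by (auto simp: w_def)
  have Wt: "0 \<le> W * \<theta>" using W \<theta>_nonneg by simp
  show ?thesis
  proof (induction l)
    case (Suc l)
    have "w x ^ Suc l = w x ^ l * (w x - 1) + w x ^ l" by (simp add: algebra_simps)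
    also have "\<dots> \<le> W ^ l * (W * \<theta>) + (1 + real l * W ^ l * (W * \<theta>))"
    proof (intro add_mono Suc.IH)
      have "w x ^ l * (w x - 1) \<le> w x ^ l * \<bar>w x - 1\<bar>" using wx by (intro mult_left_mono) auto
      also have "\<dots> \<le> W ^ l * (W * \<theta>)" using wx W by (intro mult_mono power_mono) auto
      finally show "w x ^ l * (w x - 1) \<le> W ^ l * (W * \<theta>)" .
    qed
    also have "\<dots> = 1 + real (Suc l) * W ^ l * (W * \<theta>)" by (simp add: algebra_simps)
    also have "\<dots> \<le> 1 + real (Suc l) * W ^ Suc l * (W * \<theta>)"
      using W Wt by (intro add_left_mono mult_right_mono mult_left_mono power_increasing) auto
    finally show ?case .
  qed simp
qed

end

text \<open>The weights \<open>\<gamma>\<close> and \<open>B - \<gamma>\<close> add up to the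
  constant \<open>B\<close>, so the deviation is 0 at the start and arises only from the
  displacement. The leading coefficient is therefore exactly \<open>B\<close>, and everything else
  carries a factor \<open>\<theta>\<close>; the power \<open>(1 + \<theta>) ^ k\<close> comes from
  the choice \<open>Y = 1 + \<theta>\<close>.\<close>

lemma transport_estimate:
  assumes "c\<^sub>0 > 0" "0 \<le> B"
  shows "\<exists>C\<ge>0. \<forall>f c h \<theta> \<gamma> l \<phi>. prob_space f \<longrightarrow> sets f = sets borel \<longrightarrow> deriv_bounds k f c \<longrightarrow>
    (\<forall>x. h field_differentiable at x) \<longrightarrow> (\<forall>x. \<bar>h x\<bar> \<le> \<theta>) \<longrightarrow> graded k \<theta> 1 (deriv h) \<longrightarrow>
    (\<forall>x. c\<^sub>0 \<le> 1 + deriv h x) \<longrightarrow> graded (Suc k) B 1 \<gamma> \<longrightarrow> (\<forall>x. 0 \<le> \<gamma> x) \<longrightarrow> l \<le> k \<longrightarrow>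
    \<phi> \<in> C_k_b k \<longrightarrow> (\<forall>x. \<bar>\<phi> x\<bar> \<le> 1) \<longrightarrow>
    \<bar>\<integral>x. \<gamma> x * (deriv ^^ l) \<phi> (x + h x) + (B - \<gamma> x) * (deriv ^^ l) \<phi> x \<partial>f\<bar>
      \<le> B * c l + C * (\<theta> * (1 + \<theta>) ^ k) * (\<Sum>j\<le>l. c j)"
proof -
  obtain W where W: "W \<ge> 1" "\<And>h \<theta> Y. graded k \<theta> 1 h \<Longrightarrow> (\<And>x. c\<^sub>0 \<le> 1 + h x) \<Longrightarrow> 1 \<le> Y \<Longrightarrow> \<theta> \<le> Y \<Longrightarrow>
    graded k W Y (\<lambda>x. 1 / (1 + h x)) \<and> graded k (W * \<theta>) Y (\<lambda>x. 1 / (1 + h x) - 1)"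
    using graded_reciprocal[OF assms(1), of k] by blast
  \<comment> \<open>The first summand comes from the excess of \<open>w ^ l\<close> over 1. In the
    second, \<open>3 * B\<close> is \<open>R + \<Gamma>\<close>, with \<open>R = B + B\<close> the
    bound for \<open>B - \<gamma>\<close> and its derivatives and
    \<open>\<Gamma> = B\<close>.\<close>
  define C where "C = B * (real k * W ^ k * W) + 2 * (2 * (2 ^ k * W + 1)) ^ k * (3 * B)"
  show ?thesis
  proof (intro exI[of _ C] conjI allI impI)
    show "0 \<le> C" using W(1) assms(2) by (simp add: C_def)
    fix f c h \<theta> \<gamma> l \<phi>
    assume f: "prob_space f" "sets f = sets borel" "deriv_bounds k f c"
      and h: "\<forall>x. h field_differentiable at x" "\<forall>x. \<bar>h x\<bar> \<le> \<theta>" "graded k \<theta> 1 (deriv h)" "\<forall>x. c\<^sub>0 \<le> 1 + deriv h x"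
      and \<gamma>: "graded (Suc k) B 1 \<gamma>" "\<forall>x. 0 \<le> \<gamma> x" and l: "l \<le> k" and \<phi>: "\<phi> \<in> C_k_b k" "\<forall>x. \<bar>\<phi> x\<bar> \<le> 1"
    have \<theta>: "0 \<le> \<theta>" using h(2) by (meson abs_ge_zero order_trans)
    have w: "graded k W (1 + \<theta>) (\<lambda>x. 1 / (1 + deriv h x))" "graded k (W * \<theta>) (1 + \<theta>) (\<lambda>x. 1 / (1 + deriv h x) - 1)"
      using W(2)[OF h(3) h(4)[rule_format], of "1 + \<theta>"] \<theta> by simp_all
    have h_pos: "0 < 1 + deriv h x" for x using h(4)[rule_format, of x] assms(1) by linarith
    interpret transport k f c h \<theta> W "1 + \<theta>"
      by (rule transport.intro[OF f h(1,2)[rule_format] h(3) h_pos W(1) _ w]) (use \<theta> in simp)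
    have \<gamma>B: "\<gamma> x \<le> B" for x using graded_bound[OF \<gamma>(1), of x] by simp
    have r: "graded (Suc k) (B + B) 1 (\<lambda>x. B - \<gamma> x)"
      using assms by (intro graded_diff \<gamma>(1) graded_const) auto
    define U where "U = B + B * (real k * W ^ k * (W * \<theta>))"
    have U: "\<bar>\<gamma> x\<bar> * w x ^ l + \<bar>B - \<gamma> x\<bar> \<le> U" for x
    proof -
      have "w x ^ l \<le> 1 + real l * W ^ l * (W * \<theta>)" by (rule w_power)
      also have "\<dots> \<le> 1 + real k * W ^ k * (W * \<theta>)"
        using W(1) l \<theta> by (intro add_left_mono mult_right_mono mult_mono power_increasing) auto
      finally have "\<gamma> x * w x ^ l \<le> \<gamma> x * (1 + real k * W ^ k * (W * \<theta>))"
        using \<gamma>(2) by (intro mult_left_mono) auto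
      also have "\<dots> = \<gamma> x + \<gamma> x * (real k * W ^ k * (W * \<theta>))" by (simp add: algebra_simps)
      also have "\<dots> \<le> \<gamma> x + B * (real k * W ^ k * (W * \<theta>))"
        using \<gamma>B W(1) \<theta> by (intro add_left_mono mult_right_mono) auto
      finally show ?thesis using \<gamma>(2) \<gamma>B by (simp add: U_def)
    qed
    have "\<bar>\<integral>x. (deriv ^^ 0) (pull \<gamma> (\<lambda>x. B - \<gamma> x) l \<phi>) x \<partial>f\<bar>
        \<le> U * c (0 + l) + K l * (0 + (B + B + B) * \<theta>) * (1 + \<theta>) ^ l * c_sum (0 + l)"
    proof (rule integral_pull_top)
      show "\<gamma> \<in> C_k_b (0 + l)" "(\<lambda>x. B - \<gamma> x) \<in> C_k_b (0 + l + 1)"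
        using l
        by (auto intro: C_k_b_mono[OF graded_imp_C_k_b[OF \<gamma>(1)]] C_k_b_mono[OF graded_imp_C_k_b[OF r]])
      show "graded (Suc l) (B + B) 1 (\<lambda>x. B - \<gamma> x)" by (rule graded_mono[OF r]) (use l in auto)
      show "graded l 0 (1 + \<theta>) (\<lambda>x. \<gamma> x + (B - \<gamma> x) - B)" using \<theta> by (auto intro: graded_const)
    qed (use l assms U \<phi> in auto)
    then have "\<bar>\<integral>x. \<gamma> x * (deriv ^^ l) \<phi> (x + h x) + (B - \<gamma> x) * (deriv ^^ l) \<phi> x \<partial>f\<bar>
        \<le> U * c l + K l * (3 * B * \<theta>) * (1 + \<theta>) ^ l * c_sum l"
      by (simp add: \<tau>_def)
    also have "\<dots> \<le> B * c l + B * (real k * W ^ k * (W * \<theta>)) * (1 + \<theta>) ^ k * c_sum l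
        + K k * (3 * B * \<theta>) * (1 + \<theta>) ^ k * c_sum l"
    proof -
      have 1: "B * (real k * W ^ k * (W * \<theta>)) * 1 * c l \<le> B * (real k * W ^ k * (W * \<theta>)) * (1 + \<theta>) ^ k * c_sum l"
        using \<theta> assms W(1) l deriv_bounds_nonneg[OF bounds] by (intro mult_mono c_le_sum) auto
      have "K l \<le> K k" unfolding K_def using W(1) l by (intro mult_left_mono power_increasing) auto
      then have 2: "K l * (3 * B * \<theta>) * (1 + \<theta>) ^ l * c_sum l \<le> K k * (3 * B * \<theta>) * (1 + \<theta>) ^ k * c_sum l"
        using \<theta> assms K_nonneg l c_sum_nonneg by (intro mult_right_mono mult_mono power_increasing) auto
      show ?thesis using 1 2 by (simp add: U_def algebra_simps)
    qed
    also have "\<dots> = B * c l + C * (\<theta> * (1 + \<theta>) ^ k) * c_sum l"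
      by (simp add: C_def K_def algebra_simps)
    finally show "\<bar>\<integral>x. \<gamma> x * (deriv ^^ l) \<phi> (x + h x) + (B - \<gamma> x) * (deriv ^^ l) \<phi> x \<partial>f\<bar>
      \<le> B * c l + C * (\<theta> * (1 + \<theta>) ^ k) * (\<Sum>j\<le>l. c j)"
      by (simp add: c_sum_def)
  qed
qed

section \<open>The one-step operators\<close>

text \<open>Used to assemble the dual of a one-step operator from its drift, accepted and rejected
  parts. Stating it with nonnegative integrals avoids integrability conditions.\<close>

lemma ex_sum_measure:
  assumes s: "sets m1 = sets M" "sets m2 = sets M"
  shows "\<exists>m. sets m = sets M \<and>
    (\<forall>\<psi>\<in>borel_measurable M. (\<integral>\<^sup>+x. \<psi> x \<partial>m) = (\<integral>\<^sup>+x. \<psi> x \<partial>m1) + (\<integral>\<^sup>+x. \<psi> x \<partial>m2))"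
proof -
  define m where "m = measure_of (space M) (sets M) (\<lambda>S. emeasure m1 S + emeasure m2 S)"
  have sm: "sets m = sets M" by (simp add: m_def)
  have em: "emeasure m S = emeasure m1 S + emeasure m2 S" if "S \<in> sets M" for S
    unfolding m_def
  proof (rule emeasure_measure_of_sigma[OF sets.sigma_algebra_axioms _ _ that])
    show "countably_additive (sets M) (\<lambda>S. emeasure m1 S + emeasure m2 S)"
    proof (rule countably_additiveI)
      fix A :: "nat \<Rightarrow> 'a set"
      assume A: "range A \<subseteq> sets M" "disjoint_family A"
      show "(\<Sum>i. emeasure m1 (A i) + emeasure m2 (A i)) = emeasure m1 (\<Union>i. A i) + emeasure m2 (\<Union>i. A i)"
        using A s by (subst suminf_add[symmetric]) (simp_all add: suminf_emeasure)
    qed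
  qed (simp add: positive_def)
  have "(\<integral>\<^sup>+x. \<psi> x \<partial>m) = (\<integral>\<^sup>+x. \<psi> x \<partial>m1) + (\<integral>\<^sup>+x. \<psi> x \<partial>m2)" if "\<psi> \<in> borel_measurable M" for \<psi>
    using that
  proof (induction rule: borel_measurable_induct)
    case (cong f g)
    moreover have "(\<integral>\<^sup>+x. g x \<partial>m') = (\<integral>\<^sup>+x. f x \<partial>m')" if "sets m' = sets M" for m'
      using cong(3) sets_eq_imp_space_eq[OF that] by (intro nn_integral_cong) simp
    ultimately show ?case using s sm by simp
  next
    case (set A)
    then show ?case using em s sm by simp
  next
    case (mult u c)
    then show ?case using s sm
      by (simp add: nn_integral_cmult measurable_cong_sets[OF s(1) refl] measurable_cong_sets[OF s(2) refl]
          measurable_cong_sets[OF sm refl] distrib_left)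
  next
    case (add u v)
    then show ?case using s sm
      by (simp add: nn_integral_add measurable_cong_sets[OF s(1) refl] measurable_cong_sets[OF s(2) refl]
          measurable_cong_sets[OF sm refl] ac_simps)
  next
    case (seq U)
    have *: "(\<integral>\<^sup>+x. (SUP i. U i) x \<partial>m') = (SUP i. \<integral>\<^sup>+x. U i x \<partial>m')" if "sets m' = sets M" for m'
      using seq that
      by (simp add: image_comp nn_integral_monotone_convergence_SUP measurable_cong_sets[OF that refl])
    have inc: "incseq (\<lambda>i. \<integral>\<^sup>+x. U i x \<partial>m')" for m'
      using seq by (auto simp: incseq_def le_fun_def intro!: nn_integral_mono)
    show ?case
      unfolding *[OF s(1)] *[OF s(2)] *[OF sm] using seq ennreal_SUP_add[OF inc[of m1] inc[of m2]] by simp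
  qed
  with sm show ?thesis by blast
qed

text \<open>\<open>B\<close> bounds both coefficients with all their derivatives and is at the same
  time the height of the strip \<open>{0..B}\<close> in which candidate jumps lie;
  \<open>B \<ge> 1\<close> allows division by it. The power in the last assumption is the one that
  integrability of \<open>\<eta> * (1 + \<eta>) ^ k\<close> calls for.\<close>

locale jump_coefficients =
  fixes k :: nat and q :: "'g measure" and b \<gamma> :: "real \<Rightarrow> real" and h :: "real \<Rightarrow> 'g \<Rightarrow> real"
    and \<eta> :: "'g \<Rightarrow> real" and c\<^sub>0 B :: real
  assumes B: "1 \<le> B" and b: "graded (Suc k) B 1 b" and \<gamma>: "graded (Suc k) B 1 \<gamma>" "\<And>x. 0 \<le> \<gamma> x"
    and h_measurable: "(\<lambda>(y, z). h y z) \<in> borel_measurable (borel \<Otimes>\<^sub>M q)"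
    and h: "\<And>z. z \<in> space q \<Longrightarrow> graded (Suc k) (\<eta> z) 1 (\<lambda>y. h y z)"
    and c\<^sub>0: "0 < c\<^sub>0" "\<And>y z. z \<in> space q \<Longrightarrow> c\<^sub>0 \<le> 1 + deriv (\<lambda>y. h y z) y"
    and \<eta>: "integrable q \<eta>" "integrable q (\<lambda>z. \<eta> z ^ Suc k)"
begin

lemma \<gamma>_le: "\<gamma> x \<le> B" using graded_bound[OF \<gamma>(1), of x] by simp

lemma b_bound: "\<bar>b x\<bar> \<le> B" using graded_bound[OF b, of x] by simp

lemma \<eta>_nonneg: "z \<in> space q \<Longrightarrow> 0 \<le> \<eta> z"
  using graded_nonneg h by blast

lemma h_bound: "z \<in> space q \<Longrightarrow> \<bar>h x z\<bar> \<le> \<eta> z"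
  using graded_bound[OF h, of z x] by simp

lemma coefficients_measurable [measurable]:
  "b \<in> borel_measurable borel" "\<gamma> \<in> borel_measurable borel" "\<eta> \<in> borel_measurable q"
  "(\<lambda>w. h (fst w) (snd w)) \<in> borel_measurable (borel \<Otimes>\<^sub>M q)"
  using graded_imp_C_k_b[OF b] graded_imp_C_k_b[OF \<gamma>(1)] \<eta> h_measurable
  by (auto intro!: borel_measurable_continuous_onI C_k_b_imp_continuous simp: case_prod_beta')

lemma h_measurable' [measurable (raw)]:
  "f \<in> borel_measurable M \<Longrightarrow> g \<in> measurable M q \<Longrightarrow> (\<lambda>x. h (f x) (g x)) \<in> borel_measurable M"
  using measurable_compose[OF measurable_Pair coefficients_measurable(4), of f M g] by simp

lemma graded_Lipschitz:
  assumes "graded (Suc k) R 1 g"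
  shows "\<bar>g x - g y\<bar> \<le> R * \<bar>x - y\<bar>"
proof (rule abs_diff_le_of_deriv_bound)
  show "(g has_field_derivative deriv g x) (at x)" "\<bar>deriv g x\<bar> \<le> R" for x
    using assms graded_bound[of k R 1 "deriv g" x]
    by (auto simp: graded_Suc DERIV_deriv_iff_field_differentiable)
qed

lemmas b_Lipschitz = graded_Lipschitz[OF b]
  and \<gamma>_Lipschitz = graded_Lipschitz[OF \<gamma>(1)]
  and h_Lipschitz = graded_Lipschitz[OF h]

lemma integrable_weight: "integrable q (\<lambda>z. \<eta> z * (1 + \<eta> z) ^ k)"
proof (rule Bochner_Integration.integrable_bound)
  show "integrable q (\<lambda>z. 2 ^ k * (\<eta> z + \<eta> z ^ Suc k))" using \<eta> by simp
  show "AE z in q. norm (\<eta> z * (1 + \<eta> z) ^ k) \<le> norm (2 ^ k * (\<eta> z + \<eta> z ^ Suc k))"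
  proof (rule AE_I2)
    fix z assume "z \<in> space q"
    then have t: "0 \<le> \<eta> z" by (rule \<eta>_nonneg)
    have "(1 + \<eta> z) ^ k \<le> 2 ^ k * (1 + \<eta> z ^ k)"
    proof (cases "\<eta> z \<le> 1")
      case True
      then have "(1 + \<eta> z) ^ k \<le> 2 ^ k" using t by (intro power_mono) auto
      also have "\<dots> \<le> 2 ^ k * (1 + \<eta> z ^ k)" using t by simp
      finally show ?thesis .
    next
      case False
      then have "(1 + \<eta> z) ^ k \<le> (2 * \<eta> z) ^ k" using t by (intro power_mono) auto
      also have "\<dots> \<le> 2 ^ k * (1 + \<eta> z ^ k)" by (simp add: power_mult_distrib)
      finally show ?thesis .
    qed
    then have "\<eta> z * (1 + \<eta> z) ^ k \<le> \<eta> z * (2 ^ k * (1 + \<eta> z ^ k))"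
      using t by (rule mult_left_mono)
    also have "\<dots> = 2 ^ k * (\<eta> z + \<eta> z ^ Suc k)" by (simp add: algebra_simps)
    finally show "norm (\<eta> z * (1 + \<eta> z) ^ k) \<le> norm (2 ^ k * (\<eta> z + \<eta> z ^ Suc k))" using t by simp
  qed
qed simp

definition weight where "weight = (\<integral>z. \<eta> z * (1 + \<eta> z) ^ k \<partial>q)"

lemma weight_nonneg: "0 \<le> weight"
  unfolding weight_def using \<eta>_nonneg by (intro Bochner_Integration.integral_nonneg_AE AE_I2) auto

text \<open>The transition operator of an Euler step with thinning: with probability
  \<open>\<epsilon> * B * measure \<rho> (space \<rho>)\<close> a candidate mark arrives, accepted
  with probability \<open>\<gamma> x / B\<close>; otherwise the drift acts. Drift and jump are
  alternatives rather than successive moves, which keeps the operator a mixture.\<close>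

definition one_step :: "'g measure \<Rightarrow> real \<Rightarrow> (real \<Rightarrow> real) \<Rightarrow> real \<Rightarrow> real" where
  "one_step \<rho> \<epsilon> \<phi> x = (1 - \<epsilon> * B * measure \<rho> (space \<rho>)) * \<phi> (x + \<epsilon> * b x) +
     \<epsilon> * (\<integral>z. \<gamma> x * \<phi> (x + h x z) + (B - \<gamma> x) * \<phi> x \<partial>\<rho>)"

end

locale truncated_jumps = jump_coefficients k q b \<gamma> h \<eta> c\<^sub>0 B
  for k and q :: "'g measure" and b \<gamma> h \<eta> c\<^sub>0 B +
  fixes G :: "'g set"
  assumes G: "G \<in> sets q" "emeasure q G < \<infinity>"
begin

text \<open>A density instead of a restricted space: the space and the measurable sets remain those
  of \<open>q\<close>, so measurability of the coefficients carries over.\<close>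

definition \<rho> where "\<rho> = density q (indicator G)"
definition rate where "rate = measure q G"

lemma sets_\<rho> [measurable_cong, simp]: "sets \<rho> = sets q" by (simp add: \<rho>_def)
lemma space_\<rho> [simp]: "space \<rho> = space q" by (simp add: \<rho>_def)

lemma emeasure_\<rho>: "emeasure \<rho> (space q) = ennreal rate" "measure \<rho> (space q) = rate"
proof -
  show *: "emeasure \<rho> (space q) = ennreal rate"
    using G unfolding \<rho>_def rate_def
    by (subst emeasure_density) (auto simp: emeasure_eq_ennreal_measure less_top intro!: nn_integral_cong
        split: split_indicator)
  show "measure \<rho> (space q) = rate"
    using * by (simp add: measure_def rate_def)
qed

lemma rate_nonneg: "0 \<le> rate" by (simp add: rate_def)

sublocale \<rho>: finite_measure \<rho>
  by (rule finite_measureI) (simp add: emeasure_\<rho>)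

lemma integral_weight_le: "(\<integral>z. \<eta> z * (1 + \<eta> z) ^ k \<partial>\<rho>) \<le> weight" "integrable \<rho> (\<lambda>z. \<eta> z * (1 + \<eta> z) ^ k)"
proof -
  have e: "\<rho> = density q (\<lambda>z. ennreal (indicator G z))" by (simp add: \<rho>_def ennreal_indicator)
  have i: "integrable q (\<lambda>z. indicator G z *\<^sub>R (\<eta> z * (1 + \<eta> z) ^ k))"
    using integrable_weight G by (intro integrable_mult_indicator)
  then show "integrable \<rho> (\<lambda>z. \<eta> z * (1 + \<eta> z) ^ k)"
    unfolding e using G by (subst integrable_density) auto
  have "(\<integral>z. \<eta> z * (1 + \<eta> z) ^ k \<partial>\<rho>) = (\<integral>z. indicator G z *\<^sub>R (\<eta> z * (1 + \<eta> z) ^ k) \<partial>q)"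
    unfolding e using G by (subst integral_density) auto
  also have "\<dots> \<le> weight"
    unfolding weight_def using i integrable_weight \<eta>_nonneg
    by (intro integral_mono) (auto split: split_indicator)
  finally show "(\<integral>z. \<eta> z * (1 + \<eta> z) ^ k \<partial>\<rho>) \<le> weight" .
qed

lemma integrable_jump:
  fixes \<phi> :: "real \<Rightarrow> real"
  assumes [measurable]: "\<phi> \<in> borel_measurable borel" and M: "\<And>x. \<bar>\<phi> x\<bar> \<le> M"
  shows "integrable \<rho> (\<lambda>z. \<phi> (x + h x z))"
  using M by (intro \<rho>.integrable_const_bound[of _ M]) auto

lemma one_step_eq:
  assumes "\<phi> \<in> borel_measurable borel" "\<And>x. \<bar>\<phi> x\<bar> \<le> M"
  shows "one_step \<rho> \<epsilon> \<phi> x = (1 - \<epsilon> * B * rate) * \<phi> (x + \<epsilon> * b x) +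
     \<epsilon> * (\<gamma> x * (\<integral>z. \<phi> (x + h x z) \<partial>\<rho>) + (B - \<gamma> x) * rate * \<phi> x)"
  using integrable_jump[OF assms] by (simp add: one_step_def emeasure_\<rho>(2) algebra_simps)

lemma one_step_measurable [measurable]:
  assumes [measurable]: "\<phi> \<in> borel_measurable borel"
  shows "one_step \<rho> \<epsilon> \<phi> \<in> borel_measurable borel"
  unfolding one_step_def by measurable

text \<open>For small steps the operator is an average: the weights
  \<open>1 - \<epsilon> * B * rate\<close>, \<open>\<epsilon> * \<gamma> x * rate\<close> and
  \<open>\<epsilon> * (B - \<gamma> x) * rate\<close> are nonnegative and add up to 1.\<close>

lemma one_step_bounded:
  assumes \<phi>: "\<phi> \<in> borel_measurable borel" "\<And>x. \<bar>\<phi> x\<bar> \<le> M" and \<epsilon>: "0 \<le> \<epsilon>" "\<epsilon> * B * rate \<le> 1"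
  shows "\<bar>one_step \<rho> \<epsilon> \<phi> x\<bar> \<le> M"
proof -
  have 1: "\<bar>(1 - \<epsilon> * B * rate) * \<phi> (x + \<epsilon> * b x)\<bar> \<le> (1 - \<epsilon> * B * rate) * M"
    using \<phi>(2) \<epsilon> by (simp add: abs_mult mult_left_mono)
  have "\<bar>\<integral>z. \<phi> (x + h x z) \<partial>\<rho>\<bar> \<le> (\<integral>z. \<bar>\<phi> (x + h x z)\<bar> \<partial>\<rho>)"
    by (rule integral_abs_bound)
  also have "\<dots> \<le> (\<integral>z. M \<partial>\<rho>)"
    using integrable_jump[OF \<phi>] \<phi> by (intro integral_mono) auto
  also have "\<dots> = rate * M" by (simp add: emeasure_\<rho>(2))
  finally have 2: "\<bar>\<gamma> x * (\<integral>z. \<phi> (x + h x z) \<partial>\<rho>)\<bar> \<le> \<gamma> x * (rate * M)"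
    using \<gamma>(2) by (simp add: abs_mult mult_left_mono)
  have 3: "\<bar>(B - \<gamma> x) * rate * \<phi> x\<bar> \<le> (B - \<gamma> x) * rate * M"
    using \<gamma>_le[of x] rate_nonneg \<phi>(2) by (simp add: abs_mult mult_left_mono)
  have "\<bar>\<gamma> x * (\<integral>z. \<phi> (x + h x z) \<partial>\<rho>) + (B - \<gamma> x) * rate * \<phi> x\<bar> \<le> \<gamma> x * (rate * M) + (B - \<gamma> x) * rate * M"
    using 2 3 by linarith
  then have "\<bar>\<epsilon> * (\<gamma> x * (\<integral>z. \<phi> (x + h x z) \<partial>\<rho>) + (B - \<gamma> x) * rate * \<phi> x)\<bar> \<le> \<epsilon> * (\<gamma> x * (rate * M) + (B - \<gamma> x) * rate * M)"
    unfolding abs_mult using \<epsilon> by (intro mult_mono) auto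
  with 1 show ?thesis
    unfolding one_step_eq[OF \<phi>] by (simp add: algebra_simps)
qed

lemma one_step_iterate:
  assumes "\<phi> \<in> borel_measurable borel" "\<And>x. \<bar>\<phi> x\<bar> \<le> M" "0 \<le> \<epsilon>" "\<epsilon> * B * rate \<le> 1"
  shows "(one_step \<rho> \<epsilon> ^^ m) \<phi> \<in> borel_measurable borel \<and> (\<forall>x. \<bar>(one_step \<rho> \<epsilon> ^^ m) \<phi> x\<bar> \<le> M)"
proof (induction m)
  case (Suc m)
  then show ?case using one_step_bounded[of "(one_step \<rho> \<epsilon> ^^ m) \<phi>" M \<epsilon>] assms by auto
qed (use assms in auto)

text \<open>
  Uniformity in the truncation: the total jump rate of the truncated equation cancels, because a jump at rate \<open>\<gamma>\<close> is
  compensated by the fictitious jump of size zero at rate \<open>B - \<gamma>\<close>.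
\<close>

lemma one_step_Lipschitz:
  assumes \<phi>: "\<phi> \<in> borel_measurable borel" "\<And>x. \<bar>\<phi> x\<bar> \<le> M" and L: "\<And>x y. \<bar>\<phi> x - \<phi> y\<bar> \<le> L * \<bar>x - y\<bar>"
    and \<epsilon>: "0 \<le> \<epsilon>" "\<epsilon> * B * rate \<le> 1"
  shows "\<bar>one_step \<rho> \<epsilon> \<phi> x - one_step \<rho> \<epsilon> \<phi> y\<bar> \<le> L * (1 + \<epsilon> * (B + 2 * B * (\<integral>z. \<eta> z \<partial>q))) * \<bar>x - y\<bar>"
proof -
  define d where "d = \<bar>x - y\<bar>"
  define H where "H = (\<integral>z. \<eta> z \<partial>q)"
  have L0: "0 \<le> L" using L[of 0 1] by auto
  have d: "0 \<le> d" by (simp add: d_def)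
  have e: "\<rho> = density q (\<lambda>z. ennreal (indicator G z))" by (simp add: \<rho>_def ennreal_indicator)
  have i: "integrable q (\<lambda>z. indicator G z *\<^sub>R \<eta> z)"
    using \<eta> G by (intro integrable_mult_indicator)
  then have i\<rho>: "integrable \<rho> \<eta>"
    unfolding e using G by (subst integrable_density) auto
  have "(\<integral>z. \<eta> z \<partial>\<rho>) = (\<integral>z. indicator G z *\<^sub>R \<eta> z \<partial>q)"
    unfolding e using G by (subst integral_density) auto
  also have "\<dots> \<le> H"
    unfolding H_def using i \<eta> \<eta>_nonneg by (intro integral_mono) (auto split: split_indicator)
  finally have H: "(\<integral>z. \<eta> z \<partial>\<rho>) \<le> H" .
  define J where "J x z = \<gamma> x * \<phi> (x + h x z) + (B - \<gamma> x) * \<phi> x" for x z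
  have Ji: "integrable \<rho> (J x)" for x
    unfolding J_def using integrable_jump[OF \<phi>] by (intro Bochner_Integration.integrable_add) auto
  have J: "\<bar>J x z - J y z\<bar> \<le> L * d * B + 2 * B * L * d * \<eta> z" if z: "z \<in> space \<rho>" for z
  proof -
    have z: "z \<in> space q" using that by simp
    have 1: "\<bar>\<phi> (x + h x z) - \<phi> (y + h y z)\<bar> \<le> L * (d + \<eta> z * d)"
    proof -
      have "\<bar>(x + h x z) - (y + h y z)\<bar> \<le> d + \<eta> z * d"
        using h_Lipschitz[OF z, of x y] unfolding d_def by linarith
      then show ?thesis using L[of "x + h x z" "y + h y z"] L0 by (meson mult_left_mono order_trans)
    qed
    have 2: "\<bar>\<phi> (y + h y z) - \<phi> y\<bar> \<le> L * \<eta> z"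
      using L[of "y + h y z" y] mult_left_mono[OF h_bound[OF z, of y] L0] by simp
    \<comment> \<open>Synchronous coupling: the same mark acts at \<open>x\<close> and
      \<open>y\<close>. The difference \<open>\<gamma> x - \<gamma> y\<close> of the acceptance
      weights is multiplied by the effect of a single jump, at most \<open>L * \<eta> z\<close>, and
      thus stays integrable in the mark uniformly in \<open>G\<close>.\<close>
    have "J x z - J y z = \<gamma> x * (\<phi> (x + h x z) - \<phi> (y + h y z)) + (B - \<gamma> x) * (\<phi> x - \<phi> y)
        + (\<gamma> x - \<gamma> y) * (\<phi> (y + h y z) - \<phi> y)"
      by (simp add: J_def algebra_simps)
    also have "\<bar>\<dots>\<bar> \<le> \<gamma> x * (L * (d + \<eta> z * d)) + (B - \<gamma> x) * (L * d) + (B * d) * (L * \<eta> z)"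
    proof -
      have "\<bar>\<gamma> x * (\<phi> (x + h x z) - \<phi> (y + h y z))\<bar> \<le> \<gamma> x * (L * (d + \<eta> z * d))"
        using 1 \<gamma>(2) by (simp add: abs_mult mult_left_mono)
      moreover have "\<bar>(B - \<gamma> x) * (\<phi> x - \<phi> y)\<bar> \<le> (B - \<gamma> x) * (L * d)"
        using L[of x y] \<gamma>_le by (simp add: abs_mult mult_left_mono d_def)
      moreover have "\<bar>(\<gamma> x - \<gamma> y) * (\<phi> (y + h y z) - \<phi> y)\<bar> \<le> (B * d) * (L * \<eta> z)"
        unfolding abs_mult using 2 \<gamma>_Lipschitz[of x y] B by (intro mult_mono) (auto simp: d_def)
      ultimately show ?thesis by linarith
    qed
    also have "\<dots> = L * d * B + (\<gamma> x + B) * (L * d * \<eta> z)" by (simp add: algebra_simps)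
    also have "\<dots> \<le> L * d * B + (B + B) * (L * d * \<eta> z)"
      using \<gamma>_le[of x] L0 d \<eta>_nonneg[OF z] by (intro add_left_mono mult_right_mono) auto
    finally show ?thesis by (simp add: algebra_simps)
  qed
  have "\<bar>(\<integral>z. J x z \<partial>\<rho>) - (\<integral>z. J y z \<partial>\<rho>)\<bar> = \<bar>\<integral>z. J x z - J y z \<partial>\<rho>\<bar>"
    using Ji by simp
  also have "\<dots> \<le> (\<integral>z. \<bar>J x z - J y z\<bar> \<partial>\<rho>)" by (rule integral_abs_bound)
  also have "\<dots> \<le> (\<integral>z. L * d * B + 2 * B * L * d * \<eta> z \<partial>\<rho>)"
    using Ji J i\<rho> by (intro integral_mono) auto
  also have "\<dots> = L * d * B * rate + 2 * B * L * d * (\<integral>z. \<eta> z \<partial>\<rho>)"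
    using i\<rho> by (simp add: emeasure_\<rho>(2))
  also have "\<dots> \<le> L * d * B * rate + 2 * B * L * d * H"
    using H L0 d B by (intro add_left_mono mult_left_mono) auto
  finally have jump: "\<bar>\<epsilon> * ((\<integral>z. J x z \<partial>\<rho>) - (\<integral>z. J y z \<partial>\<rho>))\<bar> \<le> \<epsilon> * (L * d * B * rate + 2 * B * L * d * H)"
    using \<epsilon> by (simp add: abs_mult mult_left_mono)
  have "\<bar>(x + \<epsilon> * b x) - (y + \<epsilon> * b y)\<bar> \<le> d + \<epsilon> * (B * d)"
  proof -
    have "\<bar>\<epsilon> * (b x - b y)\<bar> \<le> \<epsilon> * (B * d)"
      using \<epsilon> b_Lipschitz[of x y] by (simp add: abs_mult mult_left_mono d_def)
    then show ?thesis by (simp add: d_def algebra_simps)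
  qed
  then have "\<bar>\<phi> (x + \<epsilon> * b x) - \<phi> (y + \<epsilon> * b y)\<bar> \<le> L * (d + \<epsilon> * (B * d))"
    using L[of "x + \<epsilon> * b x" "y + \<epsilon> * b y"] L0 by (meson mult_left_mono order_trans)
  then have "\<bar>(1 - \<epsilon> * B * rate) * (\<phi> (x + \<epsilon> * b x) - \<phi> (y + \<epsilon> * b y))\<bar> \<le> (1 - \<epsilon> * B * rate) * (L * (d + \<epsilon> * (B * d)))"
    using \<epsilon> by (simp add: abs_mult mult_left_mono)
  also have "\<dots> = (1 - \<epsilon> * B * rate) * (L * d) + (1 - \<epsilon> * B * rate) * (L * (\<epsilon> * (B * d)))"
    by (simp add: algebra_simps)
  also have "\<dots> \<le> (1 - \<epsilon> * B * rate) * (L * d) + 1 * (L * (\<epsilon> * (B * d)))"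
    using \<epsilon> L0 d B rate_nonneg by (intro add_left_mono mult_right_mono) auto
  finally have drift: "\<bar>(1 - \<epsilon> * B * rate) * (\<phi> (x + \<epsilon> * b x) - \<phi> (y + \<epsilon> * b y))\<bar>
    \<le> (1 - \<epsilon> * B * rate) * (L * d) + L * (\<epsilon> * (B * d))" by simp
  have "one_step \<rho> \<epsilon> \<phi> x - one_step \<rho> \<epsilon> \<phi> y = (1 - \<epsilon> * B * rate) * (\<phi> (x + \<epsilon> * b x) - \<phi> (y + \<epsilon> * b y))
      + \<epsilon> * ((\<integral>z. J x z \<partial>\<rho>) - (\<integral>z. J y z \<partial>\<rho>))"
    by (simp add: one_step_def J_def emeasure_\<rho>(2)) (simp add: algebra_simps)
  then have "\<bar>one_step \<rho> \<epsilon> \<phi> x - one_step \<rho> \<epsilon> \<phi> y\<bar>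
      \<le> (1 - \<epsilon> * B * rate) * (L * d) + L * (\<epsilon> * (B * d)) + \<epsilon> * (L * d * B * rate + 2 * B * L * d * H)"
    using drift jump by linarith
  also have "\<dots> = L * (1 + \<epsilon> * (B + 2 * B * H)) * d" by (simp add: algebra_simps)
  finally show ?thesis by (simp add: d_def H_def)
qed

text \<open>Iteration needs the image of \<open>f\<close> to be a probability measure again. It is
  the sum of the images under drift and accepted jumps and of the rejected part; the weights are
  nonnegative by the restriction on \<open>\<epsilon>\<close>, and the total mass is 1 because the
  operator fixes the constant 1.\<close>

lemma one_step_dual:
  assumes "prob_space f" and f: "sets f = sets borel" and \<epsilon>: "0 \<le> \<epsilon>" "\<epsilon> * B * rate \<le> 1"
  shows "\<exists>g. prob_space g \<and> sets g = sets borel \<and>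
    (\<forall>\<phi>\<in>borel_measurable borel. \<forall>M. (\<forall>x. \<bar>\<phi> x\<bar> \<le> M) \<longrightarrow> (\<integral>x. \<phi> x \<partial>g) = (\<integral>x. one_step \<rho> \<epsilon> \<phi> x \<partial>f))"
proof -
  interpret f: prob_space f by fact
  note [measurable_cong] = f
  define m1 where "m1 = distr (density f (\<lambda>_. ennreal (1 - \<epsilon> * B * rate))) borel (\<lambda>x. x + \<epsilon> * b x)"
  define m2 where "m2 = distr (density (f \<Otimes>\<^sub>M \<rho>) (\<lambda>w. ennreal (\<epsilon> * \<gamma> (fst w)))) borel (\<lambda>w. fst w + h (fst w) (snd w))"
  define m3 where "m3 = density f (\<lambda>x. ennreal (\<epsilon> * (B - \<gamma> x) * rate))"
  obtain m12 where m12: "sets m12 = sets borel"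
    "\<And>\<psi>. \<psi> \<in> borel_measurable borel \<Longrightarrow> (\<integral>\<^sup>+x. \<psi> x \<partial>m12) = (\<integral>\<^sup>+x. \<psi> x \<partial>m1) + (\<integral>\<^sup>+x. \<psi> x \<partial>m2)"
    using ex_sum_measure[of m1 borel m2] by (auto simp: m1_def m2_def)
  obtain g where g: "sets g = sets borel"
    "\<And>\<psi>. \<psi> \<in> borel_measurable borel \<Longrightarrow> (\<integral>\<^sup>+x. \<psi> x \<partial>g) = (\<integral>\<^sup>+x. \<psi> x \<partial>m12) + (\<integral>\<^sup>+x. \<psi> x \<partial>m3)"
    using ex_sum_measure[of m12 borel m3] m12 f by (auto simp: m3_def)
  have nn: "(\<integral>\<^sup>+x. ennreal (\<psi> x) \<partial>g) = (\<integral>\<^sup>+x. ennreal (one_step \<rho> \<epsilon> \<psi> x) \<partial>f)"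
    if \<psi>: "\<psi> \<in> borel_measurable borel" "\<And>x. 0 \<le> \<psi> x" "\<And>x. \<psi> x \<le> M" for \<psi> M
  proof -
    note [measurable] = \<psi>(1)
    have "(\<integral>\<^sup>+x. ennreal (\<psi> x) \<partial>m1) = (\<integral>\<^sup>+x. ennreal ((1 - \<epsilon> * B * rate) * \<psi> (x + \<epsilon> * b x)) \<partial>f)"
      unfolding m1_def using \<epsilon>
      by (subst nn_integral_distr, simp_all, subst nn_integral_density) (simp_all add: ennreal_mult' \<psi>)
    moreover have "(\<integral>\<^sup>+x. ennreal (\<psi> x) \<partial>m3) = (\<integral>\<^sup>+x. ennreal (\<epsilon> * (B - \<gamma> x) * rate * \<psi> x) \<partial>f)"
      unfolding m3_def using \<epsilon> \<gamma>_le rate_nonneg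
      by (subst nn_integral_density) (simp_all add: ennreal_mult' \<psi>)
    moreover have "(\<integral>\<^sup>+x. ennreal (\<psi> x) \<partial>m2) = (\<integral>\<^sup>+x. ennreal (\<epsilon> * \<gamma> x * (\<integral>z. \<psi> (x + h x z) \<partial>\<rho>)) \<partial>f)"
    proof -
      have "(\<integral>\<^sup>+x. ennreal (\<psi> x) \<partial>m2) = (\<integral>\<^sup>+w. ennreal (\<epsilon> * \<gamma> (fst w)) * ennreal (\<psi> (fst w + h (fst w) (snd w))) \<partial>(f \<Otimes>\<^sub>M \<rho>))"
        unfolding m2_def by (subst nn_integral_distr, simp_all, subst nn_integral_density) simp_all
      also have "\<dots> = (\<integral>\<^sup>+x. \<integral>\<^sup>+z. ennreal (\<epsilon> * \<gamma> x) * ennreal (\<psi> (x + h x z)) \<partial>\<rho> \<partial>f)"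
        by (subst \<rho>.nn_integral_fst[symmetric]) simp_all
      also have "\<dots> = (\<integral>\<^sup>+x. ennreal (\<epsilon> * \<gamma> x * (\<integral>z. \<psi> (x + h x z) \<partial>\<rho>)) \<partial>f)"
      proof (rule nn_integral_cong)
        fix x
        have "(\<integral>\<^sup>+z. ennreal (\<psi> (x + h x z)) \<partial>\<rho>) = ennreal (\<integral>z. \<psi> (x + h x z) \<partial>\<rho>)"
          using \<psi> by (intro nn_integral_eq_integral integrable_jump[of \<psi> M]) auto
        then show "(\<integral>\<^sup>+z. ennreal (\<epsilon> * \<gamma> x) * ennreal (\<psi> (x + h x z)) \<partial>\<rho>) = ennreal (\<epsilon> * \<gamma> x * (\<integral>z. \<psi> (x + h x z) \<partial>\<rho>))"
          using \<epsilon> \<gamma>(2) by (simp add: nn_integral_cmult ennreal_mult')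
      qed
      finally show ?thesis .
    qed
    ultimately have "(\<integral>\<^sup>+x. ennreal (\<psi> x) \<partial>g) = (\<integral>\<^sup>+x. ennreal ((1 - \<epsilon> * B * rate) * \<psi> (x + \<epsilon> * b x)) \<partial>f) +
        (\<integral>\<^sup>+x. ennreal (\<epsilon> * \<gamma> x * (\<integral>z. \<psi> (x + h x z) \<partial>\<rho>)) \<partial>f) + (\<integral>\<^sup>+x. ennreal (\<epsilon> * (B - \<gamma> x) * rate * \<psi> x) \<partial>f)"
      by (simp add: g m12)
    also have "\<dots> = (\<integral>\<^sup>+x. ennreal ((1 - \<epsilon> * B * rate) * \<psi> (x + \<epsilon> * b x)) +
        ennreal (\<epsilon> * \<gamma> x * (\<integral>z. \<psi> (x + h x z) \<partial>\<rho>)) + ennreal (\<epsilon> * (B - \<gamma> x) * rate * \<psi> x) \<partial>f)"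
      by (simp add: nn_integral_add)
    also have "\<dots> = (\<integral>\<^sup>+x. ennreal (one_step \<rho> \<epsilon> \<psi> x) \<partial>f)"
    proof (rule nn_integral_cong)
      fix x
      have M: "\<bar>\<psi> x\<bar> \<le> M" for x using \<psi>(2,3) by simp
      have "0 \<le> (1 - \<epsilon> * B * rate) * \<psi> (x + \<epsilon> * b x)" "0 \<le> \<epsilon> * \<gamma> x * (\<integral>z. \<psi> (x + h x z) \<partial>\<rho>)"
        "0 \<le> \<epsilon> * (B - \<gamma> x) * rate * \<psi> x"
        using \<epsilon> \<psi> \<gamma>(2) \<gamma>_le rate_nonneg by auto
      then show "ennreal ((1 - \<epsilon> * B * rate) * \<psi> (x + \<epsilon> * b x)) +
        ennreal (\<epsilon> * \<gamma> x * (\<integral>z. \<psi> (x + h x z) \<partial>\<rho>)) + ennreal (\<epsilon> * (B - \<gamma> x) * rate * \<psi> x) = ennreal (one_step \<rho> \<epsilon> \<psi> x)"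
        unfolding one_step_eq[OF \<psi>(1) M]
        by (simp add: ennreal_plus[symmetric] algebra_simps del: ennreal_plus)
    qed
    finally show ?thesis .
  qed
  have one: "one_step \<rho> \<epsilon> (\<lambda>_. 1) x = 1" for x
    by (subst one_step_eq[of _ 1]) (auto simp: emeasure_\<rho>(2) algebra_simps)
  interpret g: prob_space g
    using nn[of "\<lambda>_. 1" 1] by (intro prob_spaceI) (simp add: one f.emeasure_space_1)
  note [measurable_cong] = g(1)
  have "(\<integral>x. \<phi> x \<partial>g) = (\<integral>x. one_step \<rho> \<epsilon> \<phi> x \<partial>f)" if \<phi>: "\<phi> \<in> borel_measurable borel" "\<forall>x. \<bar>\<phi> x\<bar> \<le> M" for \<phi> M
  proof -
    note [measurable] = \<phi>(1)
    \<comment> \<open>Adding \<open>M\<close> reduces bounded functions to the nonnegative ones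
      treated in \<open>nn\<close>.\<close>
    let ?\<psi> = "\<lambda>x. \<phi> x + M"
    have \<psi>: "0 \<le> ?\<psi> x" "?\<psi> x \<le> 2 * M" for x using \<phi>(2)[rule_format, of x] by auto
    have shift: "one_step \<rho> \<epsilon> ?\<psi> x = one_step \<rho> \<epsilon> \<phi> x + M" for x
    proof -
      have b: "\<bar>\<phi> x\<bar> \<le> M" "\<bar>?\<psi> x\<bar> \<le> 2 * M" for x using \<phi>(2)[rule_format, of x] \<psi>[of x] by auto
      have "(\<integral>z. \<phi> (x + h x z) + M \<partial>\<rho>) = (\<integral>z. \<phi> (x + h x z) \<partial>\<rho>) + rate * M"
        using integrable_jump[OF \<phi>(1) b(1), of x] by (simp add: emeasure_\<rho>(2))
      then show ?thesis
        unfolding one_step_eq[OF \<phi>(1) b(1)] one_step_eq[of ?\<psi> "2 * M", OF _ b(2), simplified]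
        by (simp add: algebra_simps)
    qed
    have S: "\<bar>one_step \<rho> \<epsilon> \<phi> x\<bar> \<le> M" for x using one_step_bounded[of \<phi> M \<epsilon> x] \<phi> \<epsilon> by auto
    have ig: "integrable g \<phi>" using \<phi> by (intro g.integrable_const_bound[of _ M]) auto
    have i_f: "integrable f (one_step \<rho> \<epsilon> \<phi>)" using S by (intro f.integrable_const_bound[of _ M]) auto
    have "ennreal (\<integral>x. ?\<psi> x \<partial>g) = ennreal (\<integral>x. one_step \<rho> \<epsilon> \<phi> x + M \<partial>f)"
    proof -
      have S0: "0 \<le> one_step \<rho> \<epsilon> \<phi> x + M" for x using S[of x] by linarith
      have "ennreal (\<integral>x. ?\<psi> x \<partial>g) = (\<integral>\<^sup>+x. ennreal (?\<psi> x) \<partial>g)"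
        using \<psi> ig by (intro nn_integral_eq_integral[symmetric]) auto
      also have "\<dots> = (\<integral>\<^sup>+x. ennreal (one_step \<rho> \<epsilon> \<phi> x + M) \<partial>f)"
        unfolding shift[symmetric] by (rule nn[of ?\<psi> "2 * M"]) (use \<psi> in auto)
      also have "\<dots> = ennreal (\<integral>x. one_step \<rho> \<epsilon> \<phi> x + M \<partial>f)"
        using S0 i_f by (intro nn_integral_eq_integral) auto
      finally show ?thesis .
    qed
    moreover have "0 \<le> (\<integral>x. ?\<psi> x \<partial>g)" using \<psi> by auto
    moreover have "0 \<le> (\<integral>x. one_step \<rho> \<epsilon> \<phi> x + M \<partial>f)"
    proof (rule Bochner_Integration.integral_nonneg)
      show "0 \<le> one_step \<rho> \<epsilon> \<phi> x + M" for x using S[of x] by linarith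
    qed
    ultimately have "(\<integral>x. ?\<psi> x \<partial>g) = (\<integral>x. one_step \<rho> \<epsilon> \<phi> x + M \<partial>f)" by simp
    then show ?thesis using ig i_f by (simp add: g.prob_space f.prob_space)
  qed
  then show ?thesis using g.prob_space_axioms g(1) by blast
qed

end

section \<open>Derivative bounds after one step and after many steps\<close>

context jump_coefficients
begin

text \<open>The jump part contributes \<open>\<epsilon> * B * rate * c l\<close> plus an integral of
  the weight, and the first term is exactly what the drift part loses by its factor
  \<open>1 - \<epsilon> * B * rate\<close>. Thus \<open>rate\<close> cancels and the constant does
  not depend on \<open>G\<close>.\<close>

lemma one_step_estimate:
  "\<exists>C\<ge>0. \<forall>G \<epsilon> f c l \<phi>. G \<in> sets q \<longrightarrow> emeasure q G < \<infinity> \<longrightarrow> 0 \<le> \<epsilon> \<longrightarrow> \<epsilon> * B \<le> 1 / 2 \<longrightarrow>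
    \<epsilon> * B * measure q G \<le> 1 \<longrightarrow> prob_space f \<longrightarrow> sets f = sets borel \<longrightarrow> deriv_bounds k f c \<longrightarrow> l \<le> k \<longrightarrow>
    \<phi> \<in> C_k_b k \<longrightarrow> (\<forall>x. \<bar>\<phi> x\<bar> \<le> 1) \<longrightarrow>
    \<bar>\<integral>x. one_step (density q (indicator G)) \<epsilon> ((deriv ^^ l) \<phi>) x \<partial>f\<bar> \<le> c l + C * \<epsilon> * (\<Sum>j\<le>l. c j)"
proof -
  \<comment> \<open>\<open>transport_estimate\<close> serves twice: for the jumps with the lower
    bound \<open>c\<^sub>0\<close>, and for the drift map \<open>x + \<epsilon> * b x\<close>, whose
    derivative is at least 1/2 because \<open>\<epsilon> * B \<le> 1 / 2\<close>.\<close>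
  have "0 < min c\<^sub>0 (1 / 2)" "0 \<le> B" using c\<^sub>0 B by auto
  from transport_estimate[OF this, of k] obtain C where C: "0 \<le> C"
    "\<And>f c h \<theta> \<gamma> l \<phi>. prob_space f \<Longrightarrow> sets f = sets borel \<Longrightarrow> deriv_bounds k f c \<Longrightarrow>
    (\<And>x. h field_differentiable at x) \<Longrightarrow> (\<And>x. \<bar>h x\<bar> \<le> \<theta>) \<Longrightarrow> graded k \<theta> 1 (deriv h) \<Longrightarrow>
    (\<And>x. min c\<^sub>0 (1 / 2) \<le> 1 + deriv h x) \<Longrightarrow> graded (Suc k) B 1 \<gamma> \<Longrightarrow> (\<And>x. 0 \<le> \<gamma> x) \<Longrightarrow> l \<le> k \<Longrightarrow>
    \<phi> \<in> C_k_b k \<Longrightarrow> (\<And>x. \<bar>\<phi> x\<bar> \<le> 1) \<Longrightarrow>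
    \<bar>\<integral>x. \<gamma> x * (deriv ^^ l) \<phi> (x + h x) + (B - \<gamma> x) * (deriv ^^ l) \<phi> x \<partial>f\<bar>
      \<le> B * c l + C * (\<theta> * (1 + \<theta>) ^ k) * (\<Sum>j\<le>l. c j)"
    by blast
  show ?thesis
  \<comment> \<open>\<open>2 ^ k\<close> bounds \<open>(1 + \<epsilon> * B) ^ k\<close> in the drift
    part; \<open>weight\<close> comes from integrating the jump estimate over the marks.\<close>
  proof (intro exI[of _ "C * (2 ^ k + weight)"] conjI allI impI)
    show "0 \<le> C * (2 ^ k + weight)" using C(1) weight_nonneg by simp
    fix G \<epsilon> f c l and \<phi> :: "real \<Rightarrow> real"
    assume G: "G \<in> sets q" "emeasure q G < \<infinity>" and \<epsilon>: "0 \<le> \<epsilon>" "\<epsilon> * B \<le> 1 / 2" "\<epsilon> * B * measure q G \<le> 1"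
      and f: "prob_space f" "sets f = sets borel" "deriv_bounds k f c" and l: "l \<le> k"
      and \<phi>: "\<phi> \<in> C_k_b k" "\<forall>x. \<bar>\<phi> x\<bar> \<le> 1"
    interpret truncated_jumps k q b \<gamma> h \<eta> c\<^sub>0 B G by unfold_locales (rule G)+
    interpret f: prob_space f by fact
    interpret fr: pair_sigma_finite f \<rho> ..
    note [measurable_cong] = f(2)
    define \<psi> where "\<psi> = (deriv ^^ l) \<phi>"
    define S where "S = (\<Sum>j\<le>l. c j)"
    have cl: "0 \<le> c j" if "j \<le> k" for j using deriv_bounds_nonneg[OF f(3) that] .
    have S: "0 \<le> S" unfolding S_def using cl l by (intro sum_nonneg) auto
    have "\<psi> \<in> C_k_b 0" unfolding \<psi>_def
      using l by (intro C_k_b_iterated_deriv C_k_b_mono[OF \<phi>(1)]) auto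
    then obtain M where M: "\<And>x. \<bar>\<psi> x\<bar> \<le> M" and "continuous_on UNIV \<psi>" unfolding C_k_b_0 by blast
    then have \<psi> [measurable]: "\<psi> \<in> borel_measurable borel" by (intro borel_measurable_continuous_onI)
    define J where "J x z = \<gamma> x * \<psi> (x + h x z) + (B - \<gamma> x) * \<psi> x" for x z
    have [measurable]: "(\<lambda>w. J (fst w) (snd w)) \<in> borel_measurable (borel \<Otimes>\<^sub>M q)"
      unfolding J_def by measurable
    have Jb: "\<bar>J x z\<bar> \<le> B * M" for x z
    proof -
      have "\<bar>\<gamma> x * \<psi> (x + h x z)\<bar> \<le> \<gamma> x * M" "\<bar>(B - \<gamma> x) * \<psi> x\<bar> \<le> (B - \<gamma> x) * M"
        using \<gamma>(2)[of x] \<gamma>_le[of x] M by (auto simp: abs_mult intro!: mult_left_mono)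
      then show ?thesis unfolding J_def by (simp add: algebra_simps)
    qed
    have fin: "emeasure (f \<Otimes>\<^sub>M \<rho>) (space (f \<Otimes>\<^sub>M \<rho>)) \<noteq> \<infinity>"
      using \<rho>.emeasure_pair_measure_Times[of "space f" f "space \<rho>"] f.emeasure_space_1 emeasure_\<rho>(1)
      by (simp add: space_pair_measure)
    interpret frf: finite_measure "f \<Otimes>\<^sub>M \<rho>" by (rule finite_measureI) (rule fin)
    have Ji: "integrable (f \<Otimes>\<^sub>M \<rho>) (\<lambda>(x, z). J x z)"
      using Jb by (intro frf.integrable_const_bound[of _ "B * M"]) (auto simp: case_prod_beta')
    have Jx: "integrable f (\<lambda>x. \<integral>z. J x z \<partial>\<rho>)"
      using fr.integrable_fst'[OF Ji] by simp
    have Jz: "integrable \<rho> (\<lambda>z. \<integral>x. J x z \<partial>f)"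
      using fr.integrable_snd[OF Ji] by simp
    have swap: "(\<integral>x. (\<integral>z. J x z \<partial>\<rho>) \<partial>f) = (\<integral>z. (\<integral>x. J x z \<partial>f) \<partial>\<rho>)"
      using fr.Fubini_integral[OF Ji] by simp
    have z: "\<bar>\<integral>x. J x z \<partial>f\<bar> \<le> B * c l + C * (\<eta> z * (1 + \<eta> z) ^ k) * S" if "z \<in> space q" for z
      unfolding J_def \<psi>_def S_def
      using h[OF that] c\<^sub>0(2)[OF that] \<gamma> l \<phi> graded_bound[OF h[OF that]]
      by (intro C(2) f) (auto simp: graded_Suc min.coboundedI1)
    have "\<bar>\<integral>z. (\<integral>x. J x z \<partial>f) \<partial>\<rho>\<bar> \<le> (\<integral>z. \<bar>\<integral>x. J x z \<partial>f\<bar> \<partial>\<rho>)" by (rule integral_abs_bound)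
    also have "\<dots> \<le> (\<integral>z. B * c l + C * S * (\<eta> z * (1 + \<eta> z) ^ k) \<partial>\<rho>)"
    proof (rule integral_mono)
      show "\<bar>\<integral>x. J x z \<partial>f\<bar> \<le> B * c l + C * S * (\<eta> z * (1 + \<eta> z) ^ k)" if "z \<in> space \<rho>" for z
        using z[of z] that by (simp add: mult_ac)
    qed (use Jz integral_weight_le(2) in auto)
    also have "\<dots> = B * c l * rate + C * S * (\<integral>z. \<eta> z * (1 + \<eta> z) ^ k \<partial>\<rho>)"
      using integral_weight_le(2) by (simp add: emeasure_\<rho>(2))
    also have "\<dots> \<le> B * c l * rate + C * S * weight"
      using C(1) S integral_weight_le(1) by (intro add_left_mono mult_left_mono) auto
    finally have jump: "\<bar>\<epsilon> * (\<integral>x. (\<integral>z. J x z \<partial>\<rho>) \<partial>f)\<bar> \<le> \<epsilon> * (B * c l * rate + C * S * weight)"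
      unfolding swap using \<epsilon>(1) by (simp add: abs_mult mult_left_mono)
    have drift: "\<bar>\<integral>x. \<psi> (x + \<epsilon> * b x) \<partial>f\<bar> \<le> c l + C * \<epsilon> * 2 ^ k * S"
    proof -
      have gb: "graded (Suc k) (\<epsilon> * B) 1 (\<lambda>x. \<epsilon> * b x)"
        using graded_cmult[OF b, of \<epsilon>] \<epsilon> by simp
      then have gb': "\<bar>deriv (\<lambda>x. \<epsilon> * b x) x\<bar> \<le> \<epsilon> * B" for x
        using graded_bound[of k "\<epsilon> * B" 1 "deriv (\<lambda>x. \<epsilon> * b x)" x] by (simp add: graded_Suc)
      have pos: "min c\<^sub>0 (1 / 2) \<le> 1 + deriv (\<lambda>x. \<epsilon> * b x) x" for x
        using gb'[of x] \<epsilon>(2) by (auto simp: abs_le_iff min_le_iff_disj)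
      \<comment> \<open>The drift is treated as a jump that is always accepted, with displacement
        \<open>\<epsilon> * b\<close> and acceptance weight \<open>B\<close>; the factor
        \<open>B\<close> is divided out afterwards.\<close>
      have "\<bar>\<integral>x. B * (deriv ^^ l) \<phi> (x + \<epsilon> * b x) + (B - B) * (deriv ^^ l) \<phi> x \<partial>f\<bar>
        \<le> B * c l + C * (\<epsilon> * B * (1 + \<epsilon> * B) ^ k) * (\<Sum>j\<le>l. c j)"
        using gb graded_bound[OF gb] pos B l \<phi>
        by (intro C(2) f graded_const) (auto simp: graded_Suc)
      then have "B * \<bar>\<integral>x. \<psi> (x + \<epsilon> * b x) \<partial>f\<bar> \<le> B * c l + C * (\<epsilon> * B * (1 + \<epsilon> * B) ^ k) * S"
        using B by (simp add: \<psi>_def S_def abs_mult)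
      also have "\<dots> \<le> B * c l + C * (\<epsilon> * B * 2 ^ k) * S"
        using C(1) S \<epsilon> B by (intro add_left_mono mult_right_mono mult_left_mono power_mono) auto
      also have "\<dots> = B * (c l + C * \<epsilon> * 2 ^ k * S)" by (simp add: algebra_simps)
      finally show ?thesis using B by simp
    qed
    have r1: "\<epsilon> * B * rate \<le> 1" using \<epsilon>(3) by (simp add: rate_def)
    have "\<bar>(1 - \<epsilon> * B * rate) * (\<integral>x. \<psi> (x + \<epsilon> * b x) \<partial>f)\<bar> \<le> (1 - \<epsilon> * B * rate) * (c l + C * \<epsilon> * 2 ^ k * S)"
      using r1 drift by (simp add: abs_mult mult_left_mono)
    also have "\<dots> = (1 - \<epsilon> * B * rate) * c l + (1 - \<epsilon> * B * rate) * (C * \<epsilon> * 2 ^ k * S)"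
      by (simp add: algebra_simps)
    also have "\<dots> \<le> (1 - \<epsilon> * B * rate) * c l + 1 * (C * \<epsilon> * 2 ^ k * S)"
      using \<epsilon> B rate_nonneg C(1) S by (intro add_left_mono mult_right_mono) auto
    finally have drift': "\<bar>(1 - \<epsilon> * B * rate) * (\<integral>x. \<psi> (x + \<epsilon> * b x) \<partial>f)\<bar>
      \<le> (1 - \<epsilon> * B * rate) * c l + C * \<epsilon> * 2 ^ k * S" by simp
    have i1: "integrable f (\<lambda>x. \<psi> (x + \<epsilon> * b x))"
      using M by (intro f.integrable_const_bound[of _ M]) auto
    have "(\<integral>x. one_step \<rho> \<epsilon> \<psi> x \<partial>f) = (1 - \<epsilon> * B * rate) * (\<integral>x. \<psi> (x + \<epsilon> * b x) \<partial>f) + \<epsilon> * (\<integral>x. (\<integral>z. J x z \<partial>\<rho>) \<partial>f)"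
      using i1 Jx by (simp add: one_step_def emeasure_\<rho>(2) J_def)
    then have "\<bar>\<integral>x. one_step \<rho> \<epsilon> \<psi> x \<partial>f\<bar>
        \<le> (1 - \<epsilon> * B * rate) * c l + C * \<epsilon> * 2 ^ k * S + \<epsilon> * (B * c l * rate + C * S * weight)"
      using jump drift' by linarith
    also have "\<dots> = c l + C * (2 ^ k + weight) * \<epsilon> * S" by (simp add: algebra_simps)
    finally show "\<bar>\<integral>x. one_step (density q (indicator G)) \<epsilon> ((deriv ^^ l) \<phi>) x \<partial>f\<bar>
        \<le> c l + C * (2 ^ k + weight) * \<epsilon> * (\<Sum>j\<le>l. c j)"
      by (simp add: \<psi>_def S_def \<rho>_def)
  qed
qed

text \<open>Applications of the operator are moved one by one from the test function to the measure
  by duality, updating the bounds from \<open>c l\<close> to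
  \<open>c l + C * \<epsilon> * (\<Sum>j\<le>l. c j)\<close>. The number \<open>k + 1\<close> of
  orders enters the constant when these are summed. \<open>c'\<close> does not depend on the test
  functions, so every order may use its own.\<close>

lemma iterated_step_estimate:
  "\<exists>C\<ge>0. \<forall>G \<epsilon> m f c. G \<in> sets q \<longrightarrow> emeasure q G < \<infinity> \<longrightarrow> 0 \<le> \<epsilon> \<longrightarrow> \<epsilon> * B \<le> 1 / 2 \<longrightarrow>
    \<epsilon> * B * measure q G \<le> 1 \<longrightarrow> prob_space f \<longrightarrow> sets f = sets borel \<longrightarrow> deriv_bounds k f c \<longrightarrow>
    (\<exists>c'. (\<Sum>l\<le>k. c' l) \<le> (1 + C * \<epsilon>) ^ m * (\<Sum>l\<le>k. c l) \<and>
      (\<forall>l\<le>k. \<forall>\<phi>\<in>C_k_b k. (\<forall>x. \<bar>\<phi> x\<bar> \<le> 1) \<longrightarrow>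
        (\<integral>x. (one_step (density q (indicator G)) \<epsilon> ^^ m) ((deriv ^^ l) \<phi>) x \<partial>f) \<le> c' l))"
proof -
  obtain C where C: "0 \<le> C"
    "\<And>G \<epsilon> f c l \<phi>. G \<in> sets q \<Longrightarrow> emeasure q G < \<infinity> \<Longrightarrow> 0 \<le> \<epsilon> \<Longrightarrow> \<epsilon> * B \<le> 1 / 2 \<Longrightarrow>
    \<epsilon> * B * measure q G \<le> 1 \<Longrightarrow> prob_space f \<Longrightarrow> sets f = sets borel \<Longrightarrow> deriv_bounds k f c \<Longrightarrow> l \<le> k \<Longrightarrow>
    \<phi> \<in> C_k_b k \<Longrightarrow> (\<And>x. \<bar>\<phi> x\<bar> \<le> 1) \<Longrightarrow>
    \<bar>\<integral>x. one_step (density q (indicator G)) \<epsilon> ((deriv ^^ l) \<phi>) x \<partial>f\<bar> \<le> c l + C * \<epsilon> * (\<Sum>j\<le>l. c j)"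
    using one_step_estimate by blast
  show ?thesis
  proof (intro exI[of _ "C * (real k + 1)"] conjI allI impI)
    show "0 \<le> C * (real k + 1)" using C(1) by simp
    fix G \<epsilon> m f c
    assume G: "G \<in> sets q" "emeasure q G < \<infinity>" and \<epsilon>: "0 \<le> \<epsilon>" "\<epsilon> * B \<le> 1 / 2" "\<epsilon> * B * measure q G \<le> 1"
      and f: "prob_space f" "sets f = sets borel" "deriv_bounds k f c"
    interpret truncated_jumps k q b \<gamma> h \<eta> c\<^sub>0 B G by unfold_locales (rule G)+
    let ?T = "one_step (density q (indicator G)) \<epsilon>"
    from f show "\<exists>c'. (\<Sum>l\<le>k. c' l) \<le> (1 + C * (real k + 1) * \<epsilon>) ^ m * (\<Sum>l\<le>k. c l) \<and>
      (\<forall>l\<le>k. \<forall>\<phi>\<in>C_k_b k. (\<forall>x. \<bar>\<phi> x\<bar> \<le> 1) \<longrightarrow> (\<integral>x. (?T ^^ m) ((deriv ^^ l) \<phi>) x \<partial>f) \<le> c' l)"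
    proof (induction m arbitrary: f c)
      case 0
      show ?case
      proof (intro exI[of _ c] conjI allI impI ballI)
        fix l and \<phi> :: "real \<Rightarrow> real" assume "l \<le> k" "\<phi> \<in> C_k_b k" "\<forall>x. \<bar>\<phi> x\<bar> \<le> 1"
        then show "(\<integral>x. (?T ^^ 0) ((deriv ^^ l) \<phi>) x \<partial>f) \<le> c l"
          using deriv_boundsD[OF 0(3), of l \<phi> 1] C_k_b_mono[of \<phi> k l] by auto
      qed simp
    next
      case (Suc m)
      have r1: "\<epsilon> * B * rate \<le> 1" using \<epsilon>(3) by (simp add: rate_def)
      define d where "d l = c l + C * \<epsilon> * (\<Sum>j\<le>l. c j)" for l
      obtain g where g: "prob_space g" "sets g = sets borel"
        "\<And>\<phi> M. \<phi> \<in> borel_measurable borel \<Longrightarrow> (\<And>x. \<bar>\<phi> x\<bar> \<le> M) \<Longrightarrow> (\<integral>x. \<phi> x \<partial>g) = (\<integral>x. ?T \<phi> x \<partial>f)"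
        using one_step_dual[OF Suc.prems(1,2) \<epsilon>(1) r1] unfolding \<rho>_def by metis
      have reg: "(deriv ^^ l) \<phi> \<in> borel_measurable borel \<and> (\<exists>M. \<forall>x. \<bar>(deriv ^^ l) \<phi> x\<bar> \<le> M)"
        if "l \<le> k" "\<phi> \<in> C_k_b k" for l \<phi>
      proof -
        have "(deriv ^^ l) \<phi> \<in> C_k_b 0"
          using that by (intro C_k_b_iterated_deriv C_k_b_mono[OF that(2)]) auto
        then show ?thesis by (auto simp: C_k_b_0 intro: borel_measurable_continuous_onI)
      qed
      have "deriv_bounds k g d"
      proof (rule deriv_boundsI[OF g(1,2)])
        fix l \<phi> assume l: "l \<le> k" "\<phi> \<in> C_k_b k" "\<And>y. \<bar>\<phi> y\<bar> \<le> 1"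
        then obtain M where "\<And>x. \<bar>(deriv ^^ l) \<phi> x\<bar> \<le> M" "(deriv ^^ l) \<phi> \<in> borel_measurable borel"
          using reg by blast
        then have "(\<integral>y. (deriv ^^ l) \<phi> y \<partial>g) = (\<integral>x. ?T ((deriv ^^ l) \<phi>) x \<partial>f)" by (intro g(3))
        also have "\<dots> \<le> d l"
          unfolding d_def using C(2)[OF G \<epsilon> Suc.prems l] by linarith
        finally show "(\<integral>y. (deriv ^^ l) \<phi> y \<partial>g) \<le> d l" .
      qed
      from Suc.IH[OF g(1,2) this] obtain c' where c': "(\<Sum>l\<le>k. c' l) \<le> (1 + C * (real k + 1) * \<epsilon>) ^ m * (\<Sum>l\<le>k. d l)"
        "\<And>l \<phi>. l \<le> k \<Longrightarrow> \<phi> \<in> C_k_b k \<Longrightarrow> (\<And>x. \<bar>\<phi> x\<bar> \<le> 1) \<Longrightarrow> (\<integral>x. (?T ^^ m) ((deriv ^^ l) \<phi>) x \<partial>g) \<le> c' l"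
        by blast
      have cl: "0 \<le> c j" if "j \<le> k" for j using deriv_bounds_nonneg[OF Suc.prems(3) that] .
      have "(\<Sum>l\<le>k. d l) \<le> (\<Sum>l\<le>k. c l + C * \<epsilon> * (\<Sum>j\<le>k. c j))"
        unfolding d_def using C(1) \<epsilon>(1) cl by (intro sum_mono add_left_mono mult_left_mono sum_mono2) auto
      also have "\<dots> = (1 + C * (real k + 1) * \<epsilon>) * (\<Sum>l\<le>k. c l)"
        by (simp add: sum.distrib algebra_simps)
      finally have "(1 + C * (real k + 1) * \<epsilon>) ^ m * (\<Sum>l\<le>k. d l) \<le> (1 + C * (real k + 1) * \<epsilon>) ^ Suc m * (\<Sum>l\<le>k. c l)"
        using C(1) \<epsilon>(1) unfolding power_Suc2 mult.assoc by (intro mult_left_mono) auto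
      with c'(1) have "(\<Sum>l\<le>k. c' l) \<le> (1 + C * (real k + 1) * \<epsilon>) ^ Suc m * (\<Sum>l\<le>k. c l)" by linarith
      moreover have "(\<integral>x. (?T ^^ Suc m) ((deriv ^^ l) \<phi>) x \<partial>f) \<le> c' l"
        if l: "l \<le> k" "\<phi> \<in> C_k_b k" "\<forall>x. \<bar>\<phi> x\<bar> \<le> 1" for l \<phi>
      proof -
        obtain M where M: "(deriv ^^ l) \<phi> \<in> borel_measurable borel" "\<And>x. \<bar>(deriv ^^ l) \<phi> x\<bar> \<le> M"
          using reg l by blast
        then have "(\<integral>x. (?T ^^ m) ((deriv ^^ l) \<phi>) x \<partial>g) = (\<integral>x. ?T ((?T ^^ m) ((deriv ^^ l) \<phi>)) x \<partial>f)"
          using one_step_iterate[OF M \<epsilon>(1) r1, of m] unfolding \<rho>_def by (intro g(3)[of _ M]) auto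
        then show ?thesis using c'(2)[of l \<phi>] l by simp
      qed
      ultimately show ?case by blast
    qed
  qed
qed

end

section \<open>Poisson random measures\<close>

locale poisson_jumps =
  fixes P :: "'w measure" and q :: "'g measure" and \<mu> :: "(real \<times> real \<times> 'g) measure"
    and N :: "'w \<Rightarrow> (real \<times> real \<times> 'g) measure"
  assumes intensity: "jump_intensity q \<mu>" and poisson: "poisson_measure P \<mu> N"
begin

sublocale prob_space P
  using poisson by (simp add: poisson_measure_def)

abbreviation half_line :: "real measure" where "half_line \<equiv> restrict_space borel {0..}"

lemma sets_\<mu> [measurable_cong]: "sets \<mu> = sets (half_line \<Otimes>\<^sub>M half_line \<Otimes>\<^sub>M q)"
  using intensity by (simp add: jump_intensity_def)

lemma space_\<mu>: "space \<mu> = {0..} \<times> {0..} \<times> space q"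
  using sets_eq_imp_space_eq[OF sets_\<mu>] by (simp add: space_pair_measure space_restrict_space)

lemma emeasure_box:
  "A \<in> sets half_line \<Longrightarrow> B \<in> sets half_line \<Longrightarrow> C \<in> sets q \<Longrightarrow>
    emeasure \<mu> (A \<times> B \<times> C) = emeasure lborel A * emeasure lborel B * emeasure q C"
  using intensity by (simp add: jump_intensity_def)

lemma sets_N: "\<omega> \<in> space P \<Longrightarrow> sets (N \<omega>) = sets \<mu>"
  using poisson by (simp add: poisson_measure_def)

lemma space_N: "\<omega> \<in> space P \<Longrightarrow> space (N \<omega>) = space \<mu>"
  using sets_eq_imp_space_eq[OF sets_N] .

lemma N_integer: "\<omega> \<in> space P \<Longrightarrow> A \<in> sets \<mu> \<Longrightarrow> emeasure (N \<omega>) A \<noteq> \<infinity> \<Longrightarrow> \<exists>n::nat. emeasure (N \<omega>) A = of_nat n"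
  using poisson unfolding poisson_measure_def by blast

lemma measurable_count [measurable]: "A \<in> sets \<mu> \<Longrightarrow> (\<lambda>\<omega>. emeasure (N \<omega>) A) \<in> borel_measurable P"
  using poisson by (simp add: poisson_measure_def)

lemma prob_count:
  "A \<in> sets \<mu> \<Longrightarrow> emeasure \<mu> A < \<infinity> \<Longrightarrow> prob {\<omega>\<in>space P. emeasure (N \<omega>) A = of_nat n} =
    measure \<mu> A ^ n / fact n * exp (- measure \<mu> A)"
  using poisson by (simp add: poisson_measure_def)

section \<open>Laws and means of the counts\<close>

lemma nn_integral_count:
  assumes A: "A \<in> sets \<mu>" "emeasure \<mu> A < \<infinity>" and [measurable]: "F \<in> borel_measurable borel"
  shows "(\<integral>\<^sup>+\<omega>. F (emeasure (N \<omega>) A) \<partial>P) =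
    (\<Sum>n. F (of_nat n) * ennreal (measure \<mu> A ^ n / fact n * exp (- measure \<mu> A)))"
proof -
  let ?m = "measure \<mu> A"
  let ?E = "\<lambda>n::nat. {\<omega>\<in>space P. emeasure (N \<omega>) A = of_nat n}"
  note [measurable] = A(1)
  have "(\<lambda>n. ?m ^ n / fact n) sums exp ?m"
    using exp_converges[of ?m] by (simp add: field_simps)
  then have s: "(\<lambda>n. ?m ^ n / fact n * exp (- ?m)) sums 1"
    using sums_mult2[of "\<lambda>n. ?m ^ n / fact n" "exp ?m" "exp (- ?m)"] by (simp add: exp_minus_inverse)
  have "emeasure P (\<Union>n. ?E n) = (\<Sum>n. emeasure P (?E n))"
    by (subst suminf_emeasure) (auto simp: disjoint_family_on_def)
  also have "\<dots> = (\<Sum>n. ennreal (?m ^ n / fact n * exp (- ?m)))"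
    by (simp add: emeasure_eq_measure prob_count[OF A])
  also have "\<dots> = ennreal 1"
    by (rule suminf_ennreal_eq[OF _ s]) simp
  \<comment> \<open>The Poisson weights add up to 1, so almost surely the count is a natural number
    and the value infinity does not contribute.\<close>
  finally have "AE \<omega> in P. \<omega> \<in> (\<Union>n. ?E n)"
    by (intro AE_prob_1) (simp add: measure_def)
  then have "AE \<omega> in P. F (emeasure (N \<omega>) A) = (\<Sum>n. F (of_nat n) * indicator (?E n) \<omega>)"
  proof eventually_elim
    case (elim \<omega>)
    then obtain n where n: "\<omega> \<in> ?E n" by blast
    have "(\<Sum>i. F (of_nat i) * indicator (?E i) \<omega>) = (\<Sum>i\<in>{n}. F (of_nat i) * indicator (?E i) \<omega>)"
      using n by (intro suminf_finite) (auto simp: indicator_def)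
    also have "\<dots> = F (of_nat n)" using n by simp
    finally show ?case using n by (simp only: mem_Collect_eq)
  qed
  then have "(\<integral>\<^sup>+\<omega>. F (emeasure (N \<omega>) A) \<partial>P) = (\<integral>\<^sup>+\<omega>. (\<Sum>n. F (of_nat n) * indicator (?E n) \<omega>) \<partial>P)"
    by (rule nn_integral_cong_AE)
  also have "\<dots> = (\<Sum>n. \<integral>\<^sup>+\<omega>. F (of_nat n) * indicator (?E n) \<omega> \<partial>P)"
    by (rule nn_integral_suminf) measurable
  also have "\<dots> = (\<Sum>n. F (of_nat n) * emeasure P (?E n))"
    by (intro suminf_cong nn_integral_cmult_indicator) measurable
  finally show ?thesis
    by (simp add: emeasure_eq_measure prob_count[OF A])
qed

lemma poisson_mean_sums:
  "(\<lambda>n. real n * (m ^ n / fact n * exp (- m))) sums (m :: real)"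
proof -
  have "(\<lambda>n. m ^ n / fact n) sums exp m"
    using exp_converges[of m] by (simp add: field_simps)
  then have "(\<lambda>n. m ^ n / fact n * (m * exp (- m))) sums (exp m * (m * exp (- m)))"
    by (rule sums_mult2)
  also have "exp m * (m * exp (- m)) = m" by (simp add: mult.left_commute exp_minus_inverse)
  also have "(\<lambda>n. m ^ n / fact n * (m * exp (- m))) = (\<lambda>n. real (Suc n) * (m ^ Suc n / fact (Suc n) * exp (- m)))"
    by (auto simp: fact_Suc field_simps simp del: of_nat_Suc)
  finally show ?thesis by (subst (asm) sums_Suc_iff) simp
qed

lemma mean_count: "A \<in> sets \<mu> \<Longrightarrow> (\<integral>\<^sup>+\<omega>. emeasure (N \<omega>) A \<partial>P) = emeasure \<mu> A"
proof (cases "emeasure \<mu> A < \<infinity>")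
  case True
  assume A: "A \<in> sets \<mu>"
  have "(\<integral>\<^sup>+\<omega>. emeasure (N \<omega>) A \<partial>P) = (\<Sum>n. of_nat n * ennreal (measure \<mu> A ^ n / fact n * exp (- measure \<mu> A)))"
    by (rule nn_integral_count[OF A True, of "\<lambda>x. x"]) simp
  also have "\<dots> = (\<Sum>n. ennreal (real n * (measure \<mu> A ^ n / fact n * exp (- measure \<mu> A))))"
    by (simp only: ennreal_of_nat_eq_real_of_nat ennreal_mult'[OF of_nat_0_le_iff])
  also have "\<dots> = ennreal (measure \<mu> A)"
    by (rule suminf_ennreal_eq[OF _ poisson_mean_sums]) simp
  finally show ?thesis using True by (simp add: emeasure_eq_ennreal_measure less_top)
next
  case False
  assume A: "A \<in> sets \<mu>"
  have inf: "emeasure \<mu> A = \<infinity>" using False by (simp add: less_top[symmetric])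
  then have "AE \<omega> in P. emeasure (N \<omega>) A = \<infinity>"
    using poisson A by (simp add: poisson_measure_def)
  then have "(\<integral>\<^sup>+\<omega>. emeasure (N \<omega>) A \<partial>P) = (\<integral>\<^sup>+\<omega>. \<infinity> \<partial>P)" by (rule nn_integral_cong_AE)
  then show ?thesis using inf by (simp add: emeasure_space_1)
qed

text \<open>The mean over counts other than one is \<open>m - m * exp (- m)\<close>, hence at most
  \<open>m\<^sup>2\<close>. In a window of length \<open>\<epsilon>\<close> the mean count is
  proportional to \<open>\<epsilon>\<close>, so several candidate jumps are an effect of second
  order.\<close>

lemma mean_multiple_count:
  assumes A: "A \<in> sets \<mu>" "emeasure \<mu> A < \<infinity>"
  shows "(\<integral>\<^sup>+\<omega>. (if emeasure (N \<omega>) A = 1 then 0 else emeasure (N \<omega>) A) \<partial>P) \<le> ennreal ((measure \<mu> A)\<^sup>2)"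
proof -
  let ?m = "measure \<mu> A"
  let ?f = "\<lambda>n. real n * (?m ^ n / fact n * exp (- ?m)) - (if n = 1 then ?m * exp (- ?m) else 0)"
  have "(\<integral>\<^sup>+\<omega>. (if emeasure (N \<omega>) A = 1 then 0 else emeasure (N \<omega>) A) \<partial>P) =
      (\<Sum>n. (if of_nat n = (1::ennreal) then 0 else of_nat n) * ennreal (?m ^ n / fact n * exp (- ?m)))"
    by (rule nn_integral_count[OF A, of "\<lambda>x. if x = 1 then 0 else x"]) simp
  also have "\<dots> = (\<Sum>n. ennreal (?f n))"
  proof (rule suminf_cong)
    fix n
    show "(if of_nat n = (1::ennreal) then 0 else of_nat n) * ennreal (?m ^ n / fact n * exp (- ?m)) = ennreal (?f n)"
    proof (cases "n = 1")
      case False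
      then have "of_nat n \<noteq> (1::ennreal)" by (metis of_nat_1 of_nat_eq_iff)
      with False show ?thesis
        by (simp only: if_False diff_zero ennreal_of_nat_eq_real_of_nat ennreal_mult'[OF of_nat_0_le_iff])
    qed simp
  qed
  also have "\<dots> = ennreal (?m - ?m * exp (- ?m))"
  proof (rule suminf_ennreal_eq)
    show "?f sums (?m - ?m * exp (- ?m))"
      using sums_single[of 1 "\<lambda>_. ?m * exp (- ?m)"]
      by (intro sums_diff poisson_mean_sums) (simp add: eq_commute)
    show "0 \<le> ?f n" for n by (cases "n = 1") auto
  qed
  also have "\<dots> \<le> ennreal (?m\<^sup>2)"
  proof (rule ennreal_leI)
    have "?m * (1 - exp (- ?m)) \<le> ?m * ?m"
      using exp_ge_add_one_self[of "- ?m"] by (intro mult_left_mono) auto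
    then show "?m - ?m * exp (- ?m) \<le> ?m\<^sup>2" by (simp add: algebra_simps power2_eq_square)
  qed
  finally show ?thesis .
qed

text \<open>Only counts of subsets of \<open>D\<close> enter, so \<open>F\<close> may be smaller
  than the full sigma-algebra. It is applied to all events and to the events determined off a
  window.\<close>

lemma measurable_nn_integral_N:
  assumes D: "D \<in> sets \<mu>" and g: "g \<in> borel_measurable \<mu>" and F: "space F = space P"
    and count: "\<And>A. A \<in> sets \<mu> \<Longrightarrow> A \<subseteq> D \<Longrightarrow> (\<lambda>\<omega>. emeasure (N \<omega>) A) \<in> borel_measurable F"
  shows "(\<lambda>\<omega>. \<integral>\<^sup>+e. g e * indicator D e \<partial>N \<omega>) \<in> borel_measurable F"
  using g
proof (induction rule: borel_measurable_induct)
  case (cong f g)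
  then have "(\<integral>\<^sup>+e. f e * indicator D e \<partial>N \<omega>) = (\<integral>\<^sup>+e. g e * indicator D e \<partial>N \<omega>)" if "\<omega> \<in> space F" for \<omega>
    using F space_N[of \<omega>] that by (intro nn_integral_cong) auto
  with cong(4) show ?case by (simp cong: measurable_cong)
next
  case (set A)
  have "(\<integral>\<^sup>+e. indicator A e * indicator D e \<partial>N \<omega>) = emeasure (N \<omega>) (A \<inter> D)" if "\<omega> \<in> space F" for \<omega>
    using set D sets_N[of \<omega>] F that by (simp add: indicator_inter_arith[symmetric])
  moreover have "(\<lambda>\<omega>. emeasure (N \<omega>) (A \<inter> D)) \<in> borel_measurable F"
    using set D by (intro count) auto
  ultimately show ?case by (simp cong: measurable_cong)
next
  case (mult u c)
  have "(\<integral>\<^sup>+e. c * u e * indicator D e \<partial>N \<omega>) = c * (\<integral>\<^sup>+e. u e * indicator D e \<partial>N \<omega>)" if "\<omega> \<in> space F" for \<omega>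
    using mult D sets_N[of \<omega>] F that
    by (subst nn_integral_cmult[symmetric]) (auto simp: mult.assoc measurable_cong_sets[OF sets_N refl] intro!: borel_measurable_times_ennreal)
  with mult show ?case by (simp cong: measurable_cong)
next
  case (add u v)
  have "(\<integral>\<^sup>+e. (v e + u e) * indicator D e \<partial>N \<omega>) = (\<integral>\<^sup>+e. v e * indicator D e \<partial>N \<omega>) + (\<integral>\<^sup>+e. u e * indicator D e \<partial>N \<omega>)"
    if "\<omega> \<in> space F" for \<omega>
    using add D sets_N[of \<omega>] F that
    by (subst nn_integral_add[symmetric]) (auto simp: distrib_right measurable_cong_sets[OF sets_N refl] intro!: borel_measurable_times_ennreal)
  with add show ?case by (simp cong: measurable_cong)
next
  case (seq U)
  have "(\<integral>\<^sup>+e. (SUP i. U i) e * indicator D e \<partial>N \<omega>) = (SUP i. \<integral>\<^sup>+e. U i e * indicator D e \<partial>N \<omega>)"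
    if "\<omega> \<in> space F" for \<omega>
  proof -
    have "(\<integral>\<^sup>+e. (SUP i. U i) e * indicator D e \<partial>N \<omega>) = (\<integral>\<^sup>+e. (SUP i. U i e * indicator D e) \<partial>N \<omega>)"
      by (simp add: SUP_mult_right_ennreal image_comp)
    also have "\<dots> = (SUP i. \<integral>\<^sup>+e. U i e * indicator D e \<partial>N \<omega>)"
      using seq D sets_N[of \<omega>] F that
      by (intro nn_integral_monotone_convergence_SUP)
        (auto simp: incseq_def le_fun_def measurable_cong_sets[OF sets_N refl] intro!: borel_measurable_times_ennreal mult_right_mono)
    finally show ?thesis .
  qed
  with seq show ?case by (simp cong: measurable_cong)
qed

lemma nn_integral_N:
  assumes g: "g \<in> borel_measurable \<mu>"
  shows "(\<lambda>\<omega>. \<integral>\<^sup>+e. g e \<partial>N \<omega>) \<in> borel_measurable P" "(\<integral>\<^sup>+\<omega>. \<integral>\<^sup>+e. g e \<partial>N \<omega> \<partial>P) = (\<integral>\<^sup>+e. g e \<partial>\<mu>)"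
proof -
  have m: "(\<lambda>\<omega>. \<integral>\<^sup>+e. g e \<partial>N \<omega>) \<in> borel_measurable P" if "g \<in> borel_measurable \<mu>" for g
  proof -
    have "(\<integral>\<^sup>+e. g e * indicator (space \<mu>) e \<partial>N \<omega>) = (\<integral>\<^sup>+e. g e \<partial>N \<omega>)" if "\<omega> \<in> space P" for \<omega>
      using space_N[OF that] by (intro nn_integral_cong) auto
    then show ?thesis
      using measurable_nn_integral_N[OF sets.top that refl measurable_count] by (simp cong: measurable_cong)
  qed
  then show "(\<lambda>\<omega>. \<integral>\<^sup>+e. g e \<partial>N \<omega>) \<in> borel_measurable P" using g .
  show "(\<integral>\<^sup>+\<omega>. \<integral>\<^sup>+e. g e \<partial>N \<omega> \<partial>P) = (\<integral>\<^sup>+e. g e \<partial>\<mu>)"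
    using g
  proof (induction rule: borel_measurable_induct)
    case (cong f g)
    have "(\<integral>\<^sup>+\<omega>. \<integral>\<^sup>+e. f e \<partial>N \<omega> \<partial>P) = (\<integral>\<^sup>+\<omega>. \<integral>\<^sup>+e. g e \<partial>N \<omega> \<partial>P)"
      using cong space_N by (intro nn_integral_cong) auto
    moreover have "(\<integral>\<^sup>+e. f e \<partial>\<mu>) = (\<integral>\<^sup>+e. g e \<partial>\<mu>)" using cong by (intro nn_integral_cong) auto
    ultimately show ?case using cong by simp
  next
    case (set A)
    have "(\<integral>\<^sup>+\<omega>. \<integral>\<^sup>+e. indicator A e \<partial>N \<omega> \<partial>P) = (\<integral>\<^sup>+\<omega>. emeasure (N \<omega>) A \<partial>P)"
      using set sets_N by (intro nn_integral_cong) auto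
    then show ?case using set mean_count by simp
  next
    case (mult u c)
    have "(\<integral>\<^sup>+\<omega>. \<integral>\<^sup>+e. c * u e \<partial>N \<omega> \<partial>P) = (\<integral>\<^sup>+\<omega>. c * (\<integral>\<^sup>+e. u e \<partial>N \<omega>) \<partial>P)"
      using mult
      by (intro nn_integral_cong nn_integral_cmult) (auto simp: measurable_cong_sets[OF sets_N refl])
    then show ?case using mult m by (simp add: nn_integral_cmult)
  next
    case (add u v)
    have "(\<integral>\<^sup>+\<omega>. \<integral>\<^sup>+e. v e + u e \<partial>N \<omega> \<partial>P) = (\<integral>\<^sup>+\<omega>. (\<integral>\<^sup>+e. v e \<partial>N \<omega>) + (\<integral>\<^sup>+e. u e \<partial>N \<omega>) \<partial>P)"
      using add by (intro nn_integral_cong nn_integral_add) (auto simp: measurable_cong_sets[OF sets_N refl])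
    then show ?case using add m by (simp add: nn_integral_add)
  next
    case (seq U)
    have "(\<integral>\<^sup>+\<omega>. \<integral>\<^sup>+e. (SUP i. U i) e \<partial>N \<omega> \<partial>P) = (\<integral>\<^sup>+\<omega>. (SUP i. \<integral>\<^sup>+e. U i e \<partial>N \<omega>) \<partial>P)"
      using seq by (intro nn_integral_cong)
        (auto simp: image_comp measurable_cong_sets[OF sets_N refl] intro!: nn_integral_monotone_convergence_SUP)
    also have "\<dots> = (SUP i. \<integral>\<^sup>+\<omega>. \<integral>\<^sup>+e. U i e \<partial>N \<omega> \<partial>P)"
      using seq m
      by (intro nn_integral_monotone_convergence_SUP) (auto simp: incseq_def le_fun_def intro!: nn_integral_mono)
    also have "\<dots> = (SUP i. \<integral>\<^sup>+e. U i e \<partial>\<mu>)" using seq by simp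
    also have "\<dots> = (\<integral>\<^sup>+e. (SUP i. U i) e \<partial>\<mu>)"
      using seq by (simp add: image_comp nn_integral_monotone_convergence_SUP)
    finally show ?case .
  qed
qed

text \<open>\<open>\<mu>\<close> is prescribed on boxes only and \<open>q\<close> need not be
  sigma-finite, so instead of Tonelli's theorem an induction on the function of the mark is used,
  starting from boxes.\<close>

lemma nn_integral_box:
  assumes I: "I \<in> sets half_line" and J: "J \<in> sets half_line" and f: "f \<in> borel_measurable q"
  shows "(\<integral>\<^sup>+(s, u, z). indicator I s * indicator J u * f z \<partial>\<mu>) = emeasure lborel I * emeasure lborel J * (\<integral>\<^sup>+z. f z \<partial>q)"
  using f
proof (induction rule: borel_measurable_induct)
  case (cong f g)
  have "(\<integral>\<^sup>+(s, u, z). indicator I s * indicator J u * f z \<partial>\<mu>) = (\<integral>\<^sup>+(s, u, z). indicator I s * indicator J u * g z \<partial>\<mu>)"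
    using cong by (intro nn_integral_cong) (auto simp: space_\<mu>)
  moreover have "(\<integral>\<^sup>+z. f z \<partial>q) = (\<integral>\<^sup>+z. g z \<partial>q)" using cong by (intro nn_integral_cong) auto
  ultimately show ?case using cong by simp
next
  case (set A)
  have "(\<integral>\<^sup>+(s, u, z). indicator I s * indicator J u * indicator A z \<partial>\<mu>) = (\<integral>\<^sup>+e. indicator (I \<times> J \<times> A) e \<partial>\<mu>)"
    by (intro nn_integral_cong) (auto simp: indicator_def)
  also have "\<dots> = emeasure \<mu> (I \<times> J \<times> A)"
    using I J set by (intro nn_integral_indicator) (auto simp: sets_\<mu>)
  finally show ?case using I J set by (simp add: emeasure_box)
next
  case (mult u c)
  note [measurable] = I J mult(2)
  have "(\<integral>\<^sup>+(s, v, z). indicator I s * indicator J v * (c * u z) \<partial>\<mu>) = (\<integral>\<^sup>+e. c * (case e of (s, v, z) \<Rightarrow> indicator I s * indicator J v * u z) \<partial>\<mu>)"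
    by (intro nn_integral_cong) (auto simp: mult_ac)
  also have "\<dots> = c * (\<integral>\<^sup>+(s, v, z). indicator I s * indicator J v * u z \<partial>\<mu>)"
    by (rule nn_integral_cmult) measurable
  finally show ?case using mult by (simp add: nn_integral_cmult mult_ac)
next
  case (add u v)
  note [measurable] = I J add(1,3)
  have "(\<integral>\<^sup>+(s, w, z). indicator I s * indicator J w * (v z + u z) \<partial>\<mu>) =
      (\<integral>\<^sup>+e. (case e of (s, w, z) \<Rightarrow> indicator I s * indicator J w * v z) + (case e of (s, w, z) \<Rightarrow> indicator I s * indicator J w * u z) \<partial>\<mu>)"
    by (intro nn_integral_cong) (auto simp: distrib_left)
  also have "\<dots> = (\<integral>\<^sup>+(s, w, z). indicator I s * indicator J w * v z \<partial>\<mu>) + (\<integral>\<^sup>+(s, w, z). indicator I s * indicator J w * u z \<partial>\<mu>)"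
    by (rule nn_integral_add) measurable
  finally show ?case using add by (simp add: nn_integral_add distrib_left)
next
  case (seq U)
  note [measurable] = I J seq(1)
  have "(\<integral>\<^sup>+(s, w, z). indicator I s * indicator J w * (SUP i. U i) z \<partial>\<mu>) =
      (\<integral>\<^sup>+e. (SUP i. case e of (s, w, z) \<Rightarrow> indicator I s * indicator J w * U i z) \<partial>\<mu>)"
    by (intro nn_integral_cong) (auto simp: SUP_mult_left_ennreal image_comp)
  also have "\<dots> = (SUP i. \<integral>\<^sup>+e. (case e of (s, w, z) \<Rightarrow> indicator I s * indicator J w * U i z) \<partial>\<mu>)"
    using seq by (intro nn_integral_monotone_convergence_SUP)
      (auto simp: incseq_def le_fun_def split: prod.split intro!: mult_left_mono)
  also have "\<dots> = (SUP i. emeasure lborel I * emeasure lborel J * (\<integral>\<^sup>+z. U i z \<partial>q))" using seq by simp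
  also have "\<dots> = emeasure lborel I * emeasure lborel J * (SUP i. (\<integral>\<^sup>+z. U i z \<partial>q))"
    by (simp add: SUP_mult_left_ennreal)
  also have "(SUP i. (\<integral>\<^sup>+z. U i z \<partial>q)) = (\<integral>\<^sup>+z. (SUP i. U i) z \<partial>q)"
    using seq by (simp add: image_comp nn_integral_monotone_convergence_SUP)
  finally show ?case .
qed

text \<open>All information carried by \<open>N\<close> off \<open>D\<close>. For a window
  \<open>D\<close> after time \<open>t\<close> it contains not only the past up to \<open>t\<close>
  but also the discarded jumps during the window itself, which perturb the path and have to be
  frozen together with the position at time \<open>t\<close>.\<close>

definition outside :: "(real \<times> real \<times> 'g) set \<Rightarrow> 'w measure" where
  "outside D = sigma (space P) {(\<lambda>\<omega>. emeasure (N \<omega>) A) -` S \<inter> space P | A S.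
     A \<in> sets \<mu> \<and> A \<inter> D = {} \<and> S \<in> sets borel}"

lemma space_outside [simp]: "space (outside D) = space P"
  by (simp add: outside_def space_measure_of_conv)

lemma sets_outside: "sets (outside D) = sigma_sets (space P) {(\<lambda>\<omega>. emeasure (N \<omega>) A) -` S \<inter> space P | A S.
     A \<in> sets \<mu> \<and> A \<inter> D = {} \<and> S \<in> sets borel}"
  unfolding outside_def by (rule sets_measure_of) auto

lemma measurable_count_outside:
  assumes "A \<in> sets \<mu>" "A \<inter> D = {}"
  shows "(\<lambda>\<omega>. emeasure (N \<omega>) A) \<in> borel_measurable (outside D)"
proof (rule measurableI)
  fix S :: "ennreal set" assume "S \<in> sets borel"
  then show "(\<lambda>\<omega>. emeasure (N \<omega>) A) -` S \<inter> space (outside D) \<in> sets (outside D)"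
    unfolding sets_outside using assms by (intro sigma_sets.Basic) auto
qed simp

lemma sets_outside_subset: "sets (outside D) \<subseteq> events"
  unfolding sets_outside using measurable_sets[OF measurable_count] by (intro sets.sigma_sets_subset) auto

lemma measurable_outside: "Z \<in> measurable (outside D) M' \<Longrightarrow> Z \<in> measurable P M'"
  using sets_outside_subset[of D] by (auto simp: measurable_def)

text \<open>
  The counts of finitely many sets outside \<open>D\<close> are sums of counts of the atoms they generate, and
  these atoms are disjoint from each other and from \<open>A \<subseteq> D\<close>.
\<close>

lemma prob_finite_outside:
  assumes D: "D \<in> sets \<mu>" and F: "finite F" "F \<subseteq> sets \<mu>" "\<And>a. a \<in> F \<Longrightarrow> a \<inter> D = {}"
    and B: "\<And>a. B a \<in> sets borel" and A: "A \<in> sets \<mu>" "A \<subseteq> D" and S: "S \<in> sets borel"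
  shows "prob ({\<omega>\<in>space P. \<forall>a\<in>F. emeasure (N \<omega>) a \<in> B a} \<inter> {\<omega>\<in>space P. emeasure (N \<omega>) A \<in> S}) =
    prob {\<omega>\<in>space P. \<forall>a\<in>F. emeasure (N \<omega>) a \<in> B a} * prob {\<omega>\<in>space P. emeasure (N \<omega>) A \<in> S}"
proof -
  define atom where "atom T = {e \<in> space \<mu> - D. {a\<in>F. e \<in> a} = T}" for T
  obtain \<beta> where \<beta>: "bij_betw \<beta> {0..<card (Pow F)} (Pow F)"
    using ex_bij_betw_nat_finite[of "Pow F"] F(1) by auto
  define n where "n = card (Pow F)"
  \<comment> \<open>The indices below \<open>n\<close> enumerate the atoms and index
    \<open>n\<close> is reserved for \<open>A\<close>; independence is then applied to the blocks
    \<open>{..<n}\<close> and \<open>{n}\<close>.\<close>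
  define fam where "fam i = (if i < n then atom (\<beta> i) else A)" for i
  have \<beta>': "\<beta> ` {..<n} = Pow F" "inj_on \<beta> {..<n}"
    using \<beta> by (auto simp: bij_betw_def n_def atLeast0LessThan)
  have atom_sets: "atom T \<in> sets \<mu>" if "T \<subseteq> F" for T
  proof -
    have "atom T = (space \<mu> - D) \<inter> {e\<in>space \<mu>. \<forall>a\<in>F. e \<in> a \<longleftrightarrow> a \<in> T}"
      using that by (auto simp: atom_def)
    moreover have "{e\<in>space \<mu>. \<forall>a\<in>F. e \<in> a \<longleftrightarrow> a \<in> T} \<in> sets \<mu>"
      using F(1,2)
      by (intro sets.sets_Collect_finite_All) (auto intro: sets.sets_Collect_const sets.sets_Collect pred_sets2)
    ultimately show ?thesis using D by auto
  qed
  have fam: "fam i \<in> sets \<mu>" if "i < Suc n" for i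
    using that A(1) atom_sets \<beta>'(1) by (auto simp: fam_def)
  have dis: "disjoint_family_on fam {..<Suc n}"
    unfolding disjoint_family_on_def
  proof (intro ballI impI)
    fix i j assume ij: "i \<in> {..<Suc n}" "j \<in> {..<Suc n}" "i \<noteq> j"
    show "fam i \<inter> fam j = {}"
    proof (cases "i < n \<and> j < n")
      case True
      then have "\<beta> i \<noteq> \<beta> j" using \<beta>'(2) ij by (auto simp: inj_on_def)
      then show ?thesis using True by (auto simp: fam_def atom_def)
    next
      case False
      then show ?thesis using ij A(2) by (auto simp: fam_def atom_def)
    qed
  qed
  let ?X = "\<lambda>i \<omega>. emeasure (N \<omega>) (fam i)"
  have "indep_vars (\<lambda>_. borel) ?X {..<Suc n}"
    using poisson fam dis by (auto simp: poisson_measure_def)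
  then have ind: "indep_var (PiM {..<n} (\<lambda>_. borel)) (\<lambda>\<omega>. restrict (\<lambda>i. ?X i \<omega>) {..<n})
      (PiM {n} (\<lambda>_. borel)) (\<lambda>\<omega>. restrict (\<lambda>i. ?X i \<omega>) {n})"
    by (rule indep_var_restrict) auto
  define S1 where "S1 = {x\<in>space (PiM {..<n} (\<lambda>_. borel :: ennreal measure)). \<forall>a\<in>F. (\<Sum>i\<in>{i\<in>{..<n}. a \<in> \<beta> i}. x i) \<in> B a}"
  define S2 where "S2 = {x\<in>space (PiM {n} (\<lambda>_. borel :: ennreal measure)). x n \<in> S}"
  have S1: "S1 \<in> sets (PiM {..<n} (\<lambda>_. borel))"
    unfolding S1_def
  proof (rule sets.sets_Collect_finite_All[OF _ F(1)])
    fix a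
    have "(\<lambda>x. \<Sum>i\<in>{i\<in>{..<n}. a \<in> \<beta> i}. x i) \<in> borel_measurable (PiM {..<n} (\<lambda>_. borel :: ennreal measure))"
      by (intro borel_measurable_sum measurable_component_singleton) auto
    from measurable_sets[OF this B[of a]]
    show "{x \<in> space (PiM {..<n} (\<lambda>_. borel)). (\<Sum>i\<in>{i\<in>{..<n}. a \<in> \<beta> i}. x i) \<in> B a} \<in> sets (PiM {..<n} (\<lambda>_. borel))"
      by (simp add: vimage_def Int_def conj_commute)
  qed
  have S2: "S2 \<in> sets (PiM {n} (\<lambda>_. borel))"
    using measurable_sets[OF measurable_component_singleton[of n "{n}" "\<lambda>_. borel"] S]
    by (simp add: S2_def vimage_def Int_def conj_commute)
  have sum: "emeasure (N \<omega>) a = (\<Sum>i\<in>{i\<in>{..<n}. a \<in> \<beta> i}. ?X i \<omega>)" if a: "a \<in> F" and \<omega>: "\<omega> \<in> space P" for a \<omega>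
  proof -
    have "a = (\<Union>i\<in>{i\<in>{..<n}. a \<in> \<beta> i}. fam i)"
    proof (intro set_eqI iffI)
      fix e assume e: "e \<in> a"
      then have e': "e \<in> space \<mu> - D" using a F sets.sets_into_space by blast
      have "{a\<in>F. e \<in> a} \<in> \<beta> ` {..<n}" unfolding \<beta>'(1) by auto
      then obtain i where "i < n" "\<beta> i = {a\<in>F. e \<in> a}" by auto
      with e e' a show "e \<in> (\<Union>i\<in>{i\<in>{..<n}. a \<in> \<beta> i}. fam i)"
        by (auto simp: fam_def atom_def intro!: exI[of _ i])
    next
      fix e assume "e \<in> (\<Union>i\<in>{i\<in>{..<n}. a \<in> \<beta> i}. fam i)"
      then show "e \<in> a" by (auto simp: fam_def atom_def)
    qed
    also have "emeasure (N \<omega>) \<dots> = (\<Sum>i\<in>{i\<in>{..<n}. a \<in> \<beta> i}. ?X i \<omega>)"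
      using fam sets_N[OF \<omega>] dis
      by (intro sum_emeasure[symmetric]) (auto simp: disjoint_family_on_def)
    finally show ?thesis .
  qed
  have e1: "(\<lambda>\<omega>. restrict (\<lambda>i. ?X i \<omega>) {..<n}) -` S1 \<inter> space P = {\<omega>\<in>space P. \<forall>a\<in>F. emeasure (N \<omega>) a \<in> B a}"
  proof -
    have "(\<Sum>i\<in>{i\<in>{..<n}. a \<in> \<beta> i}. restrict (\<lambda>i. ?X i \<omega>) {..<n} i) = emeasure (N \<omega>) a" if "a \<in> F" "\<omega> \<in> space P" for a \<omega>
      unfolding sum[OF that] by (intro sum.cong) auto
    then show ?thesis unfolding S1_def by (auto simp: space_PiM)
  qed
  have e2: "(\<lambda>\<omega>. restrict (\<lambda>i. ?X i \<omega>) {n}) -` S2 \<inter> space P = {\<omega>\<in>space P. emeasure (N \<omega>) A \<in> S}"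
    unfolding S2_def by (auto simp: space_PiM fam_def)
  have "(\<lambda>x. (restrict (\<lambda>i. ?X i x) {..<n}, restrict (\<lambda>i. ?X i x) {n})) -` (S1 \<times> S2) \<inter> space P =
    ((\<lambda>\<omega>. restrict (\<lambda>i. ?X i \<omega>) {..<n}) -` S1 \<inter> space P) \<inter> ((\<lambda>\<omega>. restrict (\<lambda>i. ?X i \<omega>) {n}) -` S2 \<inter> space P)"
    by auto
  with indep_varD[OF ind S1 S2] show ?thesis unfolding e1 e2 by simp
qed

lemma count_event:
  "A \<in> sets \<mu> \<Longrightarrow> S \<in> sets borel \<Longrightarrow> {\<omega>\<in>space P. emeasure (N \<omega>) A \<in> S} \<in> events"
  using measurable_sets[OF measurable_count, of A S] by (simp add: vimage_def Int_def conj_commute)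

text \<open>Finite cylinder events generate \<open>outside D\<close> and are stable under
  intersection, so the factorisation of \<open>prob_finite_outside\<close> extends to the whole
  sigma-algebra.\<close>

lemma indep_outside:
  assumes D: "D \<in> sets \<mu>" and E: "E \<in> sets (outside D)" and A: "A \<in> sets \<mu>" "A \<subseteq> D" and S: "S \<in> sets borel"
  shows "prob (E \<inter> {\<omega>\<in>space P. emeasure (N \<omega>) A \<in> S}) = prob E * prob {\<omega>\<in>space P. emeasure (N \<omega>) A \<in> S}"
proof -
  let ?cyl = "\<lambda>F B. {\<omega>\<in>space P. \<forall>a\<in>F. emeasure (N \<omega>) a \<in> B a}"
  define \<E> where "\<E> = {?cyl F B | F B. finite F \<and> F \<subseteq> sets \<mu> \<and> (\<forall>a\<in>F. a \<inter> D = {}) \<and> (\<forall>a. B a \<in> sets (borel :: ennreal measure))}"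
  define \<F> where "\<F> = {{\<omega>\<in>space P. emeasure (N \<omega>) A \<in> S} | S. S \<in> sets (borel :: ennreal measure)}"
  have "indep_set \<E> \<F>"
  proof (rule indep_setI)
    show "\<E> \<subseteq> events"
    proof
      fix E assume "E \<in> \<E>"
      then obtain F B where E: "E = ?cyl F B" "finite F" "F \<subseteq> sets \<mu>" "\<forall>a. B a \<in> sets borel"
        by (auto simp: \<E>_def)
      show "E \<in> events"
        unfolding E(1)
      proof (rule sets.sets_Collect_finite_All[OF _ E(2)])
        show "{\<omega>\<in>space P. emeasure (N \<omega>) a \<in> B a} \<in> events" if "a \<in> F" for a
          using count_event[of a "B a"] E that by auto
      qed
    qed
    show "\<F> \<subseteq> events"
      unfolding \<F>_def using count_event[OF A(1)] by blast
    show "prob (a \<inter> b) = prob a * prob b" if "a \<in> \<E>" "b \<in> \<F>" for a b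
      using that prob_finite_outside[OF D _ _ _ _ A] unfolding \<E>_def \<F>_def by auto
  qed
  moreover have "Int_stable \<E>"
    unfolding Int_stable_def
  proof (intro ballI)
    fix a b assume "a \<in> \<E>" "b \<in> \<E>"
    obtain F B where 1: "a = ?cyl F B \<and> finite F \<and> F \<subseteq> sets \<mu> \<and> (\<forall>a\<in>F. a \<inter> D = {}) \<and> (\<forall>a. B a \<in> sets borel)"
      using \<open>a \<in> \<E>\<close> unfolding \<E>_def by blast
    obtain F' B' where 2: "b = ?cyl F' B' \<and> finite F' \<and> F' \<subseteq> sets \<mu> \<and> (\<forall>a\<in>F'. a \<inter> D = {}) \<and> (\<forall>a. B' a \<in> sets borel)"
      using \<open>b \<in> \<E>\<close> unfolding \<E>_def by blast
    \<comment> \<open>Merges the constraints of both cylinders on the union of their index sets; a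
      set that occurs in one of them only keeps that constraint.\<close>
    define B'' where "B'' c = {x. (c \<in> F \<longrightarrow> x \<in> B c) \<and> (c \<in> F' \<longrightarrow> x \<in> B' c)}" for c
    have "a \<inter> b = ?cyl (F \<union> F') B''" unfolding conjunct1[OF 1] conjunct1[OF 2] B''_def by blast
    moreover have "B'' c = (if c \<in> F then B c else UNIV) \<inter> (if c \<in> F' then B' c else UNIV)" for c
      unfolding B''_def by auto
    then have B'': "B'' c \<in> sets borel" for c using 1 2 by auto
    ultimately have "\<exists>F B. a \<inter> b = ?cyl F B \<and> finite F \<and> F \<subseteq> sets \<mu> \<and> (\<forall>a\<in>F. a \<inter> D = {}) \<and> (\<forall>a. B a \<in> sets borel)"
      using 1 2 by (intro exI[of _ "F \<union> F'"] exI[of _ B'']) (simp add: ball_Un)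
    then show "a \<inter> b \<in> \<E>" unfolding \<E>_def by blast
  qed
  moreover have "Int_stable \<F>"
    unfolding Int_stable_def \<F>_def
  proof (safe, goal_cases)
    case (1 _ _ S S')
    then show ?case by (intro exI[of _ "S \<inter> S'"]) auto
  qed
  ultimately have "indep_set (sigma_sets (space P) \<E>) (sigma_sets (space P) \<F>)"
    by (rule indep_set_sigma_sets)
  moreover have "E \<in> sigma_sets (space P) \<E>"
  proof -
    have "sigma_sets (space P) {(\<lambda>\<omega>. emeasure (N \<omega>) A) -` S \<inter> space P | A S. A \<in> sets \<mu> \<and> A \<inter> D = {} \<and> S \<in> sets borel}
      \<subseteq> sigma_sets (space P) \<E>"
    proof (rule sigma_sets_mono', safe)
      fix A and S :: "ennreal set" assume "A \<in> sets \<mu>" "A \<inter> D = {}" "S \<in> sets borel"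
      then show "(\<lambda>\<omega>. emeasure (N \<omega>) A) -` S \<inter> space P \<in> \<E>"
        unfolding \<E>_def by (intro CollectI exI[of _ "{A}"] exI[of _ "\<lambda>_. S"]) auto
    qed
    with E show ?thesis unfolding sets_outside by blast
  qed
  moreover have "{\<omega>\<in>space P. emeasure (N \<omega>) A \<in> S} \<in> sigma_sets (space P) \<F>"
    using S by (auto simp: \<F>_def)
  ultimately show ?thesis by (rule indep_setD)
qed

text \<open>The finite part of \<open>N\<close> on \<open>D\<close>; it agrees almost surely with the restriction of \<open>N\<close> to \<open>D\<close>.\<close>

definition local_N :: "(real \<times> real \<times> 'g) set \<Rightarrow> 'w \<Rightarrow> (real \<times> real \<times> 'g) measure" where
  "local_N D \<omega> = (if emeasure (N \<omega>) D < \<infinity> then density (N \<omega>) (indicator D) else null_measure (N \<omega>))"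

lemma sets_local_N: "\<omega> \<in> space P \<Longrightarrow> sets (local_N D \<omega>) = sets \<mu>"
  by (simp add: local_N_def sets_N)

lemma emeasure_local_N:
  assumes "\<omega> \<in> space P" "D \<in> sets \<mu>" "A \<in> sets \<mu>"
  shows "emeasure (local_N D \<omega>) A = (if emeasure (N \<omega>) D < \<infinity> then emeasure (N \<omega>) (A \<inter> D) else 0)"
  using assms sets_N[OF assms(1)]
  by (auto simp: local_N_def emeasure_density indicator_inter_arith[symmetric] Int_commute)

lemma finite_local_N:
  assumes "\<omega> \<in> space P" "D \<in> sets \<mu>"
  shows "emeasure (local_N D \<omega>) A < \<infinity>"
proof -
  have "emeasure (local_N D \<omega>) A \<le> emeasure (local_N D \<omega>) (space (local_N D \<omega>))"
    by (rule emeasure_space)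
  also have "space (local_N D \<omega>) = space \<mu>" using sets_local_N[OF assms(1)] by (rule sets_eq_imp_space_eq)
  also have "emeasure (local_N D \<omega>) (space \<mu>) < \<infinity>"
    using sets.sets_into_space[OF assms(2)] by (simp add: emeasure_local_N[OF assms] Int_absorb1)
  finally show ?thesis .
qed

lemma measurable_local_count:
  assumes [measurable]: "D \<in> sets \<mu>" "A \<in> sets \<mu>"
  shows "(\<lambda>\<omega>. emeasure (local_N D \<omega>) A) \<in> borel_measurable P"
proof -
  have "(\<lambda>\<omega>. if emeasure (N \<omega>) D < \<infinity> then emeasure (N \<omega>) (A \<inter> D) else 0) \<in> borel_measurable P" by measurable
  then show ?thesis using emeasure_local_N[OF _ assms] by (simp cong: measurable_cong)
qed

lemma AE_finite_count:
  assumes "D \<in> sets \<mu>" "emeasure \<mu> D < \<infinity>"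
  shows "AE \<omega> in P. emeasure (N \<omega>) D < \<infinity>"
proof -
  have "AE \<omega> in P. emeasure (N \<omega>) D \<noteq> \<infinity>"
    using assms by (intro nn_integral_PInf_AE) (auto simp: mean_count)
  then show ?thesis by (auto simp: less_top)
qed

text \<open>On a rectangle this is the product formula for the independent variables
  \<open>indicator E\<close> and the count of \<open>b \<inter> D\<close>. A Dynkin argument extends
  it to all measurable sets; finiteness of \<open>local_N\<close> for every outcome, and of
  \<open>\<mu>\<close> on \<open>D\<close>, makes the subtraction in the complement step
  legitimate.\<close>

lemma nn_integral_local_cut:
  assumes D: "D \<in> sets \<mu>" "emeasure \<mu> D < \<infinity>" and Z: "Z \<in> measurable (outside D) M'"
    and S: "S \<in> sets (M' \<Otimes>\<^sub>M \<mu>)"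
  shows "(\<lambda>\<omega>. emeasure (local_N D \<omega>) (Pair (Z \<omega>) -` S)) \<in> borel_measurable P \<and>
    (\<lambda>\<omega>. emeasure (density \<mu> (indicator D)) (Pair (Z \<omega>) -` S)) \<in> borel_measurable P \<and>
    (\<integral>\<^sup>+\<omega>. emeasure (local_N D \<omega>) (Pair (Z \<omega>) -` S) \<partial>P) =
    (\<integral>\<^sup>+\<omega>. emeasure (density \<mu> (indicator D)) (Pair (Z \<omega>) -` S) \<partial>P)"
proof -
  let ?N = "\<lambda>\<omega>. local_N D \<omega>" and ?\<mu> = "density \<mu> (indicator D)"
  let ?R = "\<lambda>S. (\<lambda>\<omega>. emeasure (?N \<omega>) (Pair (Z \<omega>) -` S)) \<in> borel_measurable P \<and>
    (\<lambda>\<omega>. emeasure ?\<mu> (Pair (Z \<omega>) -` S)) \<in> borel_measurable P \<and>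
    (\<integral>\<^sup>+\<omega>. emeasure (?N \<omega>) (Pair (Z \<omega>) -` S) \<partial>P) = (\<integral>\<^sup>+\<omega>. emeasure ?\<mu> (Pair (Z \<omega>) -` S) \<partial>P)"
  have ZP: "Z \<in> measurable P M'" by (rule measurable_outside[OF Z])
  have local_AE: "AE \<omega> in P. emeasure (?N \<omega>) b = emeasure (N \<omega>) (b \<inter> D)" if "b \<in> sets \<mu>" for b
    using AE_finite_count[OF D] AE_space by eventually_elim (use D emeasure_local_N[OF _ D(1) that] in simp)
  have mu: "emeasure ?\<mu> A = emeasure \<mu> (A \<inter> D)" if "A \<in> sets \<mu>" for A
    using that D by (simp add: emeasure_density indicator_inter_arith[symmetric] Int_commute)
  have box: "?R (a \<times> b)" if a: "a \<in> sets M'" and b: "b \<in> sets \<mu>" for a b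
  proof -
    define E where "E = Z -` a \<inter> space P"
    have E: "E \<in> sets (outside D)" "E \<in> events"
      using measurable_sets[OF Z a] measurable_sets[OF ZP a] by (auto simp: E_def)
    have bD: "b \<inter> D \<in> sets \<mu>" using b D by auto
    have cut: "Pair (Z \<omega>) -` (a \<times> b) = (if Z \<omega> \<in> a then b else {})" for \<omega> by auto
    have 1: "emeasure (?N \<omega>) (Pair (Z \<omega>) -` (a \<times> b)) = indicator E \<omega> * emeasure (?N \<omega>) b"
      "emeasure ?\<mu> (Pair (Z \<omega>) -` (a \<times> b)) = indicator E \<omega> * emeasure \<mu> (b \<inter> D)" if "\<omega> \<in> space P" for \<omega>
      using that mu[OF b] by (auto simp: cut E_def)
    let ?X = "\<lambda>\<omega>. emeasure (N \<omega>) (b \<inter> D)"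
    have X [measurable]: "?X \<in> borel_measurable P" using bD by measurable
    \<comment> \<open>Independence in terms of laws: restricting to \<open>E\<close> only rescales
      the law of the count. Integrating the identity function gives the product formula for
      means.\<close>
    have "distr (density P (indicator E)) borel ?X = scale_measure (ennreal (prob E)) (distr P borel ?X)"
    proof (rule measure_eqI)
      fix S assume "S \<in> sets (distr (density P (indicator E)) borel ?X)"
      then have S: "S \<in> sets borel" by simp
      have m: "?X -` S \<inter> space P \<in> events" using measurable_sets[OF X S] .
      have "emeasure (distr (density P (indicator E)) borel ?X) S = emeasure P (E \<inter> (?X -` S \<inter> space P))"
        using S E m by (simp add: emeasure_distr emeasure_density indicator_inter_arith[symmetric])
      also have "?X -` S \<inter> space P = {\<omega>\<in>space P. ?X \<omega> \<in> S}" by auto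
      also have "emeasure P (E \<inter> {\<omega>\<in>space P. ?X \<omega> \<in> S}) = ennreal (prob E) * emeasure P {\<omega>\<in>space P. ?X \<omega> \<in> S}"
        using indep_outside[OF D(1) E(1) bD _ S] by (simp add: emeasure_eq_measure ennreal_mult')
      also have "\<dots> = emeasure (scale_measure (ennreal (prob E)) (distr P borel ?X)) S"
      proof -
        have v: "{\<omega>\<in>space P. ?X \<omega> \<in> S} = ?X -` S \<inter> space P" by auto
        show ?thesis unfolding v by (simp only: emeasure_scale_measure emeasure_distr[OF X S])
      qed
      finally show "emeasure (distr (density P (indicator E)) borel ?X) S = emeasure (scale_measure (ennreal (prob E)) (distr P borel ?X)) S" .
    qed simp
    then have "(\<integral>\<^sup>+x. x \<partial>distr (density P (indicator E)) borel ?X) = (\<integral>\<^sup>+x. x \<partial>scale_measure (ennreal (prob E)) (distr P borel ?X))"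
      by (rule arg_cong)
    also have "\<dots> = ennreal (prob E) * (\<integral>\<^sup>+\<omega>. ?X \<omega> \<partial>P)"
      using nn_integral_distr[OF X, of "\<lambda>x. x"] by (simp add: nn_integral_scale_measure)
    also have "(\<integral>\<^sup>+x. x \<partial>distr (density P (indicator E)) borel ?X) = (\<integral>\<^sup>+\<omega>. ?X \<omega> \<partial>density P (indicator E))"
      using X by (intro nn_integral_distr) auto
    also have "\<dots> = (\<integral>\<^sup>+\<omega>. indicator E \<omega> * ?X \<omega> \<partial>P)"
      using E X by (intro nn_integral_density) auto
    finally have prod: "(\<integral>\<^sup>+\<omega>. indicator E \<omega> * ?X \<omega> \<partial>P) = ennreal (prob E) * emeasure \<mu> (b \<inter> D)"
      unfolding mean_count[OF bD] .
    have m1: "(\<lambda>\<omega>. emeasure (?N \<omega>) (Pair (Z \<omega>) -` (a \<times> b))) \<in> borel_measurable P"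
      using 1(1) E measurable_local_count[OF D(1) b] by (simp cong: measurable_cong)
    have m2: "(\<lambda>\<omega>. emeasure ?\<mu> (Pair (Z \<omega>) -` (a \<times> b))) \<in> borel_measurable P"
      using 1(2) E by (simp cong: measurable_cong)
    have "(\<integral>\<^sup>+\<omega>. emeasure (?N \<omega>) (Pair (Z \<omega>) -` (a \<times> b)) \<partial>P) = (\<integral>\<^sup>+\<omega>. indicator E \<omega> * emeasure (?N \<omega>) b \<partial>P)"
      by (intro nn_integral_cong 1)
    also have "\<dots> = (\<integral>\<^sup>+\<omega>. indicator E \<omega> * ?X \<omega> \<partial>P)"
      using local_AE[OF b] by (intro nn_integral_cong_AE) auto
    also have "\<dots> = (\<integral>\<^sup>+\<omega>. indicator E \<omega> * emeasure \<mu> (b \<inter> D) \<partial>P)"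
      unfolding prod using E by (simp add: nn_integral_multc emeasure_eq_measure)
    also have "\<dots> = (\<integral>\<^sup>+\<omega>. emeasure ?\<mu> (Pair (Z \<omega>) -` (a \<times> b)) \<partial>P)"
      by (intro nn_integral_cong 1(2)[symmetric])
    finally show ?thesis using m1 m2 by simp
  qed
  have mu_finite: "emeasure ?\<mu> A < \<infinity>" for A
  proof -
    have "emeasure ?\<mu> A \<le> emeasure ?\<mu> (space \<mu>)" using emeasure_space[of ?\<mu> A] by simp
    also have "\<dots> < \<infinity>"
      using D sets.sets_into_space[OF D(1)] by (simp add: mu Int_absorb1)
    finally show ?thesis .
  qed
  have cut: "Pair x -` S \<in> sets \<mu>" if "S \<in> sets (M' \<Otimes>\<^sub>M \<mu>)" for x S using that by (rule sets_Pair1)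
  show ?thesis
    using Int_stable_pair_measure_generator[of M' \<mu>] pair_measure_closed[of M' \<mu>] S
    unfolding sets_pair_measure
  proof (induct rule: sigma_sets_induct_disjoint)
    case (basic S)
    then show ?case using box by blast
  next
    case empty
    show ?case by simp
  next
    case (compl S)
    then have S: "S \<in> sets (M' \<Otimes>\<^sub>M \<mu>)" by (simp add: sets_pair_measure)
    note R = compl(2)
    have top: "?R (space M' \<times> space \<mu>)" by (rule box) auto
    let ?\<Omega> = "space M' \<times> space \<mu>"
    have sub: "Pair (Z \<omega>) -` S \<subseteq> Pair (Z \<omega>) -` ?\<Omega>" for \<omega>
      using sets.sets_into_space[OF S] by (auto simp: space_pair_measure)
    have \<Omega>: "Pair (Z \<omega>) -` ?\<Omega> \<in> sets \<mu>" for \<omega> by (rule cut) auto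
    have d1: "emeasure (?N \<omega>) (Pair (Z \<omega>) -` (?\<Omega> - S)) = emeasure (?N \<omega>) (Pair (Z \<omega>) -` ?\<Omega>) - emeasure (?N \<omega>) (Pair (Z \<omega>) -` S)"
      if "\<omega> \<in> space P" for \<omega>
      unfolding vimage_Diff using sub[of \<omega>] finite_local_N[OF that D(1), of "Pair (Z \<omega>) -` S"] cut[OF S] \<Omega>
      by (intro emeasure_Diff) (auto simp: sets_local_N[OF that] less_top)
    have d2: "emeasure ?\<mu> (Pair (Z \<omega>) -` (?\<Omega> - S)) = emeasure ?\<mu> (Pair (Z \<omega>) -` ?\<Omega>) - emeasure ?\<mu> (Pair (Z \<omega>) -` S)" for \<omega>
      unfolding vimage_Diff using sub[of \<omega>] mu_finite[of "Pair (Z \<omega>) -` S"] cut[OF S] \<Omega>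
      by (intro emeasure_Diff) (auto simp: less_top)
    have le: "emeasure ?\<mu> (Pair (Z \<omega>) -` S) \<le> emeasure ?\<mu> (space \<mu>)" for \<omega>
      using emeasure_space[of ?\<mu> "Pair (Z \<omega>) -` S"] by simp
    have fin: "(\<integral>\<^sup>+\<omega>. emeasure ?\<mu> (Pair (Z \<omega>) -` S) \<partial>P) \<noteq> \<infinity>"
    proof -
      have "(\<integral>\<^sup>+\<omega>. emeasure ?\<mu> (Pair (Z \<omega>) -` S) \<partial>P) \<le> (\<integral>\<^sup>+\<omega>. emeasure ?\<mu> (space \<mu>) \<partial>P)"
        by (intro nn_integral_mono le)
      also have "\<dots> < \<infinity>" using mu_finite[of "space \<mu>"] by (simp add: emeasure_space_1)
      finally show ?thesis by simp
    qed
    have "(\<integral>\<^sup>+\<omega>. emeasure (?N \<omega>) (Pair (Z \<omega>) -` (?\<Omega> - S)) \<partial>P) =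
        (\<integral>\<^sup>+\<omega>. emeasure (?N \<omega>) (Pair (Z \<omega>) -` ?\<Omega>) - emeasure (?N \<omega>) (Pair (Z \<omega>) -` S) \<partial>P)"
      by (intro nn_integral_cong d1)
    also have "\<dots> = (\<integral>\<^sup>+\<omega>. emeasure (?N \<omega>) (Pair (Z \<omega>) -` ?\<Omega>) \<partial>P) - (\<integral>\<^sup>+\<omega>. emeasure (?N \<omega>) (Pair (Z \<omega>) -` S) \<partial>P)"
      using top R fin sub \<Omega> by (intro nn_integral_diff AE_I2 emeasure_mono) (auto simp: sets_local_N)
    also have "\<dots> = (\<integral>\<^sup>+\<omega>. emeasure ?\<mu> (Pair (Z \<omega>) -` ?\<Omega>) \<partial>P) - (\<integral>\<^sup>+\<omega>. emeasure ?\<mu> (Pair (Z \<omega>) -` S) \<partial>P)"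
      using top R by simp
    also have "\<dots> = (\<integral>\<^sup>+\<omega>. emeasure ?\<mu> (Pair (Z \<omega>) -` ?\<Omega>) - emeasure ?\<mu> (Pair (Z \<omega>) -` S) \<partial>P)"
      using top R fin sub \<Omega> by (intro nn_integral_diff[symmetric] AE_I2 emeasure_mono) auto
    also have "\<dots> = (\<integral>\<^sup>+\<omega>. emeasure ?\<mu> (Pair (Z \<omega>) -` (?\<Omega> - S)) \<partial>P)"
      by (intro nn_integral_cong d2[symmetric])
    finally have "(\<integral>\<^sup>+\<omega>. emeasure (?N \<omega>) (Pair (Z \<omega>) -` (?\<Omega> - S)) \<partial>P) = (\<integral>\<^sup>+\<omega>. emeasure ?\<mu> (Pair (Z \<omega>) -` (?\<Omega> - S)) \<partial>P)" .
    moreover have "(\<lambda>\<omega>. emeasure (?N \<omega>) (Pair (Z \<omega>) -` (?\<Omega> - S))) \<in> borel_measurable P"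
      by (subst measurable_cong[OF d1], assumption, rule borel_measurable_minus_ennreal)
        (use top R in blast)+
    moreover have "(\<lambda>\<omega>. emeasure ?\<mu> (Pair (Z \<omega>) -` (?\<Omega> - S))) \<in> borel_measurable P"
      unfolding d2 by (rule borel_measurable_minus_ennreal) (use top R in blast)+
    ultimately show ?case by blast
  next
    case (union A)
    then have A: "A i \<in> sets (M' \<Otimes>\<^sub>M \<mu>)" for i by (auto simp: sets_pair_measure)
    have dis: "disjoint_family (\<lambda>i. Pair x -` A i)" for x
      using union(1) by (auto simp: disjoint_family_on_def)
    have s1: "emeasure (?N \<omega>) (Pair (Z \<omega>) -` (\<Union>i. A i)) = (\<Sum>i. emeasure (?N \<omega>) (Pair (Z \<omega>) -` A i))" if "\<omega> \<in> space P" for \<omega>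
      unfolding vimage_UN
      using cut[OF A] dis by (intro suminf_emeasure[symmetric]) (auto simp: sets_local_N[OF that])
    have s2: "emeasure ?\<mu> (Pair (Z \<omega>) -` (\<Union>i. A i)) = (\<Sum>i. emeasure ?\<mu> (Pair (Z \<omega>) -` A i))" for \<omega>
      unfolding vimage_UN using cut[OF A] dis by (intro suminf_emeasure[symmetric]) auto
    have "(\<integral>\<^sup>+\<omega>. emeasure (?N \<omega>) (Pair (Z \<omega>) -` (\<Union>i. A i)) \<partial>P) = (\<integral>\<^sup>+\<omega>. (\<Sum>i. emeasure (?N \<omega>) (Pair (Z \<omega>) -` A i)) \<partial>P)"
      by (intro nn_integral_cong s1)
    also have "\<dots> = (\<Sum>i. \<integral>\<^sup>+\<omega>. emeasure (?N \<omega>) (Pair (Z \<omega>) -` A i) \<partial>P)"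
      using union by (intro nn_integral_suminf) auto
    also have "\<dots> = (\<Sum>i. \<integral>\<^sup>+\<omega>. emeasure ?\<mu> (Pair (Z \<omega>) -` A i) \<partial>P)"
      using union by auto
    also have "\<dots> = (\<integral>\<^sup>+\<omega>. (\<Sum>i. emeasure ?\<mu> (Pair (Z \<omega>) -` A i)) \<partial>P)"
      using union by (intro nn_integral_suminf[symmetric]) auto
    also have "\<dots> = (\<integral>\<^sup>+\<omega>. emeasure ?\<mu> (Pair (Z \<omega>) -` (\<Union>i. A i)) \<partial>P)"
      by (intro nn_integral_cong s2[symmetric])
    finally have "(\<integral>\<^sup>+\<omega>. emeasure (?N \<omega>) (Pair (Z \<omega>) -` (\<Union>i. A i)) \<partial>P) = (\<integral>\<^sup>+\<omega>. emeasure ?\<mu> (Pair (Z \<omega>) -` (\<Union>i. A i)) \<partial>P)" .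
    moreover have "(\<lambda>\<omega>. emeasure (?N \<omega>) (Pair (Z \<omega>) -` (\<Union>i. A i))) \<in> borel_measurable P"
      by (subst measurable_cong[OF s1], assumption, rule borel_measurable_suminf_order) (use union in blast)
    moreover have "(\<lambda>\<omega>. emeasure ?\<mu> (Pair (Z \<omega>) -` (\<Union>i. A i))) \<in> borel_measurable P"
      unfolding s2 by (rule borel_measurable_suminf_order) (use union in blast)
    ultimately show ?case by blast
  qed
qed

text \<open>The compensation formula with a frozen argument: \<open>Z\<close> depends on
  \<open>N\<close> off \<open>D\<close> only, so in the mean the points in \<open>D\<close> may be
  replaced by their intensity while \<open>Z\<close> is kept.\<close>

lemma nn_integral_local:
  assumes D: "D \<in> sets \<mu>" "emeasure \<mu> D < \<infinity>" and Z: "Z \<in> measurable (outside D) M'"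
    and g: "g \<in> borel_measurable (M' \<Otimes>\<^sub>M \<mu>)"
  shows "(\<lambda>\<omega>. \<integral>\<^sup>+e. g (Z \<omega>, e) \<partial>local_N D \<omega>) \<in> borel_measurable P \<and>
    (\<lambda>\<omega>. \<integral>\<^sup>+e. g (Z \<omega>, e) \<partial>density \<mu> (indicator D)) \<in> borel_measurable P \<and>
    (\<integral>\<^sup>+\<omega>. (\<integral>\<^sup>+e. g (Z \<omega>, e) \<partial>local_N D \<omega>) \<partial>P) =
    (\<integral>\<^sup>+\<omega>. (\<integral>\<^sup>+e. g (Z \<omega>, e) \<partial>density \<mu> (indicator D)) \<partial>P)"
proof -
  let ?\<mu> = "density \<mu> (indicator D)"
  have ZM: "Z \<omega> \<in> space M'" if "\<omega> \<in> space P" for \<omega>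
    using measurable_space[OF Z] that by simp
  have sec: "(\<lambda>e. g (x, e)) \<in> borel_measurable (local_N D \<omega>)" "(\<lambda>e. g (x, e)) \<in> borel_measurable ?\<mu>"
    if "g \<in> borel_measurable (M' \<Otimes>\<^sub>M \<mu>)" "\<omega> \<in> space P" "x \<in> space M'" for g :: "_ \<Rightarrow> ennreal" and x \<omega>
    using measurable_compose[OF measurable_Pair1'[OF that(3)] that(1)]
    by (simp_all add: measurable_cong_sets[OF sets_local_N[OF that(2)] refl])
  have spN: "space (local_N D \<omega>) = space \<mu>" if "\<omega> \<in> space P" for \<omega>
    using sets_local_N[OF that] by (rule sets_eq_imp_space_eq)
  show ?thesis
    using g
  proof (induction rule: borel_measurable_induct)
    case (cong f g)
    have 1: "(\<integral>\<^sup>+e. f (Z \<omega>, e) \<partial>local_N D \<omega>) = (\<integral>\<^sup>+e. g (Z \<omega>, e) \<partial>local_N D \<omega>)"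
      "(\<integral>\<^sup>+e. f (Z \<omega>, e) \<partial>?\<mu>) = (\<integral>\<^sup>+e. g (Z \<omega>, e) \<partial>?\<mu>)" if "\<omega> \<in> space P" for \<omega>
      using cong(3) ZM[OF that] spN[OF that] by (auto intro!: nn_integral_cong simp: space_pair_measure)
    show ?case
      using cong(4) by (simp only: 1 cong: measurable_cong nn_integral_cong)
  next
    case (set S)
    have 1: "(\<integral>\<^sup>+e. indicator S (Z \<omega>, e) \<partial>local_N D \<omega>) = emeasure (local_N D \<omega>) (Pair (Z \<omega>) -` S)"
      "(\<integral>\<^sup>+e. indicator S (Z \<omega>, e) \<partial>?\<mu>) = emeasure ?\<mu> (Pair (Z \<omega>) -` S)" if "\<omega> \<in> space P" for \<omega>
    proof -
      have "indicator S (Z \<omega>, e) = (indicator (Pair (Z \<omega>) -` S) e :: ennreal)" for e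
        by (simp add: indicator_def)
      then show "(\<integral>\<^sup>+e. indicator S (Z \<omega>, e) \<partial>local_N D \<omega>) = emeasure (local_N D \<omega>) (Pair (Z \<omega>) -` S)"
        "(\<integral>\<^sup>+e. indicator S (Z \<omega>, e) \<partial>?\<mu>) = emeasure ?\<mu> (Pair (Z \<omega>) -` S)"
        using sets_Pair1[OF set] sets_local_N[OF that] by (simp_all add: nn_integral_indicator)
    qed
    show ?case
      using nn_integral_local_cut[OF D Z set] by (simp only: 1 cong: measurable_cong nn_integral_cong)
  next
    case (mult u c)
    have 1: "(\<integral>\<^sup>+e. c * u (Z \<omega>, e) \<partial>local_N D \<omega>) = c * (\<integral>\<^sup>+e. u (Z \<omega>, e) \<partial>local_N D \<omega>)"
      "(\<integral>\<^sup>+e. c * u (Z \<omega>, e) \<partial>?\<mu>) = c * (\<integral>\<^sup>+e. u (Z \<omega>, e) \<partial>?\<mu>)" if "\<omega> \<in> space P" for \<omega>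
      using sec[OF mult(2) that ZM[OF that]] by (simp_all only: nn_integral_cmult)
    show ?case
    proof -
      from mult have IH: "(\<lambda>\<omega>. \<integral>\<^sup>+e. u (Z \<omega>, e) \<partial>local_N D \<omega>) \<in> borel_measurable P" "(\<lambda>\<omega>. \<integral>\<^sup>+e. u (Z \<omega>, e) \<partial>?\<mu>) \<in> borel_measurable P"
        "(\<integral>\<^sup>+\<omega>. (\<integral>\<^sup>+e. u (Z \<omega>, e) \<partial>local_N D \<omega>) \<partial>P) = (\<integral>\<^sup>+\<omega>. (\<integral>\<^sup>+e. u (Z \<omega>, e) \<partial>?\<mu>) \<partial>P)" by blast+
      note [measurable] = IH(1,2)
      have "(\<lambda>\<omega>. c * (\<integral>\<^sup>+e. u (Z \<omega>, e) \<partial>local_N D \<omega>)) \<in> borel_measurable P" "(\<lambda>\<omega>. c * (\<integral>\<^sup>+e. u (Z \<omega>, e) \<partial>?\<mu>)) \<in> borel_measurable P"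
        by measurable
      then show ?thesis using IH(3)
        by (simp only: 1 nn_integral_cmult[OF IH(1)] nn_integral_cmult[OF IH(2)] cong: measurable_cong nn_integral_cong)
    qed
  next
    case (add u v)
    have 1: "(\<integral>\<^sup>+e. v (Z \<omega>, e) + u (Z \<omega>, e) \<partial>local_N D \<omega>) = (\<integral>\<^sup>+e. v (Z \<omega>, e) \<partial>local_N D \<omega>) + (\<integral>\<^sup>+e. u (Z \<omega>, e) \<partial>local_N D \<omega>)"
      "(\<integral>\<^sup>+e. v (Z \<omega>, e) + u (Z \<omega>, e) \<partial>?\<mu>) = (\<integral>\<^sup>+e. v (Z \<omega>, e) \<partial>?\<mu>) + (\<integral>\<^sup>+e. u (Z \<omega>, e) \<partial>?\<mu>)" if "\<omega> \<in> space P" for \<omega>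
      using sec[OF add(1) that ZM[OF that]] sec[OF add(3) that ZM[OF that]]
      by (simp_all only: nn_integral_add)
    show ?case
    proof -
      let ?F = "\<lambda>u \<omega>. \<integral>\<^sup>+e. u (Z \<omega>, e) \<partial>local_N D \<omega>" and ?G = "\<lambda>u \<omega>. \<integral>\<^sup>+e. u (Z \<omega>, e) \<partial>?\<mu>"
      from add have IH: "?F u \<in> borel_measurable P" "?G u \<in> borel_measurable P" "?F v \<in> borel_measurable P" "?G v \<in> borel_measurable P"
        "(\<integral>\<^sup>+\<omega>. ?F u \<omega> \<partial>P) = (\<integral>\<^sup>+\<omega>. ?G u \<omega> \<partial>P)" "(\<integral>\<^sup>+\<omega>. ?F v \<omega> \<partial>P) = (\<integral>\<^sup>+\<omega>. ?G v \<omega> \<partial>P)" by blast+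
      note [measurable] = IH(1-4)
      have "(\<lambda>\<omega>. ?F v \<omega> + ?F u \<omega>) \<in> borel_measurable P" "(\<lambda>\<omega>. ?G v \<omega> + ?G u \<omega>) \<in> borel_measurable P"
        by measurable
      then show ?thesis using IH(5,6)
        by (simp only: 1 nn_integral_add[OF IH(3,1)] nn_integral_add[OF IH(4,2)] cong: measurable_cong nn_integral_cong)
    qed
  next
    case (seq U)
    have inc: "incseq (\<lambda>i e. U i (x, e))" for x
      using seq by (auto simp: incseq_def le_fun_def)
    have 1: "(\<integral>\<^sup>+e. (SUP i. U i) (Z \<omega>, e) \<partial>local_N D \<omega>) = (SUP i. \<integral>\<^sup>+e. U i (Z \<omega>, e) \<partial>local_N D \<omega>)"
      "(\<integral>\<^sup>+e. (SUP i. U i) (Z \<omega>, e) \<partial>?\<mu>) = (SUP i. \<integral>\<^sup>+e. U i (Z \<omega>, e) \<partial>?\<mu>)" if "\<omega> \<in> space P" for \<omega>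
      using sec[OF seq(1) that ZM[OF that]] inc[of "Z \<omega>"]
      by (simp_all add: image_comp nn_integral_monotone_convergence_SUP)
    have inc2: "incseq (\<lambda>i \<omega>. \<integral>\<^sup>+e. U i (Z \<omega>, e) \<partial>local_N D \<omega>)" "incseq (\<lambda>i \<omega>. \<integral>\<^sup>+e. U i (Z \<omega>, e) \<partial>?\<mu>)"
      using inc by (auto simp: incseq_def le_fun_def intro!: nn_integral_mono)
    have m: "(\<lambda>\<omega>. SUP i. \<integral>\<^sup>+e. U i (Z \<omega>, e) \<partial>local_N D \<omega>) \<in> borel_measurable P"
      "(\<lambda>\<omega>. SUP i. \<integral>\<^sup>+e. U i (Z \<omega>, e) \<partial>?\<mu>) \<in> borel_measurable P"
      using seq by (intro borel_measurable_SUP; simp)+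
    have "(\<integral>\<^sup>+\<omega>. (SUP i. \<integral>\<^sup>+e. U i (Z \<omega>, e) \<partial>local_N D \<omega>) \<partial>P) = (\<integral>\<^sup>+\<omega>. (SUP i. \<integral>\<^sup>+e. U i (Z \<omega>, e) \<partial>?\<mu>) \<partial>P)"
      using seq inc2 by (subst (1 2) nn_integral_monotone_convergence_SUP) auto
    with m show ?case
      by (simp only: 1 cong: measurable_cong nn_integral_cong)
  qed
qed

lemma integral_local:
  fixes g :: "_ \<Rightarrow> real"
  assumes D: "D \<in> sets \<mu>" "emeasure \<mu> D < \<infinity>" and Z: "Z \<in> measurable (outside D) M'"
    and g: "g \<in> borel_measurable (M' \<Otimes>\<^sub>M \<mu>)" "\<And>w. \<bar>g w\<bar> \<le> K"
  shows "integrable P (\<lambda>\<omega>. \<integral>e. g (Z \<omega>, e) \<partial>local_N D \<omega>)"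
    and "(\<integral>\<omega>. (\<integral>e. g (Z \<omega>, e) \<partial>local_N D \<omega>) \<partial>P) = (\<integral>\<omega>. (\<integral>e. g (Z \<omega>, e) \<partial>density \<mu> (indicator D)) \<partial>P)"
    and "integrable P (\<lambda>\<omega>. \<integral>e. g (Z \<omega>, e) \<partial>density \<mu> (indicator D))"
proof -
  let ?\<mu> = "density \<mu> (indicator D)"
  have K: "0 \<le> K" using g(2)[of undefined] by linarith
  have ZM: "Z \<omega> \<in> space M'" if "\<omega> \<in> space P" for \<omega>
    using measurable_space[OF Z] that by simp
  have fin\<mu>: "finite_measure ?\<mu>"
  proof (rule finite_measureI)
    have "emeasure ?\<mu> (space ?\<mu>) = emeasure \<mu> D"
      using D sets.sets_into_space[OF D(1)]
      by (simp add: emeasure_density indicator_inter_arith[symmetric] Int_absorb1)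
    then show "emeasure ?\<mu> (space ?\<mu>) \<noteq> \<infinity>" using D(2) by simp
  qed
  have finN: "finite_measure (local_N D \<omega>)" if "\<omega> \<in> space P" for \<omega>
    using finite_local_N[OF that D(1), of "space (local_N D \<omega>)"] by (intro finite_measureI) simp
  have int: "integrable (local_N D \<omega>) (\<lambda>e. f (Z \<omega>, e))" "integrable ?\<mu> (\<lambda>e. f (Z \<omega>, e))"
    if f: "f \<in> borel_measurable (M' \<Otimes>\<^sub>M \<mu>)" "\<And>w. \<bar>f w\<bar> \<le> L" and \<omega>: "\<omega> \<in> space P" for f :: "_ \<Rightarrow> real" and L \<omega>
    using measurable_compose[OF measurable_Pair1'[OF ZM[OF \<omega>]] f(1)] f(2)
    by (auto intro!: finite_measure.integrable_const_bound[OF finN[OF \<omega>], of _ L] finite_measure.integrable_const_bound[OF fin\<mu>, of _ L]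
        simp: measurable_cong_sets[OF sets_local_N[OF \<omega>] refl])
  have nonneg: "integrable P (\<lambda>\<omega>. \<integral>e. f (Z \<omega>, e) \<partial>local_N D \<omega>) \<and>
     integrable P (\<lambda>\<omega>. \<integral>e. f (Z \<omega>, e) \<partial>?\<mu>) \<and>
    (\<integral>\<omega>. (\<integral>e. f (Z \<omega>, e) \<partial>local_N D \<omega>) \<partial>P) = (\<integral>\<omega>. (\<integral>e. f (Z \<omega>, e) \<partial>?\<mu>) \<partial>P)"
    if f: "f \<in> borel_measurable (M' \<Otimes>\<^sub>M \<mu>)" "\<And>w. 0 \<le> f w" "\<And>w. f w \<le> L" for f :: "_ \<Rightarrow> real" and L
  proof -
    have L: "\<bar>f w\<bar> \<le> L" for w using f(2,3) by simp
    let ?F = "\<lambda>\<omega>. \<integral>e. f (Z \<omega>, e) \<partial>local_N D \<omega>" and ?G = "\<lambda>\<omega>. \<integral>e. f (Z \<omega>, e) \<partial>?\<mu>"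
    have 1: "(\<integral>\<^sup>+e. ennreal (f (Z \<omega>, e)) \<partial>local_N D \<omega>) = ennreal (?F \<omega>)"
      "(\<integral>\<^sup>+e. ennreal (f (Z \<omega>, e)) \<partial>?\<mu>) = ennreal (?G \<omega>)" if "\<omega> \<in> space P" for \<omega>
      using int[OF f(1) L that] f(2) by (auto intro!: nn_integral_eq_integral)
    have fm: "(\<lambda>w. ennreal (f w)) \<in> borel_measurable (M' \<Otimes>\<^sub>M \<mu>)" using f(1) by simp
    have nn: "0 \<le> ?F \<omega>" "0 \<le> ?G \<omega>" for \<omega> using f(2) by auto
    have F: "(\<lambda>\<omega>. ennreal (?F \<omega>)) \<in> borel_measurable P" and G: "(\<lambda>\<omega>. ennreal (?G \<omega>)) \<in> borel_measurable P"
      and FG: "(\<integral>\<^sup>+\<omega>. ennreal (?F \<omega>) \<partial>P) = (\<integral>\<^sup>+\<omega>. ennreal (?G \<omega>) \<partial>P)"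
      using nn_integral_local[OF D Z fm] by (simp_all only: 1 cong: measurable_cong nn_integral_cong)
    have F': "?F \<in> borel_measurable P" and G': "?G \<in> borel_measurable P"
      using borel_measurable_enn2real[OF F] borel_measurable_enn2real[OF G] nn by simp_all
    have Gb: "?G \<omega> \<le> L * measure ?\<mu> (space ?\<mu>)" if "\<omega> \<in> space P" for \<omega>
    proof -
      have "?G \<omega> \<le> (\<integral>e. L \<partial>?\<mu>)"
        using int(2)[OF f(1) L that] f(3) finite_measure.integrable_const[OF fin\<mu>]
        by (intro integral_mono) auto
      then show ?thesis by (simp add: mult.commute)
    qed
    have Gi: "integrable P ?G"
      using Gb nn G' by (intro integrable_const_bound[of _ "L * measure ?\<mu> (space ?\<mu>)"] AE_I2) auto
    then have "(\<integral>\<^sup>+\<omega>. ennreal (?G \<omega>) \<partial>P) = ennreal (\<integral>\<omega>. ?G \<omega> \<partial>P)"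
      using nn by (intro nn_integral_eq_integral) auto
    with FG have *: "(\<integral>\<^sup>+\<omega>. ennreal (?F \<omega>) \<partial>P) = ennreal (\<integral>\<omega>. ?G \<omega> \<partial>P)" by simp
    then have Fi: "integrable P ?F"
      using F' nn by (intro integrableI_bounded) auto
    then have "(\<integral>\<^sup>+\<omega>. ennreal (?F \<omega>) \<partial>P) = ennreal (\<integral>\<omega>. ?F \<omega> \<partial>P)"
      using nn by (intro nn_integral_eq_integral) auto
    with * have "(\<integral>\<omega>. ?F \<omega> \<partial>P) = (\<integral>\<omega>. ?G \<omega> \<partial>P)"
      using nn by (simp add: ennreal_inj Bochner_Integration.integral_nonneg)
    with Fi Gi show ?thesis by blast
  qed
  \<comment> \<open>Shifting by \<open>K\<close> produces a nonnegative function; the constant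
    \<open>K\<close> is itself an instance of the nonnegative case and is then subtracted.\<close>
  let ?f = "\<lambda>w. g w + K" and ?c = "\<lambda>w. K"
  have 2: "0 \<le> ?f w" "?f w \<le> 2 * K" for w using g(2)[of w] by auto
  note f = nonneg[OF borel_measurable_add[OF g(1) borel_measurable_const] 2]
  have c: "integrable P (\<lambda>\<omega>. \<integral>e. ?c (Z \<omega>, e) \<partial>local_N D \<omega>) \<and> integrable P (\<lambda>\<omega>. \<integral>e. ?c (Z \<omega>, e) \<partial>?\<mu>) \<and>
    (\<integral>\<omega>. (\<integral>e. ?c (Z \<omega>, e) \<partial>local_N D \<omega>) \<partial>P) = (\<integral>\<omega>. (\<integral>e. ?c (Z \<omega>, e) \<partial>?\<mu>) \<partial>P)"
    by (rule nonneg) (use K in auto)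
  have s: "(\<integral>e. g (Z \<omega>, e) \<partial>local_N D \<omega>) = (\<integral>e. ?f (Z \<omega>, e) \<partial>local_N D \<omega>) - (\<integral>e. ?c (Z \<omega>, e) \<partial>local_N D \<omega>)"
    "(\<integral>e. g (Z \<omega>, e) \<partial>?\<mu>) = (\<integral>e. ?f (Z \<omega>, e) \<partial>?\<mu>) - (\<integral>e. ?c (Z \<omega>, e) \<partial>?\<mu>)" if "\<omega> \<in> space P" for \<omega>
    using Bochner_Integration.integral_add[OF int(1)[OF g that] finite_measure.integrable_const[OF finN[OF that], of K]]
      Bochner_Integration.integral_add[OF int(2)[OF g that] finite_measure.integrable_const[OF fin\<mu>, of K]]
    by linarith+
  show "integrable P (\<lambda>\<omega>. \<integral>e. g (Z \<omega>, e) \<partial>local_N D \<omega>)"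
    by (subst Bochner_Integration.integrable_cong[OF refl s(1)], assumption, rule Bochner_Integration.integrable_diff) (use f c in blast)+
  show "integrable P (\<lambda>\<omega>. \<integral>e. g (Z \<omega>, e) \<partial>?\<mu>)"
    by (subst Bochner_Integration.integrable_cong[OF refl s(2)], assumption, rule Bochner_Integration.integrable_diff) (use f c in blast)+
  have "(\<integral>\<omega>. (\<integral>e. g (Z \<omega>, e) \<partial>local_N D \<omega>) \<partial>P) = (\<integral>\<omega>. (\<integral>e. ?f (Z \<omega>, e) \<partial>local_N D \<omega>) - (\<integral>e. ?c (Z \<omega>, e) \<partial>local_N D \<omega>) \<partial>P)"
    by (intro Bochner_Integration.integral_cong refl s(1))
  also have "\<dots> = (\<integral>\<omega>. (\<integral>e. ?f (Z \<omega>, e) \<partial>local_N D \<omega>) \<partial>P) - (\<integral>\<omega>. (\<integral>e. ?c (Z \<omega>, e) \<partial>local_N D \<omega>) \<partial>P)"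
    by (rule Bochner_Integration.integral_diff) (use f c in blast)+
  also have "\<dots> = (\<integral>\<omega>. (\<integral>e. ?f (Z \<omega>, e) \<partial>?\<mu>) \<partial>P) - (\<integral>\<omega>. (\<integral>e. ?c (Z \<omega>, e) \<partial>?\<mu>) \<partial>P)"
    using f c by presburger
  also have "\<dots> = (\<integral>\<omega>. (\<integral>e. ?f (Z \<omega>, e) \<partial>?\<mu>) - (\<integral>e. ?c (Z \<omega>, e) \<partial>?\<mu>) \<partial>P)"
    by (rule Bochner_Integration.integral_diff[symmetric]) (use f c in blast)+
  also have "\<dots> = (\<integral>\<omega>. (\<integral>e. g (Z \<omega>, e) \<partial>?\<mu>) \<partial>P)"
    by (intro Bochner_Integration.integral_cong refl s(2)[symmetric])
  finally show "(\<integral>\<omega>. (\<integral>e. g (Z \<omega>, e) \<partial>local_N D \<omega>) \<partial>P) = (\<integral>\<omega>. (\<integral>e. g (Z \<omega>, e) \<partial>?\<mu>) \<partial>P)" .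
qed

end

section \<open>Paths of the jump equation\<close>

lemma cadlag_left_lim:
  assumes "cadlag \<xi>" "0 < t"
  shows "(\<xi> \<longlongrightarrow> left_lim \<xi> t) (at_left t)"
  using assms unfolding cadlag_def left_lim_def by (metis tendsto_Lim trivial_limit_at_left_real)

lemma measurable_grid:
  fixes \<xi> :: "real \<Rightarrow> real" and k :: "real \<Rightarrow> int"
  assumes "k \<in> measurable borel (count_space UNIV)"
  shows "(\<lambda>s. \<xi> (real_of_int (k s) / c)) \<in> borel_measurable borel"
  by (rule measurable_compose[OF assms]) simp

text \<open>Sampling on the grid of mesh \<open>1 / Suc n\<close>: the floor plus one gives a grid
  point strictly to the right of \<open>s\<close>, the ceiling minus one a grid point strictly to
  the left. Strictness makes the one-sided limits applicable even if \<open>s\<close> is a grid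
  point.\<close>

lemma cadlag_measurable:
  assumes \<xi>: "cadlag \<xi>"
  shows "(\<lambda>s. if 0 \<le> s then \<xi> s else 0) \<in> borel_measurable borel"
    and "(\<lambda>s. if 0 < s then left_lim \<xi> s else 0) \<in> borel_measurable borel"
proof -
  have up: "filterlim (\<lambda>n. real_of_int (\<lfloor>real (Suc n) * s\<rfloor> + 1) / real (Suc n)) (at_right s) sequentially" for s :: real
  proof -
    have "(\<lambda>n. real_of_int (\<lfloor>real (Suc n) * s\<rfloor> + 1) / real (Suc n)) \<longlonglongrightarrow> s"
    proof (rule tendsto_sandwich)
      show "(\<lambda>n. s) \<longlonglongrightarrow> s" "(\<lambda>n. s + inverse (real (Suc n))) \<longlonglongrightarrow> s"
        using LIMSEQ_inverse_real_of_nat_add[of s] by simp_all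
      show "\<forall>\<^sub>F n in sequentially. s \<le> real_of_int (\<lfloor>real (Suc n) * s\<rfloor> + 1) / real (Suc n)"
      proof (intro always_eventually allI)
        fix n
        have "real (Suc n) * s \<le> real_of_int (\<lfloor>real (Suc n) * s\<rfloor> + 1)" by linarith
        then show "s \<le> real_of_int (\<lfloor>real (Suc n) * s\<rfloor> + 1) / real (Suc n)"
          by (simp add: pos_le_divide_eq mult.commute del: of_nat_Suc of_int_add)
      qed
      show "\<forall>\<^sub>F n in sequentially. real_of_int (\<lfloor>real (Suc n) * s\<rfloor> + 1) / real (Suc n) \<le> s + inverse (real (Suc n))"
      proof (intro always_eventually allI)
        fix n
        have "real_of_int (\<lfloor>real (Suc n) * s\<rfloor> + 1) \<le> real (Suc n) * s + 1" by linarith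
        also have "\<dots> = (s + inverse (real (Suc n))) * real (Suc n)" by (simp add: field_simps del: of_nat_Suc)
        finally show "real_of_int (\<lfloor>real (Suc n) * s\<rfloor> + 1) / real (Suc n) \<le> s + inverse (real (Suc n))"
          by (simp add: pos_divide_le_eq del: of_nat_Suc of_int_add)
      qed
    qed
    moreover have gt: "s < real_of_int (\<lfloor>real (Suc n) * s\<rfloor> + 1) / real (Suc n)" for n
    proof -
      have "real (Suc n) * s < real_of_int (\<lfloor>real (Suc n) * s\<rfloor> + 1)" by linarith
      then show ?thesis by (simp add: pos_less_divide_eq mult.commute del: of_nat_Suc of_int_add)
    qed
    moreover have "real_of_int (\<lfloor>real (Suc n) * s\<rfloor> + 1) / real (Suc n) \<noteq> s" for n
      using gt[of n] by (rule less_imp_neq[THEN not_sym])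
    ultimately show ?thesis
      unfolding filterlim_at greaterThan_iff by (intro conjI always_eventually allI) assumption+
  qed
  have down: "filterlim (\<lambda>n. real_of_int (\<lceil>real (Suc n) * s\<rceil> - 1) / real (Suc n)) (at_left s) sequentially" for s :: real
  proof -
    have "(\<lambda>n. real_of_int (\<lceil>real (Suc n) * s\<rceil> - 1) / real (Suc n)) \<longlonglongrightarrow> s"
    proof (rule tendsto_sandwich)
      show "(\<lambda>n. s + - inverse (real (Suc n))) \<longlonglongrightarrow> s" "(\<lambda>n. s) \<longlonglongrightarrow> s"
        using LIMSEQ_inverse_real_of_nat_add_minus[of s] by simp_all
      show "\<forall>\<^sub>F n in sequentially. real_of_int (\<lceil>real (Suc n) * s\<rceil> - 1) / real (Suc n) \<le> s"
      proof (intro always_eventually allI)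
        fix n
        have "real_of_int (\<lceil>real (Suc n) * s\<rceil> - 1) \<le> real (Suc n) * s" by linarith
        then show "real_of_int (\<lceil>real (Suc n) * s\<rceil> - 1) / real (Suc n) \<le> s"
          by (simp add: pos_divide_le_eq mult.commute del: of_nat_Suc of_int_diff)
      qed
      show "\<forall>\<^sub>F n in sequentially. s + - inverse (real (Suc n)) \<le> real_of_int (\<lceil>real (Suc n) * s\<rceil> - 1) / real (Suc n)"
      proof (intro always_eventually allI)
        fix n
        have "(s + - inverse (real (Suc n))) * real (Suc n) = real (Suc n) * s - 1"
          by (simp add: field_simps del: of_nat_Suc)
        also have "\<dots> \<le> real_of_int (\<lceil>real (Suc n) * s\<rceil> - 1)" by linarith
        finally show "s + - inverse (real (Suc n)) \<le> real_of_int (\<lceil>real (Suc n) * s\<rceil> - 1) / real (Suc n)"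
          by (simp add: pos_le_divide_eq del: of_nat_Suc of_int_diff)
      qed
    qed
    moreover have lt: "real_of_int (\<lceil>real (Suc n) * s\<rceil> - 1) / real (Suc n) < s" for n
    proof -
      have "real_of_int (\<lceil>real (Suc n) * s\<rceil> - 1) < real (Suc n) * s" by linarith
      then show ?thesis by (simp add: pos_divide_less_eq mult.commute del: of_nat_Suc of_int_diff)
    qed
    moreover have "real_of_int (\<lceil>real (Suc n) * s\<rceil> - 1) / real (Suc n) \<noteq> s" for n
      using lt[of n] by (rule less_imp_neq)
    ultimately show ?thesis
      unfolding filterlim_at lessThan_iff by (intro conjI always_eventually allI) assumption+
  qed
  show "(\<lambda>s. if 0 \<le> s then \<xi> s else 0) \<in> borel_measurable borel"
  proof (rule borel_measurable_LIMSEQ_real)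
    fix s :: real
    show "(\<lambda>n. if 0 \<le> s then \<xi> (real_of_int (\<lfloor>real (Suc n) * s\<rfloor> + 1) / real (Suc n)) else 0) \<longlonglongrightarrow> (if 0 \<le> s then \<xi> s else 0)"
      using filterlim_compose[OF _ up, of \<xi> "nhds (\<xi> s)" s] \<xi>
      by (auto simp: cadlag_def simp del: of_nat_Suc of_int_add)
    show "(\<lambda>s. if 0 \<le> s then \<xi> (real_of_int (\<lfloor>real (Suc n) * s\<rfloor> + 1) / real (Suc n)) else 0) \<in> borel_measurable borel" for n
      by (intro measurable_If measurable_grid[of "\<lambda>s. \<lfloor>real (Suc n) * s\<rfloor> + 1"]; measurable)
  qed
  show "(\<lambda>s. if 0 < s then left_lim \<xi> s else 0) \<in> borel_measurable borel"
  proof (rule borel_measurable_LIMSEQ_real)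
    fix s :: real
    show "(\<lambda>n. if 0 < s then \<xi> (real_of_int (\<lceil>real (Suc n) * s\<rceil> - 1) / real (Suc n)) else 0) \<longlonglongrightarrow> (if 0 < s then left_lim \<xi> s else 0)"
      using filterlim_compose[OF _ down, of \<xi> "nhds (left_lim \<xi> s)" s] cadlag_left_lim[OF \<xi>, of s]
      by (auto simp del: of_nat_Suc of_int_diff)
    show "(\<lambda>s. if 0 < s then \<xi> (real_of_int (\<lceil>real (Suc n) * s\<rceil> - 1) / real (Suc n)) else 0) \<in> borel_measurable borel" for n
      by (intro measurable_If measurable_grid[of "\<lambda>s. \<lceil>real (Suc n) * s\<rceil> - 1"]; measurable)
  qed
qed

text \<open>With \<open>c\<close> the mean, each of the events \<open>g < c\<close> and
  \<open>c < g\<close> has probability 0 or 1, and probability 1 would contradict the value of the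
  mean.\<close>

lemma AE_eq_integral_of_01:
  fixes g :: "'a \<Rightarrow> real"
  assumes "prob_space m" and 01: "\<And>A. A \<in> sets m \<Longrightarrow> emeasure m A = 0 \<or> emeasure m A = 1"
    and g: "integrable m g"
  shows "AE e in m. g e = (\<integral>e. g e \<partial>m)"
proof -
  interpret prob_space m by fact
  have "AE e in m. \<not> Q (g e)" if Q: "Measurable.pred borel Q" and no: "\<not> (AE e in m. Q (g e))" for Q
  proof -
    have s: "{e\<in>space m. Q (g e)} \<in> sets m" using g Q by measurable
    have "emeasure m {e\<in>space m. Q (g e)} \<noteq> 1"
      using no s AE_prob_1[of "{e\<in>space m. Q (g e)}"] by (auto simp: measure_def)
    with 01[OF s] have "emeasure m {e\<in>space m. Q (g e)} = 0" by blast
    then show ?thesis by (intro AE_I[of _ _ "{e\<in>space m. Q (g e)}"]) (use s in auto)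
  qed
  note zero_one = this
  let ?c = "\<integral>e. g e \<partial>m"
  have "\<not> (AE e in m. g e < ?c)"
    using integral_less_AE_space[of g "\<lambda>_. ?c"] g by (auto simp: prob_space emeasure_space_1)
  moreover have "\<not> (AE e in m. ?c < g e)"
    using integral_less_AE_space[of "\<lambda>_. ?c" g] g by (auto simp: prob_space emeasure_space_1)
  ultimately have "AE e in m. \<not> g e < ?c" "AE e in m. \<not> ?c < g e"
    using zero_one[of "\<lambda>y. y < ?c"] zero_one[of "\<lambda>y. ?c < y"] by auto
  then show ?thesis by eventually_elim auto
qed

section \<open>Pathwise analysis over a short time window\<close>

context jump_coefficients
begin

text \<open>Majorant of the jump caused by a point of \<open>N\<close>: nothing is accepted above
  height \<open>B\<close>, and no displacement exceeds \<open>\<eta>\<close>.\<close>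

definition envelope :: "real \<times> real \<times> 'g \<Rightarrow> real" where "envelope e = indicator {0..B} (fst (snd e)) * \<eta> (snd (snd e))"

definition window :: "real \<Rightarrow> real \<Rightarrow> 'g set \<Rightarrow> (real \<times> real \<times> 'g) set" where
  "window a c G = {a<..c} \<times> {0..B} \<times> G"

text \<open>Error made when a single jump is computed from the position \<open>x\<close> at the
  start of the window instead of the position just before the jump, the two being at most
  \<open>B * \<epsilon> + R\<close> apart. The first term covers equal acceptance decisions; the
  second pays for heights so close to \<open>\<gamma> x\<close> that the decisions may
  differ.\<close>

definition discrepancy :: "real \<Rightarrow> real \<Rightarrow> real \<Rightarrow> real \<Rightarrow> real \<Rightarrow> real \<Rightarrow> real \<times> real \<times> 'g \<Rightarrow> real" where
  "discrepancy \<epsilon> K L M x R e =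
    L * (1 + K) * (B * \<epsilon> + R) + 2 * M * indicator {..B * (B * \<epsilon> + R)} \<bar>fst (snd e) - \<gamma> x\<bar>"

definition landing :: "real \<Rightarrow> real \<times> real \<times> 'g \<Rightarrow> real" where
  "landing x e = x + h x (snd (snd e)) * indicator {..\<gamma> x} (fst (snd e))"

end

text \<open>One fixed outcome, with \<open>m\<close> the realised point measure.
  \<open>finite_jumps\<close> makes the jump integral in the equation absolutely convergent, so that
  it can be split over time intervals and marks.\<close>

locale jump_path = jump_coefficients k q b \<gamma> h \<eta> c\<^sub>0 B
  for k and q :: "'g measure" and b \<gamma> h \<eta> c\<^sub>0 B +
  fixes m :: "(real \<times> real \<times> 'g) measure" and \<xi> :: "real \<Rightarrow> real" and x\<^sub>0 :: real
  assumes sets_m [measurable_cong]: "sets m = sets (restrict_space borel {0..} \<Otimes>\<^sub>M restrict_space borel {0..} \<Otimes>\<^sub>M q)"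
    and integer: "\<And>A. A \<in> sets m \<Longrightarrow> emeasure m A \<noteq> \<infinity> \<Longrightarrow> \<exists>n::nat. emeasure m A = of_nat n"
    and path: "cadlag \<xi>"
    and equation: "\<And>t. 0 \<le> t \<Longrightarrow> \<xi> t = x\<^sub>0 + (LBINT s:{0..t}. b (\<xi> s)) +
          (\<integral>(s, u, z). indicator {0<..t} s * (h (left_lim \<xi> s) z * indicator {..\<gamma> (left_lim \<xi> s)} u) \<partial>m)"
    and finite_jumps: "\<And>T. 0 \<le> T \<Longrightarrow> (\<integral>\<^sup>+e. indicator {0<..T} (fst e) * indicator {0..B} (fst (snd e)) * ennreal (\<eta> (snd (snd e))) \<partial>m) < \<infinity>"
begin

definition pre where "pre s = (if 0 < s then left_lim \<xi> s else 0)"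

lemma space_m: "space m = {0..} \<times> {0..} \<times> space q"
  using sets_eq_imp_space_eq[OF sets_m] by (simp add: space_pair_measure space_restrict_space)

lemma left_measurable [measurable]: "pre \<in> borel_measurable borel"
  unfolding pre_def[abs_def] by (rule cadlag_measurable[OF path])

lemma half_line_measurable: "(\<lambda>x. x) \<in> borel_measurable (restrict_space borel {0..})"
  by (rule measurable_restrict_space1) simp

lemma proj_measurable [measurable]:
  "(\<lambda>e. fst e) \<in> borel_measurable m" "(\<lambda>e. fst (snd e)) \<in> borel_measurable m" "(\<lambda>e. snd (snd e)) \<in> measurable m q"
proof -
  have "fst \<in> measurable m (restrict_space borel {0..})" "(\<lambda>e. fst (snd e)) \<in> measurable m (restrict_space borel {0..})"
    "(\<lambda>e. snd (snd e)) \<in> measurable m q"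
    unfolding measurable_cong_sets[OF sets_m refl] by simp_all
  then show "(\<lambda>e. fst e) \<in> borel_measurable m" "(\<lambda>e. fst (snd e)) \<in> borel_measurable m" "(\<lambda>e. snd (snd e)) \<in> measurable m q"
    using measurable_compose[OF _ half_line_measurable, of fst m] measurable_compose[OF _ half_line_measurable, of "\<lambda>e. fst (snd e)" m]
    by simp_all
qed

definition jump where
  "jump e = (if 0 < fst e then h (pre (fst e)) (snd (snd e)) * indicator {..\<gamma> (pre (fst e))} (fst (snd e)) else 0)"

definition slab where "slab a c = {e \<in> space m. a < fst e \<and> fst e \<le> c}"

lemma slab_sets [measurable]: "slab a c \<in> sets m"
  unfolding slab_def by measurable

lemma jump_measurable [measurable]: "jump \<in> borel_measurable m"
proof -
  have "(\<lambda>e. if 0 < fst e then h (pre (fst e)) (snd (snd e)) * (if fst (snd e) \<le> \<gamma> (pre (fst e)) then 1 else 0) else 0) \<in> borel_measurable m"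
    by measurable
  also have "(\<lambda>e. if 0 < fst e then h (pre (fst e)) (snd (snd e)) * (if fst (snd e) \<le> \<gamma> (pre (fst e)) then 1 else 0) else 0) = jump"
    by (auto simp: jump_def fun_eq_iff)
  finally show ?thesis .
qed

lemma envelope_measurable [measurable]: "envelope \<in> borel_measurable m"
  unfolding envelope_def by measurable

lemma jump_le_envelope: "e \<in> space m \<Longrightarrow> \<bar>jump e\<bar> \<le> envelope e"
  using h_bound[of "snd (snd e)" "pre (fst e)"] \<gamma>_le[of "pre (fst e)"] \<eta>_nonneg[of "snd (snd e)"]
  by (auto simp: jump_def envelope_def space_m indicator_def)

definition activity where "activity D = (\<integral>\<^sup>+e. indicator D e * ennreal (envelope e) \<partial>m)"

lemma activity_mono: "D \<subseteq> D' \<Longrightarrow> activity D \<le> activity D'"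
  unfolding activity_def by (intro nn_integral_mono mult_right_mono) (auto simp: indicator_def)

lemma activity_Un: "D \<in> sets m \<Longrightarrow> D' \<in> sets m \<Longrightarrow> activity (D \<union> D') \<le> activity D + activity D'"
proof -
  assume [measurable]: "D \<in> sets m" "D' \<in> sets m"
  have "activity (D \<union> D') \<le> (\<integral>\<^sup>+e. indicator D e * ennreal (envelope e) + indicator D' e * ennreal (envelope e) \<partial>m)"
    unfolding activity_def by (intro nn_integral_mono) (auto simp: indicator_def)
  also have "\<dots> = activity D + activity D'" unfolding activity_def by (rule nn_integral_add) measurable
  finally show ?thesis .
qed

lemma activity_finite:
  assumes "0 \<le> a" "D \<subseteq> slab a T"
  shows "activity D < \<infinity>"
proof (cases "0 \<le> T")
  case True
  have "activity D \<le> activity (slab 0 T)"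
    using assms by (intro activity_mono) (auto simp: slab_def)
  also have "\<dots> \<le> (\<integral>\<^sup>+e. indicator {0<..T} (fst e) * indicator {0..B} (fst (snd e)) * ennreal (\<eta> (snd (snd e))) \<partial>m)"
    unfolding activity_def by (intro nn_integral_mono) (auto simp: slab_def envelope_def indicator_def)
  also have "\<dots> < \<infinity>" by (rule finite_jumps[OF True])
  finally show ?thesis .
next
  case False
  then have "D = {}" using assms by (auto simp: slab_def)
  then show ?thesis by (simp add: activity_def)
qed

lemma jump_integrable:
  assumes D: "D \<in> sets m" "0 \<le> a" "D \<subseteq> slab a T"
  shows "integrable m (\<lambda>e. indicator D e * jump e)"
    and "\<bar>\<integral>e. indicator D e * jump e \<partial>m\<bar> \<le> enn2real (activity D)"
proof -
  note [measurable] = D(1)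
  have le: "(\<integral>\<^sup>+e. ennreal (norm (indicator D e * jump e)) \<partial>m) \<le> activity D"
    unfolding activity_def using jump_le_envelope
    by (intro nn_integral_mono) (auto simp: indicator_def intro: ennreal_leI)
  also have fin: "activity D < \<infinity>" using activity_finite D by blast
  finally show I: "integrable m (\<lambda>e. indicator D e * jump e)"
    by (intro integrableI_bounded) (auto intro!: borel_measurable_times)
  have "\<bar>\<integral>e. indicator D e * jump e \<partial>m\<bar> \<le> (\<integral>e. norm (indicator D e * jump e) \<partial>m)"
    using integral_norm_bound[of m "\<lambda>e. indicator D e * jump e"] by simp
  also have "\<dots> = enn2real (\<integral>\<^sup>+e. ennreal (norm (indicator D e * jump e)) \<partial>m)"
    using I by (intro integral_eq_nn_integral) auto
  also have "\<dots> \<le> enn2real (activity D)"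
    using le fin by (intro enn2real_mono) auto
  finally show "\<bar>\<integral>e. indicator D e * jump e \<partial>m\<bar> \<le> enn2real (activity D)" .
qed

lemma equation': "0 \<le> t \<Longrightarrow> \<xi> t = x\<^sub>0 + (LBINT s:{0..t}. b (\<xi> s)) + (\<integral>e. indicator (slab 0 t) e * jump e \<partial>m)"
proof -
  assume t: "0 \<le> t"
  have "(\<integral>(s, u, z). indicator {0<..t} s * (h (left_lim \<xi> s) z * indicator {..\<gamma> (left_lim \<xi> s)} u) \<partial>m)
      = (\<integral>e. indicator (slab 0 t) e * jump e \<partial>m)"
    by (intro Bochner_Integration.integral_cong) (auto simp: slab_def jump_def pre_def indicator_def split: prod.split)
  then show ?thesis using equation[OF t] by simp
qed

lemma drift_integrable: "0 \<le> a \<Longrightarrow> set_integrable lborel {a<..c} (\<lambda>s. b (\<xi> s))" "set_integrable lborel {0..c} (\<lambda>s. b (\<xi> s))"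
proof -
  let ?f = "\<lambda>s. b (if 0 \<le> s then \<xi> s else 0)"
  have m: "?f \<in> borel_measurable borel"
    using cadlag_measurable(1)[OF path] by measurable
  have *: "set_integrable lborel A ?f" if "A \<in> sets borel" "A \<subseteq> {a'..c'}" for A a' c'
  proof (rule set_integrable_subset)
    have "set_integrable lborel {a'..c'} (\<lambda>_. B)" by (intro borel_integrable_atLeastAtMost') auto
    then show "set_integrable lborel {a'..c'} ?f"
      by (rule set_integrable_bound) (use m b_bound B in \<open>auto simp: set_borel_measurable_def intro!: borel_measurable_scaleR\<close>)
  qed (use that in auto)
  have cong: "set_integrable lborel A (\<lambda>s. b (\<xi> s)) \<longleftrightarrow> set_integrable lborel A ?f" if "A \<subseteq> {0..}" for A
    using that by (intro set_integrable_cong) auto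
  show "set_integrable lborel {a<..c} (\<lambda>s. b (\<xi> s))" if "0 \<le> a"
    using *[of "{a<..c}" a c, OF _ greaterThanAtMost_subseteq_atLeastAtMost_iff[THEN iffD2]] that
    by (subst cong) auto
  show "set_integrable lborel {0..c} (\<lambda>s. b (\<xi> s))"
    using *[of "{0..c}" 0 c] by (subst cong) auto
qed

lemma increment:
  assumes t: "0 \<le> t" "t \<le> r"
  shows "\<xi> r - \<xi> t = (LBINT s:{t<..r}. b (\<xi> s)) + (\<integral>e. indicator (slab t r) e * jump e \<partial>m)"
proof -
  have "{0..r} = {0..t} \<union> {t<..r}" using t by auto
  moreover have "(LBINT s:{0..t} \<union> {t<..r}. b (\<xi> s)) = (LBINT s:{0..t}. b (\<xi> s)) + (LBINT s:{t<..r}. b (\<xi> s))"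
    using drift_integrable t by (intro set_integral_Un) auto
  ultimately have 1: "(LBINT s:{0..r}. b (\<xi> s)) = (LBINT s:{0..t}. b (\<xi> s)) + (LBINT s:{t<..r}. b (\<xi> s))"
    by simp
  have "(\<integral>e. indicator (slab 0 r) e * jump e \<partial>m) = (\<integral>e. indicator (slab 0 t) e * jump e + indicator (slab t r) e * jump e \<partial>m)"
    using t by (intro Bochner_Integration.integral_cong) (auto simp: slab_def indicator_def)
  also have "\<dots> = (\<integral>e. indicator (slab 0 t) e * jump e \<partial>m) + (\<integral>e. indicator (slab t r) e * jump e \<partial>m)"
    using jump_integrable(1)[of "slab 0 t" 0 t] jump_integrable(1)[of "slab t r" t r] t
    by (intro Bochner_Integration.integral_add) auto
  finally show ?thesis using 1 equation'[of t] equation'[of r] t by simp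
qed

lemma drift_bound:
  assumes "0 \<le> t" "t \<le> r" "\<And>s. t \<le> s \<Longrightarrow> s \<le> r \<Longrightarrow> \<bar>b (\<xi> s) - c\<bar> \<le> K"
  shows "\<bar>(LBINT s:{t<..r}. b (\<xi> s)) - (r - t) * c\<bar> \<le> (r - t) * K"
proof -
  have c: "set_integrable lborel {t<..r} (\<lambda>_. y)" for y :: real
    by (rule set_integrable_subset[OF borel_integrable_atLeastAtMost'[of t r "\<lambda>_. y"]]) (auto simp: less_imp_le)
  have val: "(LBINT s:{t<..r}. y) = (r - t) * y" for y :: real
    using assms(2) by (simp add: set_lebesgue_integral_def mult.commute)
  have "\<bar>(LBINT s:{t<..r}. b (\<xi> s)) - (r - t) * c\<bar> = \<bar>LBINT s:{t<..r}. (b (\<xi> s) - c)\<bar>"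
    using drift_integrable(1)[OF assms(1), of r] c val by (subst set_integral_diff) auto
  also have "\<dots> \<le> (LBINT s:{t<..r}. \<bar>b (\<xi> s) - c\<bar>)"
    using set_integral_norm_bound[of lborel "{t<..r}" "\<lambda>s. b (\<xi> s) - c"] set_integral_diff(1)[OF drift_integrable(1)[OF assms(1)] c]
    by simp
  also have "\<dots> \<le> (LBINT s:{t<..r}. K)"
    using drift_integrable(1)[OF assms(1), of r] c assms(3)
    by (intro set_integral_mono set_integrable_abs set_integral_diff) auto
  finally show ?thesis by (simp add: val)
qed

lemma increment_bound:
  assumes t: "0 \<le> t" "t \<le> r"
  shows "\<bar>\<xi> r - \<xi> t\<bar> \<le> B * (r - t) + enn2real (activity (slab t r))"
proof -
  have "\<bar>(LBINT s:{t<..r}. b (\<xi> s)) - (r - t) * 0\<bar> \<le> (r - t) * B"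
    using t b_bound by (intro drift_bound) auto
  moreover have "\<bar>\<integral>e. indicator (slab t r) e * jump e \<partial>m\<bar> \<le> enn2real (activity (slab t r))"
    using t by (intro jump_integrable(2)) auto
  ultimately show ?thesis unfolding increment[OF t] by (simp add: mult.commute)
qed

end

context jump_path
begin

lemma window_sets [measurable]:
  assumes "0 \<le> a" and [measurable]: "G \<in> sets q"
  shows "window a c G \<in> sets m"
proof -
  have "window a c G = {e\<in>space m. a < fst e \<and> fst e \<le> c \<and> fst (snd e) \<le> B \<and> snd (snd e) \<in> G}"
    using assms(1) sets.sets_into_space[OF assms(2)] by (auto simp: window_def space_m)
  also have "\<dots> \<in> sets m" by measurable
  finally show ?thesis .
qed

lemma activity_null: "D \<in> sets m \<Longrightarrow> emeasure m D = 0 \<Longrightarrow> activity D = 0"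
proof -
  assume D: "D \<in> sets m" "emeasure m D = 0"
  then have "AE e in m. e \<notin> D" by (intro AE_not_in) (auto simp: null_sets_def)
  then have "activity D = (\<integral>\<^sup>+e. 0 \<partial>m)"
    unfolding activity_def by (intro nn_integral_cong_AE) (auto simp: indicator_def)
  then show ?thesis by simp
qed

text \<open>A point of the slab outside the window either lies above height \<open>B\<close>, where
  the envelope vanishes, or has a mark outside \<open>G\<close>.\<close>

lemma activity_slab:
  assumes t: "0 \<le> t" and G: "G \<in> sets q"
  shows "activity (slab t r - window t r G) = activity (window t r (space q - G))"
  unfolding activity_def using t
  by (intro nn_integral_cong) (auto simp: window_def slab_def envelope_def space_m indicator_def)

lemma activity_slab_le:
  assumes t: "0 \<le> t" and G: "G \<in> sets q"
  shows "activity (slab t r) \<le> activity (window t r G) + activity (window t r (space q - G))"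
proof -
  have "activity (slab t r) \<le> activity (window t r G \<union> (slab t r - window t r G))"
    by (rule activity_mono) auto
  also have "\<dots> \<le> activity (window t r G) + activity (slab t r - window t r G)"
    using t G by (intro activity_Un) auto
  finally show ?thesis unfolding activity_slab[OF assms] .
qed

lemma window_activity_finite: "0 \<le> t \<Longrightarrow> G \<in> sets q \<Longrightarrow> activity (window t r G) < \<infinity>"
  using sets.sets_into_space[of G q]
  by (intro activity_finite[of t _ r]) (auto simp: window_def slab_def space_m)

text \<open>Majorant of the total displacement by marks outside \<open>G\<close>; for random paths
  it becomes \<open>remainder\<close>.\<close>

definition residual where "residual t \<epsilon> G = enn2real (activity (window t (t + \<epsilon>) (space q - G)))"

lemma residual_nonneg: "0 \<le> residual t \<epsilon> G" by (simp add: residual_def)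

lemma enn2real_activity_le:
  assumes t: "0 \<le> t" and G: "G \<in> sets q" and r: "r \<le> t + \<epsilon>" and null: "emeasure m (window t r G) = 0"
  shows "enn2real (activity (slab t r)) \<le> residual t \<epsilon> G"
proof -
  have "activity (slab t r) \<le> activity (window t r (space q - G))"
    using activity_slab_le[OF t G, of r] activity_null[OF window_sets[OF t G] null] by simp
  also have "\<dots> \<le> activity (window t (t + \<epsilon>) (space q - G))"
    using r by (intro activity_mono) (auto simp: window_def)
  finally show ?thesis
    unfolding residual_def using window_activity_finite[OF t] G by (intro enn2real_mono) auto
qed

lemma quiet_increment:
  assumes t: "0 \<le> t" "t \<le> r" "r \<le> t + \<epsilon>" and G: "G \<in> sets q" and null: "emeasure m (window t r G) = 0"
  shows "\<bar>\<xi> r - \<xi> t\<bar> \<le> B * \<epsilon> + residual t \<epsilon> G"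
proof -
  have "B * (r - t) \<le> B * \<epsilon>" using t B by (intro mult_left_mono) auto
  then show ?thesis
    using increment_bound[OF t(1,2)] enn2real_activity_le[OF t(1) G t(3) null] by linarith
qed

text \<open>The path stays within \<open>B * \<epsilon> + residual t \<epsilon> G\<close> of its
  initial value, so freezing the drift at time \<open>t\<close> costs a Lipschitz factor
  \<open>B\<close> times this over a time \<open>\<epsilon>\<close>; the discarded marks enter once
  more directly.\<close>

lemma no_jump_error:
  assumes t: "0 \<le> t" "0 \<le> \<epsilon>" and G: "G \<in> sets q" and null: "emeasure m (window t (t + \<epsilon>) G) = 0"
  shows "\<bar>\<xi> (t + \<epsilon>) - (\<xi> t + \<epsilon> * b (\<xi> t))\<bar> \<le> \<epsilon> * (B * (B * \<epsilon> + residual t \<epsilon> G)) + residual t \<epsilon> G"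
proof -
  have sub: "emeasure m (window t r G) = 0" if "r \<le> t + \<epsilon>" for r
  proof -
    have "window t r G \<subseteq> window t (t + \<epsilon>) G" using that by (auto simp: window_def)
    from emeasure_mono[OF this window_sets[OF t(1) G]] show ?thesis using null by simp
  qed
  have "\<bar>(LBINT s:{t<..t + \<epsilon>}. b (\<xi> s)) - (t + \<epsilon> - t) * b (\<xi> t)\<bar> \<le> (t + \<epsilon> - t) * (B * (B * \<epsilon> + residual t \<epsilon> G))"
  proof (rule drift_bound)
    fix s assume s: "t \<le> s" "s \<le> t + \<epsilon>"
    have "\<bar>b (\<xi> s) - b (\<xi> t)\<bar> \<le> B * \<bar>\<xi> s - \<xi> t\<bar>" by (rule b_Lipschitz)
    also have "\<dots> \<le> B * (B * \<epsilon> + residual t \<epsilon> G)"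
      using quiet_increment[OF t(1) s G sub[OF s(2)]] B by (intro mult_left_mono) auto
    finally show "\<bar>b (\<xi> s) - b (\<xi> t)\<bar> \<le> B * (B * \<epsilon> + residual t \<epsilon> G)" .
  qed (use t in auto)
  moreover have "\<bar>\<integral>e. indicator (slab t (t + \<epsilon>)) e * jump e \<partial>m\<bar> \<le> residual t \<epsilon> G"
    using jump_integrable(2)[of "slab t (t + \<epsilon>)" t "t + \<epsilon>"] enn2real_activity_le[OF t(1) G order_refl null] t
    by auto
  moreover have "\<xi> (t + \<epsilon>) - \<xi> t = (LBINT s:{t<..t + \<epsilon>}. b (\<xi> s)) + (\<integral>e. indicator (slab t (t + \<epsilon>)) e * jump e \<partial>m)"
    using t by (intro increment) auto
  ultimately show ?thesis by simp
qed

text \<open>A \<open>{0, 1}\<close>-valued probability measure makes every real function almost surely constant.\<close>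

lemma single_jump:
  assumes t: "0 \<le> t" "0 \<le> \<epsilon>" and G: "G \<in> sets q" and one: "emeasure m (window t (t + \<epsilon>) G) = 1"
  shows "AE e in density m (indicator (window t (t + \<epsilon>) G)).
    e \<in> window t (t + \<epsilon>) G \<and> \<bar>pre (fst e) - \<xi> t\<bar> \<le> B * \<epsilon> + residual t \<epsilon> G \<and>
    \<bar>\<xi> (t + \<epsilon>) - \<xi> t - jump e\<bar> \<le> B * \<epsilon> + residual t \<epsilon> G"
proof -
  let ?D = "window t (t + \<epsilon>) G" and ?R = "residual t \<epsilon> G"
  let ?m = "density m (indicator ?D)"
  have D [measurable]: "?D \<in> sets m" using window_sets[OF t(1) G] .
  have D_slab: "?D \<subseteq> slab t (t + \<epsilon>)"
    using sets.sets_into_space[OF D] by (auto simp: window_def slab_def)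
  have em: "emeasure ?m A = emeasure m (A \<inter> ?D)" if "A \<in> sets m" for A
    using that by (simp add: emeasure_density indicator_inter_arith[symmetric] Int_commute)
  interpret D: prob_space ?m
    using sets.sets_into_space[OF D] one by (intro prob_spaceI) (simp add: em Int_absorb1)
  have 01: "emeasure ?m A = 0 \<or> emeasure ?m A = 1" if "A \<in> sets ?m" for A
  proof -
    have A: "A \<inter> ?D \<in> sets m" using that by auto
    have le: "emeasure m (A \<inter> ?D) \<le> 1" using emeasure_mono[of "A \<inter> ?D" ?D m] one by simp
    then have "emeasure m (A \<inter> ?D) \<noteq> \<infinity>" by (auto simp: top_unique)
    then obtain n :: nat where n: "emeasure m (A \<inter> ?D) = of_nat n" using integer[OF A] by blast
    then have "n \<le> 1" using le by (metis of_nat_1 of_nat_le_iff)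
    then have "n = 0 \<or> n = 1" by auto
    with n that show ?thesis by (auto simp: em)
  qed
  have inD: "AE e in ?m. e \<in> ?D"
    by (subst AE_density) (auto simp: indicator_def)
  have "AE e in ?m. norm (fst e) \<le> t + \<epsilon>"
    using inD by eventually_elim (use t in \<open>auto simp: window_def\<close>)
  then have fst_int: "integrable ?m fst"
    by (rule D.integrable_const_bound) simp
  \<comment> \<open>The time of the only candidate, recovered as the mean of the time coordinate
    under the \<open>{0, 1}\<close>-valued measure \<open>?m\<close>.\<close>
  define s\<^sub>0 where "s\<^sub>0 = (\<integral>e. fst e \<partial>?m)"
  have s\<^sub>0: "AE e in ?m. fst e = s\<^sub>0"
    unfolding s\<^sub>0_def by (rule AE_eq_integral_of_01[OF D.prob_space_axioms 01 fst_int])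
  \<comment> \<open>No candidate precedes \<open>s\<^sub>0\<close>, so up to there only drift and
    discarded marks move the path; passing to the left limit controls the position just before the
    jump.\<close>
  have before: "emeasure m (window t r G) = 0" if "r < s\<^sub>0" "r \<le> t + \<epsilon>" for r
  proof -
    have sub: "window t r G \<subseteq> ?D" using that by (auto simp: window_def)
    have W: "window t r G \<in> sets m" using window_sets[OF t(1) G] .
    have "AE e in ?m. e \<notin> window t r G"
      using s\<^sub>0 by eventually_elim (use that in \<open>auto simp: window_def\<close>)
    then have "emeasure ?m (window t r G) = 0"
    proof -
      have "{e \<in> space ?m. e \<in> window t r G} = window t r G" using sets.sets_into_space[OF W] by auto
      with \<open>AE e in ?m. e \<notin> window t r G\<close> show ?thesis
        using emeasure_eq_0_AE[of "\<lambda>e. e \<in> window t r G" ?m] by simp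
    qed
    then show ?thesis using W sub by (simp add: em Int_absorb2)
  qed
  have left: "\<bar>pre s - \<xi> t\<bar> \<le> B * \<epsilon> + ?R" if s: "s = s\<^sub>0" "t < s" "s \<le> t + \<epsilon>" for s
  proof -
    have "((\<lambda>r. \<bar>\<xi> r - \<xi> t\<bar>) \<longlongrightarrow> \<bar>left_lim \<xi> s - \<xi> t\<bar>) (at_left s)"
      using cadlag_left_lim[OF path, of s] s t by (intro tendsto_intros) auto
    moreover have "\<forall>\<^sub>F r in at_left s. \<bar>\<xi> r - \<xi> t\<bar> \<le> B * \<epsilon> + ?R"
      using eventually_at_left_real[OF s(2)]
    proof eventually_elim
      case (elim r)
      then show ?case using s before[of r] by (intro quiet_increment[OF t(1) _ _ G]) auto
    qed
    ultimately have "\<bar>left_lim \<xi> s - \<xi> t\<bar> \<le> B * \<epsilon> + ?R"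
      by (rule tendsto_upperbound) simp
    then show ?thesis using s t by (simp add: pre_def)
  qed
  have e: "?m = density m (\<lambda>e. ennreal (indicator ?D e))" by (simp add: ennreal_indicator)
  have J1: "integrable m (\<lambda>e. indicator ?D e * jump e)"
    by (rule jump_integrable(1)[OF D t(1) D_slab])
  then have J: "integrable ?m jump"
    unfolding e by (subst integrable_density) auto
  have J2: "integrable m (\<lambda>e. indicator (slab t (t + \<epsilon>) - ?D) e * jump e)"
    using t by (intro jump_integrable(1)[of _ t "t + \<epsilon>"]) auto
  have "(\<integral>e. indicator (slab t (t + \<epsilon>)) e * jump e \<partial>m) =
      (\<integral>e. indicator ?D e * jump e + indicator (slab t (t + \<epsilon>) - ?D) e * jump e \<partial>m)"
    using D_slab by (intro Bochner_Integration.integral_cong) (auto simp: indicator_def)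
  also have "\<dots> = (\<integral>e. indicator ?D e * jump e \<partial>m) + (\<integral>e. indicator (slab t (t + \<epsilon>) - ?D) e * jump e \<partial>m)"
    using J1 J2 by (rule Bochner_Integration.integral_add)
  also have "(\<integral>e. indicator ?D e * jump e \<partial>m) = (\<integral>e. jump e \<partial>?m)"
    unfolding e by (subst integral_density) auto
  finally have split: "(\<integral>e. indicator (slab t (t + \<epsilon>)) e * jump e \<partial>m) =
      (\<integral>e. jump e \<partial>?m) + (\<integral>e. indicator (slab t (t + \<epsilon>) - ?D) e * jump e \<partial>m)" .
  have "\<bar>\<integral>e. indicator (slab t (t + \<epsilon>) - ?D) e * jump e \<partial>m\<bar> \<le> enn2real (activity (slab t (t + \<epsilon>) - ?D))"
    using t by (intro jump_integrable(2)[of _ t "t + \<epsilon>"]) auto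
  then have rest: "\<bar>\<integral>e. indicator (slab t (t + \<epsilon>) - ?D) e * jump e \<partial>m\<bar> \<le> ?R"
    unfolding activity_slab[OF t(1) G] residual_def .
  have "\<bar>(LBINT s:{t<..t + \<epsilon>}. b (\<xi> s)) - (t + \<epsilon> - t) * 0\<bar> \<le> (t + \<epsilon> - t) * B"
    using t b_bound by (intro drift_bound) auto
  moreover have "\<xi> (t + \<epsilon>) - \<xi> t = (LBINT s:{t<..t + \<epsilon>}. b (\<xi> s)) + (\<integral>e. indicator (slab t (t + \<epsilon>)) e * jump e \<partial>m)"
    using t by (intro increment) auto
  ultimately have total: "\<bar>\<xi> (t + \<epsilon>) - \<xi> t - (\<integral>e. jump e \<partial>?m)\<bar> \<le> B * \<epsilon> + ?R"
    unfolding split using rest by (simp add: mult.commute)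
  have "AE e in ?m. jump e = (\<integral>e. jump e \<partial>?m)"
    by (rule AE_eq_integral_of_01[OF D.prob_space_axioms 01 J])
  with inD s\<^sub>0 show ?thesis
  proof eventually_elim
    case (elim e)
    then have "t < fst e" "fst e \<le> t + \<epsilon>" by (auto simp: window_def)
    with elim left[of "fst e"] total show ?case by simp
  qed
qed

lemma landing_measurable [measurable]: "landing x \<in> borel_measurable m"
proof -
  have "(\<lambda>e. x + h x (snd (snd e)) * (if fst (snd e) \<le> \<gamma> x then 1 else 0)) \<in> borel_measurable m" by measurable
  also have "(\<lambda>e. x + h x (snd (snd e)) * (if fst (snd e) \<le> \<gamma> x then 1 else 0)) = landing x"
    by (auto simp: landing_def fun_eq_iff)
  finally show ?thesis .
qed

text \<open>The three error terms belong to the possible numbers of candidates in the window: none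
  (drift frozen at time \<open>t\<close>), exactly one (jump computed from \<open>\<xi> t\<close>
  instead of the position before it), and at least two (crude bound by the sup norm). In each case
  the other two terms are merely nonnegative.\<close>

lemma step_error:
  assumes t: "0 \<le> t" "0 \<le> \<epsilon>" and G: "G \<in> sets q" "\<And>z. z \<in> G \<Longrightarrow> \<eta> z \<le> K" and K: "0 \<le> K"
    and \<phi>: "\<phi> \<in> borel_measurable borel" "\<And>x. \<bar>\<phi> x\<bar> \<le> M" and L: "\<And>x y. \<bar>\<phi> x - \<phi> y\<bar> \<le> L * \<bar>x - y\<bar>"
    and fin: "emeasure m (window t (t + \<epsilon>) G) < \<infinity>"
  shows "ennreal \<bar>\<phi> (\<xi> (t + \<epsilon>)) - (\<phi> (\<xi> t + \<epsilon> * b (\<xi> t)) +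
      (\<integral>e. \<phi> (landing (\<xi> t) e) - \<phi> (\<xi> t + \<epsilon> * b (\<xi> t)) \<partial>density m (indicator (window t (t + \<epsilon>) G))))\<bar>
    \<le> ennreal (L * (\<epsilon> * (B * (B * \<epsilon> + residual t \<epsilon> G)) + residual t \<epsilon> G)) +
      (\<integral>\<^sup>+e. ennreal (discrepancy \<epsilon> K L M (\<xi> t) (residual t \<epsilon> G) e) \<partial>density m (indicator (window t (t + \<epsilon>) G))) +
      ennreal (3 * M) * (if emeasure m (window t (t + \<epsilon>) G) = 1 then 0 else emeasure m (window t (t + \<epsilon>) G))"
    (is "ennreal \<bar>_ - ?\<Psi>\<bar> \<le> ?E1 + ?E2 + ?E3")
proof -
  let ?D = "window t (t + \<epsilon>) G" and ?R = "residual t \<epsilon> G" and ?x = "\<xi> t"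
  let ?m = "density m (indicator ?D)" and ?y = "\<xi> t + \<epsilon> * b (\<xi> t)"
  have D [measurable]: "?D \<in> sets m" using window_sets[OF t(1) G(1)] .
  have L0: "0 \<le> L" using L[of 0 1] by auto
  have M0: "0 \<le> M" using \<phi>(2)[of 0] by linarith
  note [measurable] = \<phi>(1)
  have mD: "emeasure ?m (space ?m) = emeasure m ?D"
    using sets.sets_into_space[OF D]
    by (simp add: emeasure_density indicator_inter_arith[symmetric] Int_absorb1)
  interpret D: finite_measure ?m
    using fin by (intro finite_measureI) (simp only: mD less_top infinity_ennreal_def)
  have int: "integrable ?m (\<lambda>e. \<phi> (landing ?x e))"
    using \<phi>(2) by (intro D.integrable_const_bound[of _ M]) auto
  obtain n :: nat where n: "emeasure m ?D = of_nat n" using integer[OF D] fin by (metis less_irrefl)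
  then have meas: "measure ?m (space ?m) = real n" using mD by (simp add: measure_def)
  consider "n = 0" | "n = 1" | "2 \<le> n" by linarith
  then show ?thesis
  proof cases
    case 1
    then have null: "emeasure m ?D = 0" using n by simp
    have "AE e in m. indicator ?D e = (0::ennreal)"
      using AE_not_in[of ?D m] null by (auto simp: null_sets_def indicator_def)
    then have "(\<integral>e. f e \<partial>?m) = 0" for f :: "_ \<Rightarrow> real"
      by (intro integral_eq_zero_AE) (auto simp: AE_density)
    then have "\<bar>\<phi> (\<xi> (t + \<epsilon>)) - ?\<Psi>\<bar> = \<bar>\<phi> (\<xi> (t + \<epsilon>)) - \<phi> ?y\<bar>" by simp
    also have "\<dots> \<le> L * \<bar>\<xi> (t + \<epsilon>) - ?y\<bar>" by (rule L)
    also have "\<dots> \<le> L * (\<epsilon> * (B * (B * \<epsilon> + ?R)) + ?R)"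
      using no_jump_error[OF t G(1) null] L0 by (rule mult_left_mono)
    finally have "ennreal \<bar>\<phi> (\<xi> (t + \<epsilon>)) - ?\<Psi>\<bar> \<le> ?E1" by (rule ennreal_leI)
    then show ?thesis by (simp add: add_increasing2 add.assoc)
  next
    case 2
    then have one: "emeasure m ?D = 1" using n by simp
    interpret D1: prob_space ?m using mD one by (intro prob_spaceI) simp
    let ?F = "\<lambda>e. \<phi> (\<xi> (t + \<epsilon>)) - \<phi> (landing ?x e)"
    have "\<phi> (\<xi> (t + \<epsilon>)) - ?\<Psi> = (\<integral>e. ?F e \<partial>?m)"
      using int D1.prob_space by simp
    then have "ennreal \<bar>\<phi> (\<xi> (t + \<epsilon>)) - ?\<Psi>\<bar> = ennreal (norm (\<integral>e. ?F e \<partial>?m))" by simp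
    also have "\<dots> \<le> (\<integral>\<^sup>+e. ennreal (norm (?F e)) \<partial>?m)"
      using int by (intro integral_norm_bound_ennreal) auto
    also have "\<dots> \<le> ?E2"
    proof (rule nn_integral_mono_AE)
      show "AE e in ?m. ennreal (norm (?F e)) \<le> ennreal (discrepancy \<epsilon> K L M ?x ?R e)"
        using single_jump[OF t G(1) one]
      proof eventually_elim
        case (elim e)
        obtain s u z where e: "e = (s, u, z)" by (cases e) auto
        let ?d = "B * \<epsilon> + ?R"
        have d: "0 \<le> ?d" using t B residual_nonneg by simp
        from elim have su: "t < s" "0 \<le> u" "u \<le> B" "z \<in> G" and pr: "\<bar>pre s - ?x\<bar> \<le> ?d"
          and jp: "\<bar>\<xi> (t + \<epsilon>) - ?x - jump e\<bar> \<le> ?d"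
          by (auto simp: e window_def)
        have zq: "z \<in> space q" using su(4) sets.sets_into_space[OF G(1)] by auto
        show ?case
        \<comment> \<open>If the height \<open>u\<close> is farther from \<open>\<gamma> ?x\<close>
          than \<open>\<gamma>\<close> can move, acceptance is decided in the same way just before
          the jump and at time \<open>t\<close>; otherwise the trivial bound \<open>2 * M\<close> is
          used.\<close>
        proof (rule ennreal_leI, cases "\<bar>u - \<gamma> ?x\<bar> \<le> B * ?d")
          case True
          have "norm (?F e) \<le> M + M"
            using \<phi>(2)[of "\<xi> (t + \<epsilon>)"] \<phi>(2)[of "landing ?x e"] by (simp add: abs_le_iff)
          also have "\<dots> \<le> discrepancy \<epsilon> K L M ?x ?R e"
            using True L0 K d by (simp add: discrepancy_def e)
          finally show "norm (?F e) \<le> discrepancy \<epsilon> K L M ?x ?R e" .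
        next
          case False
          have "\<bar>\<gamma> (pre s) - \<gamma> ?x\<bar> \<le> B * \<bar>pre s - ?x\<bar>" by (rule \<gamma>_Lipschitz)
          also have "\<dots> \<le> B * ?d" using pr B by (intro mult_left_mono) auto
          finally have "u \<le> \<gamma> (pre s) \<longleftrightarrow> u \<le> \<gamma> ?x" using False by linarith
          then have "jump e = h (pre s) z * indicator {..\<gamma> ?x} u"
            using su t by (simp add: jump_def e indicator_def)
          moreover have "\<bar>h (pre s) z - h ?x z\<bar> \<le> K * ?d"
          proof -
            have "\<bar>h (pre s) z - h ?x z\<bar> \<le> \<eta> z * \<bar>pre s - ?x\<bar>" by (rule h_Lipschitz[OF zq])
            also have "\<dots> \<le> K * ?d" using pr G(2)[OF su(4)] K \<eta>_nonneg[OF zq] by (intro mult_mono) auto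
            finally show ?thesis .
          qed
          then have "\<bar>h (pre s) z * indicator {..\<gamma> ?x} u - h ?x z * indicator {..\<gamma> ?x} u\<bar> \<le> K * ?d"
            using K d by (auto simp: indicator_def)
          ultimately have "\<bar>\<xi> (t + \<epsilon>) - landing ?x e\<bar> \<le> (1 + K) * ?d"
            using jp by (simp add: landing_def e algebra_simps)
          then have "L * \<bar>\<xi> (t + \<epsilon>) - landing ?x e\<bar> \<le> L * ((1 + K) * ?d)" using L0 by (rule mult_left_mono)
          then show "norm (?F e) \<le> discrepancy \<epsilon> K L M ?x ?R e"
            using L[of "\<xi> (t + \<epsilon>)" "landing ?x e"] False by (simp add: discrepancy_def e mult.assoc)
        qed
      qed
    qed
    finally show ?thesis by (simp add: add_increasing add_increasing2)
  next
    case 3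
    have "\<bar>\<integral>e. \<phi> (landing ?x e) - \<phi> ?y \<partial>?m\<bar> \<le> (\<integral>e. \<bar>\<phi> (landing ?x e) - \<phi> ?y\<bar> \<partial>?m)"
      by (rule integral_abs_bound)
    also have "\<dots> \<le> (\<integral>e. 2 * M \<partial>?m)"
    proof (rule integral_mono)
      show "\<bar>\<phi> (landing ?x e) - \<phi> ?y\<bar> \<le> 2 * M" for e using \<phi>(2)[of "landing ?x e"] \<phi>(2)[of ?y] by linarith
    qed (use int in auto)
    also have "\<dots> = real n * (2 * M)" using meas by simp
    finally have "\<bar>\<phi> (\<xi> (t + \<epsilon>)) - ?\<Psi>\<bar> \<le> M + M + real n * (2 * M)"
      using \<phi>(2)[of "\<xi> (t + \<epsilon>)"] \<phi>(2)[of ?y] by linarith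
    \<comment> \<open>The two terms \<open>M\<close> are absorbed because \<open>n \<ge> 2\<close>;
      this is the origin of the factor 3.\<close>
    also have "\<dots> \<le> 3 * M * real n"
    proof -
      have "2 * M \<le> real n * M" using 3 M0 by (intro mult_right_mono) auto
      then show ?thesis by (simp add: algebra_simps)
    qed
    finally have "ennreal \<bar>\<phi> (\<xi> (t + \<epsilon>)) - ?\<Psi>\<bar> \<le> ennreal (3 * M * real n)" by (rule ennreal_leI)
    also have "\<dots> = ?E3"
    proof -
      have "of_nat n \<noteq> (1::ennreal)" using 3 of_nat_eq_iff[of n 1, where ?'a = ennreal] by simp
      then show ?thesis using n M0 by (simp add: ennreal_mult' ennreal_of_nat_eq_real_of_nat)
    qed
    finally show ?thesis by (simp add: add_increasing)
  qed
qed

end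

section \<open>Consistency of the scheme\<close>

locale jump_sde = jump_coefficients k q b \<gamma> h \<eta> c\<^sub>0 B + poisson_jumps P q \<mu> N
  for k and q :: "'g measure" and b \<gamma> h \<eta> c\<^sub>0 B and P :: "'w measure" and \<mu> N +
  fixes p :: real and X :: "real \<Rightarrow> real \<Rightarrow> 'w \<Rightarrow> real"
  assumes X: "\<And>x. jump_sde_solution P q N b \<gamma> h p x (X x)"
begin

section \<open>Almost sure regularity and measurability of the solution\<close>

lemma half_line_Ioc: "0 \<le> a \<Longrightarrow> {a<..c} \<in> sets half_line"
  and half_line_Icc: "0 \<le> a \<Longrightarrow> {a..c} \<in> sets half_line"
  by (auto simp: sets_restrict_space_iff)

lemma proj_\<mu> [measurable]:
  "(\<lambda>e. fst e) \<in> borel_measurable \<mu>" "(\<lambda>e. fst (snd e)) \<in> borel_measurable \<mu>" "(\<lambda>e. snd (snd e)) \<in> measurable \<mu> q"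
proof -
  have id: "(\<lambda>x. x) \<in> borel_measurable half_line" by (rule measurable_restrict_space1) simp
  have "fst \<in> measurable \<mu> half_line" "(\<lambda>e. fst (snd e)) \<in> measurable \<mu> half_line" "(\<lambda>e. snd (snd e)) \<in> measurable \<mu> q"
    unfolding measurable_cong_sets[OF sets_\<mu> refl] by simp_all
  then show "(\<lambda>e. fst e) \<in> borel_measurable \<mu>" "(\<lambda>e. fst (snd e)) \<in> borel_measurable \<mu>" "(\<lambda>e. snd (snd e)) \<in> measurable \<mu> q"
    using measurable_compose[OF _ id, of fst \<mu>] measurable_compose[OF _ id, of "\<lambda>e. fst (snd e)" \<mu>]
    by simp_all
qed

lemma envelope_\<mu> [measurable]: "envelope \<in> borel_measurable \<mu>"
  unfolding envelope_def by measurable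

lemma window_\<mu>:
  assumes "0 \<le> a" "G \<in> sets q"
  shows "window a c G \<in> sets \<mu>"
  unfolding window_def sets_\<mu>
  using assms half_line_Ioc[of a c] half_line_Icc[of 0 B] by (intro pair_measureI) auto

lemma nn_integral_window:
  assumes "0 \<le> a" "a \<le> c" and U: "U \<in> sets borel" "U \<subseteq> {0..B}" and [measurable]: "f \<in> borel_measurable q"
    and [measurable]: "G \<in> sets q"
  shows "(\<integral>\<^sup>+e. indicator (window a c G) e * indicator U (fst (snd e)) * f (snd (snd e)) \<partial>\<mu>) =
    ennreal (c - a) * emeasure lborel U * (\<integral>\<^sup>+z. indicator G z * f z \<partial>q)"
proof -
  have "(\<integral>\<^sup>+e. indicator (window a c G) e * indicator U (fst (snd e)) * f (snd (snd e)) \<partial>\<mu>) =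
      (\<integral>\<^sup>+(s, u, z). indicator {a<..c} s * indicator U u * (indicator G z * f z) \<partial>\<mu>)"
    using U(2) by (intro nn_integral_cong) (auto simp: window_def indicator_def)
  also have "\<dots> = emeasure lborel {a<..c} * emeasure lborel U * (\<integral>\<^sup>+z. indicator G z * f z \<partial>q)"
    using assms by (intro nn_integral_box half_line_Ioc) (auto simp: sets_restrict_space_iff)
  finally show ?thesis using assms(2) by simp
qed

lemma \<eta>_nn_integral:
  assumes [measurable]: "G \<in> sets q"
  shows "(\<integral>\<^sup>+z. indicator G z * ennreal (\<eta> z) \<partial>q) = ennreal (\<integral>z. indicator G z * \<eta> z \<partial>q)"
proof -
  have "(\<integral>\<^sup>+z. indicator G z * ennreal (\<eta> z) \<partial>q) = (\<integral>\<^sup>+z. ennreal (indicator G z * \<eta> z) \<partial>q)"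
    by (intro nn_integral_cong) (auto simp: indicator_def)
  also have "\<dots> = ennreal (\<integral>z. indicator G z * \<eta> z \<partial>q)"
    using integrable_mult_indicator[OF assms \<eta>(1)] \<eta>_nonneg
    by (intro nn_integral_eq_integral) (auto simp: indicator_def)
  finally show ?thesis .
qed

text \<open>The mean total size of the candidate jumps up to an integer time is finite by
  \<open>nn_integral_N\<close>; countably many integer times share one null set, and monotonicity
  covers all real times.\<close>

lemma AE_path: "AE \<omega> in P. jump_path k q b \<gamma> h \<eta> c\<^sub>0 B (N \<omega>) (\<lambda>t. X x t \<omega>) x"
proof -
  let ?F = "\<lambda>T e. indicator {0<..T} (fst e) * indicator {0..B} (fst (snd e)) * ennreal (\<eta> (snd (snd e)))"
  have "AE \<omega> in P. (\<integral>\<^sup>+e. ?F (real n) e \<partial>N \<omega>) \<noteq> \<infinity>" for n :: nat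
  proof (rule nn_integral_PInf_AE)
    have m: "?F (real n) \<in> borel_measurable \<mu>" by measurable
    show "(\<lambda>\<omega>. \<integral>\<^sup>+e. ?F (real n) e \<partial>N \<omega>) \<in> borel_measurable P" by (rule nn_integral_N[OF m])
    have "(\<integral>\<^sup>+e. ?F (real n) e \<partial>\<mu>) = (\<integral>\<^sup>+e. indicator (window 0 (real n) (space q)) e * indicator {0..B} (fst (snd e)) * ennreal (\<eta> (snd (snd e))) \<partial>\<mu>)"
      by (intro nn_integral_cong) (auto simp: window_def indicator_def space_\<mu>)
    also have "\<dots> = ennreal (real n) * ennreal B * ennreal (\<integral>z. indicator (space q) z * \<eta> z \<partial>q)"
      using B by (subst nn_integral_window) (auto simp: \<eta>_nn_integral)
    also have "\<dots> < \<infinity>" by (simp add: ennreal_mult_less_top)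
    finally show "(\<integral>\<^sup>+\<omega>. (\<integral>\<^sup>+e. ?F (real n) e \<partial>N \<omega>) \<partial>P) \<noteq> \<infinity>" by (simp add: nn_integral_N(2)[OF m])
  qed
  then have fin: "AE \<omega> in P. \<forall>n::nat. (\<integral>\<^sup>+e. ?F (real n) e \<partial>N \<omega>) \<noteq> \<infinity>" by (simp add: AE_all_countable)
  have cad: "AE \<omega> in P. cadlag (\<lambda>t. X x t \<omega>)"
    and eqn: "AE \<omega> in P. \<forall>t\<ge>0. X x t \<omega> = x + (LBINT s:{0..t}. b (X x s \<omega>)) +
          (\<integral>(s, u, z). indicator {0<..t} s * (h (left_lim (\<lambda>r. X x r \<omega>) s) z *
               indicator {..\<gamma> (left_lim (\<lambda>r. X x r \<omega>) s)} u) \<partial>(N \<omega>))"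
    using X[of x] unfolding jump_sde_solution_def by blast+
  from fin cad eqn AE_space show ?thesis
  proof eventually_elim
    case (elim \<omega>)
    have "(\<integral>\<^sup>+e. ?F T e \<partial>N \<omega>) < \<infinity>" if "0 \<le> T" for T
    proof -
      obtain n :: nat where "T \<le> real n" using real_arch_simple by blast
      then have "(\<integral>\<^sup>+e. ?F T e \<partial>N \<omega>) \<le> (\<integral>\<^sup>+e. ?F (real n) e \<partial>N \<omega>)"
        by (intro nn_integral_mono mult_right_mono) (auto simp: indicator_def)
      also have "\<dots> < \<infinity>" using elim(1) by (auto simp: less_top)
      finally show ?thesis .
    qed
    with elim show ?case
      by (intro jump_path.intro jump_coefficients_axioms jump_path_axioms.intro)
        (auto simp: sets_N sets_\<mu>[symmetric] dest: N_integer[OF elim(4)])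
  qed
qed

lemma filtration_set_outside:
  assumes t: "0 \<le> t" and A: "A \<in> sets (restrict_space borel {0..t} \<Otimes>\<^sub>M half_line \<Otimes>\<^sub>M q)"
  shows "A \<in> sets \<mu>" "A \<subseteq> {0..t} \<times> UNIV"
proof -
  have \<Omega>: "space (restrict_space borel {0..t} \<Otimes>\<^sub>M half_line \<Otimes>\<^sub>M q) = {0..t} \<times> {0..} \<times> space q"
    by (auto simp: space_pair_measure space_restrict_space)
  show "A \<subseteq> {0..t} \<times> UNIV" using sets.sets_into_space[OF A] unfolding \<Omega> by auto
  have sub: "a \<in> sets half_line" if "a \<in> sets (restrict_space (borel :: real measure) {0..t})" for a
    using that t by (auto simp: sets_restrict_space_iff)
  have \<Omega>': "{0..t} \<times> {0..} \<times> space q \<in> sets \<mu>"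
    unfolding sets_\<mu> using half_line_Icc[of 0 t] by (intro pair_measureI) (auto simp: sets_restrict_space_iff)
  from A show "A \<in> sets \<mu>"
    unfolding sets_pair_measure[of "restrict_space borel {0..t}"]
  proof (induction rule: sigma_sets.induct)
    case (Basic a)
    then show ?case unfolding sets_\<mu> using sub by (auto intro!: pair_measureI)
  next
    case (Compl a)
    then show ?case using \<Omega>' by (auto simp: space_pair_measure space_restrict_space)
  qed auto
qed

text \<open>The sets that generate the filtration at time \<open>t\<close> live on times up to
  \<open>t\<close>, whereas the window starts strictly after \<open>t\<close>; being disjoint from
  it, they count as outside, and adaptedness gives the claim.\<close>

lemma X_outside:
  assumes t: "0 \<le> t"
  shows "X x t \<in> borel_measurable (outside (window t r G))"
proof -
  have "X x t \<in> borel_measurable (jump_filtration P q N t)"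
    using X[of x] t unfolding jump_sde_solution_def by blast
  moreover have "sets (jump_filtration P q N t) \<subseteq> sets (outside (window t r G))"
    unfolding jump_filtration_def
  proof (subst sets_measure_of)
    show "sigma_sets (space P) {(\<lambda>\<omega>. emeasure (N \<omega>) A) -` B \<inter> space P |A B.
          A \<in> sets (restrict_space borel {0..t} \<Otimes>\<^sub>M half_line \<Otimes>\<^sub>M q) \<and> B \<in> sets borel}
      \<subseteq> sets (outside (window t r G))"
      unfolding sets_outside
    proof (rule sigma_sets_mono', safe)
      fix A and S :: "ennreal set"
      assume A: "A \<in> sets (restrict_space borel {0..t} \<Otimes>\<^sub>M half_line \<Otimes>\<^sub>M q)" and S: "S \<in> sets borel"
      have "A \<inter> window t r G = {}" using filtration_set_outside(2)[OF t A] by (auto simp: window_def)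
      then show "\<exists>A' S'. (\<lambda>\<omega>. emeasure (N \<omega>) A) -` S \<inter> space P = (\<lambda>\<omega>. emeasure (N \<omega>) A') -` S' \<inter> space P \<and>
          A' \<in> sets \<mu> \<and> A' \<inter> window t r G = {} \<and> S' \<in> sets borel"
        using filtration_set_outside(1)[OF t A] S by blast
    qed
  qed auto
  moreover have "space (jump_filtration P q N t) = space P"
    by (simp add: jump_filtration_def space_measure_of_conv)
  ultimately show ?thesis by (auto simp: measurable_def)
qed

lemma X_measurable: "0 \<le> t \<Longrightarrow> X x t \<in> borel_measurable P"
  using measurable_outside[OF X_outside] .

text \<open>At time 0 the drift is integrated over a null set and the jump integral over the empty
  interval \<open>{0<..0}\<close>.\<close>

lemma X_0: "AE \<omega> in P. X x 0 \<omega> = x"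
  using AE_path[of x]
proof eventually_elim
  case (elim \<omega>)
  then interpret jump_path k q b \<gamma> h \<eta> c\<^sub>0 B "N \<omega>" "\<lambda>t. X x t \<omega>" x .
  have "(LBINT s:{0..0}. b (X x s \<omega>)) = 0"
    unfolding set_lebesgue_integral_def
    by (intro integral_eq_zero_AE) (use AE_lborel_singleton[of 0] in \<open>auto elim: eventually_mono\<close>)
  then show ?case using equation[of 0] by (simp add: case_prod_beta')
qed

end

locale truncated_sde = jump_sde k q b \<gamma> h \<eta> c\<^sub>0 B P \<mu> N p X + truncated_jumps k q b \<gamma> h \<eta> c\<^sub>0 B G
  for k and q :: "'g measure" and b \<gamma> h \<eta> c\<^sub>0 B and P :: "'w measure" and \<mu> N p X G +
  fixes K :: real
  assumes K: "0 \<le> K" "\<And>z. z \<in> G \<Longrightarrow> \<eta> z \<le> K"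
begin

definition tail where "tail = (\<integral>z. indicator (space q - G) z * \<eta> z \<partial>q)"

lemma tail_nonneg: "0 \<le> tail"
  unfolding tail_def using \<eta>_nonneg by (intro Bochner_Integration.integral_nonneg_AE AE_I2) auto

definition remainder where
  "remainder t \<epsilon> \<omega> = enn2real (\<integral>\<^sup>+e. indicator (window t (t + \<epsilon>) (space q - G)) e * ennreal (envelope e) \<partial>N \<omega>)"

lemma remainder_outside:
  assumes t: "0 \<le> t"
  shows "remainder t \<epsilon> \<in> borel_measurable (outside (window t (t + \<epsilon>) G))"
proof -
  have "(\<lambda>\<omega>. \<integral>\<^sup>+e. ennreal (envelope e) * indicator (window t (t + \<epsilon>) (space q - G)) e \<partial>N \<omega>)
      \<in> borel_measurable (outside (window t (t + \<epsilon>) G))"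
  proof (rule measurable_nn_integral_N)
    show "window t (t + \<epsilon>) (space q - G) \<in> sets \<mu>" using t G by (intro window_\<mu>) auto
    fix A assume "A \<in> sets \<mu>" "A \<subseteq> window t (t + \<epsilon>) (space q - G)"
    then show "(\<lambda>\<omega>. emeasure (N \<omega>) A) \<in> borel_measurable (outside (window t (t + \<epsilon>) G))"
      by (intro measurable_count_outside) (auto simp: window_def)
  qed auto
  then show ?thesis unfolding remainder_def[abs_def] by (simp add: mult.commute)
qed

lemma mean_remainder:
  assumes t: "0 \<le> t" "0 \<le> \<epsilon>"
  shows "(\<integral>\<^sup>+\<omega>. ennreal (remainder t \<epsilon> \<omega>) \<partial>P) \<le> ennreal (\<epsilon> * B * tail)"
proof -
  let ?D = "window t (t + \<epsilon>) (space q - G)"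
  have D [measurable]: "?D \<in> sets \<mu>" using t G by (intro window_\<mu>) auto
  have "(\<integral>\<^sup>+\<omega>. ennreal (remainder t \<epsilon> \<omega>) \<partial>P) \<le> (\<integral>\<^sup>+\<omega>. (\<integral>\<^sup>+e. indicator ?D e * ennreal (envelope e) \<partial>N \<omega>) \<partial>P)"
  proof (unfold remainder_def, intro nn_integral_mono)
    \<comment> \<open>Only an inequality, since \<open>enn2real\<close> sends infinity to 0.\<close>
    show "ennreal (enn2real a) \<le> a" for a by (cases a) simp_all
  qed
  also have "\<dots> = (\<integral>\<^sup>+e. indicator ?D e * ennreal (envelope e) \<partial>\<mu>)"
    by (rule nn_integral_N(2)) measurable
  also have "\<dots> = (\<integral>\<^sup>+e. indicator ?D e * indicator {0..B} (fst (snd e)) * ennreal (\<eta> (snd (snd e))) \<partial>\<mu>)"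
    by (intro nn_integral_cong) (auto simp: envelope_def indicator_def)
  also have "\<dots> = ennreal \<epsilon> * ennreal B * ennreal tail"
    using t B G by (subst nn_integral_window) (auto simp: \<eta>_nn_integral tail_def)
  also have "\<dots> = ennreal (\<epsilon> * B * tail)"
    using t B tail_nonneg by (simp add: ennreal_mult)
  finally show ?thesis .
qed

lemma emeasure_window:
  assumes t: "0 \<le> t" "0 \<le> \<epsilon>"
  shows "emeasure \<mu> (window t (t + \<epsilon>) G) = ennreal (\<epsilon> * B * rate)" "measure \<mu> (window t (t + \<epsilon>) G) = \<epsilon> * B * rate"
proof -
  have "emeasure \<mu> (window t (t + \<epsilon>) G) = ennreal \<epsilon> * ennreal B * emeasure q G"
    unfolding window_def using t B G by (subst emeasure_box) (auto intro: half_line_Ioc half_line_Icc)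
  also have "emeasure q G = ennreal rate" using G by (simp add: rate_def emeasure_eq_ennreal_measure less_top)
  finally show *: "emeasure \<mu> (window t (t + \<epsilon>) G) = ennreal (\<epsilon> * B * rate)"
    using t B rate_nonneg by (simp add: ennreal_mult)
  show "measure \<mu> (window t (t + \<epsilon>) G) = \<epsilon> * B * rate"
    using * t B rate_nonneg by (simp add: measure_def)
qed

text \<open>Splitting the strip \<open>{0..B}\<close> at the height \<open>\<gamma> x\<close> into
  accepted and rejected candidates turns the integral over heights into the weights
  \<open>\<gamma> x\<close> and \<open>B - \<gamma> x\<close> of the one-step operator.\<close>

lemma landing_integral:
  assumes t: "0 \<le> t" "0 \<le> \<epsilon>" and [measurable]: "\<phi> \<in> borel_measurable borel" and M: "\<And>x. \<bar>\<phi> x\<bar> \<le> M"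
  shows "(\<integral>e. \<phi> (landing x e) \<partial>density \<mu> (indicator (window t (t + \<epsilon>) G))) =
    \<epsilon> * (\<gamma> x * (\<integral>z. \<phi> (x + h x z) \<partial>\<rho>) + (B - \<gamma> x) * rate * \<phi> x)"
proof -
  let ?D = "window t (t + \<epsilon>) G"
  let ?m = "density \<mu> (indicator ?D)"
  have D [measurable]: "?D \<in> sets \<mu>" using t G by (intro window_\<mu>) auto
  have em: "emeasure ?m (space ?m) = ennreal (\<epsilon> * B * rate)"
    using sets.sets_into_space[OF D] emeasure_window[OF t]
    by (simp add: emeasure_density indicator_inter_arith[symmetric] Int_absorb1)
  interpret D: finite_measure ?m by (rule finite_measureI) (simp only: em, simp)
  have [measurable]: "landing x \<in> borel_measurable \<mu>"
  proof -
    have "(\<lambda>e. x + h x (snd (snd e)) * (if fst (snd e) \<le> \<gamma> x then 1 else 0)) \<in> borel_measurable \<mu>"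
      by measurable
    also have "(\<lambda>e. x + h x (snd (snd e)) * (if fst (snd e) \<le> \<gamma> x then 1 else 0)) = landing x"
      by (auto simp: landing_def fun_eq_iff)
    finally show ?thesis .
  qed
  have int: "integrable ?m (\<lambda>e. \<phi> (landing x e))"
    using M by (intro D.integrable_const_bound[of _ M]) auto
  let ?\<psi> = "\<lambda>x. \<phi> x + M"
  have \<psi>0: "0 \<le> ?\<psi> x" for x using M[of x] by linarith
  have i\<rho>: "integrable \<rho> (\<lambda>z. \<phi> (x + h x z))" by (rule integrable_jump) (use M in auto)
  let ?J = "\<integral>z. \<phi> (x + h x z) \<partial>\<rho>"
  have J: "(\<integral>\<^sup>+z. indicator G z * ennreal (?\<psi> (x + h x z)) \<partial>q) = ennreal (?J + rate * M)"
  proof -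
    have "(\<integral>\<^sup>+z. indicator G z * ennreal (?\<psi> (x + h x z)) \<partial>q) = (\<integral>\<^sup>+z. ennreal (?\<psi> (x + h x z)) \<partial>\<rho>)"
      unfolding \<rho>_def using G by (subst nn_integral_density) auto
    also have "\<dots> = ennreal (\<integral>z. ?\<psi> (x + h x z) \<partial>\<rho>)"
      using i\<rho> \<psi>0 by (intro nn_integral_eq_integral) auto
    also have "(\<integral>z. ?\<psi> (x + h x z) \<partial>\<rho>) = ?J + rate * M" using i\<rho> by (simp add: emeasure_\<rho>(2))
    finally show ?thesis .
  qed
  have J0: "0 \<le> ?J + rate * M"
  proof -
    have "?J + rate * M = (\<integral>z. ?\<psi> (x + h x z) \<partial>\<rho>)" using i\<rho> by (simp add: emeasure_\<rho>(2))
    also have "0 \<le> \<dots>" using \<psi>0 by (intro Bochner_Integration.integral_nonneg) auto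
    finally show ?thesis .
  qed
  have rG: "(\<integral>\<^sup>+z. indicator G z * ennreal (?\<psi> x) \<partial>q) = ennreal (rate * ?\<psi> x)"
    using G \<psi>0[of x] rate_nonneg
    by (simp add: nn_integral_multc ennreal_mult rate_def emeasure_eq_ennreal_measure less_top)
  have \<gamma>x: "0 \<le> \<gamma> x" "\<gamma> x \<le> B" using \<gamma>(2) \<gamma>_le by auto
  have "ennreal (\<integral>e. ?\<psi> (landing x e) \<partial>?m) = (\<integral>\<^sup>+e. ennreal (?\<psi> (landing x e)) \<partial>?m)"
    using int \<psi>0 by (intro nn_integral_eq_integral[symmetric]) auto
  also have "\<dots> = (\<integral>\<^sup>+e. indicator ?D e * ennreal (?\<psi> (landing x e)) \<partial>\<mu>)"
    by (rule nn_integral_density) measurable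
  also have "\<dots> = (\<integral>\<^sup>+e. indicator ?D e * indicator {0..\<gamma> x} (fst (snd e)) * ennreal (?\<psi> (x + h x (snd (snd e)))) +
      indicator ?D e * indicator {\<gamma> x<..B} (fst (snd e)) * ennreal (?\<psi> x) \<partial>\<mu>)"
    by (intro nn_integral_cong) (auto simp: landing_def window_def indicator_def)
  also have "\<dots> = (\<integral>\<^sup>+e. indicator ?D e * indicator {0..\<gamma> x} (fst (snd e)) * ennreal (?\<psi> (x + h x (snd (snd e)))) \<partial>\<mu>) +
      (\<integral>\<^sup>+e. indicator ?D e * indicator {\<gamma> x<..B} (fst (snd e)) * ennreal (?\<psi> x) \<partial>\<mu>)"
    by (rule nn_integral_add) measurable
  also have "(\<integral>\<^sup>+e. indicator ?D e * indicator {0..\<gamma> x} (fst (snd e)) * ennreal (?\<psi> (x + h x (snd (snd e)))) \<partial>\<mu>) =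
      ennreal \<epsilon> * ennreal (\<gamma> x) * ennreal (?J + rate * M)"
    using nn_integral_window[OF t(1), of "t + \<epsilon>" "{0..\<gamma> x}" "\<lambda>z. ennreal (?\<psi> (x + h x z))" G] t \<gamma>x G
    by (simp add: J)
  also have "(\<integral>\<^sup>+e. indicator ?D e * indicator {\<gamma> x<..B} (fst (snd e)) * ennreal (?\<psi> x) \<partial>\<mu>) =
      ennreal \<epsilon> * ennreal (B - \<gamma> x) * ennreal (rate * ?\<psi> x)"
    using nn_integral_window[OF t(1), of "t + \<epsilon>" "{\<gamma> x<..B}" "\<lambda>z. ennreal (?\<psi> x)" G] t \<gamma>x G
    by (simp add: rG greaterThanAtMost_subseteq_atLeastAtMost_iff)
  also have "ennreal \<epsilon> * ennreal (\<gamma> x) * ennreal (?J + rate * M) + ennreal \<epsilon> * ennreal (B - \<gamma> x) * ennreal (rate * ?\<psi> x) =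
      ennreal (\<epsilon> * \<gamma> x * (?J + rate * M) + \<epsilon> * (B - \<gamma> x) * (rate * ?\<psi> x))"
    using t \<gamma>x J0 rate_nonneg \<psi>0[of x] by (simp add: ennreal_mult ennreal_plus mult_nonneg_nonneg)
  finally have "(\<integral>e. ?\<psi> (landing x e) \<partial>?m) = \<epsilon> * \<gamma> x * (?J + rate * M) + \<epsilon> * (B - \<gamma> x) * (rate * ?\<psi> x)"
    using t \<gamma>x J0 rate_nonneg \<psi>0
    by (subst (asm) ennreal_inj) (auto intro!: Bochner_Integration.integral_nonneg add_nonneg_nonneg mult_nonneg_nonneg)
  moreover have "(\<integral>e. ?\<psi> (landing x e) \<partial>?m) = (\<integral>e. \<phi> (landing x e) \<partial>?m) + (\<epsilon> * B * rate) * M"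
    using int em t B rate_nonneg by (simp add: measure_def)
  ultimately show ?thesis by (simp add: algebra_simps)
qed

text \<open>The heights with doubtful decision form an interval of length at most
  \<open>2 * (B * (B * \<epsilon> + R))\<close>, so the error is the small mean number of candidates
  times the small displacement. \<open>4 * M\<close> is \<open>2 * M\<close> times the 2 in that
  length.\<close>

lemma discrepancy_integral:
  assumes t: "0 \<le> t" "0 \<le> \<epsilon>" and LM: "0 \<le> L" "0 \<le> M" "0 \<le> R"
  shows "(\<integral>\<^sup>+e. ennreal (discrepancy \<epsilon> K L M x R e) \<partial>density \<mu> (indicator (window t (t + \<epsilon>) G)))
    \<le> ennreal ((L * (1 + K) + 4 * M) * (\<epsilon> * B * rate) * (B * \<epsilon> + R))"
proof -
  let ?D = "window t (t + \<epsilon>) G" and ?d = "B * \<epsilon> + R"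
  define U where "U = {\<gamma> x - B * ?d..\<gamma> x + B * ?d} \<inter> {0..B}"
  have D [measurable]: "?D \<in> sets \<mu>" using t G by (intro window_\<mu>) auto
  have d: "0 \<le> ?d" using t B LM by simp
  have U: "emeasure lborel U \<le> ennreal (2 * (B * ?d))"
  proof -
    have "emeasure lborel U \<le> emeasure lborel {\<gamma> x - B * ?d..\<gamma> x + B * ?d}"
      unfolding U_def by (intro emeasure_mono) auto
    also have "\<dots> = ennreal (2 * (B * ?d))" using d B by simp
    finally show ?thesis .
  qed
  have [measurable]: "discrepancy \<epsilon> K L M x R \<in> borel_measurable \<mu>"
    unfolding discrepancy_def by measurable
  have "(\<integral>\<^sup>+e. ennreal (discrepancy \<epsilon> K L M x R e) \<partial>density \<mu> (indicator ?D)) =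
      (\<integral>\<^sup>+e. indicator ?D e * ennreal (discrepancy \<epsilon> K L M x R e) \<partial>\<mu>)"
    by (rule nn_integral_density) measurable
  also have "\<dots> \<le> (\<integral>\<^sup>+e. ennreal (L * (1 + K) * ?d) * indicator ?D e +
      ennreal (2 * M) * (indicator ?D e * indicator U (fst (snd e)) * 1) \<partial>\<mu>)"
  proof (intro nn_integral_mono)
    fix e
    have "0 \<le> L * (1 + K) * ?d" using LM K d by simp
    then show "indicator ?D e * ennreal (discrepancy \<epsilon> K L M x R e) \<le> ennreal (L * (1 + K) * ?d) * indicator ?D e +
      ennreal (2 * M) * (indicator ?D e * indicator U (fst (snd e)) * 1)"
      using LM
      by (auto simp: indicator_def discrepancy_def U_def window_def abs_le_iff ennreal_plus[symmetric] simp del: ennreal_plus)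
  qed
  also have "\<dots> = ennreal (L * (1 + K) * ?d) * emeasure \<mu> ?D + ennreal (2 * M) * (\<integral>\<^sup>+e. indicator ?D e * indicator U (fst (snd e)) * 1 \<partial>\<mu>)"
    unfolding U_def by (subst nn_integral_add) (simp_all add: nn_integral_cmult)
  also have "(\<integral>\<^sup>+e. indicator ?D e * indicator U (fst (snd e)) * 1 \<partial>\<mu>) = ennreal \<epsilon> * emeasure lborel U * emeasure q G"
    using nn_integral_window[OF t(1), of "t + \<epsilon>" U "\<lambda>_. 1" G] t G by (simp add: U_def)
  also have "emeasure q G = ennreal rate" using G by (simp add: rate_def emeasure_eq_ennreal_measure less_top)
  also have "ennreal (L * (1 + K) * ?d) * emeasure \<mu> ?D + ennreal (2 * M) * (ennreal \<epsilon> * emeasure lborel U * ennreal rate)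
      \<le> ennreal (L * (1 + K) * ?d) * emeasure \<mu> ?D + ennreal (2 * M) * (ennreal \<epsilon> * ennreal (2 * (B * ?d)) * ennreal rate)"
    using U by (intro add_left_mono mult_left_mono mult_mono) auto
  also have "ennreal (L * (1 + K) * ?d) * emeasure \<mu> ?D + ennreal (2 * M) * (ennreal \<epsilon> * ennreal (2 * (B * ?d)) * ennreal rate) =
      ennreal (L * (1 + K) * ?d * (\<epsilon> * B * rate) + 2 * M * (\<epsilon> * (2 * (B * ?d)) * rate))"
  proof -
    have "ennreal a1 * ennreal a2 + ennreal a3 * (ennreal a4 * ennreal a5 * ennreal a6) = ennreal (a1 * a2 + a3 * (a4 * a5 * a6))"
      if "0 \<le> a1" "0 \<le> a2" "0 \<le> a3" "0 \<le> a4" "0 \<le> a5" "0 \<le> a6" for a1 a2 a3 a4 a5 a6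
      using that by (simp add: ennreal_mult ennreal_plus)
    then show ?thesis
      unfolding emeasure_window[OF t] using LM K d t B rate_nonneg by (simp only: mult_nonneg_nonneg)
  qed
  also have "L * (1 + K) * ?d * (\<epsilon> * B * rate) + 2 * M * (\<epsilon> * (2 * (B * ?d)) * rate) =
      (L * (1 + K) + 4 * M) * (\<epsilon> * B * rate) * ?d" by (simp add: algebra_simps)
  finally show ?thesis .
qed

lemma landing_pair_measurable:
  "(\<lambda>w. landing (fst w) (snd w)) \<in> borel_measurable (borel \<Otimes>\<^sub>M \<mu>)"
proof -
  have "(\<lambda>w. fst w + h (fst w) (snd (snd (snd w))) * (if fst (snd (snd w)) \<le> \<gamma> (fst w) then 1 else 0)) \<in> borel_measurable (borel \<Otimes>\<^sub>M \<mu>)"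
    by measurable
  also have "(\<lambda>w. fst w + h (fst w) (snd (snd (snd w))) * (if fst (snd (snd w)) \<le> \<gamma> (fst w) then 1 else 0)) = (\<lambda>w. landing (fst w) (snd w))"
    by (auto simp: landing_def fun_eq_iff)
  finally show ?thesis .
qed

text \<open>Position and remainder are both measurable off the window, so the candidates in it may
  be replaced by their intensity, which turns the mean of the random prediction
  \<open>\<Psi>\<close> into that of \<open>one_step\<close>. The error is of second order in
  \<open>\<epsilon>\<close> with a constant depending on \<open>G\<close>, plus a multiple of
  \<open>\<epsilon> * tail\<close> whose factor does not depend on \<open>G\<close>.\<close>

lemma one_step_consistent:
  assumes t: "0 \<le> t" "0 \<le> \<epsilon>" "\<epsilon> \<le> 1" and \<phi>: "\<phi> \<in> borel_measurable borel" "\<And>x. \<bar>\<phi> x\<bar> \<le> M"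
    and L: "\<And>x y. \<bar>\<phi> x - \<phi> y\<bar> \<le> L * \<bar>x - y\<bar>" and \<epsilon>: "\<epsilon> * B * rate \<le> 1"
  shows "\<bar>(\<integral>\<omega>. \<phi> (X x (t + \<epsilon>) \<omega>) \<partial>P) - (\<integral>\<omega>. one_step \<rho> \<epsilon> \<phi> (X x t \<omega>) \<partial>P)\<bar>
    \<le> \<epsilon>\<^sup>2 * (L * B\<^sup>2 + (L * (1 + K) + 4 * M) * (B * rate) * (B + B * tail) + 3 * M * (B * rate)\<^sup>2)
      + \<epsilon> * (L * (B + 1) * B * tail)"
proof -
  let ?D = "window t (t + \<epsilon>) G" and ?R = "remainder t \<epsilon>"
  let ?\<mu> = "density \<mu> (indicator ?D)" and ?N = "local_N ?D"
  have D: "?D \<in> sets \<mu>" "emeasure \<mu> ?D < \<infinity>"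
    using t G window_\<mu> emeasure_window[of t \<epsilon>] by auto
  note [measurable] = \<phi>(1) D(1)
  have L0: "0 \<le> L" using L[of 0 1] by auto
  have M0: "0 \<le> M" using \<phi>(2)[of 0] by linarith
  have R0: "0 \<le> ?R \<omega>" for \<omega> by (simp add: remainder_def)
  have X1: "X x t \<in> borel_measurable (outside ?D)" using X_outside[OF t(1)] .
  have XP [measurable]: "X x t \<in> borel_measurable P" "X x (t + \<epsilon>) \<in> borel_measurable P"
    using X_measurable t by auto
  have R1: "?R \<in> borel_measurable (outside ?D)" using remainder_outside[OF t(1)] .
  have [measurable]: "?R \<in> borel_measurable P" using measurable_outside[OF R1] .
  define y where "y z = z + \<epsilon> * b z" for z
  have [measurable]: "y \<in> borel_measurable borel" unfolding y_def by measurable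
  define g where "g w = \<phi> (landing (fst w) (snd w)) - \<phi> (y (fst w))" for w
  have g: "g \<in> borel_measurable (borel \<Otimes>\<^sub>M \<mu>)" "\<And>w. \<bar>g w\<bar> \<le> 2 * M"
  proof -
    note [measurable] = landing_pair_measurable
    show "g \<in> borel_measurable (borel \<Otimes>\<^sub>M \<mu>)" unfolding g_def by measurable
    show "\<bar>g w\<bar> \<le> 2 * M" for w
      unfolding g_def using \<phi>(2)[of "landing (fst w) (snd w)"] \<phi>(2)[of "y (fst w)"] by linarith
  qed
  note gN = integral_local[OF D X1 g]
  define \<Psi> where "\<Psi> \<omega> = \<phi> (y (X x t \<omega>)) + (\<integral>e. g (X x t \<omega>, e) \<partial>?N \<omega>)" for \<omega>
  have i\<phi>: "integrable P (\<lambda>\<omega>. \<phi> (f \<omega>))" if "f \<in> borel_measurable P" for f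
    using that \<phi>(2) by (intro integrable_const_bound[of _ M]) auto
  have i\<phi>y: "integrable P (\<lambda>\<omega>. \<phi> (y (X x t \<omega>)))" by (rule i\<phi>) measurable
  have i\<Psi>: "integrable P \<Psi>" unfolding \<Psi>_def using gN(1) i\<phi>y by (intro Bochner_Integration.integrable_add)
  have one: "\<phi> (y z) + (\<integral>e. g (z, e) \<partial>?\<mu>) = one_step \<rho> \<epsilon> \<phi> z" for z
  proof -
    have em: "emeasure ?\<mu> (space ?\<mu>) = ennreal (\<epsilon> * B * rate)"
      using sets.sets_into_space[OF D(1)] emeasure_window[OF t(1,2)]
      by (simp add: emeasure_density indicator_inter_arith[symmetric] Int_absorb1)
    interpret F: finite_measure ?\<mu> by (rule finite_measureI) (simp only: em, simp)
    have land: "landing z \<in> borel_measurable \<mu>"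
      using measurable_compose[OF measurable_Pair1'[of z borel \<mu>] landing_pair_measurable] by simp
    have "integrable ?\<mu> (\<lambda>e. \<phi> (landing z e))"
      using \<phi>(2) land by (intro F.integrable_const_bound[of _ M]) auto
    then have "(\<integral>e. g (z, e) \<partial>?\<mu>) = (\<integral>e. \<phi> (landing z e) \<partial>?\<mu>) - \<epsilon> * B * rate * \<phi> (y z)"
      using em t B rate_nonneg unfolding g_def by (simp add: measure_def)
    then show ?thesis
      unfolding landing_integral[OF t(1,2) \<phi>] one_step_eq[OF \<phi>] y_def by (simp add: algebra_simps)
  qed
  have "(\<integral>\<omega>. \<Psi> \<omega> \<partial>P) = (\<integral>\<omega>. \<phi> (y (X x t \<omega>)) \<partial>P) + (\<integral>\<omega>. (\<integral>e. g (X x t \<omega>, e) \<partial>?\<mu>) \<partial>P)"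
    unfolding \<Psi>_def using gN(1) i\<phi>y by (simp add: gN(2))
  also have "\<dots> = (\<integral>\<omega>. one_step \<rho> \<epsilon> \<phi> (X x t \<omega>) \<partial>P)"
    using gN(3) i\<phi>y by (simp add: one[symmetric])
  finally have \<Psi>: "(\<integral>\<omega>. \<Psi> \<omega> \<partial>P) = (\<integral>\<omega>. one_step \<rho> \<epsilon> \<phi> (X x t \<omega>) \<partial>P)" .
  let ?E1 = "\<lambda>\<omega>. ennreal (L * (\<epsilon> * (B * (B * \<epsilon> + ?R \<omega>)) + ?R \<omega>))"
  let ?E2 = "\<lambda>\<omega>. \<integral>\<^sup>+e. ennreal (discrepancy \<epsilon> K L M (X x t \<omega>) (?R \<omega>) e) \<partial>?N \<omega>"
  let ?E3 = "\<lambda>\<omega>. ennreal (3 * M) * (if emeasure (N \<omega>) ?D = 1 then 0 else emeasure (N \<omega>) ?D)"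
  have AE: "AE \<omega> in P. ennreal \<bar>\<phi> (X x (t + \<epsilon>) \<omega>) - \<Psi> \<omega>\<bar> \<le> ?E1 \<omega> + ?E2 \<omega> + ?E3 \<omega>"
    using AE_path[of x] AE_finite_count[OF D]
  proof eventually_elim
    case (elim \<omega>)
    then interpret J: jump_path k q b \<gamma> h \<eta> c\<^sub>0 B "N \<omega>" "\<lambda>t. X x t \<omega>" x by simp
    have N: "?N \<omega> = density (N \<omega>) (indicator ?D)" using elim(2) by (simp add: local_N_def)
    have R: "J.residual t \<epsilon> G = ?R \<omega>" by (simp add: J.residual_def J.activity_def remainder_def)
    from J.step_error[OF t(1,2) G(1) K(2,1) \<phi> L elim(2)] show ?case
      unfolding \<Psi>_def N R g_def y_def by simp
  qed
  \<comment> \<open>The discrepancy depends on the remainder as well as on the position, so the pair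
    is frozen.\<close>
  have pairZ: "(\<lambda>\<omega>. (X x t \<omega>, ?R \<omega>)) \<in> measurable (outside ?D) (borel \<Otimes>\<^sub>M borel)"
    using X1 R1 by (rule measurable_Pair)
  have disc: "(\<lambda>w. ennreal (discrepancy \<epsilon> K L M (fst (fst w)) (snd (fst w)) (snd w))) \<in> borel_measurable ((borel \<Otimes>\<^sub>M borel) \<Otimes>\<^sub>M \<mu>)"
    unfolding discrepancy_def indicator_def of_bool_def atMost_iff by measurable
  note E2 = nn_integral_local[OF D pairZ disc, simplified]
  have E1m: "?E1 \<in> borel_measurable P" by measurable
  have E3m: "?E3 \<in> borel_measurable P" by measurable
  have I1: "(\<integral>\<^sup>+\<omega>. ?E1 \<omega> \<partial>P) \<le> ennreal (\<epsilon>\<^sup>2 * (L * B\<^sup>2) + \<epsilon> * (L * (B + 1) * B * tail))"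
  proof -
    have "?E1 \<omega> = ennreal (\<epsilon>\<^sup>2 * (L * B\<^sup>2)) + ennreal (L * (\<epsilon> * B + 1)) * ennreal (?R \<omega>)" for \<omega>
      using t L0 B R0[of \<omega>]
      by (simp add: ennreal_mult[symmetric] ennreal_plus[symmetric] algebra_simps power2_eq_square del: ennreal_plus)
    then have "(\<integral>\<^sup>+\<omega>. ?E1 \<omega> \<partial>P) = ennreal (\<epsilon>\<^sup>2 * (L * B\<^sup>2)) + ennreal (L * (\<epsilon> * B + 1)) * (\<integral>\<^sup>+\<omega>. ennreal (?R \<omega>) \<partial>P)"
      by (simp add: nn_integral_add nn_integral_cmult emeasure_space_1)
    also have "\<dots> \<le> ennreal (\<epsilon>\<^sup>2 * (L * B\<^sup>2)) + ennreal (L * (\<epsilon> * B + 1)) * ennreal (\<epsilon> * B * tail)"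
      using mean_remainder[OF t(1,2)] by (intro add_left_mono mult_left_mono) auto
    also have "\<dots> = ennreal (\<epsilon>\<^sup>2 * (L * B\<^sup>2) + L * (\<epsilon> * B + 1) * (\<epsilon> * B * tail))"
      using t L0 B tail_nonneg
      by (simp add: ennreal_mult[symmetric] ennreal_plus[symmetric] del: ennreal_plus)
    also have "\<dots> \<le> ennreal (\<epsilon>\<^sup>2 * (L * B\<^sup>2) + L * (1 * B + 1) * (\<epsilon> * B * tail))"
      using t L0 B tail_nonneg
      by (intro ennreal_leI add_left_mono mult_right_mono mult_left_mono add_right_mono) auto
    finally show ?thesis by (simp add: algebra_simps)
  qed
  define c where "c = (L * (1 + K) + 4 * M) * (\<epsilon> * B * rate)"
  have c0: "0 \<le> c" using L0 M0 K t B rate_nonneg by (simp add: c_def)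
  have I2: "(\<integral>\<^sup>+\<omega>. ?E2 \<omega> \<partial>P) \<le> ennreal (c * (B * \<epsilon> + \<epsilon> * B * tail))"
  proof -
    have "(\<integral>\<^sup>+\<omega>. ?E2 \<omega> \<partial>P) = (\<integral>\<^sup>+\<omega>. (\<integral>\<^sup>+e. ennreal (discrepancy \<epsilon> K L M (X x t \<omega>) (?R \<omega>) e) \<partial>?\<mu>) \<partial>P)"
      using E2 by blast
    also have "\<dots> \<le> (\<integral>\<^sup>+\<omega>. ennreal (c * (B * \<epsilon> + ?R \<omega>)) \<partial>P)"
      unfolding c_def by (intro nn_integral_mono discrepancy_integral t L0 M0 R0)
    also have "\<dots> = (\<integral>\<^sup>+\<omega>. ennreal (c * (B * \<epsilon>)) + ennreal c * ennreal (?R \<omega>) \<partial>P)"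
    proof (rule nn_integral_cong)
      fix \<omega>
      have "0 \<le> c * (B * \<epsilon>)" "0 \<le> c * ?R \<omega>" using c0 B t R0[of \<omega>] by (simp_all del: mult_eq_0_iff)
      then show "ennreal (c * (B * \<epsilon> + ?R \<omega>)) = ennreal (c * (B * \<epsilon>)) + ennreal c * ennreal (?R \<omega>)"
        unfolding distrib_left by (simp only: ennreal_plus ennreal_mult[OF c0 R0])
    qed
    also have "\<dots> = ennreal (c * (B * \<epsilon>)) + ennreal c * (\<integral>\<^sup>+\<omega>. ennreal (?R \<omega>) \<partial>P)"
      by (simp add: nn_integral_add nn_integral_cmult emeasure_space_1)
    also have "\<dots> \<le> ennreal (c * (B * \<epsilon>)) + ennreal c * ennreal (\<epsilon> * B * tail)"
      using mean_remainder[OF t(1,2)] by (intro add_left_mono mult_left_mono) auto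
    also have "\<dots> = ennreal (c * (B * \<epsilon> + \<epsilon> * B * tail))"
    proof -
      have "0 \<le> c * (B * \<epsilon>)" "0 \<le> \<epsilon> * B * tail" using c0 B t tail_nonneg by (simp_all del: mult_eq_0_iff)
      then show ?thesis
        using mult_nonneg_nonneg[OF c0, of "\<epsilon> * B * tail"]
        unfolding distrib_left by (simp only: ennreal_plus ennreal_mult[OF c0])
    qed
    finally show ?thesis .
  qed
  have I3: "(\<integral>\<^sup>+\<omega>. ?E3 \<omega> \<partial>P) \<le> ennreal (3 * M * (\<epsilon> * B * rate)\<^sup>2)"
  proof -
    have "(\<integral>\<^sup>+\<omega>. ?E3 \<omega> \<partial>P) = ennreal (3 * M) * (\<integral>\<^sup>+\<omega>. (if emeasure (N \<omega>) ?D = 1 then 0 else emeasure (N \<omega>) ?D) \<partial>P)"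
      by (rule nn_integral_cmult) measurable
    also have "\<dots> \<le> ennreal (3 * M) * ennreal ((measure \<mu> ?D)\<^sup>2)"
      by (intro mult_left_mono mean_multiple_count D) simp
    also have "\<dots> = ennreal (3 * M * (\<epsilon> * B * rate)\<^sup>2)"
      unfolding emeasure_window(2)[OF t(1,2)] using M0 by (subst ennreal_mult) auto
    finally show ?thesis .
  qed
  have "ennreal \<bar>(\<integral>\<omega>. \<phi> (X x (t + \<epsilon>) \<omega>) \<partial>P) - (\<integral>\<omega>. \<Psi> \<omega> \<partial>P)\<bar> = ennreal (norm (\<integral>\<omega>. \<phi> (X x (t + \<epsilon>) \<omega>) - \<Psi> \<omega> \<partial>P))"
    using i\<phi>[OF XP(2)] i\<Psi> by simp
  also have "\<dots> \<le> (\<integral>\<^sup>+\<omega>. ennreal (norm (\<phi> (X x (t + \<epsilon>) \<omega>) - \<Psi> \<omega>)) \<partial>P)"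
    using i\<phi>[OF XP(2)] i\<Psi> by (intro integral_norm_bound_ennreal) auto
  also have "\<dots> \<le> (\<integral>\<^sup>+\<omega>. ?E1 \<omega> + ?E2 \<omega> + ?E3 \<omega> \<partial>P)"
    using AE by (intro nn_integral_mono_AE) simp
  also have "\<dots> = (\<integral>\<^sup>+\<omega>. ?E1 \<omega> \<partial>P) + (\<integral>\<^sup>+\<omega>. ?E2 \<omega> \<partial>P) + (\<integral>\<^sup>+\<omega>. ?E3 \<omega> \<partial>P)"
    using E1m E3m E2 by (simp only: nn_integral_add borel_measurable_add)
  also have "\<dots> \<le> ennreal (\<epsilon>\<^sup>2 * (L * B\<^sup>2) + \<epsilon> * (L * (B + 1) * B * tail)) + ennreal (c * (B * \<epsilon> + \<epsilon> * B * tail)) + ennreal (3 * M * (\<epsilon> * B * rate)\<^sup>2)"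
    by (intro add_mono I1 I2 I3)
  also have "\<dots> = ennreal (\<epsilon>\<^sup>2 * (L * B\<^sup>2) + \<epsilon> * (L * (B + 1) * B * tail) + c * (B * \<epsilon> + \<epsilon> * B * tail) + 3 * M * (\<epsilon> * B * rate)\<^sup>2)"
    using t L0 M0 B tail_nonneg c0 rate_nonneg
    by (simp only: ennreal_plus add_nonneg_nonneg mult_nonneg_nonneg zero_le_power2 order_trans[OF zero_le_one B] zero_le_numeral zero_le_one)
  finally have "\<bar>(\<integral>\<omega>. \<phi> (X x (t + \<epsilon>) \<omega>) \<partial>P) - (\<integral>\<omega>. \<Psi> \<omega> \<partial>P)\<bar> \<le>
      \<epsilon>\<^sup>2 * (L * B\<^sup>2) + \<epsilon> * (L * (B + 1) * B * tail) + c * (B * \<epsilon> + \<epsilon> * B * tail) + 3 * M * (\<epsilon> * B * rate)\<^sup>2"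
    using t L0 M0 B tail_nonneg c0 rate_nonneg
    by (subst (asm) ennreal_le_iff) (auto intro!: add_nonneg_nonneg mult_nonneg_nonneg)
  then show ?thesis unfolding \<Psi> c_def by (simp add: power2_eq_square algebra_simps)
qed

end

section \<open>Convergence of the scheme\<close>

context truncated_sde
begin

definition Lipschitz_growth where "Lipschitz_growth = B + 2 * B * (\<integral>z. \<eta> z \<partial>q)"

lemma Lipschitz_growth_nonneg: "0 \<le> Lipschitz_growth"
  using B \<eta>_nonneg
  by (auto simp: Lipschitz_growth_def intro!: add_nonneg_nonneg mult_nonneg_nonneg Bochner_Integration.integral_nonneg_AE AE_I2)

lemma one_step_iterate_Lipschitz:
  assumes \<phi>: "\<phi> \<in> borel_measurable borel" "\<And>x. \<bar>\<phi> x\<bar> \<le> M" and L: "\<And>x y. \<bar>\<phi> x - \<phi> y\<bar> \<le> L * \<bar>x - y\<bar>"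
    and \<epsilon>: "0 \<le> \<epsilon>" "\<epsilon> * B * rate \<le> 1"
  shows "\<bar>(one_step \<rho> \<epsilon> ^^ i) \<phi> x - (one_step \<rho> \<epsilon> ^^ i) \<phi> y\<bar> \<le> L * (1 + \<epsilon> * Lipschitz_growth) ^ i * \<bar>x - y\<bar>"
proof (induction i arbitrary: x y)
  case (Suc i)
  have it: "(one_step \<rho> \<epsilon> ^^ i) \<phi> \<in> borel_measurable borel" "\<And>x. \<bar>(one_step \<rho> \<epsilon> ^^ i) \<phi> x\<bar> \<le> M"
    using one_step_iterate[OF \<phi> \<epsilon>, of i] by auto
  have "\<bar>one_step \<rho> \<epsilon> ((one_step \<rho> \<epsilon> ^^ i) \<phi>) x - one_step \<rho> \<epsilon> ((one_step \<rho> \<epsilon> ^^ i) \<phi>) y\<bar>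
      \<le> L * (1 + \<epsilon> * Lipschitz_growth) ^ i * (1 + \<epsilon> * Lipschitz_growth) * \<bar>x - y\<bar>"
    unfolding Lipschitz_growth_def by (rule one_step_Lipschitz[OF it Suc.IH[unfolded Lipschitz_growth_def] \<epsilon>])
  then show ?case by (simp add: mult_ac)
qed (use L in simp)

text \<open>Coefficient of \<open>\<epsilon>\<^sup>2\<close> in \<open>one_step_consistent\<close>;
  it depends on the truncation through \<open>K\<close>, \<open>rate\<close> and
  \<open>tail\<close>.\<close>

definition scheme_constant where
  "scheme_constant M L = L * B\<^sup>2 + (L * (1 + K) + 4 * M) * (B * rate) * (B + B * tail) + 3 * M * (B * rate)\<^sup>2"

text \<open>Telescoping from time \<open>t\<close> down to 0: each stage replaces one more window of
  the equation by one application of the operator, the iterated test function having Lipschitz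
  constant at most \<open>L * exp (t * Lipschitz_growth)\<close>. As
  \<open>m * \<epsilon> = t\<close>, summing the \<open>m\<close> local errors costs one power of
  \<open>\<epsilon>\<close>.\<close>

lemma scheme_error:
  assumes t: "0 \<le> t" and m: "m \<ge> 1" and \<epsilon>: "t / real m \<le> 1" "t / real m * B * rate \<le> 1"
    and \<phi>: "\<phi> \<in> borel_measurable borel" "\<And>x. \<bar>\<phi> x\<bar> \<le> M" and L: "\<And>x y. \<bar>\<phi> x - \<phi> y\<bar> \<le> L * \<bar>x - y\<bar>"
  shows "\<bar>(\<integral>\<omega>. \<phi> (X x t \<omega>) \<partial>P) - (one_step \<rho> (t / real m) ^^ m) \<phi> x\<bar>
    \<le> t * (t / real m * scheme_constant M (L * exp (t * Lipschitz_growth)) + L * exp (t * Lipschitz_growth) * (B + 1) * B * tail)"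
proof -
  define \<epsilon> where "\<epsilon> = t / real m"
  define L' where "L' = L * exp (t * Lipschitz_growth)"
  define e\<^sub>0 where "e\<^sub>0 = \<epsilon>\<^sup>2 * scheme_constant M L' + \<epsilon> * (L' * (B + 1) * B * tail)"
  have e: "0 \<le> \<epsilon>" "\<epsilon> \<le> 1" "\<epsilon> * B * rate \<le> 1" and me: "real m * \<epsilon> = t"
    using t m \<epsilon> by (auto simp: \<epsilon>_def)
  have L0: "0 \<le> L" using L[of 0 1] by auto
  let ?f = "\<lambda>i. (one_step \<rho> \<epsilon> ^^ i) \<phi>"
  have f: "?f i \<in> borel_measurable borel" "\<bar>?f i x\<bar> \<le> M" for i x
    using one_step_iterate[OF \<phi> e(1,3), of i] by auto
  have fL: "\<bar>?f i x - ?f i y\<bar> \<le> L' * \<bar>x - y\<bar>" if "i \<le> m" for i x y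
  proof -
    have "(1 + \<epsilon> * Lipschitz_growth) ^ i \<le> exp (\<epsilon> * Lipschitz_growth) ^ i"
      using e Lipschitz_growth_nonneg by (intro power_mono exp_ge_add_one_self) auto
    also have "\<dots> = exp (real i * (\<epsilon> * Lipschitz_growth))" by (simp add: exp_of_nat_mult)
    also have "\<dots> \<le> exp (real m * (\<epsilon> * Lipschitz_growth))"
      using that e Lipschitz_growth_nonneg by (simp add: mult_right_mono)
    also have "\<dots> = exp (t * Lipschitz_growth)" by (simp add: mult.assoc[symmetric] me)
    finally have "L * (1 + \<epsilon> * Lipschitz_growth) ^ i * \<bar>x - y\<bar> \<le> L' * \<bar>x - y\<bar>"
      unfolding L'_def using L0 by (intro mult_right_mono mult_left_mono) auto
    then show ?thesis using one_step_iterate_Lipschitz[OF \<phi> L e(1,3), of i x y] by linarith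
  qed
  have claim: "\<bar>(\<integral>\<omega>. \<phi> (X x t \<omega>) \<partial>P) - (\<integral>\<omega>. ?f i (X x (real (m - i) * \<epsilon>) \<omega>) \<partial>P)\<bar> \<le> real i * e\<^sub>0" if "i \<le> m" for i
    using that
  proof (induction i)
    case 0
    then show ?case by (simp add: me)
  next
    case (Suc i)
    have s: "real (m - i) * \<epsilon> = real (m - Suc i) * \<epsilon> + \<epsilon>"
      using Suc.prems by (simp add: of_nat_diff algebra_simps)
    have "\<bar>(\<integral>\<omega>. ?f i (X x (real (m - Suc i) * \<epsilon> + \<epsilon>) \<omega>) \<partial>P) - (\<integral>\<omega>. one_step \<rho> \<epsilon> (?f i) (X x (real (m - Suc i) * \<epsilon>) \<omega>) \<partial>P)\<bar> \<le> e\<^sub>0"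
      unfolding e\<^sub>0_def scheme_constant_def
      using Suc.prems e by (intro one_step_consistent f fL) auto
    then show ?case using Suc unfolding s by (simp add: algebra_simps)
  qed
  have "(\<integral>\<omega>. ?f m (X x 0 \<omega>) \<partial>P) = (\<integral>\<omega>. ?f m x \<partial>P)"
    using X_0[of x] f(1) X_measurable[of 0 x] by (intro integral_cong_AE) auto
  then have "\<bar>(\<integral>\<omega>. \<phi> (X x t \<omega>) \<partial>P) - ?f m x\<bar> \<le> real m * e\<^sub>0"
    using claim[of m] by (simp add: prob_space)
  also have "real m * e\<^sub>0 = (real m * \<epsilon>) * (\<epsilon> * scheme_constant M L' + L' * (B + 1) * B * tail)"
    by (simp add: e\<^sub>0_def power2_eq_square algebra_simps)
  finally show ?thesis unfolding me by (simp add: \<epsilon>_def L'_def)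
qed

end

context jump_sde
begin

text \<open>The lower bound on \<open>\<eta>\<close> makes the set of finite measure by Markov's
  inequality; the upper bound supplies the constant \<open>K\<close> of the truncated
  equation.\<close>

definition core where "core n = {z\<in>space q. 1 / real (Suc n) \<le> \<eta> z \<and> \<eta> z \<le> real (Suc n)}"

lemma core_sets: "core n \<in> sets q"
  unfolding core_def by measurable

lemma core_finite: "emeasure q (core n) < \<infinity>"
proof -
  have "emeasure q (core n) = (\<integral>\<^sup>+z. indicator (core n) z \<partial>q)" using core_sets by simp
  also have "\<dots> \<le> (\<integral>\<^sup>+z. ennreal (real (Suc n) * \<eta> z) \<partial>q)"
  proof (rule nn_integral_mono)
    fix z
    show "indicator (core n) z \<le> ennreal (real (Suc n) * \<eta> z)"
    proof (cases "z \<in> core n")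
      case True
      then have "1 \<le> real (Suc n) * \<eta> z"
        by (auto simp: core_def divide_le_eq mult.commute simp del: of_nat_Suc)
      then show ?thesis using True by (simp del: of_nat_Suc)
    qed simp
  qed
  also have "\<dots> < \<infinity>"
    using \<eta>(1) \<eta>_nonneg by (subst nn_integral_eq_integral) (auto simp del: of_nat_Suc)
  finally show ?thesis .
qed

lemma tail_tendsto: "(\<lambda>n. \<integral>z. indicator (space q - core n) z * \<eta> z \<partial>q) \<longlonglongrightarrow> 0"
proof -
  have "(\<lambda>n. \<integral>z. indicator (space q - core n) z * \<eta> z \<partial>q) \<longlonglongrightarrow> (\<integral>z. 0 \<partial>q)"
  proof (rule integral_dominated_convergence[where w = \<eta>])
    show "(\<lambda>z. indicator (space q - core n) z * \<eta> z) \<in> borel_measurable q" for n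
      using core_sets[of n] by measurable
    show "AE z in q. norm (indicator (space q - core n) z * \<eta> z) \<le> \<eta> z" for n
      using \<eta>_nonneg by (intro AE_I2) (auto simp: indicator_def)
    show "AE z in q. (\<lambda>n. indicator (space q - core n) z * \<eta> z) \<longlonglongrightarrow> 0"
    proof (rule AE_I2)
      fix z assume z: "z \<in> space q"
      show "(\<lambda>n. indicator (space q - core n) z * \<eta> z) \<longlonglongrightarrow> 0"
      \<comment> \<open>Marks with \<open>\<eta> z = 0\<close> never enter a core, but they
        contribute 0 to the integral.\<close>
      proof (cases "\<eta> z = 0")
        case False
        then have pos: "0 < \<eta> z" using \<eta>_nonneg[OF z] by simp
        obtain n\<^sub>1 :: nat where n1: "\<eta> z \<le> real n\<^sub>1" using real_arch_simple by blast
        obtain n\<^sub>2 where n2: "inverse (real (Suc n\<^sub>2)) < \<eta> z" using reals_Archimedean[OF pos] by blast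
        have "indicator (space q - core n) z * \<eta> z = 0" if "max n\<^sub>1 n\<^sub>2 \<le> n" for n
        proof -
          have "1 / real (Suc n) \<le> inverse (real (Suc n\<^sub>2))"
            using that by (simp add: inverse_eq_divide frac_le)
          then have "z \<in> core n" using n1 n2 z that by (auto simp: core_def)
          then show ?thesis by simp
        qed
        then show ?thesis
          by (intro tendsto_eventually) (unfold eventually_sequentially, blast)
      qed simp
    qed
  qed (use \<eta>(1) in auto)
  then show ?thesis by simp
qed

lemma truncated_sde_core: "truncated_sde k q b \<gamma> h \<eta> c\<^sub>0 B P \<mu> N p X (core n) (real (Suc n))"
proof (intro truncated_sde.intro jump_sde_axioms truncated_jumps.intro jump_coefficients_axioms
    truncated_jumps_axioms.intro truncated_sde_axioms.intro core_sets core_finite)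
qed (auto simp: core_def)

text \<open>\<open>G\<close> is chosen to make the tail term small, and then \<open>m\<close> large
  enough for the terms with constants depending on \<open>G\<close>. Both serve all starting points
  and all test functions with the bounds \<open>M\<close> and \<open>L\<close> at once; the norm,
  which tests every order with its own function, and measurability in \<open>x\<close> rely on this
  uniformity.\<close>

lemma scheme_converges:
  assumes t: "0 \<le> t" and e: "0 < e" and L: "0 \<le> L"
  shows "\<exists>G m. G \<in> sets q \<and> emeasure q G < \<infinity> \<and> 1 \<le> m \<and> t / real m * B \<le> 1 / 2 \<and> t / real m * B * measure q G \<le> 1 \<and>
    (\<forall>\<phi> x. \<phi> \<in> borel_measurable borel \<longrightarrow> (\<forall>x. \<bar>\<phi> x\<bar> \<le> M) \<longrightarrow> (\<forall>x y. \<bar>\<phi> x - \<phi> y\<bar> \<le> L * \<bar>x - y\<bar>) \<longrightarrow>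
      \<bar>(\<integral>\<omega>. \<phi> (X x t \<omega>) \<partial>P) - (one_step (density q (indicator G)) (t / real m) ^^ m) \<phi> x\<bar> \<le> e)"
proof -
  define \<Lambda> where "\<Lambda> = B + 2 * B * (\<integral>z. \<eta> z \<partial>q)"
  define L' where "L' = L * exp (t * \<Lambda>)"
  have "(\<lambda>n. t * (L' * (B + 1) * B * (\<integral>z. indicator (space q - core n) z * \<eta> z \<partial>q))) \<longlonglongrightarrow> t * (L' * (B + 1) * B * 0)"
    by (intro tendsto_intros tail_tendsto)
  then have "\<forall>\<^sub>F n in sequentially. t * (L' * (B + 1) * B * (\<integral>z. indicator (space q - core n) z * \<eta> z \<partial>q)) < e / 2"
    using e by (intro order_tendstoD) auto
  then obtain n where n: "t * (L' * (B + 1) * B * (\<integral>z. indicator (space q - core n) z * \<eta> z \<partial>q)) < e / 2"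
    by (auto simp: eventually_sequentially)
  interpret truncated_sde k q b \<gamma> h \<eta> c\<^sub>0 B P \<mu> N p X "core n" "real (Suc n)" by (rule truncated_sde_core)
  have g: "Lipschitz_growth = \<Lambda>" by (simp add: Lipschitz_growth_def \<Lambda>_def)
  have lim: "(\<lambda>m. t / real m * c) \<longlonglongrightarrow> 0" for c
    using tendsto_mult[OF lim_const_over_n[of t] tendsto_const[of c]] by simp
  have "\<forall>\<^sub>F m in sequentially. 1 \<le> m \<and> t / real m * 1 < 1 \<and> t / real m * B < 1 / 2 \<and> t / real m * (B * rate) < 1 \<and>
      t / real m * (t * scheme_constant M L') < e / 2"
    using e by (intro eventually_conj eventually_ge_at_top order_tendstoD(2)[OF lim]) auto
  then obtain m where m: "1 \<le> m" "t / real m \<le> 1" "t / real m * B \<le> 1 / 2" "t / real m * B * rate \<le> 1"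
      "t / real m * (t * scheme_constant M L') < e / 2"
    by (auto simp: eventually_sequentially mult.assoc)
  show ?thesis
  proof (intro exI[of _ "core n"] exI[of _ m] conjI allI impI core_sets core_finite m)
    show "t / real m * B * measure q (core n) \<le> 1" using m(4) by (simp add: rate_def)
    fix \<phi> x
    assume \<phi>: "\<phi> \<in> borel_measurable borel" "\<forall>x. \<bar>\<phi> x\<bar> \<le> M" "\<forall>x y. \<bar>\<phi> x - \<phi> y\<bar> \<le> L * \<bar>x - y\<bar>"
    have "\<bar>(\<integral>\<omega>. \<phi> (X x t \<omega>) \<partial>P) - (one_step \<rho> (t / real m) ^^ m) \<phi> x\<bar>
      \<le> t * (t / real m * scheme_constant M (L * exp (t * Lipschitz_growth)) + L * exp (t * Lipschitz_growth) * (B + 1) * B * tail)"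
      by (rule scheme_error[OF t m(1,2,4)]) (use \<phi> in auto)
    also have "\<dots> = t / real m * (t * scheme_constant M L') + t * (L' * (B + 1) * B * tail)"
      by (simp add: g L'_def algebra_simps)
    also have "\<dots> \<le> e" using m(5) n unfolding tail_def by linarith
    finally show "\<bar>(\<integral>\<omega>. \<phi> (X x t \<omega>) \<partial>P) - (one_step (density q (indicator (core n))) (t / real m) ^^ m) \<phi> x\<bar> \<le> e"
      by (simp add: \<rho>_def)
  qed
qed

section \<open>Measurability in the starting point\<close>

lemma iterated_step_measurable:
  assumes G: "G \<in> sets q" "emeasure q G < \<infinity>" and "\<phi> \<in> borel_measurable borel"
  shows "(one_step (density q (indicator G)) \<epsilon> ^^ m) \<phi> \<in> borel_measurable borel"
proof -
  interpret truncated_jumps k q b \<gamma> h \<eta> c\<^sub>0 B G by unfold_locales (rule G)+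
  have "(one_step \<rho> \<epsilon> ^^ m) \<phi> \<in> borel_measurable borel"
    by (induction m) (use assms(3) one_step_measurable in auto)
  then show ?thesis by (simp add: \<rho>_def)
qed

text \<open>A uniform limit of iterated one-step operators, each of which preserves
  measurability.\<close>

lemma expectation_measurable:
  assumes t: "0 \<le> t" and \<phi>: "\<phi> \<in> borel_measurable borel" "\<And>x. \<bar>\<phi> x\<bar> \<le> M" "\<And>x y. \<bar>\<phi> x - \<phi> y\<bar> \<le> L * \<bar>x - y\<bar>"
  shows "(\<lambda>x. \<integral>\<omega>. \<phi> (X x t \<omega>) \<partial>P) \<in> borel_measurable borel"
proof -
  have L: "0 \<le> L" using \<phi>(3)[of 0 1] by auto
  have "\<exists>F. F \<in> borel_measurable borel \<and> (\<forall>x. \<bar>(\<integral>\<omega>. \<phi> (X x t \<omega>) \<partial>P) - F x\<bar> \<le> inverse (real (Suc n)))" for n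
  proof -
    obtain G m where G: "G \<in> sets q" "emeasure q G < \<infinity>"
      and le: "\<forall>\<phi> x. \<phi> \<in> borel_measurable borel \<longrightarrow> (\<forall>x. \<bar>\<phi> x\<bar> \<le> M) \<longrightarrow> (\<forall>x y. \<bar>\<phi> x - \<phi> y\<bar> \<le> L * \<bar>x - y\<bar>) \<longrightarrow>
        \<bar>(\<integral>\<omega>. \<phi> (X x t \<omega>) \<partial>P) - (one_step (density q (indicator G)) (t / real m) ^^ m) \<phi> x\<bar> \<le> inverse (real (Suc n))"
      using scheme_converges[OF t _ L, of "inverse (real (Suc n))" M] by auto
    show ?thesis
      using iterated_step_measurable[OF G \<phi>(1)] le \<phi> by blast
  qed
  then obtain F where F: "\<And>n. F n \<in> borel_measurable borel"
    "\<And>n x. \<bar>(\<integral>\<omega>. \<phi> (X x t \<omega>) \<partial>P) - F n x\<bar> \<le> inverse (real (Suc n))" by metis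
  show ?thesis
  proof (rule borel_measurable_LIMSEQ_real)
    fix x :: real
    have "(\<lambda>n. (\<integral>\<omega>. \<phi> (X x t \<omega>) \<partial>P) - F n x) \<longlonglongrightarrow> 0"
      using F(2)[of x] by (intro Lim_null_comparison[OF always_eventually LIMSEQ_inverse_real_of_nat]) auto
    from tendsto_diff[OF tendsto_const[of "\<integral>\<omega>. \<phi> (X x t \<omega>) \<partial>P"] this]
    show "(\<lambda>n. F n x) \<longlonglongrightarrow> (\<integral>\<omega>. \<phi> (X x t \<omega>) \<partial>P)" by simp
  qed (rule F)
qed

text \<open>Measurability of the kernel is what gives \<open>bind\<close> its meaning as a mixture
  of laws. Half-lines generate the Borel sets and are stable under intersection, and their
  indicators are limits of Lipschitz functions, for which \<open>expectation_measurable\<close>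
  applies.\<close>

lemma kernel_measurable:
  assumes t: "0 \<le> t"
  shows "(\<lambda>x. distr P borel (X x t)) \<in> measurable borel (subprob_algebra borel)"
proof (rule measurable_subprob_algebra_generated[where \<Omega> = UNIV and G = "range atMost"])
  have pr: "prob_space (distr P borel (X x t))" for x
    using X_measurable[OF t] by (intro prob_space_distr)
  show "sets borel = sigma_sets UNIV (range (atMost :: real \<Rightarrow> _))"
    by (subst borel_eq_atMost) (simp add: sets_measure_of)
  show "Int_stable (range (atMost :: real \<Rightarrow> _))"
    by (auto simp: Int_stable_def)
  show "subprob_space (distr P borel (X x t))" for x
    using pr by (rule prob_space_imp_subprob_space)
  have "emeasure (distr P borel (X x t)) UNIV = 1" for x
    using prob_space.emeasure_space_1[OF pr[of x]] by simp
  then show "(\<lambda>x. emeasure (distr P borel (X x t)) UNIV) \<in> borel_measurable borel" by simp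
  fix A assume "A \<in> range (atMost :: real \<Rightarrow> _)"
  then obtain a where A: "A = {..a}" by auto
  \<comment> \<open>For \<open>n \<ge> 1\<close> a ramp falling from 1 at \<open>a\<close> to 0 at
    \<open>a + 1 / n\<close>.\<close>
  define \<psi> where "\<psi> n y = max 0 (min 1 (1 - real n * (y - a)))" for n :: nat and y :: real
  have \<psi>: "\<psi> n \<in> borel_measurable borel" "\<bar>\<psi> n y\<bar> \<le> 1" "\<bar>\<psi> n y - \<psi> n z\<bar> \<le> real n * \<bar>y - z\<bar>" for n y z
  proof -
    show "\<psi> n \<in> borel_measurable borel" unfolding \<psi>_def by measurable
    have "\<bar>\<psi> n y - \<psi> n z\<bar> \<le> \<bar>(1 - real n * (y - a)) - (1 - real n * (z - a))\<bar>" by (simp add: \<psi>_def)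
    also have "\<dots> = real n * \<bar>y - z\<bar>"
    proof -
      have "(1 - real n * (y - a)) - (1 - real n * (z - a)) = - (real n * (y - z))"
        by (simp add: algebra_simps)
      then show ?thesis by (simp add: abs_mult)
    qed
    finally show "\<bar>\<psi> n y - \<psi> n z\<bar> \<le> real n * \<bar>y - z\<bar>" .
  qed (auto simp: \<psi>_def)
  have "(\<lambda>x. measure (distr P borel (X x t)) A) \<in> borel_measurable borel"
  proof (rule borel_measurable_LIMSEQ_real)
    show "(\<lambda>x. \<integral>\<omega>. \<psi> n (X x t \<omega>) \<partial>P) \<in> borel_measurable borel" for n
      by (rule expectation_measurable[OF t \<psi>])
    fix x :: real
    have Xm: "X x t \<in> borel_measurable P" by (rule X_measurable[OF t])
    have "(\<lambda>n. \<integral>\<omega>. \<psi> n (X x t \<omega>) \<partial>P) \<longlonglongrightarrow> (\<integral>\<omega>. indicator A (X x t \<omega>) \<partial>P)"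
    proof (rule integral_dominated_convergence[where w = "\<lambda>_. 1"])
      show "AE \<omega> in P. (\<lambda>n. \<psi> n (X x t \<omega>)) \<longlonglongrightarrow> indicator A (X x t \<omega>)"
      proof (rule AE_I2)
        fix \<omega>
        show "(\<lambda>n. \<psi> n (X x t \<omega>)) \<longlonglongrightarrow> indicator A (X x t \<omega>)"
        proof (cases "X x t \<omega> \<le> a")
          case True
          then have "\<psi> n (X x t \<omega>) = 1" for n
            using mult_nonneg_nonpos[of "real n" "X x t \<omega> - a"] by (simp add: \<psi>_def)
          then show ?thesis using True by (simp add: A)
        next
          case False
          obtain n\<^sub>0 :: nat where n0: "1 / (X x t \<omega> - a) \<le> real n\<^sub>0" using real_arch_simple by blast
          have "\<psi> n (X x t \<omega>) = 0" if "n\<^sub>0 \<le> n" for n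
          proof -
            have "1 / (X x t \<omega> - a) \<le> real n" using n0 that by linarith
            then have "1 \<le> real n * (X x t \<omega> - a)" using False by (simp add: divide_le_eq)
            then show ?thesis by (simp add: \<psi>_def)
          qed
          then show ?thesis using False by (intro tendsto_eventually) (auto simp: eventually_sequentially A)
        qed
      qed
      show "(\<lambda>\<omega>. \<psi> n (X x t \<omega>)) \<in> borel_measurable P" for n
        using measurable_compose[OF Xm \<psi>(1)] .
      show "(\<lambda>\<omega>. indicator A (X x t \<omega>)) \<in> borel_measurable P"
        using measurable_compose[OF Xm, of "indicator A" borel] by (simp add: A)
    qed (use \<psi>(2) in auto)
    also have "(\<integral>\<omega>. (indicator A (X x t \<omega>) :: real) \<partial>P) = measure (distr P borel (X x t)) A"
    proof -
      have "(\<integral>\<omega>. (indicator A (X x t \<omega>) :: real) \<partial>P) = (\<integral>y. indicator A y \<partial>distr P borel (X x t))"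
        using Xm by (subst integral_distr) (auto simp: A)
      then show ?thesis by (simp add: A)
    qed
    finally show "(\<lambda>n. \<integral>\<omega>. \<psi> n (X x t \<omega>) \<partial>P) \<longlonglongrightarrow> measure (distr P borel (X x t)) A" .
  qed
  moreover have "emeasure (distr P borel (X x t)) A = ennreal (measure (distr P borel (X x t)) A)" for x
    using prob_space.finite_measure[OF pr] by (intro finite_measure.emeasure_eq_measure)
  ultimately show "(\<lambda>x. emeasure (distr P borel (X x t)) A) \<in> borel_measurable borel" by simp
qed auto

end

section \<open>Propagation of the norm\<close>

text \<open>Near-optimal elements are chosen for all suprema simultaneously, each with loss below
  \<open>d\<close>; the \<open>+ 1\<close> in its denominator covers an empty index set. A bound for
  tuples of test functions thus bounds a sum of suprema.\<close>

lemma sum_Sup_le: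
  fixes A :: "'i \<Rightarrow> real set"
  assumes I: "finite I" and A: "\<And>i. i \<in> I \<Longrightarrow> A i \<noteq> {}"
    and le: "\<And>x. (\<And>i. i \<in> I \<Longrightarrow> x i \<in> A i) \<Longrightarrow> (\<Sum>i\<in>I. x i) \<le> S"
  shows "(\<Sum>i\<in>I. Sup (A i)) \<le> S"
proof (rule field_le_epsilon)
  fix e :: real assume e: "0 < e"
  define d where "d = e / (real (card I) + 1)"
  have d: "0 < d" using e by (simp add: d_def)
  have "\<exists>x. x \<in> A i \<and> Sup (A i) - d < x" if "i \<in> I" for i
    using less_cSupE[of "Sup (A i) - d" "A i"] A[OF that] d by auto
  then obtain x where x: "\<And>i. i \<in> I \<Longrightarrow> x i \<in> A i" "\<And>i. i \<in> I \<Longrightarrow> Sup (A i) - d < x i" by metis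
  have "(\<Sum>i\<in>I. Sup (A i)) \<le> (\<Sum>i\<in>I. x i + d)"
    using x(2) by (intro sum_mono) (simp add: less_imp_le algebra_simps)
  also have "\<dots> = (\<Sum>i\<in>I. x i) + real (card I) * d" by (simp add: sum.distrib)
  also have "\<dots> \<le> S + (real (card I) + 1) * d"
    using le[of x] x(1) d by (intro add_mono mult_right_mono) auto
  also have "(real (card I) + 1) * d = e" by (simp add: d_def)
  finally show "(\<Sum>i\<in>I. Sup (A i)) \<le> S + e" .
qed

lemma Wbar_norm_le:
  assumes "\<And>l \<phi>. l \<le> k \<Longrightarrow> \<phi> \<in> C_k_b k \<Longrightarrow> (\<And>y. \<bar>\<phi> y\<bar> \<le> 1) \<Longrightarrow> (\<integral>y. (deriv ^^ l) \<phi> y \<partial>f) \<le> a l"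
  shows "Wbar_norm k f \<le> ereal (\<Sum>l\<le>k. a l)"
  unfolding Wbar_norm_def sum_ereal[symmetric] using assms by (intro sum_mono SUP_least) auto

text \<open>Every supremum is nonnegative, as the zero function is admissible; a finite sum
  therefore has finite terms, and these serve as the bounds \<open>c\<close>.\<close>

lemma Wbar_prob_deriv_bounds:
  assumes "f \<in> Wbar_prob k"
  obtains c where "deriv_bounds k f c" "Wbar_norm k f = ereal (\<Sum>l\<le>k. c l)"
proof -
  have f: "prob_space f" "sets f = sets borel" "Wbar_norm k f < \<infinity>" using assms by (auto simp: Wbar_prob_def)
  define s where "s l = (SUP \<phi> \<in> {\<phi> \<in> C_k_b k. \<forall>y. \<bar>\<phi> y\<bar> \<le> 1}. ereal (\<integral>y. (deriv ^^ l) \<phi> y \<partial>f))" for l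
  have s0: "0 \<le> s l" for l
    unfolding s_def by (rule SUP_upper2[of "\<lambda>_. 0"]) (auto simp: C_k_b_const iterated_deriv_zero)
  have W: "Wbar_norm k f = (\<Sum>l\<le>k. s l)" by (simp add: Wbar_norm_def s_def)
  have fin: "ereal (real_of_ereal (s l)) = s l" if "l \<le> k" for l
  proof -
    have "s l \<le> (\<Sum>l\<le>k. s l)" using that s0 sum_mono2[of "{..k}" "{l}" s] by simp
    then have "s l < \<infinity>" using f(3) W by (metis le_less_trans)
    then show ?thesis using s0[of l] by (cases "s l") auto
  qed
  have "deriv_bounds k f (\<lambda>l. real_of_ereal (s l))"
  proof (rule deriv_boundsI[OF f(1,2)])
    fix l \<phi> assume l: "l \<le> k" "\<phi> \<in> C_k_b k" "\<And>y. \<bar>\<phi> y\<bar> \<le> 1"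
    have "ereal (\<integral>y. (deriv ^^ l) \<phi> y \<partial>f) \<le> s l" unfolding s_def using l by (intro SUP_upper) auto
    also have "\<dots> = ereal (real_of_ereal (s l))" using fin[OF l(1)] by simp
    finally show "(\<integral>y. (deriv ^^ l) \<phi> y \<partial>f) \<le> real_of_ereal (s l)" by simp
  qed
  moreover have "Wbar_norm k f = ereal (\<Sum>l\<le>k. real_of_ereal (s l))"
    unfolding W sum_ereal[symmetric] using fin by (intro sum.cong) auto
  ultimately show ?thesis by (rule that)
qed

context jump_sde
begin

text \<open>Test functions with \<open>k + 1\<close> derivatives have Lipschitz derivatives of all
  orders up to \<open>k\<close>, as the comparison with the scheme requires; averaging finally
  admits those with \<open>k\<close> derivatives. The growth factor of \<open>m\<close> steps of
  length \<open>t / m\<close> is at most \<open>exp (C * t)\<close> for every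
  \<open>m\<close>.\<close>

lemma Wbar_norm_propagates:
  "\<exists>C\<ge>0. \<forall>f\<in>Wbar_prob k. \<forall>t\<ge>0.
    Wbar_norm k (f \<bind> (\<lambda>x. distr P borel (X x t))) \<le> Wbar_norm k f * ereal (exp (C * t))"
proof -
  obtain C where C: "0 \<le> C"
    "\<And>G \<epsilon> m f c. G \<in> sets q \<Longrightarrow> emeasure q G < \<infinity> \<Longrightarrow> 0 \<le> \<epsilon> \<Longrightarrow> \<epsilon> * B \<le> 1 / 2 \<Longrightarrow>
    \<epsilon> * B * measure q G \<le> 1 \<Longrightarrow> prob_space f \<Longrightarrow> sets f = sets borel \<Longrightarrow> deriv_bounds k f c \<Longrightarrow>
    (\<exists>c'. (\<Sum>l\<le>k. c' l) \<le> (1 + C * \<epsilon>) ^ m * (\<Sum>l\<le>k. c l) \<and>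
      (\<forall>l\<le>k. \<forall>\<phi>\<in>C_k_b k. (\<forall>x. \<bar>\<phi> x\<bar> \<le> 1) \<longrightarrow>
        (\<integral>x. (one_step (density q (indicator G)) \<epsilon> ^^ m) ((deriv ^^ l) \<phi>) x \<partial>f) \<le> c' l))"
    using iterated_step_estimate by blast
  show ?thesis
  proof (intro exI[of _ C] conjI ballI allI impI)
    show "0 \<le> C" by (rule C)
    fix f and t :: real assume fW: "f \<in> Wbar_prob k" and t: "0 \<le> t"
    have f: "prob_space f" "sets f = sets borel" using fW by (auto simp: Wbar_prob_def)
    obtain c where c: "deriv_bounds k f c" "Wbar_norm k f = ereal (\<Sum>l\<le>k. c l)"
      using Wbar_prob_deriv_bounds[OF fW] .
    interpret f: prob_space f by (rule f)
    have spf: "space f = UNIV" using sets_eq_imp_space_eq[OF f(2)] by simp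
    define S where "S = exp (C * t) * (\<Sum>l\<le>k. c l)"
    have c0: "0 \<le> (\<Sum>l\<le>k. c l)" using deriv_bounds_nonneg[OF c(1)] by (intro sum_nonneg) auto
    define \<kappa> where "\<kappa> x = distr P borel (X x t)" for x
    have \<kappa>: "\<kappa> \<in> measurable f (subprob_algebra borel)"
      using kernel_measurable[OF t] unfolding \<kappa>_def by (simp add: measurable_cong_sets[OF f(2) refl])
    have \<kappa>_prob: "prob_space (\<kappa> x)" for x
      unfolding \<kappa>_def using X_measurable[OF t] by (intro prob_space_distr)
    define g where "g = f \<bind> \<kappa>"
    have g: "prob_space g" unfolding g_def using \<kappa>_prob \<kappa> by (intro f.prob_space_bind) auto
    have sg: "sets g = sets borel" unfolding g_def by (rule sets_bind) (auto simp: \<kappa>_def spf)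
    have int_g: "(\<integral>y. \<psi> y \<partial>g) = (\<integral>x. (\<integral>\<omega>. \<psi> (X x t \<omega>) \<partial>P) \<partial>f)"
      if \<psi>: "\<psi> \<in> borel_measurable borel" "\<And>x. \<bar>\<psi> x\<bar> \<le> M" for \<psi> :: "real \<Rightarrow> real" and M
    proof -
      have "(\<integral>y. \<psi> y \<partial>g) = (\<integral>x. (\<integral>y. \<psi> y \<partial>\<kappa> x) \<partial>f)"
        unfolding g_def
        by (rule integral_bind[where K = borel and B = M and B' = 1])
          (use \<psi> \<kappa> f.finite_measure_axioms prob_space.emeasure_space_1[OF \<kappa>_prob] in auto)
      then show ?thesis
        unfolding \<kappa>_def using \<psi>(1) X_measurable[OF t] by (simp add: integral_distr)
    qed
    \<comment> \<open>A whole tuple of test functions is treated at once: the bounds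
      \<open>c' l\<close> for single orders depend on \<open>G\<close> and \<open>m\<close>, hence
      on the functions and the accuracy, and only their sum is controlled uniformly.\<close>
    have key: "(\<Sum>l\<le>k. \<integral>y. (deriv ^^ l) (\<phi> l) y \<partial>g) \<le> S"
      if \<phi>: "\<And>l. l \<le> k \<Longrightarrow> \<phi> l \<in> C_k_b (Suc k)" "\<And>l y. l \<le> k \<Longrightarrow> \<bar>\<phi> l y\<bar> \<le> 1" for \<phi>
    proof (rule field_le_epsilon)
      fix e :: real assume e: "0 < e"
      define d where "d = e / (real k + 1)"
      have d: "0 < d" "(1 + real k) * d = e" using e by (simp_all add: d_def add.commute[of 1])
      let ?\<psi> = "\<lambda>l. (deriv ^^ l) (\<phi> l)"
      have "\<exists>M L. (\<forall>x. \<bar>?\<psi> l x\<bar> \<le> M) \<and> (\<forall>x y. \<bar>?\<psi> l x - ?\<psi> l y\<bar> \<le> L * \<bar>x - y\<bar>)" if "l \<le> k" for l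
      proof -
        have "?\<psi> l \<in> C_k_b 1"
          using that by (intro C_k_b_iterated_deriv C_k_b_mono[OF \<phi>(1)[OF that]]) auto
        then obtain M L where M: "\<And>x. \<bar>?\<psi> l x\<bar> \<le> M" and L: "\<And>x. \<bar>deriv (?\<psi> l) x\<bar> \<le> L"
          and fd: "\<And>x. ?\<psi> l field_differentiable at x"
          unfolding One_nat_def C_k_b_Suc C_k_b_0 by blast
        have "\<bar>?\<psi> l x - ?\<psi> l y\<bar> \<le> L * \<bar>x - y\<bar>" for x y
          using abs_diff_le_of_deriv_bound[of "?\<psi> l" "deriv (?\<psi> l)" L x y] L fd
          by (simp add: DERIV_deriv_iff_field_differentiable)
        then show ?thesis using M by blast
      qed
      then obtain M' L' where bd: "\<And>l x. l \<le> k \<Longrightarrow> \<bar>?\<psi> l x\<bar> \<le> M' l" "\<And>l x y. l \<le> k \<Longrightarrow> \<bar>?\<psi> l x - ?\<psi> l y\<bar> \<le> L' l * \<bar>x - y\<bar>"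
        by metis
      \<comment> \<open>Common bounds for all orders, so that one truncation and one step length
        serve the whole tuple; in \<open>L\<close> the value 0 is inserted to make it
        nonnegative.\<close>
      define M where "M = Max (M' ` {..k})"
      define L where "L = Max (insert 0 (L' ` {..k}))"
      have L0: "0 \<le> L" unfolding L_def by (intro Max_ge) auto
      have M: "\<bar>?\<psi> l x\<bar> \<le> M" if "l \<le> k" for l x
      proof -
        have "M' l \<le> M" unfolding M_def using that by (intro Max_ge) auto
        then show ?thesis using bd(1)[OF that, of x] by linarith
      qed
      have L: "\<bar>?\<psi> l x - ?\<psi> l y\<bar> \<le> L * \<bar>x - y\<bar>" if "l \<le> k" for l x y
      proof -
        have "L' l \<le> L" unfolding L_def using that by (intro Max_ge) auto
        then have "L' l * \<bar>x - y\<bar> \<le> L * \<bar>x - y\<bar>" by (intro mult_right_mono) auto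
        then show ?thesis using bd(2)[OF that, of x y] by linarith
      qed
      have meas: "?\<psi> l \<in> borel_measurable borel" if "l \<le> k" for l
        using that
        by (intro borel_measurable_continuous_onI C_k_b_imp_continuous[of _ 0] C_k_b_iterated_deriv C_k_b_mono[OF \<phi>(1)[OF that]]) auto
      obtain G m where G: "G \<in> sets q" "emeasure q G < \<infinity>" and m: "1 \<le> m" "t / real m * B \<le> 1 / 2" "t / real m * B * measure q G \<le> 1"
        and approx: "\<And>\<phi> x. \<phi> \<in> borel_measurable borel \<Longrightarrow> (\<And>x. \<bar>\<phi> x\<bar> \<le> M) \<Longrightarrow> (\<And>x y. \<bar>\<phi> x - \<phi> y\<bar> \<le> L * \<bar>x - y\<bar>) \<Longrightarrow>
          \<bar>(\<integral>\<omega>. \<phi> (X x t \<omega>) \<partial>P) - (one_step (density q (indicator G)) (t / real m) ^^ m) \<phi> x\<bar> \<le> d"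
        using scheme_converges[OF t d(1) L0, of M] by blast
      let ?T = "one_step (density q (indicator G)) (t / real m) ^^ m"
      have "0 \<le> t / real m" using t by simp
      from C(2)[OF G this m(2,3) f c(1), of m] obtain c' where c': "(\<Sum>l\<le>k. c' l) \<le> (1 + C * (t / real m)) ^ m * (\<Sum>l\<le>k. c l)"
        "\<And>l \<phi>. l \<le> k \<Longrightarrow> \<phi> \<in> C_k_b k \<Longrightarrow> (\<And>x. \<bar>\<phi> x\<bar> \<le> 1) \<Longrightarrow> (\<integral>x. ?T ((deriv ^^ l) \<phi>) x \<partial>f) \<le> c' l"
        by blast
      have "(\<integral>y. ?\<psi> l y \<partial>g) \<le> c' l + d" if l: "l \<le> k" for l
      proof -
        let ?E = "\<lambda>x. \<integral>\<omega>. ?\<psi> l (X x t \<omega>) \<partial>P"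
        have near: "\<bar>?E x - ?T (?\<psi> l) x\<bar> \<le> d" for x using approx[OF meas[OF l] M[OF l] L[OF l]] .
        have Em: "?E \<in> borel_measurable borel"
          by (rule expectation_measurable[OF t meas[OF l] M[OF l] L[OF l]])
        have Eb: "\<bar>?E x\<bar> \<le> M" for x
        proof -
          have "0 \<le> M" using M[OF l, of 0] by linarith
          have "\<bar>?E x\<bar> \<le> (\<integral>\<omega>. \<bar>?\<psi> l (X x t \<omega>)\<bar> \<partial>P)" by (rule integral_abs_bound)
          also have "\<dots> \<le> (\<integral>\<omega>. M \<partial>P)"
            using \<open>0 \<le> M\<close> M[OF l] measurable_compose[OF X_measurable[OF t] meas[OF l]]
            by (intro integral_mono integrable_abs integrable_const_bound[of _ M]) auto
          finally show ?thesis by (simp add: prob_space)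
        qed
        have Ei: "integrable f ?E"
          using Eb Em
          by (intro f.integrable_const_bound[of _ M]) (auto simp: measurable_cong_sets[OF f(2) refl])
        have Tm: "?T (?\<psi> l) \<in> borel_measurable borel" by (rule iterated_step_measurable[OF G meas[OF l]])
        have "\<bar>?T (?\<psi> l) x\<bar> \<le> M + d" for x using near[of x] Eb[of x] by linarith
        then have Ti: "integrable f (?T (?\<psi> l))"
          using Tm
          by (intro f.integrable_const_bound[of _ "M + d"]) (auto simp: measurable_cong_sets[OF f(2) refl])
        have "(\<integral>y. ?\<psi> l y \<partial>g) = (\<integral>x. ?E x \<partial>f)" by (rule int_g[OF meas[OF l] M[OF l]])
        also have "\<dots> \<le> (\<integral>x. ?T (?\<psi> l) x + d \<partial>f)"
          using near Ei Ti by (intro integral_mono) (auto simp: abs_le_iff algebra_simps)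
        also have "\<dots> = (\<integral>x. ?T (?\<psi> l) x \<partial>f) + d" using Ti by (simp add: f.prob_space)
        also have "(\<integral>x. ?T (?\<psi> l) x \<partial>f) \<le> c' l"
          by (rule c'(2)[OF l C_k_b_SucD[OF \<phi>(1)[OF l]] \<phi>(2)[OF l]])
        finally show ?thesis by simp
      qed
      then have "(\<Sum>l\<le>k. \<integral>y. ?\<psi> l y \<partial>g) \<le> (\<Sum>l\<le>k. c' l + d)" by (intro sum_mono) auto
      also have "\<dots> = (\<Sum>l\<le>k. c' l) + e" using d(2) by (simp add: sum.distrib)
      also have "(\<Sum>l\<le>k. c' l) \<le> S"
      proof -
        have "(1 + C * (t / real m)) ^ m \<le> exp (C * (t / real m)) ^ m"
          using C(1) t by (intro power_mono exp_ge_add_one_self) auto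
        also have "\<dots> = exp (C * t)" using m(1) by (simp add: exp_of_nat_mult[symmetric])
        finally have "(1 + C * (t / real m)) ^ m * (\<Sum>l\<le>k. c l) \<le> S"
          unfolding S_def using c0 by (rule mult_right_mono)
        with c'(1) show ?thesis by linarith
      qed
      finally show "(\<Sum>l\<le>k. \<integral>y. ?\<psi> l y \<partial>g) \<le> S + e" by simp
    qed
    define A where "A l = {\<integral>y. (deriv ^^ l) \<phi> y \<partial>g | \<phi>. \<phi> \<in> C_k_b (Suc k) \<and> (\<forall>y. \<bar>\<phi> y\<bar> \<le> 1)}" for l
    have A_bdd: "bdd_above (A l)" if "l \<le> k" for l
    proof (rule bdd_aboveI)
      fix v assume "v \<in> A l"
      then obtain \<phi> where \<phi>: "v = (\<integral>y. (deriv ^^ l) \<phi> y \<partial>g)" "\<phi> \<in> C_k_b (Suc k)" "\<forall>y. \<bar>\<phi> y\<bar> \<le> 1"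
        by (auto simp: A_def)
      \<comment> \<open>A single order is isolated by testing all the others with the zero
        function.\<close>
      have "(\<Sum>i\<le>k. \<integral>y. (deriv ^^ i) (if i = l then \<phi> else (\<lambda>_. 0)) y \<partial>g) \<le> S"
        using \<phi> by (intro key) (auto simp: C_k_b_const)
      also have "(\<Sum>i\<le>k. \<integral>y. (deriv ^^ i) (if i = l then \<phi> else (\<lambda>_. 0)) y \<partial>g) = (\<Sum>i\<le>k. if i = l then v else 0)"
        by (intro sum.cong) (auto simp: iterated_deriv_zero \<phi>(1))
      also have "\<dots> = v" using that by simp
      finally show "v \<le> S" .
    qed
    have "Wbar_norm k g \<le> ereal (\<Sum>l\<le>k. Sup (A l))"
    proof (rule Wbar_norm_le)
      fix l and \<phi> :: "real \<Rightarrow> real" assume l: "l \<le> k" "\<phi> \<in> C_k_b k" "\<And>y. \<bar>\<phi> y\<bar> \<le> 1"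
      show "(\<integral>y. (deriv ^^ l) \<phi> y \<partial>g) \<le> Sup (A l)"
      proof (rule integral_deriv_le_of_smoother[OF g sg l(1) _ l(2,3)])
        fix \<zeta> assume "\<zeta> \<in> C_k_b (Suc k)" "\<And>y. \<bar>\<zeta> y\<bar> \<le> 1"
        then show "(\<integral>y. (deriv ^^ l) \<zeta> y \<partial>g) \<le> Sup (A l)"
          by (intro cSup_upper[OF _ A_bdd[OF l(1)]]) (auto simp: A_def)
      qed
    qed
    also have "(\<Sum>l\<le>k. Sup (A l)) \<le> S"
    proof (rule sum_Sup_le)
      show "A l \<noteq> {}" for l unfolding A_def using C_k_b_const[of 0 "Suc k"] by fastforce
      fix x assume x: "\<And>l. l \<in> {..k} \<Longrightarrow> x l \<in> A l"
      then have "\<forall>l\<in>{..k}. \<exists>\<phi>. x l = (\<integral>y. (deriv ^^ l) \<phi> y \<partial>g) \<and> \<phi> \<in> C_k_b (Suc k) \<and> (\<forall>y. \<bar>\<phi> y\<bar> \<le> 1)"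
        by (auto simp: A_def)
      then obtain \<phi> where "\<And>l. l \<le> k \<Longrightarrow> x l = (\<integral>y. (deriv ^^ l) (\<phi> l) y \<partial>g) \<and> \<phi> l \<in> C_k_b (Suc k) \<and> (\<forall>y. \<bar>\<phi> l y\<bar> \<le> 1)"
        by (metis atMost_iff)
      then show "(\<Sum>l\<le>k. x l) \<le> S" using key[of \<phi>] by simp
    qed simp
    finally have "Wbar_norm k g \<le> ereal S" by simp
    also have "ereal S = Wbar_norm k f * ereal (exp (C * t))" by (simp add: c(2) S_def mult.commute)
    finally show "Wbar_norm k (f \<bind> (\<lambda>x. distr P borel (X x t))) \<le> Wbar_norm k f * ereal (exp (C * t))"
      unfolding g_def \<kappa>_def [abs_def] .
  qed
qed

end

theorem proposition2p2:
  fixes k :: nat and p :: real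
    and q :: "'g measure" and P :: "'w measure"
    and \<mu> :: "(real \<times> real \<times> 'g) measure"
    and N :: "'w \<Rightarrow> (real \<times> real \<times> 'g) measure"
    and b \<gamma> :: "real \<Rightarrow> real" and h :: "real \<Rightarrow> 'g \<Rightarrow> real"
    and \<eta> :: "'g \<Rightarrow> real" and c\<^sub>0 :: real
    and X :: "real \<Rightarrow> real \<Rightarrow> 'w \<Rightarrow> real"
  assumes k: "k \<ge> 1" and p: "p \<ge> real k + 1"
    and intensity: "jump_intensity q \<mu>"
    and poisson: "poisson_measure P \<mu> N"
    and b: "b \<in> C_k_b (k + 1)"
    and \<gamma>: "\<gamma> \<in> C_k_b (k + 1)" "\<And>y. \<gamma> y \<ge> 0"
    and h_measurable: "(\<lambda>(y, z). h y z) \<in> borel_measurable (borel \<Otimes>\<^sub>M q)"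
    and h_smooth: "\<And>z. z \<in> space q \<Longrightarrow> C_k (k + 1) (\<lambda>y. h y z)"
    and \<eta>: "integrable q \<eta>" "integrable q (\<lambda>z. \<bar>\<eta> z\<bar> powr p)"
    and h_bound: "\<And>l y z. l \<le> k + 1 \<Longrightarrow> z \<in> space q \<Longrightarrow> \<bar>(deriv ^^ l) (\<lambda>y. h y z) y\<bar> \<le> \<eta> z"
    and S: "c\<^sub>0 > 0" "\<And>y z. z \<in> space q \<Longrightarrow> 1 + deriv (\<lambda>y. h y z) y \<ge> c\<^sub>0"
    and X: "\<And>x. jump_sde_solution P q N b \<gamma> h p x (X x)"
  shows "\<exists>C>0. \<forall>f\<in>Wbar_prob k. \<forall>t\<ge>0.
           Wbar_norm k (f \<bind> (\<lambda>x. distr P borel (X x t))) \<le> Wbar_norm k f * ereal (exp (C * t))"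
proof -
  obtain B\<^sub>1 B\<^sub>2 where B12: "graded (Suc k) B\<^sub>1 1 b" "graded (Suc k) B\<^sub>2 1 \<gamma>"
    using C_k_b_imp_graded b \<gamma>(1) by (metis Suc_eq_plus1)
  define B where "B = max 1 (max B\<^sub>1 B\<^sub>2)"
  have B: "graded (Suc k) B 1 b" "graded (Suc k) B 1 \<gamma>"
    using graded_mono[OF B12(1), of "Suc k" B 1] graded_mono[OF B12(2), of "Suc k" B 1] by (auto simp: B_def)
  have h: "graded (Suc k) (\<eta> z) 1 (\<lambda>y. h y z)" if z: "z \<in> space q" for z
  proof -
    have "bounded (range ((deriv ^^ l) (\<lambda>y. h y z)))" if "l \<le> Suc k" for l
      using h_bound[OF _ z, of l] that by (auto simp: bounded_range_iff)
    then show ?thesis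
      using h_smooth[OF z] h_bound[OF _ z] by (auto simp: graded_def C_k_b_def)
  qed
  have \<eta>_nonneg: "0 \<le> \<eta> z" if "z \<in> space q" for z
    using graded_nonneg[OF h[OF that]] .
  have "integrable q (\<lambda>z. \<eta> z ^ Suc k)"
  proof (rule Bochner_Integration.integrable_bound)
    show "integrable q (\<lambda>z. \<eta> z + \<bar>\<eta> z\<bar> powr p)" using \<eta> by simp
    show "(\<lambda>z. \<eta> z ^ Suc k) \<in> borel_measurable q" using \<eta>(1) by measurable
    show "AE z in q. norm (\<eta> z ^ Suc k) \<le> norm (\<eta> z + \<bar>\<eta> z\<bar> powr p)"
    proof (rule AE_I2)
      fix z assume "z \<in> space q"
      then have t: "0 \<le> \<eta> z" by (rule \<eta>_nonneg)
      \<comment> \<open>Below 1 the power is dominated by \<open>\<eta> z\<close> itself, above 1 by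
        the power with exponent \<open>p \<ge> k + 1\<close>.\<close>
      have "\<eta> z ^ Suc k \<le> \<eta> z + \<bar>\<eta> z\<bar> powr p"
      proof (cases "\<eta> z \<le> 1")
        case True
        then have "\<eta> z ^ Suc k \<le> \<eta> z" using t power_decreasing[of 1 "Suc k" "\<eta> z"] by simp
        then show ?thesis by (simp add: add_increasing2)
      next
        case False
        then have "\<eta> z ^ Suc k = \<eta> z powr (real (Suc k))" by (simp only: powr_realpow)
        also have "\<dots> \<le> \<eta> z powr p" using False p by (intro powr_mono) auto
        finally show ?thesis using t by simp
      qed
      then show "norm (\<eta> z ^ Suc k) \<le> norm (\<eta> z + \<bar>\<eta> z\<bar> powr p)" using t by simp
    qed
  qed
  then interpret jump_sde k q b \<gamma> h \<eta> c\<^sub>0 B P \<mu> N p X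
    using B \<gamma>(2) h_measurable h S \<eta>(1) intensity poisson X
    by (intro jump_sde.intro jump_coefficients.intro poisson_jumps.intro jump_sde_axioms.intro) (auto simp: B_def)
  obtain C where "0 \<le> C" and C: "\<And>f t. f \<in> Wbar_prob k \<Longrightarrow> 0 \<le> t \<Longrightarrow>
      Wbar_norm k (f \<bind> (\<lambda>x. distr P borel (X x t))) \<le> Wbar_norm k f * ereal (exp (C * t))"
    using Wbar_norm_propagates by blast
  show ?thesis
  \<comment> \<open>\<open>C\<close> is only known to be nonnegative; adding 1 makes it positive and
    can only enlarge the right-hand side, because the norm and \<open>t\<close> are
    nonnegative.\<close>
  proof (intro exI[of _ "C + 1"] conjI ballI allI impI)
    fix f and t :: real assume f: "f \<in> Wbar_prob k" and t: "0 \<le> t"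
    obtain c where c: "deriv_bounds k f c" "Wbar_norm k f = ereal (\<Sum>l\<le>k. c l)"
      using Wbar_prob_deriv_bounds[OF f] .
    have "0 \<le> Wbar_norm k f" unfolding c(2) using deriv_bounds_nonneg[OF c(1)] by (auto intro: sum_nonneg)
    then have "Wbar_norm k f * ereal (exp (C * t)) \<le> Wbar_norm k f * ereal (exp ((C + 1) * t))"
      using t by (intro ereal_mult_left_mono) (auto simp: algebra_simps)
    with C[OF f t] show "Wbar_norm k (f \<bind> (\<lambda>x. distr P borel (X x t))) \<le> Wbar_norm k f * ereal (exp ((C + 1) * t))"
      by (rule order_trans)
  qed (use \<open>0 \<le> C\<close> in simp)
qed

end
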